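(* Let $k$ be a field and let $\Lambda=\begin{pmatrix} A & N\\ M & B\end{pmatrix}$ be a finite dimensional null-square projective $k$-algebra, where $A$ and $B$ are basic and sober algebras with presentations $(Q_A,R_A)$ and $(Q_B,R_B)$ respectively, and where the projective bimodules $M$ and $N$ are $$M=\bigoplus_{(g,e)\in F\times E}{}_gm_e\,(Bg\otimes eA),\qquad N=\bigoplus_{(f,h)\in E\times F}{}_fn_h\,(Af\otimes hB),$$ with $E$ and $F$ the complete systems of primitive orthogonal idempotents of $A$ and $B$ given by the vertices of $Q_A$ and $Q_B$. Let $Q_\Lambda$ be the Gabriel quiver of $\Lambda$ and let $R$ be the disjoint union of $R_A$, $R_B$, and the sets $v\curlyvee u$ and $u\curlyvee v$ for all pairs $(u,v)$, where $u$ is a down arrow and $v$ is an up arrow of $Q_\Lambda$. Then the algebra $\Lambda$ is presented by $(Q_\Lambda,R)$.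
   Context: Given $k$-algebras $A$, $B$, a $B$-$A$-bimodule $M$ and an $A$-$B$-bimodule $N$, the null-square algebra $\begin{pmatrix} A & N\\ M & B\end{pmatrix}$ is the algebra of such matrices with matrix multiplication given by the products of $A$ and $B$, the bimodule structures, and $mn=0$, $nm=0$ for all $m\in M$, $n\in N$. It is null-square projective if $M$ and $N$ are projective bimodules. Here $\otimes=\otimes_k$, ${}_gm_e,{}_fn_h$ are non-negative integers, and ${}_gm_e\,(Bg\otimes eA)$ denotes a direct sum of ${}_gm_e$ copies. A finite dimensional algebra $A$ is basic and sober if $A/\mathrm{rad}\,A$ is a product of copies of $k$. If $E$ is a complete system of primitive orthogonal idempotents of such an $A$, the Gabriel quiver $Q_A$ has vertex set $E$ and $\dim_k y(\mathrm{rad}A/\mathrm{rad}^2A)x$ arrows from $x$ to $y$. Paths are written from right to left, as composition of morphisms; $kQ$ is the path algebra. A presentation $(Q_A,R_A)$ of $A$ consists of the Gabriel quiver and a set $R_A$ such that there is an algebra surjection $kQ_A\to A$ whose kernel $I$ is the two-sided ideal generated by $R_A$, where $I$ is admissible (with $\mathfrak F$ the two-sided ideal generated by the arrows, $\mathfrak F^m\subset I\subset \mathfrak F^2$ for some positive integer $m$) and each element of $R_A$ lies in $yIx$ for some vertices $x,y$. The Gabriel quiver $Q_\Lambda$ of $\Lambda$ is the disjoint union of $Q_A$, $Q_B$ and the following new arrows: ${}_gm_e$ arrows from $e\in E$ to $g\in F$ (down arrows), one for each direct summand $Bg\otimes eA$ of $M$; and ${}_fn_h$ arrows from $h\in F$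 to $f\in E$ (up arrows), one for each direct summand $Af\otimes hB$ of $N$. Let $P_A$ be a set of oriented paths of $Q_A$ (including possibly paths of length zero) which is a basis of $kQ_A/\langle R_A\rangle$, and let $P_B$ be a set of oriented paths of $Q_B$ which is a basis of $kQ_B/\langle R_B\rangle$. For a set $Z$ of paths, $yZx$ denotes the set of paths of $Z$ starting at $x$ and ending at $y$. For a down arrow $u$ from $e$ to $g$ and an up arrow $v$ from $h$ to $f$, define the sets of paths of $Q_\Lambda$ $$v\curlyvee u=v(hP_Bg)u=\{v\gamma u\mid \gamma\in hP_Bg\},\qquad u\curlyvee v=u(eP_Af)v=\{u\gamma v\mid\gamma\in eP_Af\}.$$ *)

theory Defs
  imports "HOL-Algebra.Module" "HOL-Algebra.QuotRing" "HOL-Algebra.Ideal_Product" "Graph_Theory.Arc_Walk"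
begin

section \<open>Linear algebra over a field\<close>

text \<open>
  Vector spaces and algebras over a field \<open>K\<close> are records of type \<open>('k, 'v) module\<close>, as in
  \<^theory>\<open>HOL-Algebra.Module\<close>. For a plain vector space the components \<open>mult\<close> and \<open>one\<close> are
  irrelevant.
\<close>

definition lin_comb :: "('k, 'v, 'z) module_scheme \<Rightarrow> ('v \<Rightarrow> 'k) \<Rightarrow> 'v set \<Rightarrow> 'v" where
  "lin_comb V c T = (\<Oplus>\<^bsub>V\<^esub>x\<in>T. c x \<odot>\<^bsub>V\<^esub> x)"

definition lin_span ::
    "('k, 'r) ring_scheme \<Rightarrow> ('k, 'v, 'z) module_scheme \<Rightarrow> 'v set \<Rightarrow> 'v set" where
  "lin_span K V S = {lin_comb V c T | c T. finite T \<and> T \<subseteq> S \<and> c \<in> T \<rightarrow> carrier K}"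

definition lin_indep ::
    "('k, 'r) ring_scheme \<Rightarrow> ('k, 'v, 'z) module_scheme \<Rightarrow> 'v set \<Rightarrow> bool" where
  "lin_indep K V S \<longleftrightarrow>
     (\<forall>c T. finite T \<and> T \<subseteq> S \<and> c \<in> T \<rightarrow> carrier K \<and> lin_comb V c T = \<zero>\<^bsub>V\<^esub>
        \<longrightarrow> (\<forall>x\<in>T. c x = \<zero>\<^bsub>K\<^esub>))"

definition is_basis ::
    "('k, 'r) ring_scheme \<Rightarrow> ('k, 'v, 'z) module_scheme \<Rightarrow> 'v set \<Rightarrow> bool" where
  "is_basis K V S \<longleftrightarrow> S \<subseteq> carrier V \<and> lin_indep K V S \<and> lin_span K V S = carrier V"

definition finite_dim :: "('k, 'r) ring_scheme \<Rightarrow> ('k, 'v, 'z) module_scheme \<Rightarrow> bool" where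
  "finite_dim K V \<longleftrightarrow> (\<exists>S. finite S \<and> is_basis K V S)"

definition has_dim :: "('k, 'r) ring_scheme \<Rightarrow> ('k, 'v, 'z) module_scheme \<Rightarrow> nat \<Rightarrow> bool" where
  "has_dim K V n \<longleftrightarrow> (\<exists>S. finite S \<and> card S = n \<and> is_basis K V S)"

text \<open>
  The quotient of a vector space by a subspace, or of an algebra by a two-sided ideal: the
  library's \<^const>\<open>FactRing\<close> together with the induced scalar multiplication
  \<open>c (W + x) = W + c x\<close>.
\<close>

definition quot_mod :: "('k, 'v, 'z) module_scheme \<Rightarrow> 'v set \<Rightarrow> ('k, 'v set) module" where
  "quot_mod V W =
     ring.extend (V Quot W) (module.fields (\<lambda>c X. \<Union>x\<in>X. W +>\<^bsub>V\<^esub> (c \<odot>\<^bsub>V\<^esub> x)))"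

definition fin_supp :: "('k, 'r) ring_scheme \<Rightarrow> 'x set \<Rightarrow> ('x \<Rightarrow> 'k) set" where
  "fin_supp K X = {f. (\<forall>x. f x \<in> carrier K) \<and> (\<forall>x. x \<notin> X \<longrightarrow> f x = \<zero>\<^bsub>K\<^esub>)
                      \<and> finite {x. f x \<noteq> \<zero>\<^bsub>K\<^esub>}}"

definition delta :: "('k, 'r) ring_scheme \<Rightarrow> 'x \<Rightarrow> 'x \<Rightarrow> 'k" where
  "delta K x = (\<lambda>y. if y = x then \<one>\<^bsub>K\<^esub> else \<zero>\<^bsub>K\<^esub>)"

text \<open>The linear map between spaces of finitely supported functions with \<open>delta x \<mapsto> delta (h x)\<close>.\<close>

definition push :: "('k, 'r) ring_scheme \<Rightarrow> ('x \<Rightarrow> 'y) \<Rightarrow> ('x \<Rightarrow> 'k) \<Rightarrow> 'y \<Rightarrow> 'k" where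
  "push K h f = (\<lambda>y. \<Oplus>\<^bsub>K\<^esub>x\<in>{x. f x \<noteq> \<zero>\<^bsub>K\<^esub> \<and> h x = y}. f x)"

definition free_space :: "('k, 'r) ring_scheme \<Rightarrow> 'x set \<Rightarrow> ('k, 'x \<Rightarrow> 'k) module" where
  "free_space K X =
     \<lparr>carrier = fin_supp K X, mult = undefined, one = undefined,
      zero = (\<lambda>_. \<zero>\<^bsub>K\<^esub>), add = (\<lambda>f g x. f x \<oplus>\<^bsub>K\<^esub> g x), smult = (\<lambda>c f x. c \<otimes>\<^bsub>K\<^esub> f x)\<rparr>"


section \<open>Finite dimensional algebras\<close>

locale k_algebra = K?: field K + A?: ring A + Module.module K A
  for K :: "('k, 'r) ring_scheme" and A :: "('k, 'a, 'z) module_scheme" +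
  assumes smult_mult_left: "\<lbrakk>c \<in> carrier K; x \<in> carrier A; y \<in> carrier A\<rbrakk> \<Longrightarrow>
      (c \<odot>\<^bsub>A\<^esub> x) \<otimes>\<^bsub>A\<^esub> y = c \<odot>\<^bsub>A\<^esub> (x \<otimes>\<^bsub>A\<^esub> y)"
    and smult_mult_right: "\<lbrakk>c \<in> carrier K; x \<in> carrier A; y \<in> carrier A\<rbrakk> \<Longrightarrow>
      x \<otimes>\<^bsub>A\<^esub> (c \<odot>\<^bsub>A\<^esub> y) = c \<odot>\<^bsub>A\<^esub> (x \<otimes>\<^bsub>A\<^esub> y)"

definition alg_hom :: "('k, 'r) ring_scheme \<Rightarrow> ('k, 'a, 'y) module_scheme \<Rightarrow>
    ('k, 'b, 'z) module_scheme \<Rightarrow> ('a \<Rightarrow> 'b) set" where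
  "alg_hom K A B = {h \<in> ring_hom A B.
     \<forall>c\<in>carrier K. \<forall>x\<in>carrier A. h (c \<odot>\<^bsub>A\<^esub> x) = c \<odot>\<^bsub>B\<^esub> h x}"

definition alg_isomorphic :: "('k, 'r) ring_scheme \<Rightarrow> ('k, 'a, 'y) module_scheme \<Rightarrow>
    ('k, 'b, 'z) module_scheme \<Rightarrow> bool" where
  "alg_isomorphic K A B \<longleftrightarrow> (\<exists>h\<in>alg_hom K A B. bij_betw h (carrier A) (carrier B))"

definition power_algebra :: "('k, 'r) ring_scheme \<Rightarrow> nat \<Rightarrow> ('k, nat \<Rightarrow> 'k) module" where
  "power_algebra K n =
     \<lparr>carrier = {..<n} \<rightarrow>\<^sub>E carrier K,
      mult = (\<lambda>f g. \<lambda>i\<in>{..<n}. f i \<otimes>\<^bsub>K\<^esub> g i), one = (\<lambda>i\<in>{..<n}. \<one>\<^bsub>K\<^esub>),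
      zero = (\<lambda>i\<in>{..<n}. \<zero>\<^bsub>K\<^esub>), add = (\<lambda>f g. \<lambda>i\<in>{..<n}. f i \<oplus>\<^bsub>K\<^esub> g i),
      smult = (\<lambda>c f. \<lambda>i\<in>{..<n}. c \<otimes>\<^bsub>K\<^esub> f i)\<rparr>"

definition left_ideal :: "'a set \<Rightarrow> ('a, 'z) ring_scheme \<Rightarrow> bool" where
  "left_ideal L A \<longleftrightarrow> additive_subgroup L A \<and> (\<forall>a\<in>carrier A. \<forall>x\<in>L. a \<otimes>\<^bsub>A\<^esub> x \<in> L)"

definition maximal_left_ideal :: "'a set \<Rightarrow> ('a, 'z) ring_scheme \<Rightarrow> bool" where
  "maximal_left_ideal L A \<longleftrightarrow> left_ideal L A \<and> L \<noteq> carrier A \<and>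
     (\<forall>L'. left_ideal L' A \<and> L \<subseteq> L' \<longrightarrow> L' = L \<or> L' = carrier A)"

definition jacobson_rad :: "('a, 'z) ring_scheme \<Rightarrow> 'a set" where
  "jacobson_rad A = carrier A \<inter> \<Inter>{L. maximal_left_ideal L A}"

definition basic_sober :: "('k, 'r) ring_scheme \<Rightarrow> ('k, 'a, 'z) module_scheme \<Rightarrow> bool" where
  "basic_sober K A \<longleftrightarrow> k_algebra K A \<and> finite_dim K A \<and>
     (\<exists>n. alg_isomorphic K (quot_mod A (jacobson_rad A)) (power_algebra K n))"

definition idempotent :: "('a, 'z) ring_scheme \<Rightarrow> 'a \<Rightarrow> bool" where
  "idempotent A e \<longleftrightarrow> e \<in> carrier A \<and> e \<otimes>\<^bsub>A\<^esub> e = e"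

definition orthogonal :: "('a, 'z) ring_scheme \<Rightarrow> 'a \<Rightarrow> 'a \<Rightarrow> bool" where
  "orthogonal A e f \<longleftrightarrow> e \<otimes>\<^bsub>A\<^esub> f = \<zero>\<^bsub>A\<^esub> \<and> f \<otimes>\<^bsub>A\<^esub> e = \<zero>\<^bsub>A\<^esub>"

definition primitive_idempotent :: "('a, 'z) ring_scheme \<Rightarrow> 'a \<Rightarrow> bool" where
  "primitive_idempotent A e \<longleftrightarrow> idempotent A e \<and> e \<noteq> \<zero>\<^bsub>A\<^esub> \<and>
     \<not> (\<exists>e1 e2. idempotent A e1 \<and> idempotent A e2 \<and> orthogonal A e1 e2 \<and>
           e1 \<noteq> \<zero>\<^bsub>A\<^esub> \<and> e2 \<noteq> \<zero>\<^bsub>A\<^esub> \<and> e = e1 \<oplus>\<^bsub>A\<^esub> e2)"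

definition complete_primitive_orthogonal :: "('a, 'z) ring_scheme \<Rightarrow> 'a set \<Rightarrow> bool" where
  "complete_primitive_orthogonal A E \<longleftrightarrow> finite E \<and> (\<forall>e\<in>E. primitive_idempotent A e) \<and>
     (\<forall>e\<in>E. \<forall>f\<in>E. e \<noteq> f \<longrightarrow> orthogonal A e f) \<and> (\<Oplus>\<^bsub>A\<^esub>e\<in>E. e) = \<one>\<^bsub>A\<^esub>"


section \<open>Quivers, path algebras and presentations\<close>

text \<open>
  The space \<open>y (rad A / rad\<^sup>2 A) x\<close>, as a subspace of \<open>A / rad\<^sup>2 A\<close>; the bimodule action is
  \<open>y (rad\<^sup>2 A + r) x = rad\<^sup>2 A + y r x\<close>.
\<close>

definition arrow_space :: "('k, 'a, 'z) module_scheme \<Rightarrow> 'a \<Rightarrow> 'a \<Rightarrow> ('k, 'a set) module" where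
  "arrow_space A y x =
     (let J = jacobson_rad A; J2 = J [^]\<^bsub>ideals_set A\<^esub> (2::nat)
      in (quot_mod A J2)\<lparr>carrier := {J2 +>\<^bsub>A\<^esub> (y \<otimes>\<^bsub>A\<^esub> r \<otimes>\<^bsub>A\<^esub> x) | r. r \<in> J}\<rparr>)"

text \<open>The vertices of a Gabriel quiver of \<open>A\<close> are themselves idempotents of \<open>A\<close>.\<close>

definition gabriel_quiver ::
    "('k, 'r) ring_scheme \<Rightarrow> ('k, 'a, 'z) module_scheme \<Rightarrow> ('a, 'q) pre_digraph \<Rightarrow> bool" where
  "gabriel_quiver K A Q \<longleftrightarrow> basic_sober K A \<and> fin_digraph Q \<and>
     complete_primitive_orthogonal A (verts Q) \<and>
     (\<forall>x\<in>verts Q. \<forall>y\<in>verts Q.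
        has_dim K (arrow_space A y x) (card {a \<in> arcs Q. tail Q a = x \<and> head Q a = y}))"

text \<open>
  A path is its starting vertex together with the list of its arrows in the order in which they
  are traversed. Paths are composed from right to left: \<open>path_comp \<gamma> \<delta>\<close>, for \<open>\<gamma>\<delta>\<close>, traverses
  \<open>\<delta>\<close> first. The arrows \<open>a\<^sub>n \<dots> a\<^sub>1\<close>, in the usual notation, thus form the list \<open>[a\<^sub>1, \<dots>, a\<^sub>n]\<close>.
\<close>

type_synonym ('v, 'q) path = "'v \<times> 'q list"

definition paths :: "('v, 'q) pre_digraph \<Rightarrow> ('v, 'q) path set" where
  "paths Q = {(x, p). \<exists>y. pre_digraph.awalk Q x p y}"

definition path_start :: "('v, 'q) path \<Rightarrow> 'v" where
  "path_start \<gamma> = fst \<gamma>"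

definition path_end :: "('v, 'q) pre_digraph \<Rightarrow> ('v, 'q) path \<Rightarrow> 'v" where
  "path_end Q \<gamma> = pre_digraph.awlast Q (fst \<gamma>) (snd \<gamma>)"

definition path_comp :: "('v, 'q) path \<Rightarrow> ('v, 'q) path \<Rightarrow> ('v, 'q) path" where
  "path_comp \<gamma> \<delta> = (fst \<delta>, snd \<delta> @ snd \<gamma>)"

definition vertex_path :: "'v \<Rightarrow> ('v, 'q) path" where
  "vertex_path x = (x, [])"

definition arrow_path :: "('v, 'q) pre_digraph \<Rightarrow> 'q \<Rightarrow> ('v, 'q) path" where
  "arrow_path Q a = (tail Q a, [a])"

text \<open>\<open>paths_between Q Z y x\<close> is the set \<open>yZx\<close>.\<close>

definition paths_between ::
    "('v, 'q) pre_digraph \<Rightarrow> ('v, 'q) path set \<Rightarrow> 'v \<Rightarrow> 'v \<Rightarrow> ('v, 'q) path set" where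
  "paths_between Q Z y x = {\<gamma> \<in> Z. path_start \<gamma> = x \<and> path_end Q \<gamma> = y}"

definition path_algebra ::
    "('k, 'r) ring_scheme \<Rightarrow> ('v, 'q) pre_digraph \<Rightarrow> ('k, ('v, 'q) path \<Rightarrow> 'k) module" where
  "path_algebra K Q =
     (free_space K (paths Q))
       \<lparr>mult := (\<lambda>f g \<gamma>. finsum K (\<lambda>(\<alpha>, \<beta>). f \<alpha> \<otimes>\<^bsub>K\<^esub> g \<beta>)
                  {(\<alpha>, \<beta>). \<alpha> \<in> paths Q \<and> \<beta> \<in> paths Q \<and>
                            path_start \<alpha> = path_end Q \<beta> \<and> path_comp \<alpha> \<beta> = \<gamma>}),
        one := (\<lambda>\<gamma>. if \<gamma> \<in> vertex_path ` verts Q then \<one>\<^bsub>K\<^esub> else \<zero>\<^bsub>K\<^esub>)\<rparr>"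

definition arrow_ideal ::
    "('k, 'r) ring_scheme \<Rightarrow> ('v, 'q) pre_digraph \<Rightarrow> (('v, 'q) path \<Rightarrow> 'k) set" where
  "arrow_ideal K Q = Idl\<^bsub>path_algebra K Q\<^esub> ((\<lambda>a. delta K (arrow_path Q a)) ` arcs Q)"

definition admissible :: "('k, 'r) ring_scheme \<Rightarrow> ('v, 'q) pre_digraph \<Rightarrow>
    (('v, 'q) path \<Rightarrow> 'k) set \<Rightarrow> bool" where
  "admissible K Q I \<longleftrightarrow> ideal I (path_algebra K Q) \<and>
     (\<exists>m::nat. m > 0 \<and> arrow_ideal K Q [^]\<^bsub>ideals_set (path_algebra K Q)\<^esub> m \<subseteq> I) \<and>
     I \<subseteq> arrow_ideal K Q [^]\<^bsub>ideals_set (path_algebra K Q)\<^esub> (2::nat)"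

text \<open>
  The vertices of \<open>Q\<close> being idempotents of \<open>A\<close>, the surjection \<open>kQ \<rightarrow> A\<close> of a presentation sends
  the path of length zero at a vertex to that idempotent. (Otherwise \<open>R\<close> could be twisted by an
  automorphism of \<open>Q\<close> and would not be related to the idempotents used elsewhere.)
\<close>

definition presentation :: "('k, 'r) ring_scheme \<Rightarrow> ('k, 'a, 'z) module_scheme \<Rightarrow>
    ('a, 'q) pre_digraph \<Rightarrow> (('a, 'q) path \<Rightarrow> 'k) set \<Rightarrow> bool" where
  "presentation K A Q R \<longleftrightarrow> gabriel_quiver K A Q \<and>
     (\<exists>\<phi>\<in>alg_hom K (path_algebra K Q) A.
        \<phi> ` carrier (path_algebra K Q) = carrier A \<and>
        (\<forall>x\<in>verts Q. \<phi> (delta K (vertex_path x)) = x) \<and>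
        (let kQ = path_algebra K Q; I = a_kernel kQ A \<phi> in
           R \<subseteq> carrier kQ \<and> I = Idl\<^bsub>kQ\<^esub> R \<and> admissible K Q I \<and>
           (\<forall>r\<in>R. \<exists>x\<in>verts Q. \<exists>y\<in>verts Q. \<exists>z\<in>I.
              r = delta K (vertex_path y) \<otimes>\<^bsub>kQ\<^esub> z \<otimes>\<^bsub>kQ\<^esub> delta K (vertex_path x))))"

text \<open>\<open>P\<close> is a set of paths which is a basis of \<open>kQ / \<langle>R\<rangle>\<close>.\<close>

definition path_basis :: "('k, 'r) ring_scheme \<Rightarrow> ('v, 'q) pre_digraph \<Rightarrow>
    (('v, 'q) path \<Rightarrow> 'k) set \<Rightarrow> ('v, 'q) path set \<Rightarrow> bool" where
  "path_basis K Q R P \<longleftrightarrow> P \<subseteq> paths Q \<and>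
     (let kQ = path_algebra K Q; I = Idl\<^bsub>kQ\<^esub> R; cls = (\<lambda>\<gamma>. I +>\<^bsub>kQ\<^esub> delta K \<gamma>) in
        inj_on cls P \<and> is_basis K (quot_mod kQ I) (cls ` P))"


section \<open>Bimodules\<close>

record ('k, 'b, 'a, 'm) bimod = "('k, 'm) module" +
  lact :: "'b \<Rightarrow> 'm \<Rightarrow> 'm"
  ract :: "'m \<Rightarrow> 'a \<Rightarrow> 'm"

text \<open>\<open>B\<close>-\<open>A\<close>-bimodules, with \<open>K\<close> acting centrally.\<close>

locale k_bimodule = B?: k_algebra K B + A?: k_algebra K A + M?: Module.module K M
  for K :: "('k, 'r) ring_scheme" and B :: "('k, 'b, 'y) module_scheme"
    and A :: "('k, 'a, 'z) module_scheme" and M :: "('k, 'b, 'a, 'm) bimod" +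
  assumes lact_closed: "\<lbrakk>b \<in> carrier B; x \<in> carrier M\<rbrakk> \<Longrightarrow> lact M b x \<in> carrier M"
    and ract_closed: "\<lbrakk>x \<in> carrier M; a \<in> carrier A\<rbrakk> \<Longrightarrow> ract M x a \<in> carrier M"
    and lact_one: "x \<in> carrier M \<Longrightarrow> lact M \<one>\<^bsub>B\<^esub> x = x"
    and ract_one: "x \<in> carrier M \<Longrightarrow> ract M x \<one>\<^bsub>A\<^esub> = x"
    and lact_mult: "\<lbrakk>b \<in> carrier B; b' \<in> carrier B; x \<in> carrier M\<rbrakk> \<Longrightarrow>
      lact M (b \<otimes>\<^bsub>B\<^esub> b') x = lact M b (lact M b' x)"
    and ract_mult: "\<lbrakk>x \<in> carrier M; a \<in> carrier A; a' \<in> carrier A\<rbrakk> \<Longrightarrow>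
      ract M x (a \<otimes>\<^bsub>A\<^esub> a') = ract M (ract M x a) a'"
    and lact_ract: "\<lbrakk>b \<in> carrier B; x \<in> carrier M; a \<in> carrier A\<rbrakk> \<Longrightarrow>
      ract M (lact M b x) a = lact M b (ract M x a)"
    and lact_add_left: "\<lbrakk>b \<in> carrier B; b' \<in> carrier B; x \<in> carrier M\<rbrakk> \<Longrightarrow>
      lact M (b \<oplus>\<^bsub>B\<^esub> b') x = lact M b x \<oplus>\<^bsub>M\<^esub> lact M b' x"
    and lact_add_right: "\<lbrakk>b \<in> carrier B; x \<in> carrier M; x' \<in> carrier M\<rbrakk> \<Longrightarrow>
      lact M b (x \<oplus>\<^bsub>M\<^esub> x') = lact M b x \<oplus>\<^bsub>M\<^esub> lact M b x'"
    and ract_add_left: "\<lbrakk>x \<in> carrier M; x' \<in> carrier M; a \<in> carrier A\<rbrakk> \<Longrightarrow>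
      ract M (x \<oplus>\<^bsub>M\<^esub> x') a = ract M x a \<oplus>\<^bsub>M\<^esub> ract M x' a"
    and ract_add_right: "\<lbrakk>x \<in> carrier M; a \<in> carrier A; a' \<in> carrier A\<rbrakk> \<Longrightarrow>
      ract M x (a \<oplus>\<^bsub>A\<^esub> a') = ract M x a \<oplus>\<^bsub>M\<^esub> ract M x a'"
    and lact_smult_left: "\<lbrakk>c \<in> carrier K; b \<in> carrier B; x \<in> carrier M\<rbrakk> \<Longrightarrow>
      lact M (c \<odot>\<^bsub>B\<^esub> b) x = c \<odot>\<^bsub>M\<^esub> lact M b x"
    and lact_smult_right: "\<lbrakk>c \<in> carrier K; b \<in> carrier B; x \<in> carrier M\<rbrakk> \<Longrightarrow>
      lact M b (c \<odot>\<^bsub>M\<^esub> x) = c \<odot>\<^bsub>M\<^esub> lact M b x"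
    and ract_smult_left: "\<lbrakk>c \<in> carrier K; x \<in> carrier M; a \<in> carrier A\<rbrakk> \<Longrightarrow>
      ract M (c \<odot>\<^bsub>M\<^esub> x) a = c \<odot>\<^bsub>M\<^esub> ract M x a"
    and ract_smult_right: "\<lbrakk>c \<in> carrier K; x \<in> carrier M; a \<in> carrier A\<rbrakk> \<Longrightarrow>
      ract M x (c \<odot>\<^bsub>A\<^esub> a) = c \<odot>\<^bsub>M\<^esub> ract M x a"

definition bimod_isomorphic :: "('k, 'r) ring_scheme \<Rightarrow> ('b, 'x) ring_scheme \<Rightarrow>
    ('a, 'y) ring_scheme \<Rightarrow> ('k, 'b, 'a, 'm) bimod \<Rightarrow> ('k, 'b, 'a, 'n) bimod \<Rightarrow> bool" where
  "bimod_isomorphic K B A M N \<longleftrightarrow> (\<exists>h. bij_betw h (carrier M) (carrier N) \<and>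
     (\<forall>x\<in>carrier M. \<forall>y\<in>carrier M. h (x \<oplus>\<^bsub>M\<^esub> y) = h x \<oplus>\<^bsub>N\<^esub> h y) \<and>
     (\<forall>c\<in>carrier K. \<forall>x\<in>carrier M. h (c \<odot>\<^bsub>M\<^esub> x) = c \<odot>\<^bsub>N\<^esub> h x) \<and>
     (\<forall>b\<in>carrier B. \<forall>x\<in>carrier M. h (lact M b x) = lact N b (h x)) \<and>
     (\<forall>x\<in>carrier M. \<forall>a\<in>carrier A. h (ract M x a) = ract N (h x) a))"

text \<open>
  \<open>V \<otimes>\<^sub>k W\<close> is the free vector space on \<open>V \<times> W\<close> modulo the bilinearity relations; the coset of
  \<open>delta K (v, w)\<close> is the pure tensor \<open>v \<otimes> w\<close>.
\<close>

definition tensor_rels :: "('k, 'r) ring_scheme \<Rightarrow> ('k, 'v, 'y) module_scheme \<Rightarrow>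
    ('k, 'w, 'z) module_scheme \<Rightarrow> ('v \<times> 'w \<Rightarrow> 'k) set" where
  "tensor_rels K V W =
     (let F = free_space K (carrier V \<times> carrier W) in lin_span K F
       ({delta K (v \<oplus>\<^bsub>V\<^esub> v', w) \<ominus>\<^bsub>F\<^esub> (delta K (v, w) \<oplus>\<^bsub>F\<^esub> delta K (v', w)) | v v' w.
           v \<in> carrier V \<and> v' \<in> carrier V \<and> w \<in> carrier W} \<union>
        {delta K (v, w \<oplus>\<^bsub>W\<^esub> w') \<ominus>\<^bsub>F\<^esub> (delta K (v, w) \<oplus>\<^bsub>F\<^esub> delta K (v, w')) | v w w'.
           v \<in> carrier V \<and> w \<in> carrier W \<and> w' \<in> carrier W} \<union>
        {delta K (c \<odot>\<^bsub>V\<^esub> v, w) \<ominus>\<^bsub>F\<^esub> (c \<odot>\<^bsub>F\<^esub> delta K (v, w)) | c v w.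
           c \<in> carrier K \<and> v \<in> carrier V \<and> w \<in> carrier W} \<union>
        {delta K (v, c \<odot>\<^bsub>W\<^esub> w) \<ominus>\<^bsub>F\<^esub> (c \<odot>\<^bsub>F\<^esub> delta K (v, w)) | c v w.
           c \<in> carrier K \<and> v \<in> carrier V \<and> w \<in> carrier W}))"

definition tensor :: "('k, 'r) ring_scheme \<Rightarrow> ('k, 'v, 'y) module_scheme \<Rightarrow>
    ('k, 'w, 'z) module_scheme \<Rightarrow> ('k, ('v \<times> 'w \<Rightarrow> 'k) set) module" where
  "tensor K V W = quot_mod (free_space K (carrier V \<times> carrier W)) (tensor_rels K V W)"

text \<open>
  The \<open>B\<close>-\<open>A\<close>-bimodule \<open>Bg \<otimes> eA\<close>, with \<open>b (x \<otimes> y) = b x \<otimes> y\<close> and \<open>(x \<otimes> y) a = x \<otimes> y a\<close>.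
\<close>

definition proj_bimod :: "('k, 'r) ring_scheme \<Rightarrow> ('k, 'b, 'y) module_scheme \<Rightarrow>
    ('k, 'a, 'z) module_scheme \<Rightarrow> 'b \<Rightarrow> 'a \<Rightarrow> ('k, 'b, 'a, ('b \<times> 'a \<Rightarrow> 'k) set) bimod" where
  "proj_bimod K B A g e =
     (let Bg = B\<lparr>carrier := {b \<otimes>\<^bsub>B\<^esub> g | b. b \<in> carrier B}\<rparr>;
          eA = A\<lparr>carrier := {e \<otimes>\<^bsub>A\<^esub> a | a. a \<in> carrier A}\<rparr>;
          F = free_space K (carrier Bg \<times> carrier eA);
          T = tensor_rels K Bg eA
      in module.extend (tensor K Bg eA) (bimod.fields
           (\<lambda>b X. \<Union>f\<in>X. T +>\<^bsub>F\<^esub> push K (\<lambda>(x, y). (b \<otimes>\<^bsub>B\<^esub> x, y)) f)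
           (\<lambda>X a. \<Union>f\<in>X. T +>\<^bsub>F\<^esub> push K (\<lambda>(x, y). (x, y \<otimes>\<^bsub>A\<^esub> a)) f)))"

definition bimod_direct_sum ::
    "'i set \<Rightarrow> ('i \<Rightarrow> ('k, 'b, 'a, 'm) bimod) \<Rightarrow> ('k, 'b, 'a, 'i \<Rightarrow> 'm) bimod" where
  "bimod_direct_sum X T =
     \<lparr>carrier = {s \<in> \<Pi>\<^sub>E i\<in>X. carrier (T i). finite {i \<in> X. s i \<noteq> \<zero>\<^bsub>T i\<^esub>}},
      mult = undefined, one = undefined,
      zero = (\<lambda>i\<in>X. \<zero>\<^bsub>T i\<^esub>), add = (\<lambda>s t. \<lambda>i\<in>X. s i \<oplus>\<^bsub>T i\<^esub> t i),
      smult = (\<lambda>c s. \<lambda>i\<in>X. c \<odot>\<^bsub>T i\<^esub> s i),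
      lact = (\<lambda>b s. \<lambda>i\<in>X. lact (T i) b (s i)), ract = (\<lambda>s a. \<lambda>i\<in>X. ract (T i) (s i) a)\<rparr>"

text \<open>
  \<open>\<Oplus>\<^bsub>(g, e) \<in> F \<times> E\<^esub> m g e (Bg \<otimes> eA)\<close>: the summand \<open>Bg \<otimes> eA\<close> occurs once for every index
  \<open>(g, e, i)\<close> with \<open>i < m g e\<close>. It is a direct summand of a free bimodule since \<open>Bg \<otimes> eA\<close> is one of
  \<open>B \<otimes> A\<close>; a bimodule isomorphic to such a direct sum is therefore projective.
\<close>

definition proj_sum :: "('k, 'r) ring_scheme \<Rightarrow> ('k, 'b, 'y) module_scheme \<Rightarrow>
    ('k, 'a, 'z) module_scheme \<Rightarrow> 'b set \<Rightarrow> 'a set \<Rightarrow> ('b \<Rightarrow> 'a \<Rightarrow> nat) \<Rightarrow>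
    ('k, 'b, 'a, 'b \<times> 'a \<times> nat \<Rightarrow> ('b \<times> 'a \<Rightarrow> 'k) set) bimod" where
  "proj_sum K B A F E m =
     bimod_direct_sum {(g, e, i). g \<in> F \<and> e \<in> E \<and> i < m g e} (\<lambda>(g, e, i). proj_bimod K B A g e)"


section \<open>Null-square algebras and their quivers\<close>

text \<open>
  The tuple \<open>(a, n, m, b)\<close> is the matrix with rows \<open>(a, n)\<close> and \<open>(m, b)\<close>. In the product, the
  terms \<open>n m'\<close> and \<open>m n'\<close> of the diagonal entries vanish.
\<close>

definition null_square_algebra :: "('k, 'a, 'x) module_scheme \<Rightarrow> ('k, 'a, 'b, 'n) bimod \<Rightarrow>
    ('k, 'b, 'a, 'm) bimod \<Rightarrow> ('k, 'b, 'y) module_scheme \<Rightarrow>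
    ('k, 'a \<times> 'n \<times> 'm \<times> 'b) module" where
  "null_square_algebra A N M B =
     \<lparr>carrier = carrier A \<times> carrier N \<times> carrier M \<times> carrier B,
      mult = (\<lambda>(a, n, m, b) (a', n', m', b').
        (a \<otimes>\<^bsub>A\<^esub> a', lact N a n' \<oplus>\<^bsub>N\<^esub> ract N n b',
         ract M m a' \<oplus>\<^bsub>M\<^esub> lact M b m', b \<otimes>\<^bsub>B\<^esub> b')),
      one = (\<one>\<^bsub>A\<^esub>, \<zero>\<^bsub>N\<^esub>, \<zero>\<^bsub>M\<^esub>, \<one>\<^bsub>B\<^esub>),
      zero = (\<zero>\<^bsub>A\<^esub>, \<zero>\<^bsub>N\<^esub>, \<zero>\<^bsub>M\<^esub>, \<zero>\<^bsub>B\<^esub>),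
      add = (\<lambda>(a, n, m, b) (a', n', m', b').
        (a \<oplus>\<^bsub>A\<^esub> a', n \<oplus>\<^bsub>N\<^esub> n', m \<oplus>\<^bsub>M\<^esub> m', b \<oplus>\<^bsub>B\<^esub> b')),
      smult = (\<lambda>c (a, n, m, b). (c \<odot>\<^bsub>A\<^esub> a, c \<odot>\<^bsub>N\<^esub> n, c \<odot>\<^bsub>M\<^esub> m, c \<odot>\<^bsub>B\<^esub> b))\<rparr>"

text \<open>
  The elements \<open>e \<in> E\<close> and \<open>g \<in> F\<close>, viewed in the null-square algebra. They are
  distinct vertices of its quiver, even if \<open>A\<close> and \<open>B\<close> share elements.
\<close>

definition vertex_A :: "('n, 'x) ring_scheme \<Rightarrow> ('m, 'y) ring_scheme \<Rightarrow> ('b, 'z) ring_scheme \<Rightarrow>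
    'a \<Rightarrow> 'a \<times> 'n \<times> 'm \<times> 'b" where
  "vertex_A N M B e = (e, \<zero>\<^bsub>N\<^esub>, \<zero>\<^bsub>M\<^esub>, \<zero>\<^bsub>B\<^esub>)"

definition vertex_B :: "('a, 'x) ring_scheme \<Rightarrow> ('n, 'y) ring_scheme \<Rightarrow> ('m, 'z) ring_scheme \<Rightarrow>
    'b \<Rightarrow> 'a \<times> 'n \<times> 'm \<times> 'b" where
  "vertex_B A N M g = (\<zero>\<^bsub>A\<^esub>, \<zero>\<^bsub>N\<^esub>, \<zero>\<^bsub>M\<^esub>, g)"

text \<open>
  \<open>Down g e i\<close> is the arrow from \<open>e\<close> to \<open>g\<close> for the \<open>i\<close>-th summand \<open>Bg \<otimes> eA\<close> of \<open>M\<close>, and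
  \<open>Up f h j\<close> the arrow from \<open>h\<close> to \<open>f\<close> for the \<open>j\<close>-th summand \<open>Af \<otimes> hB\<close> of \<open>N\<close>.
\<close>

datatype ('a, 'b, 'p, 'q) null_square_arrow =
  Arrow_A 'p | Arrow_B 'q | Down 'b 'a nat | Up 'a 'b nat

definition down_arrows ::
    "'b set \<Rightarrow> 'a set \<Rightarrow> ('b \<Rightarrow> 'a \<Rightarrow> nat) \<Rightarrow> ('a, 'b, 'p, 'q) null_square_arrow set" where
  "down_arrows F E m = {Down g e i | g e i. g \<in> F \<and> e \<in> E \<and> i < m g e}"

definition up_arrows ::
    "'a set \<Rightarrow> 'b set \<Rightarrow> ('a \<Rightarrow> 'b \<Rightarrow> nat) \<Rightarrow> ('a, 'b, 'p, 'q) null_square_arrow set" where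
  "up_arrows E F n = {Up f h j | f h j. f \<in> E \<and> h \<in> F \<and> j < n f h}"

text \<open>\<open>iA\<close> and \<open>iB\<close> embed the vertices of \<open>QA\<close> and of \<open>QB\<close> into the new vertex set.\<close>

definition null_square_quiver ::
    "('a \<Rightarrow> 'l) \<Rightarrow> ('b \<Rightarrow> 'l) \<Rightarrow> ('a, 'p) pre_digraph \<Rightarrow> ('b, 'q) pre_digraph \<Rightarrow>
     ('b \<Rightarrow> 'a \<Rightarrow> nat) \<Rightarrow> ('a \<Rightarrow> 'b \<Rightarrow> nat) \<Rightarrow>
     ('l, ('a, 'b, 'p, 'q) null_square_arrow) pre_digraph" where
  "null_square_quiver iA iB QA QB m n =
     \<lparr>verts = iA ` verts QA \<union> iB ` verts QB,
      arcs = Arrow_A ` arcs QA \<union> Arrow_B ` arcs QB \<union>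
             down_arrows (verts QB) (verts QA) m \<union> up_arrows (verts QA) (verts QB) n,
      tail = (\<lambda>a. case a of Arrow_A p \<Rightarrow> iA (tail QA p) | Arrow_B q \<Rightarrow> iB (tail QB q)
                  | Down g e i \<Rightarrow> iA e | Up f h j \<Rightarrow> iB h),
      head = (\<lambda>a. case a of Arrow_A p \<Rightarrow> iA (head QA p) | Arrow_B q \<Rightarrow> iB (head QB q)
                  | Down g e i \<Rightarrow> iB g | Up f h j \<Rightarrow> iA f)\<rparr>"

definition path_A ::
    "('a \<Rightarrow> 'l) \<Rightarrow> ('a, 'p) path \<Rightarrow> ('l, ('a, 'b, 'p, 'q) null_square_arrow) path" where
  "path_A iA \<gamma> = (iA (fst \<gamma>), map Arrow_A (snd \<gamma>))"

definition path_B ::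
    "('b \<Rightarrow> 'l) \<Rightarrow> ('b, 'q) path \<Rightarrow> ('l, ('a, 'b, 'p, 'q) null_square_arrow) path" where
  "path_B iB \<gamma> = (iB (fst \<gamma>), map Arrow_B (snd \<gamma>))"

text \<open>
  For arrows \<open>w\<close>, \<open>w'\<close> of \<open>Q\<close> and a set \<open>P\<close> of paths of \<open>Q\<close>, the set of the paths \<open>w' \<gamma> w\<close> with
  \<open>\<gamma> \<in> P\<close> from the head of \<open>w\<close> to the tail of \<open>w'\<close>. For a down arrow \<open>u\<close> and an up arrow \<open>v\<close>
  this is \<open>v \<curlyvee> u\<close> if \<open>P = P\<^sub>B\<close>, \<open>w = u\<close>, \<open>w' = v\<close>, and it is \<open>u \<curlyvee> v\<close> if \<open>P = P\<^sub>A\<close>, \<open>w = v\<close>, \<open>w' = u\<close>.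
\<close>

definition curlyvee ::
    "('l, 'q) pre_digraph \<Rightarrow> ('l, 'q) path set \<Rightarrow> 'q \<Rightarrow> 'q \<Rightarrow> ('l, 'q) path set" where
  "curlyvee Q P w' w =
     {path_comp (arrow_path Q w') (path_comp \<gamma> (arrow_path Q w)) | \<gamma>.
        \<gamma> \<in> paths_between Q P (tail Q w') (head Q w)}"

definition null_square_relations :: "('k, 'r) ring_scheme \<Rightarrow> ('a \<Rightarrow> 'l) \<Rightarrow> ('b \<Rightarrow> 'l) \<Rightarrow>
    ('a, 'p) pre_digraph \<Rightarrow> ('b, 'q) pre_digraph \<Rightarrow>
    ('b \<Rightarrow> 'a \<Rightarrow> nat) \<Rightarrow> ('a \<Rightarrow> 'b \<Rightarrow> nat) \<Rightarrow>
    (('a, 'p) path \<Rightarrow> 'k) set \<Rightarrow> (('b, 'q) path \<Rightarrow> 'k) set \<Rightarrow>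
    ('a, 'p) path set \<Rightarrow> ('b, 'q) path set \<Rightarrow>
    (('l, ('a, 'b, 'p, 'q) null_square_arrow) path \<Rightarrow> 'k) set" where
  "null_square_relations K iA iB QA QB m n RA RB PA PB =
     (let Q = null_square_quiver iA iB QA QB m n;
          D = down_arrows (verts QB) (verts QA) m;
          U = up_arrows (verts QA) (verts QB) n
      in push K (path_A iA) ` RA \<union> push K (path_B iB) ` RB \<union>
         (\<Union>u\<in>D. \<Union>v\<in>U. delta K ` curlyvee Q (path_B iB ` PB) v u) \<union>
         (\<Union>u\<in>D. \<Union>v\<in>U. delta K ` curlyvee Q (path_A iA ` PA) u v))"

end

theory Submission
  imports Defs
begin

text \<open>
  Let \<open>\<phi>: kQ \<rightarrow> \<Lambda>\<close> be the algebra map given by the presentations of \<open>A\<close> and \<open>B\<close> on the old arrows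
  and by the generators \<open>g \<otimes> e\<close> and \<open>f \<otimes> h\<close> of \<open>M\<close> and \<open>N\<close> on the new ones. It is onto and kills the
  ideal \<open>I\<close> generated by \<open>R\<close>. In \<open>kQ / I\<close> the relations \<open>v \<gamma> u = 0\<close> for \<open>\<gamma> \<in> P\<^sub>B\<close> force \<open>v b u = 0\<close> for every
  \<open>b \<in> B\<close>, because \<open>P\<^sub>B\<close> spans \<open>B\<close>, and similarly \<open>u a v = 0\<close>. Hence the presentations of \<open>A\<close> and \<open>B\<close>
  and the universal property of \<open>M\<close> and \<open>N\<close> yield a linear map \<open>\<Lambda> \<rightarrow> kQ / I\<close> whose composite with
  \<open>\<phi>\<close> is the quotient map, so \<open>ker \<phi> = I\<close>. Long paths vanish in \<open>\<Lambda>\<close> since \<open>rad A\<close> and \<open>rad B\<close> are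
  nilpotent. Finally, any surjection \<open>kQ \<rightarrow> L\<close> with admissible kernel that fixes the vertices makes
  \<open>Q\<close> the Gabriel quiver of \<open>L\<close>, since it maps the arrow ideal onto \<open>rad L\<close>.
\<close>

section \<open>Linear maps and quotients\<close>

text \<open>The map back from \<Lambda> to kQ / I is only linear. It turns left multiplication by
  the image of an arrow into left multiplication by the class of that arrow, so induction on paths
  shows that it recovers classes, and its multiplicativity is never checked. Most products of
  classes that have to vanish do so because an idempotent of \<open>A\<close> meets one of
  \<open>B\<close>. Only the products of the images of \<open>M\<close> and \<open>N\<close>, in
  either order, lack this reason, and their vanishing is what the new relations supply. The bound
  for long paths comes from \<open>dA\<close> and \<open>dB\<close>, lengths from which on paths
  vanish in \<open>A\<close> and \<open>B\<close>. A path that is nonzero in \<Lambda> contains at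
  most one new arrow, with arrows of one old quiver before it and arrows of the other after it. For
  the Gabriel quiver the decisive fact is that the kernel consists of combinations of paths of
  length at least two. It makes the coefficient of a vertex in a preimage well defined, which gives
  a character of \<open>L\<close> for every vertex. The radical is the common kernel of these
  characters, and they also detect whether an idempotent is zero.\<close>

definition lin_map :: "('k, 'r) ring_scheme \<Rightarrow> ('k, 'v, 'y) module_scheme \<Rightarrow>
    ('k, 'w, 'z) module_scheme \<Rightarrow> ('v \<Rightarrow> 'w) set" where
  "lin_map K V W = {f. (\<forall>x\<in>carrier V. f x \<in> carrier W) \<and>
     (\<forall>x\<in>carrier V. \<forall>y\<in>carrier V. f (x \<oplus>\<^bsub>V\<^esub> y) = f x \<oplus>\<^bsub>W\<^esub> f y) \<and>
     (\<forall>c\<in>carrier K. \<forall>x\<in>carrier V. f (c \<odot>\<^bsub>V\<^esub> x) = c \<odot>\<^bsub>W\<^esub> f x)}"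

lemma lin_mapI:
  assumes "\<And>x. x \<in> carrier V \<Longrightarrow> f x \<in> carrier W"
    and "\<And>x y. \<lbrakk>x \<in> carrier V; y \<in> carrier V\<rbrakk> \<Longrightarrow> f (x \<oplus>\<^bsub>V\<^esub> y) = f x \<oplus>\<^bsub>W\<^esub> f y"
    and "\<And>c x. \<lbrakk>c \<in> carrier K; x \<in> carrier V\<rbrakk> \<Longrightarrow> f (c \<odot>\<^bsub>V\<^esub> x) = c \<odot>\<^bsub>W\<^esub> f x"
  shows "f \<in> lin_map K V W"
  using assms by (auto simp: lin_map_def)

lemma lin_mapD:
  assumes "f \<in> lin_map K V W"
  shows lin_map_closed: "x \<in> carrier V \<Longrightarrow> f x \<in> carrier W"
    and lin_map_add: "\<lbrakk>x \<in> carrier V; y \<in> carrier V\<rbrakk> \<Longrightarrow> f (x \<oplus>\<^bsub>V\<^esub> y) = f x \<oplus>\<^bsub>W\<^esub> f y"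
    and lin_map_smult: "\<lbrakk>c \<in> carrier K; x \<in> carrier V\<rbrakk> \<Longrightarrow> f (c \<odot>\<^bsub>V\<^esub> x) = c \<odot>\<^bsub>W\<^esub> f x"
  using assms by (auto simp: lin_map_def)

lemma lin_map_comp:
  assumes "f \<in> lin_map K U V" "g \<in> lin_map K V W"
  shows "(\<lambda>x. g (f x)) \<in> lin_map K U W"
  using assms by (auto simp: lin_map_def Pi_iff)

lemma lin_map_hom:
  assumes "Module.module K V" "Module.module K W" "f \<in> lin_map K V W"
  shows "abelian_group_hom V W f"
proof -
  interpret V: Module.module K V by fact
  interpret W: Module.module K W by fact
  show ?thesis
    using assms(3) by (intro abelian_group_homI group_hom.intro)
      (auto simp: group_hom_axioms_def hom_def lin_map_def V.abelian_group_axioms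
        W.abelian_group_axioms V.M.a_group W.M.a_group)
qed

lemma lin_map_zero:
  assumes "Module.module K V" "Module.module K W" "f \<in> lin_map K V W"
  shows "f \<zero>\<^bsub>V\<^esub> = \<zero>\<^bsub>W\<^esub>"
  using abelian_group_hom.hom_zero[OF lin_map_hom[OF assms]] .

lemma lin_map_minus:
  assumes "Module.module K V" "Module.module K W" "f \<in> lin_map K V W" "x \<in> carrier V" "y \<in> carrier V"
  shows "f (x \<ominus>\<^bsub>V\<^esub> y) = f x \<ominus>\<^bsub>W\<^esub> f y"
proof -
  interpret V: Module.module K V by fact
  interpret W: Module.module K W by fact
  interpret h: abelian_group_hom V W f by (rule lin_map_hom[OF assms(1-3)])
  show ?thesis using assms(4,5) by (simp add: a_minus_def)
qed

lemma lin_map_finsum: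
  assumes "Module.module K V" "Module.module K W" "f \<in> lin_map K V W" "finite T" "g \<in> T \<rightarrow> carrier V"
  shows "f (\<Oplus>\<^bsub>V\<^esub>i\<in>T. g i) = (\<Oplus>\<^bsub>W\<^esub>i\<in>T. f (g i))"
proof -
  interpret V: Module.module K V by fact
  interpret W: Module.module K W by fact
  show ?thesis using assms(4,5)
  proof (induction T)
    case empty
    then show ?case using lin_map_zero[OF assms(1-3)] by simp
  next
    case (insert i T)
    then have "f \<in> carrier V \<rightarrow> carrier W" using assms(3) by (auto simp: lin_map_def)
    with insert show ?case
      by (simp add: Pi_iff lin_map_add[OF assms(3)])
  qed
qed

text \<open>The module axioms pass along a surjection that respects the operations; \<open>W\<close>
  is a mere record here. This spares checking the axioms for quotients, direct sums and arrow spaces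
  one by one. Preservation of zero is a separate assumption because it follows from additivity only
  once \<open>W\<close> is known to be a group.\<close>

lemma module_surj_image:
  assumes "Module.module K V" "f ` carrier V = carrier W" "f \<zero>\<^bsub>V\<^esub> = \<zero>\<^bsub>W\<^esub>" "f \<in> lin_map K V W"
  shows "Module.module K W"
proof -
  interpret V: Module.module K V by fact
  note f = lin_mapD[OF assms(4)]
  have ex: "\<exists>y\<in>carrier V. x = f y" if "x \<in> carrier W" for x
    using that assms(2) by blast
  show ?thesis
  proof (intro moduleI abelian_groupI)
    show "cring K" by (rule V.R.is_cring)
    show "\<zero>\<^bsub>W\<^esub> \<in> carrier W" using assms(2,3) V.M.zero_closed by (metis image_eqI)
    fix x assume x: "x \<in> carrier W"
    then obtain x' where x': "x' \<in> carrier V" "x = f x'" using ex by blast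
    then show "\<zero>\<^bsub>W\<^esub> \<oplus>\<^bsub>W\<^esub> x = x"
      using f(2)[of "\<zero>\<^bsub>V\<^esub>" x'] assms(3) by simp
    show "\<exists>y\<in>carrier W. y \<oplus>\<^bsub>W\<^esub> x = \<zero>\<^bsub>W\<^esub>"
      using x' f(2)[of "\<ominus>\<^bsub>V\<^esub> x'" x'] f(1)[of "\<ominus>\<^bsub>V\<^esub> x'"] assms(3)
      by (intro bexI[of _ "f (\<ominus>\<^bsub>V\<^esub> x')"]) (simp_all add: V.M.l_neg)
    show "\<one>\<^bsub>K\<^esub> \<odot>\<^bsub>W\<^esub> x = x"
      using x' f(3)[of "\<one>\<^bsub>K\<^esub>" x'] by simp
    { fix a assume a: "a \<in> carrier K"
      show "a \<odot>\<^bsub>W\<^esub> x \<in> carrier W"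
        using x' a f(3)[of a x'] f(1)[of "a \<odot>\<^bsub>V\<^esub> x'"] by simp
      fix b assume b: "b \<in> carrier K"
      show "(a \<oplus>\<^bsub>K\<^esub> b) \<odot>\<^bsub>W\<^esub> x = a \<odot>\<^bsub>W\<^esub> x \<oplus>\<^bsub>W\<^esub> b \<odot>\<^bsub>W\<^esub> x"
        using x' a b by (simp add: f(2,3)[symmetric] V.smult_l_distr)
      show "(a \<otimes>\<^bsub>K\<^esub> b) \<odot>\<^bsub>W\<^esub> x = a \<odot>\<^bsub>W\<^esub> (b \<odot>\<^bsub>W\<^esub> x)"
        using x' a b by (simp add: f(2,3)[symmetric] V.smult_assoc1) }
    fix y assume y: "y \<in> carrier W"
    then obtain y' where y': "y' \<in> carrier V" "y = f y'" using ex by blast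
    show "x \<oplus>\<^bsub>W\<^esub> y \<in> carrier W" "x \<oplus>\<^bsub>W\<^esub> y = y \<oplus>\<^bsub>W\<^esub> x"
      using x' y' by (simp_all add: f(1) f(2)[symmetric] V.M.a_comm)
    { fix a assume a: "a \<in> carrier K"
      show "a \<odot>\<^bsub>W\<^esub> (x \<oplus>\<^bsub>W\<^esub> y) = a \<odot>\<^bsub>W\<^esub> x \<oplus>\<^bsub>W\<^esub> a \<odot>\<^bsub>W\<^esub> y"
        using x' y' a by (simp add: f(2,3)[symmetric] V.smult_r_distr) }
    fix z assume z: "z \<in> carrier W"
    then obtain z' where z': "z' \<in> carrier V" "z = f z'" using ex by blast
    show "x \<oplus>\<^bsub>W\<^esub> y \<oplus>\<^bsub>W\<^esub> z = x \<oplus>\<^bsub>W\<^esub> (y \<oplus>\<^bsub>W\<^esub> z)"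
      using x' y' z' by (simp add: f(1) f(2)[symmetric] V.M.a_assoc)
  qed
qed

text \<open>Distributivity and centrality of the scalars are packaged as linearity of the one-sided
  multiplications, the form in which they are established for path algebras, null-square algebras
  and images.\<close>

lemma k_algebraI:
  assumes "field K" "Module.module K A"
    and one: "\<one>\<^bsub>A\<^esub> \<in> carrier A"
    and mult: "\<And>x y. \<lbrakk>x \<in> carrier A; y \<in> carrier A\<rbrakk> \<Longrightarrow> x \<otimes>\<^bsub>A\<^esub> y \<in> carrier A"
    and assoc: "\<And>x y z. \<lbrakk>x \<in> carrier A; y \<in> carrier A; z \<in> carrier A\<rbrakk> \<Longrightarrow>
      (x \<otimes>\<^bsub>A\<^esub> y) \<otimes>\<^bsub>A\<^esub> z = x \<otimes>\<^bsub>A\<^esub> (y \<otimes>\<^bsub>A\<^esub> z)"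
    and l_one: "\<And>x. x \<in> carrier A \<Longrightarrow> \<one>\<^bsub>A\<^esub> \<otimes>\<^bsub>A\<^esub> x = x"
    and r_one: "\<And>x. x \<in> carrier A \<Longrightarrow> x \<otimes>\<^bsub>A\<^esub> \<one>\<^bsub>A\<^esub> = x"
    and l_lin: "\<And>y. y \<in> carrier A \<Longrightarrow> (\<lambda>x. x \<otimes>\<^bsub>A\<^esub> y) \<in> lin_map K A A"
    and r_lin: "\<And>x. x \<in> carrier A \<Longrightarrow> (\<lambda>y. x \<otimes>\<^bsub>A\<^esub> y) \<in> lin_map K A A"
  shows "k_algebra K A"
proof -
  have "ring A"
    using assms(2) lin_map_add[OF l_lin] lin_map_add[OF r_lin]
    by (intro ringI monoidI one mult assoc l_one r_one) (auto simp: Module.module_def)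
  then show ?thesis
    using assms(1,2) lin_map_smult[OF l_lin] lin_map_smult[OF r_lin]
    by (auto simp: k_algebra_def k_algebra_axioms_def)
qed

lemma (in k_algebra) lin_map_mult:
  shows lin_map_mult_left: "y \<in> carrier A \<Longrightarrow> (\<lambda>x. x \<otimes>\<^bsub>A\<^esub> y) \<in> lin_map K A A"
    and lin_map_mult_right: "x \<in> carrier A \<Longrightarrow> (\<lambda>y. x \<otimes>\<^bsub>A\<^esub> y) \<in> lin_map K A A"
  by (intro lin_mapI; simp add: A.l_distr A.r_distr smult_mult_left smult_mult_right)+

lemma alg_homI:
  assumes "f \<in> lin_map K A B" "f \<one>\<^bsub>A\<^esub> = \<one>\<^bsub>B\<^esub>"
    and "\<And>x y. \<lbrakk>x \<in> carrier A; y \<in> carrier A\<rbrakk> \<Longrightarrow> f (x \<otimes>\<^bsub>A\<^esub> y) = f x \<otimes>\<^bsub>B\<^esub> f y"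
  shows "f \<in> alg_hom K A B"
  using lin_mapD[OF assms(1)] assms(2,3) unfolding alg_hom_def ring_hom_def by simp

lemma alg_homD:
  assumes "f \<in> alg_hom K A B"
  shows alg_hom_lin_map: "f \<in> lin_map K A B"
    and alg_hom_one: "f \<one>\<^bsub>A\<^esub> = \<one>\<^bsub>B\<^esub>"
    and alg_hom_mult: "\<lbrakk>x \<in> carrier A; y \<in> carrier A\<rbrakk> \<Longrightarrow> f (x \<otimes>\<^bsub>A\<^esub> y) = f x \<otimes>\<^bsub>B\<^esub> f y"
  using assms unfolding alg_hom_def ring_hom_def lin_map_def by (simp_all add: Pi_iff)

lemma k_algebra_surj_image:
  assumes "k_algebra K A" "f ` carrier A = carrier B" "f \<zero>\<^bsub>A\<^esub> = \<zero>\<^bsub>B\<^esub>" "f \<in> alg_hom K A B"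
  shows "k_algebra K B"
proof -
  interpret A: k_algebra K A by fact
  note lin = lin_mapD[OF alg_hom_lin_map[OF assms(4)]] and one = alg_hom_one[OF assms(4)]
    and mult = alg_hom_mult[OF assms(4)]
  \<comment> \<open>Acts as an induction rule: a property of elements of \<open>B\<close> is checked
    on values of \<open>f\<close>, where all operations can be pulled back to
    \<open>A\<close>.\<close>
  have B: "P y" if P: "\<And>x. x \<in> carrier A \<Longrightarrow> P (f x)" and y: "y \<in> carrier B" for P y
  proof -
    obtain x where "x \<in> carrier A" "y = f x" using y assms(2) by blast
    then show "P y" using P by simp
  qed
  have closed: "x \<otimes>\<^bsub>B\<^esub> y \<in> carrier B" if "x \<in> carrier B" "y \<in> carrier B" for x y
    by (rule B[OF _ that(1)], rule B[OF _ that(2)]) (simp add: lin(1) flip: mult)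
  show ?thesis
  proof (rule k_algebraI)
    show "field K" by (rule A.K.field_axioms)
    show "Module.module K B" using module_surj_image[OF A.module_axioms assms(2,3)] alg_hom_lin_map[OF assms(4)] .
    show "\<one>\<^bsub>B\<^esub> \<in> carrier B" using one lin(1)[of "\<one>\<^bsub>A\<^esub>"] by simp
  next
    fix x y assume "x \<in> carrier B" "y \<in> carrier B" then show "x \<otimes>\<^bsub>B\<^esub> y \<in> carrier B" by (rule closed)
  next
    fix x y z assume xyz: "x \<in> carrier B" "y \<in> carrier B" "z \<in> carrier B"
    show "x \<otimes>\<^bsub>B\<^esub> y \<otimes>\<^bsub>B\<^esub> z = x \<otimes>\<^bsub>B\<^esub> (y \<otimes>\<^bsub>B\<^esub> z)"
      by (rule B[OF _ xyz(1)], rule B[OF _ xyz(2)], rule B[OF _ xyz(3)])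
        (simp add: A.A.m_assoc flip: mult)
  next
    fix x assume "x \<in> carrier B"
    then show "\<one>\<^bsub>B\<^esub> \<otimes>\<^bsub>B\<^esub> x = x" by (rule B[rotated]) (simp flip: mult one)
  next
    fix x assume "x \<in> carrier B"
    then show "x \<otimes>\<^bsub>B\<^esub> \<one>\<^bsub>B\<^esub> = x" by (rule B[rotated]) (simp flip: mult one)
  next
    fix y assume y: "y \<in> carrier B"
    show "(\<lambda>x. x \<otimes>\<^bsub>B\<^esub> y) \<in> lin_map K B B"
    proof (rule lin_mapI)
      fix x x' assume x: "x \<in> carrier B" "x' \<in> carrier B"
      show "(x \<oplus>\<^bsub>B\<^esub> x') \<otimes>\<^bsub>B\<^esub> y = x \<otimes>\<^bsub>B\<^esub> y \<oplus>\<^bsub>B\<^esub> x' \<otimes>\<^bsub>B\<^esub> y"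
        by (rule B[OF _ x(1)], rule B[OF _ x(2)], rule B[OF _ y])
          (simp add: A.A.l_distr flip: mult lin(2,3))
    next
      fix c x assume c: "c \<in> carrier K" and x: "x \<in> carrier B"
      show "(c \<odot>\<^bsub>B\<^esub> x) \<otimes>\<^bsub>B\<^esub> y = c \<odot>\<^bsub>B\<^esub> (x \<otimes>\<^bsub>B\<^esub> y)"
        by (rule B[OF _ x(1)], rule B[OF _ y])
          (simp add: A.smult_mult_left c flip: mult lin(2,3))
    qed (rule closed[OF _ y])
    show "(\<lambda>x. y \<otimes>\<^bsub>B\<^esub> x) \<in> lin_map K B B"
    proof (rule lin_mapI)
      fix x x' assume x: "x \<in> carrier B" "x' \<in> carrier B"
      show "y \<otimes>\<^bsub>B\<^esub> (x \<oplus>\<^bsub>B\<^esub> x') = y \<otimes>\<^bsub>B\<^esub> x \<oplus>\<^bsub>B\<^esub> y \<otimes>\<^bsub>B\<^esub> x'"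
        by (rule B[OF _ x(1)], rule B[OF _ x(2)], rule B[OF _ y])
          (simp add: A.A.r_distr flip: mult lin(2,3))
    next
      fix c x assume c: "c \<in> carrier K" and x: "x \<in> carrier B"
      show "y \<otimes>\<^bsub>B\<^esub> (c \<odot>\<^bsub>B\<^esub> x) = c \<odot>\<^bsub>B\<^esub> (y \<otimes>\<^bsub>B\<^esub> x)"
        by (rule B[OF _ x(1)], rule B[OF _ y])
          (simp add: A.smult_mult_right c flip: mult lin(2,3))
    qed (rule closed[OF y])
  qed
qed

lemma quot_mod_simps [simp]:
  "carrier (quot_mod V W) = a_rcosets\<^bsub>V\<^esub> W"
  "add (quot_mod V W) = set_add V" "zero (quot_mod V W) = W"
  "mult (quot_mod V W) = rcoset_mult V W" "one (quot_mod V W) = W +>\<^bsub>V\<^esub> \<one>\<^bsub>V\<^esub>"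
  "smult (quot_mod V W) = (\<lambda>c X. \<Union>x\<in>X. W +>\<^bsub>V\<^esub> (c \<odot>\<^bsub>V\<^esub> x))"
  by (simp_all add: quot_mod_def ring.extend_def module.fields_def FactRing_def)

lemma (in Module.module) submodule_abelian_subgroup: "submodule W R M \<Longrightarrow> abelian_subgroup W M"
  by (intro abelian_subgroupI3 additive_subgroup.intro)
    (simp_all add: submodule_def M.abelian_group_axioms)

text \<open>Scalar multiplication in \<open>quot_mod\<close>, and later the bimodule actions, are
  unions over all representatives of a coset. The point is \<open>quot_class_image\<close>: if
  \<open>f\<close> preserves \<open>W\<close>, its values at two representatives differ by some
  \<open>f w\<close> with \<open>w \<in> W\<close>, so all cosets in the union coincide.\<close>

lemma (in Module.module) quot_class:
  assumes "submodule W R M"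
  shows quot_class_lin_map: "(+>\<^bsub>M\<^esub>) W \<in> lin_map R M (quot_mod M W)"
    and quot_class_surj: "(+>\<^bsub>M\<^esub>) W ` carrier M = carrier (quot_mod M W)"
    and quot_class_zero: "W +>\<^bsub>M\<^esub> \<zero>\<^bsub>M\<^esub> = W"
    and quot_class_eq_iff: "\<lbrakk>x \<in> carrier M; y \<in> carrier M\<rbrakk> \<Longrightarrow>
      W +>\<^bsub>M\<^esub> x = W +>\<^bsub>M\<^esub> y \<longleftrightarrow> x \<ominus>\<^bsub>M\<^esub> y \<in> W"
    and quot_class_image: "\<lbrakk>x \<in> carrier M; f \<in> lin_map R M M; f ` W \<subseteq> W\<rbrakk> \<Longrightarrow>
      (\<Union>z\<in>W +>\<^bsub>M\<^esub> x. W +>\<^bsub>M\<^esub> f z) = W +>\<^bsub>M\<^esub> f x"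
    and quot_mod_module: "Module.module R (quot_mod M W)"
proof -
  interpret W: abelian_subgroup W M using submodule_abelian_subgroup[OF assms] .
  have sub: "W \<subseteq> carrier M" by (rule W.a_subset)
  show surj: "(+>\<^bsub>M\<^esub>) W ` carrier M = carrier (quot_mod M W)"
    by (auto simp: A_RCOSETS_def')
  show zero: "W +>\<^bsub>M\<^esub> \<zero>\<^bsub>M\<^esub> = W" using sub by simp
  show eq: "W +>\<^bsub>M\<^esub> x = W +>\<^bsub>M\<^esub> y \<longleftrightarrow> x \<ominus>\<^bsub>M\<^esub> y \<in> W" if "x \<in> carrier M" "y \<in> carrier M" for x y
  proof -
    have "W +>\<^bsub>M\<^esub> x = W +>\<^bsub>M\<^esub> y \<longleftrightarrow> x \<in> W +>\<^bsub>M\<^esub> y"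
      using that W.a_rcos_self[of x] W.a_repr_independence'[of x y] by auto
    also have "\<dots> \<longleftrightarrow> x \<ominus>\<^bsub>M\<^esub> y \<in> W" using W.a_rcos_module[of y x] that by (simp add: M.minus_eq)
    finally show ?thesis .
  qed
  show img: "(\<Union>z\<in>W +>\<^bsub>M\<^esub> x. W +>\<^bsub>M\<^esub> f z) = W +>\<^bsub>M\<^esub> f x"
    if "x \<in> carrier M" "f \<in> lin_map R M M" "f ` W \<subseteq> W" for x f
  proof -
    have "W +>\<^bsub>M\<^esub> f z = W +>\<^bsub>M\<^esub> f x" if z: "z \<in> W +>\<^bsub>M\<^esub> x" for z
    proof -
      obtain w where w: "w \<in> W" "z = w \<oplus>\<^bsub>M\<^esub> x" using z by (auto simp: a_r_coset_def')
      then have "f z \<ominus>\<^bsub>M\<^esub> f x = f w"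
        using \<open>x \<in> carrier M\<close> W.a_Hcarr[OF w(1)] lin_map_closed[OF \<open>f \<in> lin_map R M M\<close>]
        by (simp add: lin_map_add[OF \<open>f \<in> lin_map R M M\<close>] M.minus_eq M.a_assoc M.r_neg)
      moreover have "f w \<in> W" using w \<open>f ` W \<subseteq> W\<close> by blast
      moreover have "z \<in> carrier M" using w \<open>x \<in> carrier M\<close> W.a_Hcarr[OF w(1)] by simp
      ultimately show ?thesis using eq[of "f z" "f x"] \<open>x \<in> carrier M\<close>
          lin_map_closed[OF \<open>f \<in> lin_map R M M\<close>] by simp
    qed
    then show ?thesis using W.a_rcos_self[OF \<open>x \<in> carrier M\<close>] by (intro SUP_eq_const) blast+
  qed
  have sm: "(\<Union>z\<in>W +>\<^bsub>M\<^esub> x. W +>\<^bsub>M\<^esub> (c \<odot>\<^bsub>M\<^esub> z)) = W +>\<^bsub>M\<^esub> (c \<odot>\<^bsub>M\<^esub> x)"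
    if "c \<in> carrier R" "x \<in> carrier M" for c x
  proof (rule img[OF that(2)])
    show "(\<odot>\<^bsub>M\<^esub>) c \<in> lin_map R M M"
      by (rule lin_mapI) (use that in \<open>simp_all add: smult_r_distr R.m_comm flip: smult_assoc1\<close>)
    show "(\<odot>\<^bsub>M\<^esub>) c ` W \<subseteq> W"
      using submodule.smult_closed[OF assms that(1)] by blast
  qed
  show lin: "(+>\<^bsub>M\<^esub>) W \<in> lin_map R M (quot_mod M W)"
    by (intro lin_mapI) (simp_all add: sm W.a_rcos_sum M.a_rcosetsI[OF sub])
  show "Module.module R (quot_mod M W)"
    using module_surj_image[OF module_axioms surj _ lin] zero by simp
qed

section \<open>Free vector spaces\<close>

lemma free_space_simps [simp]:
  "carrier (free_space K X) = fin_supp K X" "\<zero>\<^bsub>free_space K X\<^esub> = (\<lambda>_. \<zero>\<^bsub>K\<^esub>)"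
  "f \<oplus>\<^bsub>free_space K X\<^esub> g = (\<lambda>x. f x \<oplus>\<^bsub>K\<^esub> g x)" "c \<odot>\<^bsub>free_space K X\<^esub> f = (\<lambda>x. c \<otimes>\<^bsub>K\<^esub> f x)"
  by (simp_all add: free_space_def)

lemma fin_suppD:
  assumes "f \<in> fin_supp K X"
  shows fin_supp_closed: "f x \<in> carrier K" and fin_supp_outside: "x \<notin> X \<Longrightarrow> f x = \<zero>\<^bsub>K\<^esub>"
    and fin_supp_finite: "finite {x. f x \<noteq> \<zero>\<^bsub>K\<^esub>}" and fin_supp_subset: "{x. f x \<noteq> \<zero>\<^bsub>K\<^esub>} \<subseteq> X"
  using assms by (auto simp: fin_supp_def)

lemma fin_suppI:
  assumes "\<And>x. f x \<in> carrier K" "\<And>x. x \<notin> X \<Longrightarrow> f x = \<zero>\<^bsub>K\<^esub>" "\<And>x. x \<notin> S \<Longrightarrow> f x = \<zero>\<^bsub>K\<^esub>" "finite S"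
  shows "f \<in> fin_supp K X"
proof -
  have "{x. f x \<noteq> \<zero>\<^bsub>K\<^esub>} \<subseteq> S" using assms(3) by blast
  then show ?thesis using assms finite_subset by (auto simp: fin_supp_def)
qed

lemma fin_supp_mono: "X \<subseteq> Y \<Longrightarrow> fin_supp K X \<subseteq> fin_supp K Y"
  by (auto simp: fin_supp_def)

text \<open>The universal map out of a free vector space. Summing over the support keeps the sum
  finite without reference to an index set, so one formula serves \<open>free_space K X\<close> for
  every \<open>X\<close>.\<close>

definition lin_ext :: "('k, 'r) ring_scheme \<Rightarrow> ('k, 'w, 'z) module_scheme \<Rightarrow> ('x \<Rightarrow> 'w) \<Rightarrow>
    ('x \<Rightarrow> 'k) \<Rightarrow> 'w" where
  "lin_ext K W t f = (\<Oplus>\<^bsub>W\<^esub>x\<in>{x. f x \<noteq> \<zero>\<^bsub>K\<^esub>}. f x \<odot>\<^bsub>W\<^esub> t x)"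

context
  fixes K :: "('k, 'r) ring_scheme"
  assumes K: "field K"
begin

interpretation K: field K by (rule K)

lemma delta_simps [simp]: "delta K x x = \<one>\<^bsub>K\<^esub>" "y \<noteq> x \<Longrightarrow> delta K x y = \<zero>\<^bsub>K\<^esub>" "delta K x y \<in> carrier K"
  by (simp_all add: delta_def)

lemma delta_support [simp]: "{y. delta K x y \<noteq> \<zero>\<^bsub>K\<^esub>} = {x}"
  by (auto simp: delta_def)

lemma delta_in_fin_supp [simp]: "delta K x \<in> fin_supp K X \<longleftrightarrow> x \<in> X"
proof
  show "x \<in> X" if "delta K x \<in> fin_supp K X"
    using fin_supp_subset[OF that] by simp
  show "delta K x \<in> fin_supp K X" if "x \<in> X"
    using that by (intro fin_suppI[where S = "{x}"]) (auto intro!: delta_simps(2))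
qed

lemma delta_inject [simp]: "delta K x = delta K y \<longleftrightarrow> x = y"
  by (metis K.one_not_zero delta_simps(1,2))

lemma free_space_module: "Module.module K (free_space K X)"
proof (intro moduleI abelian_groupI)
  show "cring K" by (rule K.is_cring)
  fix f assume f: "f \<in> carrier (free_space K X)"
  note f' = fin_suppD[OF f[simplified]]
  show "\<exists>g\<in>carrier (free_space K X). g \<oplus>\<^bsub>free_space K X\<^esub> f = \<zero>\<^bsub>free_space K X\<^esub>"
    using f' by (intro bexI[of _ "\<lambda>x. \<ominus>\<^bsub>K\<^esub> f x"])
      (auto simp: K.l_neg intro!: fin_suppI[where S = "{x. f x \<noteq> \<zero>\<^bsub>K\<^esub>}"])
  { fix c assume "c \<in> carrier K"
    then show "c \<odot>\<^bsub>free_space K X\<^esub> f \<in> carrier (free_space K X)"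
      using f' by (auto intro!: fin_suppI[where S = "{x. f x \<noteq> \<zero>\<^bsub>K\<^esub>}"]) }
  fix g assume g: "g \<in> carrier (free_space K X)"
  note g' = fin_suppD[OF g[simplified]]
  show "f \<oplus>\<^bsub>free_space K X\<^esub> g \<in> carrier (free_space K X)"
    using f' g' by (auto intro!: fin_suppI[where S = "{x. f x \<noteq> \<zero>\<^bsub>K\<^esub>} \<union> {x. g x \<noteq> \<zero>\<^bsub>K\<^esub>}"])
next
  show "\<zero>\<^bsub>free_space K X\<^esub> \<in> carrier (free_space K X)"
    by (auto intro: fin_suppI[where S = "{}"])
qed (auto simp: fin_supp_closed K.l_distr K.r_distr K.m_assoc K.a_assoc fun_eq_iff intro: K.a_comm)

lemma fin_supp_ops:
  shows fin_supp_add: "\<lbrakk>f \<in> fin_supp K X; g \<in> fin_supp K X\<rbrakk> \<Longrightarrow> (\<lambda>x. f x \<oplus>\<^bsub>K\<^esub> g x) \<in> fin_supp K X"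
    and fin_supp_smult: "\<lbrakk>c \<in> carrier K; f \<in> fin_supp K X\<rbrakk> \<Longrightarrow> (\<lambda>x. c \<otimes>\<^bsub>K\<^esub> f x) \<in> fin_supp K X"
    and fin_supp_zero: "(\<lambda>_. \<zero>\<^bsub>K\<^esub>) \<in> fin_supp K X"
proof -
  interpret F: Module.module K "free_space K X" by (rule free_space_module)
  show "\<lbrakk>f \<in> fin_supp K X; g \<in> fin_supp K X\<rbrakk> \<Longrightarrow> (\<lambda>x. f x \<oplus>\<^bsub>K\<^esub> g x) \<in> fin_supp K X"
    using F.M.a_closed[of f g] by simp
  show "\<lbrakk>c \<in> carrier K; f \<in> fin_supp K X\<rbrakk> \<Longrightarrow> (\<lambda>x. c \<otimes>\<^bsub>K\<^esub> f x) \<in> fin_supp K X"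
    using F.smult_closed[of c f] by simp
  show "(\<lambda>_. \<zero>\<^bsub>K\<^esub>) \<in> fin_supp K X" using F.M.zero_closed by simp
qed

text \<open>The induction runs over a finite set containing the support, from which one point at a
  time is split off.\<close>

lemma fin_supp_induct [consumes 1, case_names zero add delta]:
  assumes "f \<in> fin_supp K X"
    and zero: "P (\<lambda>_. \<zero>\<^bsub>K\<^esub>)"
    and add: "\<And>f g. \<lbrakk>f \<in> fin_supp K X; g \<in> fin_supp K X; P f; P g\<rbrakk> \<Longrightarrow> P (\<lambda>x. f x \<oplus>\<^bsub>K\<^esub> g x)"
    and delta: "\<And>c x. \<lbrakk>c \<in> carrier K; x \<in> X\<rbrakk> \<Longrightarrow> P (\<lambda>y. c \<otimes>\<^bsub>K\<^esub> delta K x y)"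
  shows "P f"
proof -
  have "\<forall>f\<in>fin_supp K X. {x. f x \<noteq> \<zero>\<^bsub>K\<^esub>} \<subseteq> T \<longrightarrow> P f" if "finite T" for T
    using that
  proof (induction T)
    case empty
    have "f = (\<lambda>_. \<zero>\<^bsub>K\<^esub>)" if "{x. f x \<noteq> \<zero>\<^bsub>K\<^esub>} \<subseteq> {}" for f :: "_ \<Rightarrow> 'k" using that by auto
    then show ?case using zero by blast
  next
    case (insert a T)
    show ?case
    proof (intro ballI impI)
      fix f assume f: "f \<in> fin_supp K X" and T: "{x. f x \<noteq> \<zero>\<^bsub>K\<^esub>} \<subseteq> insert a T"
      \<comment> \<open>\<open>f\<close> with its value at \<open>a\<close> erased, so that the
        support shrinks into \<open>T\<close>.\<close>
      define g where "g = (\<lambda>x. if x = a then \<zero>\<^bsub>K\<^esub> else f x)"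
      have g: "g \<in> fin_supp K X"
        using fin_suppD[OF f] by (intro fin_suppI[where S = "{x. f x \<noteq> \<zero>\<^bsub>K\<^esub>}"]) (simp_all add: g_def)
      have "{x. g x \<noteq> \<zero>\<^bsub>K\<^esub>} \<subseteq> T" using T by (auto simp: g_def)
      then have Pg: "P g" using insert.IH g by blast
      show "P f"
      proof (cases "f a = \<zero>\<^bsub>K\<^esub>")
        case True
        then have "g = f" by (auto simp: g_def)
        then show ?thesis using Pg by simp
      next
        case False
        then have "a \<in> X" using fin_supp_outside[OF f] by blast
        have "f = (\<lambda>x. f a \<otimes>\<^bsub>K\<^esub> delta K a x \<oplus>\<^bsub>K\<^esub> g x)"
          using fin_supp_closed[OF f] by (auto simp: g_def delta_def)
        moreover have "P (\<lambda>x. f a \<otimes>\<^bsub>K\<^esub> delta K a x \<oplus>\<^bsub>K\<^esub> g x)"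
          using fin_supp_closed[OF f] \<open>a \<in> X\<close> g Pg by (intro add delta fin_supp_smult) auto
        ultimately show ?thesis by simp
      qed
    qed
  qed
  then show ?thesis using assms(1) fin_supp_finite[OF assms(1)] by blast
qed

lemma lin_map_eq_on_delta:
  assumes "Module.module K W" "f \<in> lin_map K (free_space K X) W" "g \<in> lin_map K (free_space K X) W"
    and "\<And>x. x \<in> X \<Longrightarrow> f (delta K x) = g (delta K x)" and "v \<in> fin_supp K X"
  shows "f v = g v"
  using assms(5)
proof (induction rule: fin_supp_induct)
  case zero
  show ?case using lin_map_zero[OF free_space_module assms(1,2)] lin_map_zero[OF free_space_module assms(1,3)] by simp
next
  case (add u v)
  then show ?case using lin_map_add[OF assms(2), of u v] lin_map_add[OF assms(3), of u v] by simp
next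
  case (delta c x)
  then show ?case
    using lin_map_smult[OF assms(2), of c "delta K x"] lin_map_smult[OF assms(3), of c "delta K x"] assms(4)
    by simp
qed

text \<open>Points outside the support contribute the zero vector. A common index set is what lets
  the values at two functions and at their sum be compared term by term.\<close>

lemma lin_ext_superset:
  assumes "Module.module K W" "f \<in> fin_supp K X" "t \<in> X \<rightarrow> carrier W"
    and "finite S" "{x. f x \<noteq> \<zero>\<^bsub>K\<^esub>} \<subseteq> S" "S \<subseteq> X"
  shows "lin_ext K W t f = (\<Oplus>\<^bsub>W\<^esub>x\<in>S. f x \<odot>\<^bsub>W\<^esub> t x)"
proof -
  interpret W: Module.module K W by fact
  show ?thesis unfolding lin_ext_def
    using assms(3-6) fin_supp_closed[OF assms(2)]
    by (intro W.M.add.finprod_mono_neutral_cong_left) (auto simp: Pi_iff subset_iff)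
qed

lemma lin_ext_delta:
  assumes "Module.module K W" "t \<in> X \<rightarrow> carrier W" "x \<in> X"
  shows "lin_ext K W t (delta K x) = t x"
proof -
  interpret W: Module.module K W by fact
  have "lin_ext K W t (delta K x) = (\<Oplus>\<^bsub>W\<^esub>y\<in>{x}. delta K x y \<odot>\<^bsub>W\<^esub> t y)"
    using assms by (intro lin_ext_superset[where X = X]) auto
  also have "\<dots> = t x" using assms by (simp add: Pi_iff)
  finally show ?thesis .
qed

lemma lin_ext_lin_map:
  assumes "Module.module K W" "t \<in> X \<rightarrow> carrier W"
  shows "lin_ext K W t \<in> lin_map K (free_space K X) W"
proof -
  interpret W: Module.module K W by fact
  have t: "f x \<odot>\<^bsub>W\<^esub> t x \<in> carrier W" if "f \<in> fin_supp K X" "x \<in> X" for f x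
    using that assms(2) fin_supp_closed by fastforce
  show ?thesis
  proof (rule lin_mapI)
    fix f assume "f \<in> carrier (free_space K X)"
    then have f: "f \<in> fin_supp K X" by simp
    show "lin_ext K W t f \<in> carrier W"
      unfolding lin_ext_def using t[OF f] fin_supp_subset[OF f] by (intro W.M.finsum_closed) blast
    { fix c assume c: "c \<in> carrier K"
      have "lin_ext K W t (\<lambda>x. c \<otimes>\<^bsub>K\<^esub> f x) = (\<Oplus>\<^bsub>W\<^esub>x\<in>{x. f x \<noteq> \<zero>\<^bsub>K\<^esub>}. (c \<otimes>\<^bsub>K\<^esub> f x) \<odot>\<^bsub>W\<^esub> t x)"
        using assms c f fin_suppD[OF f] by (intro lin_ext_superset[where X = X] fin_supp_smult) auto
      also have "\<dots> = (\<Oplus>\<^bsub>W\<^esub>x\<in>{x. f x \<noteq> \<zero>\<^bsub>K\<^esub>}. c \<odot>\<^bsub>W\<^esub> (f x \<odot>\<^bsub>W\<^esub> t x))"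
        using assms c t[OF f] fin_suppD[OF f]
        by (intro W.M.finsum_cong') (auto simp: Pi_iff subset_iff W.smult_assoc1)
      also have "\<dots> = c \<odot>\<^bsub>W\<^esub> lin_ext K W t f"
        unfolding lin_ext_def using c t[OF f] fin_suppD[OF f]
        by (intro W.finsum_smult_ldistr[symmetric]) auto
      finally show "lin_ext K W t (c \<odot>\<^bsub>free_space K X\<^esub> f) = c \<odot>\<^bsub>W\<^esub> lin_ext K W t f" by simp }
    fix g assume "g \<in> carrier (free_space K X)"
    then have g: "g \<in> fin_supp K X" by simp
    let ?S = "{x. f x \<noteq> \<zero>\<^bsub>K\<^esub>} \<union> {x. g x \<noteq> \<zero>\<^bsub>K\<^esub>}"
    have S: "finite ?S" "?S \<subseteq> X" using fin_suppD[OF f] fin_suppD[OF g] by auto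
    have "lin_ext K W t (\<lambda>x. f x \<oplus>\<^bsub>K\<^esub> g x) = (\<Oplus>\<^bsub>W\<^esub>x\<in>?S. (f x \<oplus>\<^bsub>K\<^esub> g x) \<odot>\<^bsub>W\<^esub> t x)"
      using assms f g S by (intro lin_ext_superset[where X = X] fin_supp_add) auto
    also have "\<dots> = (\<Oplus>\<^bsub>W\<^esub>x\<in>?S. f x \<odot>\<^bsub>W\<^esub> t x \<oplus>\<^bsub>W\<^esub> g x \<odot>\<^bsub>W\<^esub> t x)"
      using assms S t[OF f] t[OF g] fin_supp_closed[OF f] fin_supp_closed[OF g]
      by (intro W.M.finsum_cong') (auto simp: Pi_iff subset_iff W.smult_l_distr)
    also have "\<dots> = (\<Oplus>\<^bsub>W\<^esub>x\<in>?S. f x \<odot>\<^bsub>W\<^esub> t x) \<oplus>\<^bsub>W\<^esub> (\<Oplus>\<^bsub>W\<^esub>x\<in>?S. g x \<odot>\<^bsub>W\<^esub> t x)"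
      using S t[OF f] t[OF g] by (intro W.M.finsum_addf) auto
    also have "\<dots> = lin_ext K W t f \<oplus>\<^bsub>W\<^esub> lin_ext K W t g"
      using assms f g S
      by (intro arg_cong2[where f = "(\<oplus>\<^bsub>W\<^esub>)"] lin_ext_superset[symmetric, where X = X]) auto
    finally show "lin_ext K W t (f \<oplus>\<^bsub>free_space K X\<^esub> g) = lin_ext K W t f \<oplus>\<^bsub>W\<^esub> lin_ext K W t g"
      by simp
  qed
qed

text \<open>Replaces the sum over a fibre, whose index set depends on \<open>y\<close> and on
  \<open>f\<close>, by a sum over a fixed finite set with a case distinction, so that different
  functions become comparable.\<close>

lemma push_eq:
  assumes "f \<in> fin_supp K X" "finite S" "{x. f x \<noteq> \<zero>\<^bsub>K\<^esub>} \<subseteq> S"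
  shows "push K h f y = (\<Oplus>\<^bsub>K\<^esub>x\<in>S. if h x = y then f x else \<zero>\<^bsub>K\<^esub>)"
  unfolding push_def using assms(2,3) fin_supp_closed[OF assms(1)]
  by (intro K.add.finprod_mono_neutral_cong_left) auto

lemma push_lin_map:
  assumes "h \<in> X \<rightarrow> Y"
  shows "push K h \<in> lin_map K (free_space K X) (free_space K Y)"
proof (rule lin_mapI)
  fix f assume "f \<in> carrier (free_space K X)"
  then have f: "f \<in> fin_supp K X" by simp
  note f' = fin_suppD[OF f]
  have zero: "push K h f y = \<zero>\<^bsub>K\<^esub>" if "y \<notin> h ` {x. f x \<noteq> \<zero>\<^bsub>K\<^esub>}" for y
  proof -
    have "{x. f x \<noteq> \<zero>\<^bsub>K\<^esub> \<and> h x = y} = {}" using that by blast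
    then show ?thesis unfolding push_def by (simp only: K.finsum_empty)
  qed
  show "push K h f \<in> carrier (free_space K Y)"
  proof (simp, rule fin_suppI)
    show "push K h f y \<in> carrier K" for y
      unfolding push_def by (intro K.finsum_closed) (simp add: f'(1))
    show "push K h f y = \<zero>\<^bsub>K\<^esub>" if "y \<notin> Y" for y
      using that assms f'(4) by (intro zero) blast
    show "finite (h ` {x. f x \<noteq> \<zero>\<^bsub>K\<^esub>})" using f' by simp
  qed (rule zero)
  { fix c assume c: "c \<in> carrier K"
    have "push K h (\<lambda>x. c \<otimes>\<^bsub>K\<^esub> f x) y = c \<otimes>\<^bsub>K\<^esub> push K h f y" for y
    proof -
      have "push K h (\<lambda>x. c \<otimes>\<^bsub>K\<^esub> f x) y = (\<Oplus>\<^bsub>K\<^esub>x\<in>{x. f x \<noteq> \<zero>\<^bsub>K\<^esub>}. if h x = y then c \<otimes>\<^bsub>K\<^esub> f x else \<zero>\<^bsub>K\<^esub>)"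
        using c f' by (intro push_eq[OF fin_supp_smult[OF c f]]) auto
      also have "\<dots> = (\<Oplus>\<^bsub>K\<^esub>x\<in>{x. f x \<noteq> \<zero>\<^bsub>K\<^esub>}. c \<otimes>\<^bsub>K\<^esub> (if h x = y then f x else \<zero>\<^bsub>K\<^esub>))"
        using c f' by (intro K.finsum_cong') auto
      also have "\<dots> = c \<otimes>\<^bsub>K\<^esub> push K h f y"
        using c f' by (subst push_eq[OF f f'(3) order_refl], subst K.finsum_rdistr) auto
      finally show ?thesis .
    qed
    then show "push K h (c \<odot>\<^bsub>free_space K X\<^esub> f) = c \<odot>\<^bsub>free_space K Y\<^esub> push K h f" by auto }
  fix g assume "g \<in> carrier (free_space K X)"
  then have g: "g \<in> fin_supp K X" by simp
  note g' = fin_suppD[OF g]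
  let ?S = "{x. f x \<noteq> \<zero>\<^bsub>K\<^esub>} \<union> {x. g x \<noteq> \<zero>\<^bsub>K\<^esub>}"
  have S: "finite ?S" using f' g' by simp
  have "push K h (\<lambda>x. f x \<oplus>\<^bsub>K\<^esub> g x) y = push K h f y \<oplus>\<^bsub>K\<^esub> push K h g y" for y
  proof -
    have "push K h (\<lambda>x. f x \<oplus>\<^bsub>K\<^esub> g x) y = (\<Oplus>\<^bsub>K\<^esub>x\<in>?S. if h x = y then f x \<oplus>\<^bsub>K\<^esub> g x else \<zero>\<^bsub>K\<^esub>)"
      using f' g' by (intro push_eq[OF fin_supp_add[OF f g] S]) auto
    also have "\<dots> = (\<Oplus>\<^bsub>K\<^esub>x\<in>?S. (if h x = y then f x else \<zero>\<^bsub>K\<^esub>) \<oplus>\<^bsub>K\<^esub> (if h x = y then g x else \<zero>\<^bsub>K\<^esub>))"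
      using f' g' by (intro K.finsum_cong') auto
    also have "\<dots> = (\<Oplus>\<^bsub>K\<^esub>x\<in>?S. if h x = y then f x else \<zero>\<^bsub>K\<^esub>) \<oplus>\<^bsub>K\<^esub> (\<Oplus>\<^bsub>K\<^esub>x\<in>?S. if h x = y then g x else \<zero>\<^bsub>K\<^esub>)"
      using f' g' by (intro K.finsum_addf) auto
    also have "\<dots> = push K h f y \<oplus>\<^bsub>K\<^esub> push K h g y"
      using push_eq[OF f S, of h y] push_eq[OF g S, of h y] by simp
    finally show ?thesis .
  qed
  then show "push K h (f \<oplus>\<^bsub>free_space K X\<^esub> g) = push K h f \<oplus>\<^bsub>free_space K Y\<^esub> push K h g" by auto
qed

lemma push_delta: "push K h (delta K x) = delta K (h x)"
proof
  fix y
  have "push K h (delta K x) y = (\<Oplus>\<^bsub>K\<^esub>x'\<in>{x}. if h x' = y then delta K x x' else \<zero>\<^bsub>K\<^esub>)"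
    by (rule push_eq[where X = UNIV]) auto
  then show "push K h (delta K x) y = delta K (h x) y" by (auto simp: delta_def)
qed

text \<open>Fibres of an injective map have at most one point, so coefficients survive. In the
  computation of the arrow spaces this reads off the coefficient of an arrow.\<close>

lemma push_inj_image:
  assumes "f \<in> fin_supp K X" "inj h"
  shows "push K h f (h x) = f x"
proof -
  note f' = fin_suppD[OF assms(1)]
  \<comment> \<open>The point \<open>x\<close> is added by hand, since it may lie outside the
    support.\<close>
  have "push K h f (h x) = (\<Oplus>\<^bsub>K\<^esub>x'\<in>{x} \<union> {x. f x \<noteq> \<zero>\<^bsub>K\<^esub>}. if h x' = h x then f x' else \<zero>\<^bsub>K\<^esub>)"
    using f' by (intro push_eq[OF assms(1)]) auto
  also have "\<dots> = (\<Oplus>\<^bsub>K\<^esub>x'\<in>{x}. f x')"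
    using f' assms(2) by (intro K.add.finprod_mono_neutral_cong_left[symmetric]) (auto simp: inj_eq)
  finally show ?thesis using f' by simp
qed

lemma finsum_free_space_apply:
  assumes "finite T" "g \<in> T \<rightarrow> fin_supp K X"
  shows "(\<Oplus>\<^bsub>free_space K X\<^esub>i\<in>T. g i) x = (\<Oplus>\<^bsub>K\<^esub>i\<in>T. g i x)"
proof -
  interpret F: Module.module K "free_space K X" by (rule free_space_module)
  show ?thesis using assms
    by (induction T) (simp_all add: Pi_iff fin_supp_closed[where X = X])
qed

lemma lin_map_eq_finsum:
  assumes "Module.module K V" "\<theta> \<in> lin_map K (free_space K X) V" "f \<in> fin_supp K X"
    and "finite S" "{x. f x \<noteq> \<zero>\<^bsub>K\<^esub>} \<subseteq> S" "S \<subseteq> X"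
  shows "\<theta> f = (\<Oplus>\<^bsub>V\<^esub>x\<in>S. f x \<odot>\<^bsub>V\<^esub> \<theta> (delta K x))"
proof -
  have t: "(\<lambda>x. \<theta> (delta K x)) \<in> X \<rightarrow> carrier V"
    using lin_map_closed[OF assms(2)] by simp
  have "\<theta> f = lin_ext K V (\<lambda>x. \<theta> (delta K x)) f"
    by (rule lin_map_eq_on_delta[OF assms(1,2) lin_ext_lin_map[OF assms(1) t] _ assms(3)])
      (simp add: lin_ext_delta[OF assms(1) t])
  also note lin_ext_superset[OF assms(1,3) t assms(4-6)]
  finally show ?thesis .
qed

text \<open>The basis consists of the images of the deltas. Bases carry coefficients indexed by
  vectors, free spaces carry coefficients indexed by \<open>X\<close>; the proof translates between
  the two along the injective map \<open>x \<mapsto> \<theta> (delta K x)\<close>.\<close>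

lemma has_dim_of_free_space_iso:
  assumes V: "Module.module K V" and X: "finite X" and \<theta>: "\<theta> \<in> lin_map K (free_space K X) V"
    and bij: "bij_betw \<theta> (fin_supp K X) (carrier V)"
  shows "has_dim K V (card X)"
proof -
  interpret V: Module.module K V by fact
  let ?b = "\<lambda>x. \<theta> (delta K x)"
  let ?S = "?b ` X"
  have inj\<theta>: "inj_on \<theta> (fin_supp K X)" using bij by (rule bij_betw_imp_inj_on)
  have injb: "inj_on ?b X"
    using inj_onD[OF inj\<theta>] by (intro inj_onI) (metis delta_in_fin_supp delta_inject)
  have comb: "lin_comb V c (?b ` U) = \<theta> (\<lambda>x. if x \<in> U then c (?b x) else \<zero>\<^bsub>K\<^esub>)"
    and supp: "(\<lambda>x. if x \<in> U then c (?b x) else \<zero>\<^bsub>K\<^esub>) \<in> fin_supp K X"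
    if U: "U \<subseteq> X" "c \<in> ?b ` U \<rightarrow> carrier K" for U c
  proof -
    have fin: "finite U" using U X finite_subset by blast
    have cl: "?b x \<in> carrier V" "c (?b x) \<in> carrier K" if "x \<in> U" for x
      using that U lin_map_closed[OF \<theta>, of "delta K x"] by auto
    let ?f = "\<lambda>x. if x \<in> U then c (?b x) else \<zero>\<^bsub>K\<^esub>"
    show f: "?f \<in> fin_supp K X" using U X cl by (intro fin_suppI[where S = X]) auto
    have "\<theta> ?f = (\<Oplus>\<^bsub>V\<^esub>x\<in>U. ?f x \<odot>\<^bsub>V\<^esub> ?b x)"
      using U fin by (intro lin_map_eq_finsum[OF V \<theta> f]) auto
    also have "\<dots> = (\<Oplus>\<^bsub>V\<^esub>x\<in>U. c (?b x) \<odot>\<^bsub>V\<^esub> ?b x)"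
      using cl by (intro V.M.finsum_cong') auto
    also have "\<dots> = lin_comb V c (?b ` U)"
      unfolding lin_comb_def using U cl
      by (intro V.M.finsum_reindex[symmetric] inj_on_subset[OF injb]) auto
    finally show "lin_comb V c (?b ` U) = \<theta> ?f" by simp
  qed
  have "lin_indep K V ?S"
    unfolding lin_indep_def
  proof (intro allI impI ballI)
    fix c T v assume h: "finite T \<and> T \<subseteq> ?S \<and> c \<in> T \<rightarrow> carrier K \<and> lin_comb V c T = \<zero>\<^bsub>V\<^esub>" and v: "v \<in> T"
    then obtain U where U: "U \<subseteq> X" "T = ?b ` U" by (auto elim: subset_imageE)
    let ?f = "\<lambda>x. if x \<in> U then c (?b x) else \<zero>\<^bsub>K\<^esub>"
    have c: "c \<in> ?b ` U \<rightarrow> carrier K" using h U by simp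
    have "\<theta> ?f = \<theta> (\<lambda>_. \<zero>\<^bsub>K\<^esub>)"
      using h comb[OF U(1) c] U lin_map_zero[OF free_space_module V \<theta>] by simp
    then have "?f = (\<lambda>_. \<zero>\<^bsub>K\<^esub>)"
      by (rule inj_onD[OF inj\<theta> _ supp[OF U(1) c] fin_supp_zero])
    moreover obtain x where x: "x \<in> U" "v = ?b x" using v U by blast
    ultimately show "c v = \<zero>\<^bsub>K\<^esub>" using fun_cong[of ?f "\<lambda>_. \<zero>\<^bsub>K\<^esub>" x] by simp
  qed
  moreover have "lin_span K V ?S = carrier V"
  proof
    show "lin_span K V ?S \<subseteq> carrier V"
    proof
      fix v assume "v \<in> lin_span K V ?S"
      then obtain c T where cT: "v = lin_comb V c T" "T \<subseteq> ?S" "c \<in> T \<rightarrow> carrier K"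
        unfolding lin_span_def by blast
      then obtain U where U: "U \<subseteq> X" "T = ?b ` U" by (auto elim: subset_imageE)
      have c: "c \<in> ?b ` U \<rightarrow> carrier K" using cT U by simp
      show "v \<in> carrier V"
        unfolding cT(1) U(2) comb[OF U(1) c] using supp[OF U(1) c] by (intro lin_map_closed[OF \<theta>]) simp
    qed
    show "carrier V \<subseteq> lin_span K V ?S"
    proof
      fix v assume "v \<in> carrier V"
      then obtain f where f: "f \<in> fin_supp K X" "v = \<theta> f" using bij_betw_imp_surj_on[OF bij] by blast
      define c where "c = (\<lambda>w. f (the_inv_into X ?b w))"
      have cb: "c (?b x) = f x" if "x \<in> X" for x
        using the_inv_into_f_f[OF injb that] by (simp add: c_def)
      have c: "c \<in> ?S \<rightarrow> carrier K" using fin_supp_closed[OF f(1)] by (auto simp: c_def)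
      have "(\<lambda>x. if x \<in> X then c (?b x) else \<zero>\<^bsub>K\<^esub>) = f"
        using cb fin_supp_outside[OF f(1)] by auto
      then have "v = lin_comb V c ?S" unfolding f(2) comb[OF order_refl c] by (rule arg_cong[OF sym])
      then show "v \<in> lin_span K V ?S" unfolding lin_span_def using X c by (intro CollectI exI[of _ c] exI[of _ ?S]) simp
    qed
  qed
  moreover have "?S \<subseteq> carrier V"
  proof
    fix v assume "v \<in> ?S"
    then obtain x where "x \<in> X" "v = ?b x" by blast
    then show "v \<in> carrier V" by (simp add: lin_map_closed[OF \<theta>])
  qed
  ultimately have "is_basis K V ?S" unfolding is_basis_def by (intro conjI)
  with finite_imageI[OF X] card_image[OF injb] show ?thesis
    unfolding has_dim_def by (intro exI conjI)
qed

end

section \<open>Ideals in algebras over a field\<close>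

lemma (in k_algebra) ideal_of_subspace:
  assumes "I \<subseteq> carrier A" "\<zero>\<^bsub>A\<^esub> \<in> I"
    and "\<And>x y. \<lbrakk>x \<in> I; y \<in> I\<rbrakk> \<Longrightarrow> x \<oplus>\<^bsub>A\<^esub> y \<in> I"
    and "\<And>c x. \<lbrakk>c \<in> carrier K; x \<in> I\<rbrakk> \<Longrightarrow> c \<odot>\<^bsub>A\<^esub> x \<in> I"
    and "\<And>x y. \<lbrakk>x \<in> carrier A; y \<in> I\<rbrakk> \<Longrightarrow> x \<otimes>\<^bsub>A\<^esub> y \<in> I"
    and "\<And>x y. \<lbrakk>x \<in> carrier A; y \<in> I\<rbrakk> \<Longrightarrow> y \<otimes>\<^bsub>A\<^esub> x \<in> I"
  shows "ideal I A"
proof (rule idealI)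
  have "\<ominus>\<^bsub>A\<^esub> x \<in> I" if "x \<in> I" for x
    using assms(4)[of "\<ominus>\<^bsub>K\<^esub> \<one>\<^bsub>K\<^esub>" x] assms(1) that
    by (simp add: smult_l_minus subset_iff)
  then show "subgroup I (add_monoid A)"
    using assms(1-3) by (intro A.add.subgroupI) (auto simp: a_inv_def)
qed (rule A.ring_axioms, (rule assms; assumption)+)

text \<open>Since \<open>c x = (c 1) x\<close>, a ring ideal is a subspace, and quotients by ideals
  are quotients of vector spaces.\<close>

lemma (in k_algebra) smult_mem_ideal:
  assumes "ideal I A" "c \<in> carrier K" "x \<in> I"
  shows "c \<odot>\<^bsub>A\<^esub> x \<in> I"
proof -
  have x: "x \<in> carrier A" using ideal.Icarr[OF assms(1,3)] .
  have "(c \<odot>\<^bsub>A\<^esub> \<one>\<^bsub>A\<^esub>) \<otimes>\<^bsub>A\<^esub> x \<in> I" using ideal.I_l_closed[OF assms(1,3)] assms(2) by simp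
  then show ?thesis using x assms(2) by (simp add: smult_mult_left)
qed

lemma (in k_algebra) ideal_submodule:
  assumes "ideal I A"
  shows "submodule I K A"
  using smult_mem_ideal[OF assms] ideal.axioms(1)[OF assms]
  by (simp add: submodule_def submodule_axioms_def additive_subgroup_def)

text \<open>Finite sums see only the additive monoid. The path algebra and the free space on the
  paths differ in \<open>mult\<close> and \<open>one\<close>, so sums in the former may be evaluated
  in the latter.\<close>

lemma finsum_cong_add_monoid: "add_monoid V = add_monoid W \<Longrightarrow> finsum V = finsum W"
  by (intro ext) (simp add: finsum_def)

section \<open>Path algebras\<close>

text \<open>Finiteness of the quiver provides the unit of \<open>kQ\<close>, the sum of the finitely
  many paths of length zero.\<close>

locale quiver_algebra = K?: field K + Q?: fin_digraph Q
  for K :: "('k, 'r) ring_scheme" and Q :: "('v, 'q) pre_digraph"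
begin

abbreviation "kQ \<equiv> path_algebra K Q"
abbreviation "vtx x \<equiv> delta K (vertex_path x)"
abbreviation "arr a \<equiv> delta K (arrow_path Q a)"

lemma paths_iff: "(x, p) \<in> paths Q \<longleftrightarrow> awalk x p (awlast x p)"
  by (auto simp: paths_def)

lemma path_awalk: "\<gamma> \<in> paths Q \<longleftrightarrow> awalk (path_start \<gamma>) (snd \<gamma>) (path_end Q \<gamma>)"
  by (cases \<gamma>) (simp add: paths_iff path_start_def path_end_def)

lemma path_endpoints [simp]:
  "path_start (vertex_path x) = x" "path_end Q (vertex_path x) = x"
  "path_start (arrow_path Q a) = tail Q a" "path_end Q (arrow_path Q a) = head Q a"
  "path_start (path_comp \<alpha> \<beta>) = path_start \<beta>"
  by (simp_all add: path_start_def path_end_def vertex_path_def arrow_path_def path_comp_def)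

lemma vertex_path_in_paths [simp]: "vertex_path x \<in> paths Q \<longleftrightarrow> x \<in> verts Q"
  by (simp add: vertex_path_def paths_iff awalk_Nil_iff)

lemma arrow_path_in_paths [simp]: "a \<in> arcs Q \<Longrightarrow> arrow_path Q a \<in> paths Q"
  by (simp add: arrow_path_def paths_iff arc_implies_awalk)

lemma path_ends_in_verts:
  assumes "\<gamma> \<in> paths Q"
  shows path_start_in_verts [simp]: "path_start \<gamma> \<in> verts Q"
    and path_end_in_verts [simp]: "path_end Q \<gamma> \<in> verts Q"
  using assms unfolding path_awalk by auto

lemma path_comp_in_paths:
  assumes "\<alpha> \<in> paths Q" "\<beta> \<in> paths Q" "path_start \<alpha> = path_end Q \<beta>"
  shows path_comp_closed: "path_comp \<alpha> \<beta> \<in> paths Q"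
    and path_end_comp: "path_end Q (path_comp \<alpha> \<beta>) = path_end Q \<alpha>"
proof -
  have "awalk (path_start \<beta>) (snd (path_comp \<alpha> \<beta>)) (path_end Q \<alpha>)"
    using assms awalk_appendI[of "path_start \<beta>" "snd \<beta>" "path_end Q \<beta>" "snd \<alpha>" "path_end Q \<alpha>"]
    unfolding path_awalk by (simp add: path_comp_def)
  then have *: "awalk (fst (path_comp \<alpha> \<beta>)) (snd (path_comp \<alpha> \<beta>)) (path_end Q \<alpha>)"
    by (simp add: path_comp_def path_start_def)
  then show "path_end Q (path_comp \<alpha> \<beta>) = path_end Q \<alpha>" by (auto simp: path_end_def)
  show "path_comp \<alpha> \<beta> \<in> paths Q"
    using * by (cases "path_comp \<alpha> \<beta>") (auto simp: paths_def)
qed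

lemma path_comp_assoc: "path_comp (path_comp \<alpha> \<beta>) \<gamma> = path_comp \<alpha> (path_comp \<beta> \<gamma>)"
  by (simp add: path_comp_def)

lemma path_comp_vertex [simp]:
  "path_comp \<alpha> (vertex_path (path_start \<alpha>)) = \<alpha>" "path_comp (vertex_path x) \<beta> = \<beta>"
  by (simp_all add: path_comp_def vertex_path_def path_start_def)

lemma length_path_comp [simp]: "length (snd (path_comp \<alpha> \<beta>)) = length (snd \<alpha>) + length (snd \<beta>)"
  by (simp add: path_comp_def)

text \<open>The cut is after the first \<open>k\<close> traversed arrows, so \<open>\<beta>\<close>
  is the initial segment although it stands on the right.\<close>

lemma path_split:
  assumes "\<gamma> \<in> paths Q" "k \<le> length (snd \<gamma>)"
  obtains \<alpha> \<beta> where "\<alpha> \<in> paths Q" "\<beta> \<in> paths Q" "path_start \<alpha> = path_end Q \<beta>"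
    "\<gamma> = path_comp \<alpha> \<beta>" "length (snd \<beta>) = k"
proof -
  obtain x p where \<gamma>: "\<gamma> = (x, p)" by (cases \<gamma>)
  let ?y = "awlast x (take k p)"
  have w: "awalk x (take k p @ drop k p) (awlast x p)" using assms(1) by (simp add: \<gamma> paths_iff)
  then have w1: "awalk x (take k p) ?y" and w2: "awalk ?y (drop k p) (awlast x p)"
    by (simp_all only: awalk_append_iff)
  show thesis
  proof (rule that[of "(?y, drop k p)" "(x, take k p)"])
    show "(?y, drop k p) \<in> paths Q" "(x, take k p) \<in> paths Q" using w1 w2 by (auto simp: paths_def)
  qed (use assms(2) in \<open>simp_all add: \<gamma> path_start_def path_end_def path_comp_def\<close>)
qed

lemma arrow_path_of_length_1:
  assumes "\<gamma> \<in> paths Q" "length (snd \<gamma>) = 1"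
  obtains a where "a \<in> arcs Q" "\<gamma> = arrow_path Q a"
proof -
  obtain x a where \<gamma>: "\<gamma> = (x, [a])"
    using assms(2) by (cases \<gamma>) (auto simp: length_Suc_conv)
  then have "awalk x [a] (awlast x [a])" using assms(1) by (simp add: paths_iff)
  then have "a \<in> arcs Q" "x = tail Q a" by (auto simp: awalk_Cons_iff)
  then show thesis using that by (simp add: \<gamma> arrow_path_def)
qed

lemma vertex_path_of_length_0:
  assumes "\<gamma> \<in> paths Q" "length (snd \<gamma>) = 0"
  shows "\<gamma> = vertex_path (path_start \<gamma>)"
  using assms(2) by (cases \<gamma>) (simp add: vertex_path_def path_start_def)

text \<open>Paths grow at their end, that is, by composition with an arrow on the left. Evaluation,
  the radical filtration and the comparison with kQ / I all follow this direction, each step being a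
  left multiplication.\<close>

lemma path_induct [consumes 1, case_names vertex arrow]:
  assumes "\<gamma> \<in> paths Q"
    and vertex: "\<And>x. x \<in> verts Q \<Longrightarrow> P (vertex_path x)"
    and arrow: "\<And>a \<gamma>. \<lbrakk>a \<in> arcs Q; \<gamma> \<in> paths Q; path_end Q \<gamma> = tail Q a; P \<gamma>\<rbrakk> \<Longrightarrow>
      P (path_comp (arrow_path Q a) \<gamma>)"
  shows "P \<gamma>"
  using assms(1)
proof (induction "length (snd \<gamma>)" arbitrary: \<gamma>)
  case 0
  then have "\<gamma> = vertex_path (path_start \<gamma>)" by (intro vertex_path_of_length_0) simp_all
  then show ?case using vertex[OF path_start_in_verts[OF 0(2)]] by simp
next
  case (Suc n)
  then obtain \<alpha> \<beta> where *: "\<alpha> \<in> paths Q" "\<beta> \<in> paths Q" "path_start \<alpha> = path_end Q \<beta>"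
    "\<gamma> = path_comp \<alpha> \<beta>" "length (snd \<beta>) = n"
    using path_split[of \<gamma> n] by (metis Suc_n_not_le_n nat_le_linear)
  then have "length (snd \<alpha>) = 1" using Suc.hyps(2) by simp
  then obtain a where "a \<in> arcs Q" "\<alpha> = arrow_path Q a"
    using arrow_path_of_length_1[OF *(1)] by blast
  then show ?case using arrow[of a \<beta>] Suc.hyps(1)[of \<beta>] * by simp
qed

definition factorizations :: "('v, 'q) path \<Rightarrow> (('v, 'q) path \<times> ('v, 'q) path) set" where
  "factorizations \<gamma> = {(\<alpha>, \<beta>). \<alpha> \<in> paths Q \<and> \<beta> \<in> paths Q \<and>
     path_start \<alpha> = path_end Q \<beta> \<and> path_comp \<alpha> \<beta> = \<gamma>}"

text \<open>A factorization is determined by the number of arrows of its right factor; the left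
  factor has to start where that one ends.\<close>

lemma finite_factorizations: "finite (factorizations \<gamma>)"
proof -
  have "factorizations \<gamma> \<subseteq> (\<lambda>i. ((awlast (fst \<gamma>) (take i (snd \<gamma>)), drop i (snd \<gamma>)), (fst \<gamma>, take i (snd \<gamma>)))) `
      {..length (snd \<gamma>)}"
  proof
    fix q assume "q \<in> factorizations \<gamma>"
    then obtain y q' x p' where "q = ((y, q'), (x, p'))" "y = awlast x p'" "\<gamma> = (x, p' @ q')"
      by (cases q) (auto simp: factorizations_def path_comp_def path_start_def path_end_def)
    then show "q \<in> (\<lambda>i. ((awlast (fst \<gamma>) (take i (snd \<gamma>)), drop i (snd \<gamma>)), (fst \<gamma>, take i (snd \<gamma>)))) `
      {..length (snd \<gamma>)}"
      by (intro image_eqI[where x = "length p'"]) simp_all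
  qed
  then show ?thesis by (rule finite_subset) simp
qed

lemma kQ_simps [simp]:
  "carrier kQ = fin_supp K (paths Q)" "\<zero>\<^bsub>kQ\<^esub> = (\<lambda>_. \<zero>\<^bsub>K\<^esub>)"
  "f \<oplus>\<^bsub>kQ\<^esub> g = (\<lambda>x. f x \<oplus>\<^bsub>K\<^esub> g x)" "c \<odot>\<^bsub>kQ\<^esub> f = (\<lambda>x. c \<otimes>\<^bsub>K\<^esub> f x)"
  by (simp_all add: path_algebra_def free_space_def)

lemma kQ_mult_apply:
  "(f \<otimes>\<^bsub>kQ\<^esub> g) \<gamma> = (\<Oplus>\<^bsub>K\<^esub>q\<in>factorizations \<gamma>. f (fst q) \<otimes>\<^bsub>K\<^esub> g (snd q))"
  by (simp add: path_algebra_def factorizations_def case_prod_unfold)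

lemma kQ_one: "\<one>\<^bsub>kQ\<^esub> = (\<lambda>\<gamma>. if \<gamma> \<in> vertex_path ` verts Q then \<one>\<^bsub>K\<^esub> else \<zero>\<^bsub>K\<^esub>)"
  by (simp add: path_algebra_def)

lemma kQ_lin_map:
  "lin_map K kQ W = lin_map K (free_space K (paths Q)) W"
  "lin_map K V kQ = lin_map K V (free_space K (paths Q))"
  by (simp_all add: lin_map_def)

lemma kQ_module: "Module.module K kQ"
  by (rule module_surj_image[OF free_space_module[OF K.field_axioms, of "paths Q"], where f = "\<lambda>x. x"])
    (simp_all add: lin_map_def)

lemma factorization_term:
  assumes "f \<in> fin_supp K X" "g \<in> fin_supp K Y"
  shows "f \<alpha> \<otimes>\<^bsub>K\<^esub> g \<beta> \<in> carrier K"
  using fin_supp_closed[OF assms(1)] fin_supp_closed[OF assms(2)] by simp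

lemma kQ_mult_eq_zeroI:
  assumes "\<And>\<alpha> \<beta>. (\<alpha>, \<beta>) \<in> factorizations \<gamma> \<Longrightarrow> f \<alpha> \<otimes>\<^bsub>K\<^esub> g \<beta> = \<zero>\<^bsub>K\<^esub>"
  shows "(f \<otimes>\<^bsub>kQ\<^esub> g) \<gamma> = \<zero>\<^bsub>K\<^esub>"
  unfolding kQ_mult_apply using assms by (intro K.add.finprod_one_eqI) auto

text \<open>Stated for arbitrary sets of paths, so as to give both the closure of \<open>kQ\<close>
  under products and the behaviour of path length in \<open>long_mult\<close>.\<close>

lemma kQ_mult_fin_supp:
  assumes f: "f \<in> fin_supp K X" and g: "g \<in> fin_supp K Y"
    and Z: "\<And>\<alpha> \<beta>. \<lbrakk>\<alpha> \<in> X; \<beta> \<in> Y; \<alpha> \<in> paths Q; \<beta> \<in> paths Q; path_start \<alpha> = path_end Q \<beta>\<rbrakk> \<Longrightarrow> path_comp \<alpha> \<beta> \<in> Z"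
  shows "f \<otimes>\<^bsub>kQ\<^esub> g \<in> fin_supp K Z"
proof (rule fin_suppI)
  let ?S = "(\<lambda>(\<alpha>, \<beta>). path_comp \<alpha> \<beta>) ` ({\<alpha>. f \<alpha> \<noteq> \<zero>\<^bsub>K\<^esub>} \<times> {\<beta>. g \<beta> \<noteq> \<zero>\<^bsub>K\<^esub>})"
  show "finite ?S" using fin_supp_finite[OF f] fin_supp_finite[OF g] by simp
  fix \<gamma>
  show "(f \<otimes>\<^bsub>kQ\<^esub> g) \<gamma> \<in> carrier K"
    unfolding kQ_mult_apply using factorization_term[OF f g] by (intro K.finsum_closed) simp
  have zero: "f \<alpha> \<otimes>\<^bsub>K\<^esub> g \<beta> = \<zero>\<^bsub>K\<^esub>" if "f \<alpha> = \<zero>\<^bsub>K\<^esub> \<or> g \<beta> = \<zero>\<^bsub>K\<^esub>" for \<alpha> \<beta>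
    using that fin_supp_closed[OF f, of \<alpha>] fin_supp_closed[OF g, of \<beta>] by auto
  show "(f \<otimes>\<^bsub>kQ\<^esub> g) \<gamma> = \<zero>\<^bsub>K\<^esub>" if "\<gamma> \<notin> Z"
  proof (rule kQ_mult_eq_zeroI, rule zero)
    fix \<alpha> \<beta> assume "(\<alpha>, \<beta>) \<in> factorizations \<gamma>"
    then have "\<alpha> \<notin> X \<or> \<beta> \<notin> Y" using Z[of \<alpha> \<beta>] that by (auto simp: factorizations_def)
    then show "f \<alpha> = \<zero>\<^bsub>K\<^esub> \<or> g \<beta> = \<zero>\<^bsub>K\<^esub>"
      using fin_supp_outside[OF f] fin_supp_outside[OF g] by blast
  qed
  show "(f \<otimes>\<^bsub>kQ\<^esub> g) \<gamma> = \<zero>\<^bsub>K\<^esub>" if "\<gamma> \<notin> ?S"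
  proof (rule kQ_mult_eq_zeroI, rule zero)
    fix \<alpha> \<beta> assume "(\<alpha>, \<beta>) \<in> factorizations \<gamma>"
    then have "\<gamma> = path_comp \<alpha> \<beta>" by (simp add: factorizations_def)
    then show "f \<alpha> = \<zero>\<^bsub>K\<^esub> \<or> g \<beta> = \<zero>\<^bsub>K\<^esub>" using that by force
  qed
qed

lemma kQ_mult_closed:
  "\<lbrakk>f \<in> fin_supp K (paths Q); g \<in> fin_supp K (paths Q)\<rbrakk> \<Longrightarrow> f \<otimes>\<^bsub>kQ\<^esub> g \<in> fin_supp K (paths Q)"
  by (rule kQ_mult_fin_supp) (assumption | rule path_comp_closed)+

lemma kQ_mult_lin_map:
  shows kQ_mult_lin_map_left: "g \<in> fin_supp K (paths Q) \<Longrightarrow> (\<lambda>f. f \<otimes>\<^bsub>kQ\<^esub> g) \<in> lin_map K kQ kQ"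
    and kQ_mult_lin_map_right: "f \<in> fin_supp K (paths Q) \<Longrightarrow> (\<lambda>g. f \<otimes>\<^bsub>kQ\<^esub> g) \<in> lin_map K kQ kQ"
proof -
  note cl = fin_supp_closed
  show "(\<lambda>f. f \<otimes>\<^bsub>kQ\<^esub> g) \<in> lin_map K kQ kQ" if g: "g \<in> fin_supp K (paths Q)" for g
  proof (rule lin_mapI)
    fix f assume "f \<in> carrier kQ"
    then have f: "f \<in> fin_supp K (paths Q)" by simp
    show "f \<otimes>\<^bsub>kQ\<^esub> g \<in> carrier kQ" using kQ_mult_closed[OF f g] by simp
    { fix c assume c: "c \<in> carrier K"
      have "((c \<odot>\<^bsub>kQ\<^esub> f) \<otimes>\<^bsub>kQ\<^esub> g) \<gamma> = c \<otimes>\<^bsub>K\<^esub> (f \<otimes>\<^bsub>kQ\<^esub> g) \<gamma>" for \<gamma>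
        unfolding kQ_mult_apply using c cl[OF f] cl[OF g]
        by (subst K.finsum_rdistr[OF finite_factorizations]) (simp_all add: K.m_assoc)
      then show "(c \<odot>\<^bsub>kQ\<^esub> f) \<otimes>\<^bsub>kQ\<^esub> g = c \<odot>\<^bsub>kQ\<^esub> (f \<otimes>\<^bsub>kQ\<^esub> g)" by (simp add: fun_eq_iff) }
    fix f' assume "f' \<in> carrier kQ"
    then have f': "f' \<in> fin_supp K (paths Q)" by simp
    have "((f \<oplus>\<^bsub>kQ\<^esub> f') \<otimes>\<^bsub>kQ\<^esub> g) \<gamma> = (f \<otimes>\<^bsub>kQ\<^esub> g) \<gamma> \<oplus>\<^bsub>K\<^esub> (f' \<otimes>\<^bsub>kQ\<^esub> g) \<gamma>" for \<gamma>
      unfolding kQ_mult_apply using cl[OF f] cl[OF f'] cl[OF g]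
      by (subst K.finsum_addf[symmetric]) (simp_all add: K.l_distr)
    then show "(f \<oplus>\<^bsub>kQ\<^esub> f') \<otimes>\<^bsub>kQ\<^esub> g = f \<otimes>\<^bsub>kQ\<^esub> g \<oplus>\<^bsub>kQ\<^esub> f' \<otimes>\<^bsub>kQ\<^esub> g" by (simp add: fun_eq_iff)
  qed
  show "(\<lambda>g. f \<otimes>\<^bsub>kQ\<^esub> g) \<in> lin_map K kQ kQ" if f: "f \<in> fin_supp K (paths Q)" for f
  proof (rule lin_mapI)
    fix g assume "g \<in> carrier kQ"
    then have g: "g \<in> fin_supp K (paths Q)" by simp
    show "f \<otimes>\<^bsub>kQ\<^esub> g \<in> carrier kQ" using kQ_mult_closed[OF f g] by simp
    { fix c assume c: "c \<in> carrier K"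
      have "(f \<otimes>\<^bsub>kQ\<^esub> (c \<odot>\<^bsub>kQ\<^esub> g)) \<gamma> = c \<otimes>\<^bsub>K\<^esub> (f \<otimes>\<^bsub>kQ\<^esub> g) \<gamma>" for \<gamma>
        unfolding kQ_mult_apply using c cl[OF f] cl[OF g]
        by (subst K.finsum_rdistr[OF finite_factorizations]) (simp_all add: K.m_lcomm)
      then show "f \<otimes>\<^bsub>kQ\<^esub> (c \<odot>\<^bsub>kQ\<^esub> g) = c \<odot>\<^bsub>kQ\<^esub> (f \<otimes>\<^bsub>kQ\<^esub> g)" by (simp add: fun_eq_iff) }
    fix g' assume "g' \<in> carrier kQ"
    then have g': "g' \<in> fin_supp K (paths Q)" by simp
    have "(f \<otimes>\<^bsub>kQ\<^esub> (g \<oplus>\<^bsub>kQ\<^esub> g')) \<gamma> = (f \<otimes>\<^bsub>kQ\<^esub> g) \<gamma> \<oplus>\<^bsub>K\<^esub> (f \<otimes>\<^bsub>kQ\<^esub> g') \<gamma>" for \<gamma>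
      unfolding kQ_mult_apply using cl[OF f] cl[OF g] cl[OF g']
      by (subst K.finsum_addf[symmetric]) (simp_all add: K.r_distr)
    then show "f \<otimes>\<^bsub>kQ\<^esub> (g \<oplus>\<^bsub>kQ\<^esub> g') = f \<otimes>\<^bsub>kQ\<^esub> g \<oplus>\<^bsub>kQ\<^esub> f \<otimes>\<^bsub>kQ\<^esub> g'" by (simp add: fun_eq_iff)
  qed
qed

lemma kQ_mult_delta:
  assumes "\<alpha> \<in> paths Q" "\<beta> \<in> paths Q"
  shows "delta K \<alpha> \<otimes>\<^bsub>kQ\<^esub> delta K \<beta> =
    (if path_start \<alpha> = path_end Q \<beta> then delta K (path_comp \<alpha> \<beta>) else \<zero>\<^bsub>kQ\<^esub>)"
proof
  fix \<gamma>
  show "(delta K \<alpha> \<otimes>\<^bsub>kQ\<^esub> delta K \<beta>) \<gamma> =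
    (if path_start \<alpha> = path_end Q \<beta> then delta K (path_comp \<alpha> \<beta>) else \<zero>\<^bsub>kQ\<^esub>) \<gamma>"
  proof (cases "(\<alpha>, \<beta>) \<in> factorizations \<gamma>")
    case True
    have "(delta K \<alpha> \<otimes>\<^bsub>kQ\<^esub> delta K \<beta>) \<gamma> =
        (\<Oplus>\<^bsub>K\<^esub>q\<in>factorizations \<gamma>. if (\<alpha>, \<beta>) = q then \<one>\<^bsub>K\<^esub> else \<zero>\<^bsub>K\<^esub>)"
      unfolding kQ_mult_apply by (intro K.finsum_cong') (auto simp: delta_def)
    also have "\<dots> = \<one>\<^bsub>K\<^esub>"
      by (rule K.finsum_singleton[OF True finite_factorizations]) simp
    finally show ?thesis using True by (simp add: factorizations_def delta_def)
  next
    case False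
    have "(delta K \<alpha> \<otimes>\<^bsub>kQ\<^esub> delta K \<beta>) \<gamma> = \<zero>\<^bsub>K\<^esub>"
      using False by (intro kQ_mult_eq_zeroI) (auto simp: delta_def)
    then show ?thesis using False assms by (auto simp: factorizations_def delta_def)
  qed
qed

lemma delta_comp:
  "\<lbrakk>\<alpha> \<in> paths Q; \<beta> \<in> paths Q; path_start \<alpha> = path_end Q \<beta>\<rbrakk> \<Longrightarrow>
    delta K (path_comp \<alpha> \<beta>) = delta K \<alpha> \<otimes>\<^bsub>kQ\<^esub> delta K \<beta>"
  by (simp add: kQ_mult_delta)

lemma kQ_lin_map_eqI:
  assumes "Module.module K W" "f \<in> lin_map K kQ W" "g \<in> lin_map K kQ W"
    and "\<And>\<gamma>. \<gamma> \<in> paths Q \<Longrightarrow> f (delta K \<gamma>) = g (delta K \<gamma>)" and "v \<in> carrier kQ"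
  shows "f v = g v"
  using lin_map_eq_on_delta[OF K.field_axioms assms(1) assms(2,3)[unfolded kQ_lin_map] assms(4)] assms(5)
  by simp

lemma delta_path_in_kQ [simp]: "delta K \<gamma> \<in> fin_supp K (paths Q) \<longleftrightarrow> \<gamma> \<in> paths Q"
  by (rule delta_in_fin_supp[OF K.field_axioms])

lemma kQ_mult_assoc_delta:
  assumes "\<alpha> \<in> paths Q" "\<beta> \<in> paths Q" "\<gamma> \<in> paths Q"
  shows "(delta K \<alpha> \<otimes>\<^bsub>kQ\<^esub> delta K \<beta>) \<otimes>\<^bsub>kQ\<^esub> delta K \<gamma> = delta K \<alpha> \<otimes>\<^bsub>kQ\<^esub> (delta K \<beta> \<otimes>\<^bsub>kQ\<^esub> delta K \<gamma>)"
proof -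
  have z: "\<zero>\<^bsub>kQ\<^esub> \<otimes>\<^bsub>kQ\<^esub> g = \<zero>\<^bsub>kQ\<^esub>" "g \<otimes>\<^bsub>kQ\<^esub> \<zero>\<^bsub>kQ\<^esub> = \<zero>\<^bsub>kQ\<^esub>" if "g \<in> fin_supp K (paths Q)" for g
    using lin_map_zero[OF kQ_module kQ_module kQ_mult_lin_map_left[OF that]]
      lin_map_zero[OF kQ_module kQ_module kQ_mult_lin_map_right[OF that]] by auto
  show ?thesis
    using assms z
    by (simp add: kQ_mult_delta path_comp_closed path_end_comp path_comp_assoc del: kQ_simps(2))
qed

text \<open>Both sides are linear in each argument, so it suffices to compare them on paths. The
  arguments are freed one at a time, beginning with \<open>h\<close>; no double sum over
  factorizations has to be rearranged.\<close>

lemma kQ_mult_assoc: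
  assumes f: "f \<in> carrier kQ" and g: "g \<in> carrier kQ" and h: "h \<in> carrier kQ"
  shows "(f \<otimes>\<^bsub>kQ\<^esub> g) \<otimes>\<^bsub>kQ\<^esub> h = f \<otimes>\<^bsub>kQ\<^esub> (g \<otimes>\<^bsub>kQ\<^esub> h)"
proof -
  note L = kQ_mult_lin_map_left and R = kQ_mult_lin_map_right and M = kQ_module
  have 1: "(delta K \<alpha> \<otimes>\<^bsub>kQ\<^esub> delta K \<beta>) \<otimes>\<^bsub>kQ\<^esub> h = delta K \<alpha> \<otimes>\<^bsub>kQ\<^esub> (delta K \<beta> \<otimes>\<^bsub>kQ\<^esub> h)"
    if "\<alpha> \<in> paths Q" "\<beta> \<in> paths Q" for \<alpha> \<beta>
  proof (rule kQ_lin_map_eqI[OF M _ _ _ h])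
    show "(\<lambda>h. (delta K \<alpha> \<otimes>\<^bsub>kQ\<^esub> delta K \<beta>) \<otimes>\<^bsub>kQ\<^esub> h) \<in> lin_map K kQ kQ"
      using that by (intro R kQ_mult_closed) simp_all
    show "(\<lambda>h. delta K \<alpha> \<otimes>\<^bsub>kQ\<^esub> (delta K \<beta> \<otimes>\<^bsub>kQ\<^esub> h)) \<in> lin_map K kQ kQ"
      using that by (intro lin_map_comp[OF R R]) simp_all
  qed (rule kQ_mult_assoc_delta[OF that])
  have 2: "(delta K \<alpha> \<otimes>\<^bsub>kQ\<^esub> g) \<otimes>\<^bsub>kQ\<^esub> h = delta K \<alpha> \<otimes>\<^bsub>kQ\<^esub> (g \<otimes>\<^bsub>kQ\<^esub> h)"
    if "\<alpha> \<in> paths Q" for \<alpha>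
  proof (rule kQ_lin_map_eqI[OF M _ _ _ g])
    show "(\<lambda>g. (delta K \<alpha> \<otimes>\<^bsub>kQ\<^esub> g) \<otimes>\<^bsub>kQ\<^esub> h) \<in> lin_map K kQ kQ"
      using that h by (intro lin_map_comp[OF R L]) simp_all
    show "(\<lambda>g. delta K \<alpha> \<otimes>\<^bsub>kQ\<^esub> (g \<otimes>\<^bsub>kQ\<^esub> h)) \<in> lin_map K kQ kQ"
      using that h by (intro lin_map_comp[OF L R]) simp_all
  qed (rule 1[OF that])
  show ?thesis
  proof (rule kQ_lin_map_eqI[OF M _ _ _ f])
    show "(\<lambda>f. (f \<otimes>\<^bsub>kQ\<^esub> g) \<otimes>\<^bsub>kQ\<^esub> h) \<in> lin_map K kQ kQ"
      using g h by (intro lin_map_comp[OF L L]) simp_all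
    show "(\<lambda>f. f \<otimes>\<^bsub>kQ\<^esub> (g \<otimes>\<^bsub>kQ\<^esub> h)) \<in> lin_map K kQ kQ"
      using g h by (intro L kQ_mult_closed) simp_all
  qed (rule 2)
qed

text \<open>The unit is defined by its coefficients; as an actual sum it can be treated term by term
  by linear maps.\<close>

lemma kQ_one_eq_finsum: "\<one>\<^bsub>kQ\<^esub> = (\<Oplus>\<^bsub>kQ\<^esub>x\<in>verts Q. vtx x)"
proof
  fix \<gamma>
  have "(\<Oplus>\<^bsub>kQ\<^esub>x\<in>verts Q. vtx x) \<gamma> = (\<Oplus>\<^bsub>free_space K (paths Q)\<^esub>x\<in>verts Q. vtx x) \<gamma>"
    by (subst finsum_cong_add_monoid[of kQ "free_space K (paths Q)"])
      (simp_all add: path_algebra_def)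
  also have "\<dots> = (\<Oplus>\<^bsub>K\<^esub>x\<in>verts Q. vtx x \<gamma>)"
    by (rule finsum_free_space_apply[OF K.field_axioms finite_verts]) simp
  also have "\<dots> = \<one>\<^bsub>kQ\<^esub> \<gamma>"
  proof (cases "\<gamma> \<in> vertex_path ` verts Q")
    case True
    then obtain y where y: "y \<in> verts Q" "\<gamma> = vertex_path y" by blast
    have "(\<Oplus>\<^bsub>K\<^esub>x\<in>verts Q. vtx x \<gamma>) = (\<Oplus>\<^bsub>K\<^esub>x\<in>verts Q. if y = x then \<one>\<^bsub>K\<^esub> else \<zero>\<^bsub>K\<^esub>)"
      by (intro K.finsum_cong') (auto simp: delta_def y(2) vertex_path_def)
    also have "\<dots> = \<one>\<^bsub>K\<^esub>" by (rule K.finsum_singleton[OF y(1) finite_verts]) simp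
    finally show ?thesis using True by (simp add: kQ_one)
  next
    case False
    then have "(\<Oplus>\<^bsub>K\<^esub>x\<in>verts Q. vtx x \<gamma>) = \<zero>\<^bsub>K\<^esub>"
      by (intro K.add.finprod_one_eqI) (auto simp: delta_def)
    then show ?thesis using False by (simp add: kQ_one)
  qed
  finally show "\<one>\<^bsub>kQ\<^esub> \<gamma> = (\<Oplus>\<^bsub>kQ\<^esub>x\<in>verts Q. vtx x) \<gamma>" by simp
qed

lemma vtx_mult_delta:
  assumes "x \<in> verts Q" "\<gamma> \<in> paths Q"
  shows "vtx x \<otimes>\<^bsub>kQ\<^esub> delta K \<gamma> = (if x = path_end Q \<gamma> then delta K \<gamma> else \<zero>\<^bsub>kQ\<^esub>)"
    and "delta K \<gamma> \<otimes>\<^bsub>kQ\<^esub> vtx x = (if x = path_start \<gamma> then delta K \<gamma> else \<zero>\<^bsub>kQ\<^esub>)"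
  using assms by (auto simp add: kQ_mult_delta simp del: kQ_simps)

lemma kQ_one_closed: "\<one>\<^bsub>kQ\<^esub> \<in> fin_supp K (paths Q)"
  by (rule fin_suppI[where S = "vertex_path ` verts Q"]) (auto simp: kQ_one)

lemma kQ_unit_delta:
  assumes "\<gamma> \<in> paths Q"
  shows "\<one>\<^bsub>kQ\<^esub> \<otimes>\<^bsub>kQ\<^esub> delta K \<gamma> = delta K \<gamma>" "delta K \<gamma> \<otimes>\<^bsub>kQ\<^esub> \<one>\<^bsub>kQ\<^esub> = delta K \<gamma>"
proof -
  interpret P: Module.module K kQ by (rule kQ_module)
  have \<gamma>: "delta K \<gamma> \<in> fin_supp K (paths Q)" using assms by simp
  have V: "vtx \<in> verts Q \<rightarrow> carrier kQ" by simp
  have cl: "delta K \<gamma> \<in> carrier kQ" "\<zero>\<^bsub>kQ\<^esub> \<in> carrier kQ" using \<gamma> P.M.zero_closed by simp_all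
  have "\<one>\<^bsub>kQ\<^esub> \<otimes>\<^bsub>kQ\<^esub> delta K \<gamma> = (\<Oplus>\<^bsub>kQ\<^esub>x\<in>verts Q. vtx x \<otimes>\<^bsub>kQ\<^esub> delta K \<gamma>)"
    unfolding kQ_one_eq_finsum
    by (rule lin_map_finsum[OF kQ_module kQ_module kQ_mult_lin_map_left[OF \<gamma>] finite_verts V])
  also have "\<dots> = (\<Oplus>\<^bsub>kQ\<^esub>x\<in>verts Q. if path_end Q \<gamma> = x then delta K \<gamma> else \<zero>\<^bsub>kQ\<^esub>)"
    using assms cl by (intro P.M.finsum_cong') (auto simp add: vtx_mult_delta simp del: kQ_simps)
  also have "\<dots> = delta K \<gamma>"
    using assms cl by (intro P.M.finsum_singleton finite_verts) (simp_all del: kQ_simps)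
  finally show "\<one>\<^bsub>kQ\<^esub> \<otimes>\<^bsub>kQ\<^esub> delta K \<gamma> = delta K \<gamma>" .
  have "delta K \<gamma> \<otimes>\<^bsub>kQ\<^esub> \<one>\<^bsub>kQ\<^esub> = (\<Oplus>\<^bsub>kQ\<^esub>x\<in>verts Q. delta K \<gamma> \<otimes>\<^bsub>kQ\<^esub> vtx x)"
    unfolding kQ_one_eq_finsum
    by (rule lin_map_finsum[OF kQ_module kQ_module kQ_mult_lin_map_right[OF \<gamma>] finite_verts V])
  also have "\<dots> = (\<Oplus>\<^bsub>kQ\<^esub>x\<in>verts Q. if path_start \<gamma> = x then delta K \<gamma> else \<zero>\<^bsub>kQ\<^esub>)"
    using assms cl by (intro P.M.finsum_cong') (auto simp add: vtx_mult_delta simp del: kQ_simps)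
  also have "\<dots> = delta K \<gamma>"
    using assms cl by (intro P.M.finsum_singleton finite_verts) (simp_all del: kQ_simps)
  finally show "delta K \<gamma> \<otimes>\<^bsub>kQ\<^esub> \<one>\<^bsub>kQ\<^esub> = delta K \<gamma>" .
qed

lemma kQ_algebra: "k_algebra K kQ"
proof (rule k_algebraI[OF K.field_axioms kQ_module])
  have id: "(\<lambda>x. x) \<in> lin_map K kQ kQ" by (simp add: lin_map_def)
  show "\<one>\<^bsub>kQ\<^esub> \<otimes>\<^bsub>kQ\<^esub> f = f" if "f \<in> carrier kQ" for f
    by (rule kQ_lin_map_eqI[OF kQ_module kQ_mult_lin_map_right[OF kQ_one_closed] id kQ_unit_delta(1) that])
  show "f \<otimes>\<^bsub>kQ\<^esub> \<one>\<^bsub>kQ\<^esub> = f" if "f \<in> carrier kQ" for f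
    by (rule kQ_lin_map_eqI[OF kQ_module kQ_mult_lin_map_left[OF kQ_one_closed] id kQ_unit_delta(2) that])
qed (simp_all add: kQ_one_closed kQ_mult_closed kQ_mult_lin_map_left kQ_mult_lin_map_right
  kQ_mult_assoc[simplified])

end

sublocale quiver_algebra \<subseteq> kQ: k_algebra K kQ
  by (rule kQ_algebra)

context quiver_algebra
begin

section \<open>Powers of the arrow ideal\<close>

definition long_paths :: "nat \<Rightarrow> ('v, 'q) path set" where
  "long_paths k = {\<gamma> \<in> paths Q. k \<le> length (snd \<gamma>)}"

text \<open>By \<open>arrow_ideal_power\<close> this is the power of the arrow ideal with exponent
  \<open>k\<close>. The description by supports turns membership into a condition on
  coefficients.\<close>

definition long :: "nat \<Rightarrow> (('v, 'q) path \<Rightarrow> 'k) set" where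
  "long k = fin_supp K (long_paths k)"

lemma long_iff: "f \<in> long k \<longleftrightarrow> f \<in> carrier kQ \<and> (\<forall>\<gamma>. length (snd \<gamma>) < k \<longrightarrow> f \<gamma> = \<zero>\<^bsub>K\<^esub>)"
  by (auto simp: long_def long_paths_def fin_supp_def not_le)

lemma long_0: "long 0 = carrier kQ"
  by (simp add: long_def long_paths_def)

lemma long_antimono: "j \<le> k \<Longrightarrow> long k \<subseteq> long j"
  unfolding long_def by (rule fin_supp_mono) (auto simp: long_paths_def)

lemma long_closed: "f \<in> long k \<Longrightarrow> f \<in> carrier kQ"
  by (simp add: long_iff)

lemma long_delta: "delta K \<gamma> \<in> long k \<longleftrightarrow> \<gamma> \<in> paths Q \<and> k \<le> length (snd \<gamma>)"
  unfolding long_def by (simp add: delta_in_fin_supp[OF K.field_axioms] long_paths_def)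

lemma long_mult:
  assumes "f \<in> long i" "g \<in> long j"
  shows "f \<otimes>\<^bsub>kQ\<^esub> g \<in> long (i + j)"
  unfolding long_def
proof (rule kQ_mult_fin_supp[OF assms[unfolded long_def]])
  fix \<alpha> \<beta> assume "\<alpha> \<in> long_paths i" "\<beta> \<in> long_paths j" "path_start \<alpha> = path_end Q \<beta>"
  then show "path_comp \<alpha> \<beta> \<in> long_paths (i + j)"
    by (simp add: long_paths_def path_comp_closed)
qed

lemma long_ideal: "ideal (long k) kQ"
proof (rule kQ.ideal_of_subspace)
  show "long k \<subseteq> carrier kQ" by (auto simp: long_iff)
  show "\<zero>\<^bsub>kQ\<^esub> \<in> long k" unfolding long_def using fin_supp_zero[OF K.field_axioms] by simp
  show "f \<oplus>\<^bsub>kQ\<^esub> g \<in> long k" if "f \<in> long k" "g \<in> long k" for f g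
    using that unfolding long_def by (simp add: fin_supp_add[OF K.field_axioms])
  show "c \<odot>\<^bsub>kQ\<^esub> f \<in> long k" if "c \<in> carrier K" "f \<in> long k" for c f
    using that unfolding long_def by (simp add: fin_supp_smult[OF K.field_axioms])
  show "f \<otimes>\<^bsub>kQ\<^esub> g \<in> long k" if "f \<in> carrier kQ" "g \<in> long k" for f g
    using long_mult[of f 0 g k] that by (simp add: long_0)
  show "g \<otimes>\<^bsub>kQ\<^esub> f \<in> long k" if "f \<in> carrier kQ" "g \<in> long k" for f g
    using long_mult[of g k f 0] that by (simp add: long_0)
qed

lemma smult_delta_mult:
  assumes "c \<in> carrier K" "\<alpha> \<in> paths Q" "\<beta> \<in> paths Q" "path_start \<alpha> = path_end Q \<beta>"
  shows "(\<lambda>\<gamma>. c \<otimes>\<^bsub>K\<^esub> delta K (path_comp \<alpha> \<beta>) \<gamma>) = (c \<odot>\<^bsub>kQ\<^esub> delta K \<alpha>) \<otimes>\<^bsub>kQ\<^esub> delta K \<beta>"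
proof -
  have "(c \<odot>\<^bsub>kQ\<^esub> delta K \<alpha>) \<otimes>\<^bsub>kQ\<^esub> delta K \<beta> = c \<odot>\<^bsub>kQ\<^esub> delta K (path_comp \<alpha> \<beta>)"
    using assms by (subst kQ.smult_mult_left) (simp_all add: delta_comp)
  then show ?thesis by simp
qed

text \<open>A path with at least \<open>i + j\<close> arrows is cut after its first \<open>j\<close>
  arrows, which exhibits it as the product of a member of \<open>long i\<close> and a member of
  \<open>long j\<close>.\<close>

lemma long_subset_of_split:
  assumes I: "ideal I kQ"
    and mult: "\<And>f g. \<lbrakk>f \<in> long i; g \<in> long j\<rbrakk> \<Longrightarrow> f \<otimes>\<^bsub>kQ\<^esub> g \<in> I"
  shows "long (i + j) \<subseteq> I"
proof
  interpret I: ideal I kQ by (rule I)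
  fix f assume "f \<in> long (i + j)"
  then have "f \<in> fin_supp K (long_paths (i + j))" by (simp add: long_def)
  then show "f \<in> I"
  proof (induction rule: fin_supp_induct[OF K.field_axioms, consumes 1, case_names zero add delta])
    case zero
    show ?case using I.zero_closed by simp
  next
    case (add f g)
    then show ?case using I.a_closed[of f g] by simp
  next
    case (delta c \<gamma>)
    then have \<gamma>: "\<gamma> \<in> paths Q" "j \<le> length (snd \<gamma>)" "i + j \<le> length (snd \<gamma>)"
      by (simp_all add: long_paths_def)
    then obtain \<alpha> \<beta> where *: "\<alpha> \<in> paths Q" "\<beta> \<in> paths Q" "path_start \<alpha> = path_end Q \<beta>"
      "\<gamma> = path_comp \<alpha> \<beta>" "length (snd \<beta>) = j"
      using path_split by blast
    then have "i \<le> length (snd \<alpha>)" using \<gamma> by simp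
    \<comment> \<open>The scalar goes into the left factor, since \<open>mult\<close> covers
      products only.\<close>
    then have "c \<odot>\<^bsub>kQ\<^esub> delta K \<alpha> \<in> long i"
      using * delta(1) by (intro kQ.smult_mem_ideal[OF long_ideal]) (simp_all add: long_delta)
    moreover have "delta K \<beta> \<in> long j" using * by (simp add: long_delta)
    ultimately show ?case using mult smult_delta_mult[OF delta(1) *(1,2,3)] *(4) by simp
  qed
qed

lemma long_prod: "long i \<cdot>\<^bsub>kQ\<^esub> long j = long (i + j)"
proof
  show "long i \<cdot>\<^bsub>kQ\<^esub> long j \<subseteq> long (i + j)"
  proof
    fix f assume "f \<in> long i \<cdot>\<^bsub>kQ\<^esub> long j"
    then show "f \<in> long (i + j)"
    proof (induction rule: ideal_prod.induct)
      case (sum f g)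
      then show ?case
        using additive_subgroup.a_closed[OF ideal.axioms(1)[OF long_ideal]] by blast
    qed (rule long_mult)
  qed
  show "long (i + j) \<subseteq> long i \<cdot>\<^bsub>kQ\<^esub> long j"
    by (intro long_subset_of_split kQ.A.ideal_prod_is_ideal long_ideal ideal_prod.prod)
qed

text \<open>Every path of positive length is a left multiple of its first arrow.\<close>

lemma arrow_ideal_eq_long: "arrow_ideal K Q = long 1"
proof
  have arr: "arr ` arcs Q \<subseteq> carrier kQ" by auto
  show "arrow_ideal K Q \<subseteq> long 1"
    unfolding arrow_ideal_def
    by (rule kQ.A.genideal_minimal[OF long_ideal]) (auto simp: long_delta arrow_path_def[of Q] paths_iff arc_implies_awalk)
  interpret I: ideal "arrow_ideal K Q" kQ
    unfolding arrow_ideal_def by (rule kQ.A.genideal_ideal[OF arr])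
  have arr_in: "arr a \<in> arrow_ideal K Q" if "a \<in> arcs Q" for a
    using kQ.A.genideal_self[OF arr] that unfolding arrow_ideal_def by blast
  show "long 1 \<subseteq> arrow_ideal K Q"
  proof
    fix f assume "f \<in> long 1"
    then have "f \<in> fin_supp K (long_paths 1)" by (simp add: long_def)
    then show "f \<in> arrow_ideal K Q"
    proof (induction rule: fin_supp_induct[OF K.field_axioms, consumes 1, case_names zero add delta])
      case zero
      show ?case using I.zero_closed by simp
    next
      case (add f g)
      then show ?case using I.a_closed[of f g] by simp
    next
      case (delta c \<gamma>)
      then have \<gamma>: "\<gamma> \<in> paths Q" "1 \<le> length (snd \<gamma>)" by (simp_all add: long_paths_def)
      then obtain \<alpha> \<beta> where *: "\<alpha> \<in> paths Q" "\<beta> \<in> paths Q" "path_start \<alpha> = path_end Q \<beta>"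
        "\<gamma> = path_comp \<alpha> \<beta>" "length (snd \<beta>) = 1"
        using path_split by blast
      obtain a where a: "a \<in> arcs Q" "\<beta> = arrow_path Q a"
        using arrow_path_of_length_1[OF *(2,5)] by blast
      have "(c \<odot>\<^bsub>kQ\<^esub> delta K \<alpha>) \<otimes>\<^bsub>kQ\<^esub> arr a \<in> arrow_ideal K Q"
        using *(1) delta(1) by (intro I.I_l_closed arr_in a(1) kQ.smult_closed) simp_all
      then show ?case using smult_delta_mult[OF delta(1) *(1,2,3)] *(4) a(2) by simp
    qed
  qed
qed

lemma arrow_ideal_power: "arrow_ideal K Q [^]\<^bsub>ideals_set kQ\<^esub> (k::nat) = long k"
proof (induction k)
  case 0
  then show ?case by (simp add: nat_pow_def ideals_set_def long_0)
next
  case (Suc k)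
  have "arrow_ideal K Q [^]\<^bsub>ideals_set kQ\<^esub> Suc k = long k \<cdot>\<^bsub>kQ\<^esub> long 1"
    using Suc by (simp add: nat_pow_def ideals_set_def arrow_ideal_eq_long)
  then show ?case by (simp add: long_prod)
qed

lemma admissible_iff:
  "admissible K Q I \<longleftrightarrow> ideal I kQ \<and> (\<exists>m>0. long m \<subseteq> I) \<and> I \<subseteq> long 2"
  unfolding admissible_def arrow_ideal_power ..

text \<open>Linear multiplicative maps are compared rather than algebra homomorphisms, because the
  maps in question land in a corner of \<Lambda> and send the unit to a corner idempotent. Agreement
  on vertices is therefore a condition of its own.\<close>

lemma kQ_maps_eqI:
  assumes W: "k_algebra K W" and f: "f \<in> lin_map K kQ W" and g: "g \<in> lin_map K kQ W"
    and fm: "\<And>x y. \<lbrakk>x \<in> carrier kQ; y \<in> carrier kQ\<rbrakk> \<Longrightarrow> f (x \<otimes>\<^bsub>kQ\<^esub> y) = f x \<otimes>\<^bsub>W\<^esub> f y"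
    and gm: "\<And>x y. \<lbrakk>x \<in> carrier kQ; y \<in> carrier kQ\<rbrakk> \<Longrightarrow> g (x \<otimes>\<^bsub>kQ\<^esub> y) = g x \<otimes>\<^bsub>W\<^esub> g y"
    and vtx: "\<And>x. x \<in> verts Q \<Longrightarrow> f (vtx x) = g (vtx x)"
    and arr: "\<And>a. a \<in> arcs Q \<Longrightarrow> f (arr a) = g (arr a)"
    and v: "v \<in> carrier kQ"
  shows "f v = g v"
proof (rule kQ_lin_map_eqI[OF _ f g _ v])
  show "Module.module K W" using W by (simp add: k_algebra_def)
  fix \<gamma> assume "\<gamma> \<in> paths Q"
  then show "f (delta K \<gamma>) = g (delta K \<gamma>)"
  proof (induction rule: path_induct)
    case (arrow a \<gamma>)
    then show ?case by (simp add: delta_comp fm gm arr)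
  qed (rule vtx)
qed

end

section \<open>Homomorphisms out of a path algebra\<close>

locale path_evaluation = quiver_algebra K Q + L?: k_algebra K L
  for K :: "('k, 'r) ring_scheme" and Q :: "('v, 'q) pre_digraph"
    and L :: "('k, 'l, 'z) module_scheme" +
  fixes \<nu> :: "'v \<Rightarrow> 'l" and \<theta> :: "'q \<Rightarrow> 'l"
  assumes vertex_closed: "x \<in> verts Q \<Longrightarrow> \<nu> x \<in> carrier L"
    and vertex_idem: "x \<in> verts Q \<Longrightarrow> \<nu> x \<otimes>\<^bsub>L\<^esub> \<nu> x = \<nu> x"
    and vertex_orth: "\<lbrakk>x \<in> verts Q; y \<in> verts Q; x \<noteq> y\<rbrakk> \<Longrightarrow> \<nu> x \<otimes>\<^bsub>L\<^esub> \<nu> y = \<zero>\<^bsub>L\<^esub>"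
    and vertex_sum: "(\<Oplus>\<^bsub>L\<^esub>x\<in>verts Q. \<nu> x) = \<one>\<^bsub>L\<^esub>"
    and arrow_closed: "a \<in> arcs Q \<Longrightarrow> \<theta> a \<in> carrier L"
    and arrow_head: "a \<in> arcs Q \<Longrightarrow> \<nu> (head Q a) \<otimes>\<^bsub>L\<^esub> \<theta> a = \<theta> a"
    and arrow_tail: "a \<in> arcs Q \<Longrightarrow> \<theta> a \<otimes>\<^bsub>L\<^esub> \<nu> (tail Q a) = \<theta> a"
begin

text \<open>Arrows are listed in the order of traversal and each is multiplied on the left, in
  accordance with composition from right to left. The start value, the idempotent of the initial
  vertex, covers paths of length zero.\<close>

definition path_value :: "('v, 'q) path \<Rightarrow> 'l" where
  "path_value \<gamma> = fold (\<lambda>a z. \<theta> a \<otimes>\<^bsub>L\<^esub> z) (snd \<gamma>) (\<nu> (fst \<gamma>))"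

definition evaluation :: "(('v, 'q) path \<Rightarrow> 'k) \<Rightarrow> 'l" where
  "evaluation = lin_ext K L path_value"

lemma path_value_vertex [simp]: "path_value (vertex_path x) = \<nu> x"
  by (simp add: path_value_def vertex_path_def)

lemma path_value_arrow [simp]: "path_value (path_comp (arrow_path Q a) \<gamma>) = \<theta> a \<otimes>\<^bsub>L\<^esub> path_value \<gamma>"
  by (simp add: path_value_def path_comp_def arrow_path_def)

lemma path_value_ends:
  assumes "\<gamma> \<in> paths Q"
  shows "path_value \<gamma> \<in> carrier L \<and> \<nu> (path_end Q \<gamma>) \<otimes>\<^bsub>L\<^esub> path_value \<gamma> = path_value \<gamma> \<and>
    path_value \<gamma> \<otimes>\<^bsub>L\<^esub> \<nu> (path_start \<gamma>) = path_value \<gamma>"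
  using assms
proof (induction rule: path_induct)
  case (vertex x)
  then show ?case by (simp add: vertex_closed vertex_idem)
next
  case (arrow a \<gamma>)
  then have "\<nu> (path_end Q \<gamma>) \<in> carrier L" "\<nu> (path_start \<gamma>) \<in> carrier L" "\<nu> (head Q a) \<in> carrier L"
    by (auto intro!: vertex_closed)
  then show ?case
    using arrow by (simp add: path_end_comp arrow_closed arrow_head L.A.m_assoc flip: L.A.m_assoc[of "\<nu> (head Q a)"])
qed

lemma path_value_comp:
  assumes "\<alpha> \<in> paths Q" "\<beta> \<in> paths Q" "path_start \<alpha> = path_end Q \<beta>"
  shows "path_value (path_comp \<alpha> \<beta>) = path_value \<alpha> \<otimes>\<^bsub>L\<^esub> path_value \<beta>"
  using assms(1,3)
proof (induction rule: path_induct)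
  case (vertex x)
  then show ?case using path_value_ends[OF assms(2)] by simp
next
  case (arrow a \<gamma>)
  then show ?case
    using path_value_ends[OF assms(2)] path_value_ends[of \<gamma>]
    by (simp add: path_comp_assoc L.A.m_assoc arrow_closed)
qed

text \<open>The idempotents of the two mismatched endpoints can be inserted between the factors, and
  they are orthogonal.\<close>

lemma path_value_comp_zero:
  assumes "\<alpha> \<in> paths Q" "\<beta> \<in> paths Q" "path_start \<alpha> \<noteq> path_end Q \<beta>"
  shows "path_value \<alpha> \<otimes>\<^bsub>L\<^esub> path_value \<beta> = \<zero>\<^bsub>L\<^esub>"
proof -
  let ?x = "\<nu> (path_start \<alpha>)" and ?y = "\<nu> (path_end Q \<beta>)" and ?a = "path_value \<alpha>" and ?b = "path_value \<beta>"
  have cl: "?x \<in> carrier L" "?y \<in> carrier L" "?a \<in> carrier L" "?b \<in> carrier L"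
    using path_value_ends assms by (simp_all add: vertex_closed)
  have "?a \<otimes>\<^bsub>L\<^esub> ?b = (?a \<otimes>\<^bsub>L\<^esub> ?x) \<otimes>\<^bsub>L\<^esub> (?y \<otimes>\<^bsub>L\<^esub> ?b)"
    using path_value_ends assms by simp
  also have "\<dots> = ?a \<otimes>\<^bsub>L\<^esub> ((?x \<otimes>\<^bsub>L\<^esub> ?y) \<otimes>\<^bsub>L\<^esub> ?b)" using cl by (simp add: L.A.m_assoc)
  also have "\<dots> = \<zero>\<^bsub>L\<^esub>" using cl assms by (simp add: vertex_orth)
  finally show ?thesis .
qed

lemma path_value_Pi: "path_value \<in> paths Q \<rightarrow> carrier L"
  using path_value_ends by blast

lemma evaluation_lin_map: "evaluation \<in> lin_map K kQ L"
  unfolding evaluation_def kQ_lin_map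
  by (rule lin_ext_lin_map[OF K.field_axioms L.module_axioms path_value_Pi])

lemma evaluation_delta: "\<gamma> \<in> paths Q \<Longrightarrow> evaluation (delta K \<gamma>) = path_value \<gamma>"
  unfolding evaluation_def by (rule lin_ext_delta[OF K.field_axioms L.module_axioms path_value_Pi])

lemma evaluation_vertex: "x \<in> verts Q \<Longrightarrow> evaluation (vtx x) = \<nu> x"
  by (simp add: evaluation_delta)

lemma evaluation_arrow:
  assumes "a \<in> arcs Q"
  shows "evaluation (arr a) = \<theta> a"
proof -
  have "arrow_path Q a = path_comp (arrow_path Q a) (vertex_path (tail Q a))"
    using path_comp_vertex(1)[of "arrow_path Q a"] by simp
  then have "path_value (arrow_path Q a) = \<theta> a"
    using path_value_arrow[of a "vertex_path (tail Q a)"] assms by (simp add: arrow_tail)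
  then show ?thesis using assms by (simp add: evaluation_delta)
qed

text \<open>Bilinearity reduces multiplicativity to pairs of paths. The unit is the sum of the
  vertices, whose images add up to one by \<open>vertex_sum\<close>.\<close>

lemma evaluation_alg_hom: "evaluation \<in> alg_hom K kQ L"
proof (rule alg_homI[OF evaluation_lin_map])
  have "evaluation \<one>\<^bsub>kQ\<^esub> = (\<Oplus>\<^bsub>L\<^esub>x\<in>verts Q. evaluation (vtx x))"
    unfolding kQ_one_eq_finsum
    by (rule lin_map_finsum[OF kQ_module L.module_axioms evaluation_lin_map finite_verts]) simp
  also have "\<dots> = \<one>\<^bsub>L\<^esub>"
    unfolding vertex_sum[symmetric] using vertex_closed by (intro L.A.finsum_cong') (auto simp: evaluation_vertex)
  finally show "evaluation \<one>\<^bsub>kQ\<^esub> = \<one>\<^bsub>L\<^esub>" .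
  note ev = evaluation_lin_map and M = L.module_axioms
  have ev_zero: "evaluation \<zero>\<^bsub>kQ\<^esub> = \<zero>\<^bsub>L\<^esub>"
    by (rule lin_map_zero[OF kQ_module M ev])
  have dd: "evaluation (delta K \<alpha> \<otimes>\<^bsub>kQ\<^esub> delta K \<beta>) = evaluation (delta K \<alpha>) \<otimes>\<^bsub>L\<^esub> evaluation (delta K \<beta>)"
    if "\<alpha> \<in> paths Q" "\<beta> \<in> paths Q" for \<alpha> \<beta>
    using that ev_zero
    by (simp add: kQ_mult_delta evaluation_delta path_comp_closed path_value_comp path_value_comp_zero)
  have df: "evaluation (delta K \<alpha> \<otimes>\<^bsub>kQ\<^esub> g) = evaluation (delta K \<alpha>) \<otimes>\<^bsub>L\<^esub> evaluation g"
    if "\<alpha> \<in> paths Q" "g \<in> carrier kQ" for \<alpha> g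
  proof (rule kQ_lin_map_eqI[OF M _ _ _ that(2)])
    show "(\<lambda>g. evaluation (delta K \<alpha> \<otimes>\<^bsub>kQ\<^esub> g)) \<in> lin_map K kQ L"
      using that by (intro lin_map_comp[OF kQ_mult_lin_map_right ev]) simp
    show "(\<lambda>g. evaluation (delta K \<alpha>) \<otimes>\<^bsub>L\<^esub> evaluation g) \<in> lin_map K kQ L"
      using that by (intro lin_map_comp[OF ev L.lin_map_mult_right] lin_map_closed[OF ev]) simp
  qed (rule dd[OF that(1)])
  fix f g assume f: "f \<in> carrier kQ" and g: "g \<in> carrier kQ"
  show "evaluation (f \<otimes>\<^bsub>kQ\<^esub> g) = evaluation f \<otimes>\<^bsub>L\<^esub> evaluation g"
  proof (rule kQ_lin_map_eqI[OF M _ _ _ f])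
    show "(\<lambda>f. evaluation (f \<otimes>\<^bsub>kQ\<^esub> g)) \<in> lin_map K kQ L"
      using g by (intro lin_map_comp[OF kQ_mult_lin_map_left ev]) simp
    show "(\<lambda>f. evaluation f \<otimes>\<^bsub>L\<^esub> evaluation g) \<in> lin_map K kQ L"
      using g by (intro lin_map_comp[OF ev L.lin_map_mult_left] lin_map_closed[OF ev])
  qed (rule df[OF _ g])
qed

end

section \<open>Images of linear maps and linear spans\<close>

lemma lin_map_image_submodule:
  assumes "Module.module K V" "Module.module K W" "f \<in> lin_map K V W"
  shows "submodule (f ` carrier V) K W"
proof -
  interpret V: Module.module K V by fact
  interpret W: Module.module K W by fact
  note f = lin_mapD[OF assms(3)]
  show ?thesis
  proof (rule W.submoduleI)
    show "f ` carrier V \<subseteq> carrier W" using f(1) by blast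
    show "\<zero>\<^bsub>W\<^esub> \<in> f ` carrier V"
      unfolding lin_map_zero[OF assms, symmetric] by (rule imageI[OF V.M.zero_closed])
    { fix y assume "y \<in> f ` carrier V"
      then obtain x where x: "x \<in> carrier V" "y = f x" by blast
      have "f (\<ominus>\<^bsub>V\<^esub> x) = \<ominus>\<^bsub>W\<^esub> y"
        using abelian_group_hom.hom_a_inv[OF lin_map_hom[OF assms] x(1)] x(2) by simp
      then show "\<ominus>\<^bsub>W\<^esub> y \<in> f ` carrier V" using imageI[OF V.M.a_inv_closed[OF x(1)], of f] by simp
      { fix z assume "z \<in> f ` carrier V"
        then obtain x' where x': "x' \<in> carrier V" "z = f x'" by blast
        show "y \<oplus>\<^bsub>W\<^esub> z \<in> f ` carrier V"
          unfolding x(2) x'(2) f(2)[OF x(1) x'(1), symmetric] using x(1) x'(1) by simp }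
      { fix c assume c: "c \<in> carrier K"
        show "c \<odot>\<^bsub>W\<^esub> y \<in> f ` carrier V"
          unfolding x(2) f(3)[OF c x(1), symmetric] using x(1) c by simp } }
  qed
qed

context
  fixes K :: "('k, 'r) ring_scheme"
  assumes K: "field K"
begin

interpretation K: field K by (rule K)

text \<open>With a span rewritten as the image of a free space, facts on spans become facts on
  linear maps and are accessible to \<open>fin_supp_induct\<close>.\<close>

lemma lin_span_eq_image:
  assumes "Module.module K V" "S \<subseteq> carrier V"
  shows "lin_span K V S = lin_ext K V (\<lambda>x. x) ` fin_supp K S"
proof -
  interpret V: Module.module K V by fact
  have id: "(\<lambda>x. x) \<in> S \<rightarrow> carrier V" using assms(2) by blast
  show ?thesis
  proof
    show "lin_span K V S \<subseteq> lin_ext K V (\<lambda>x. x) ` fin_supp K S"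
    proof
      fix v assume "v \<in> lin_span K V S"
      then obtain c T where T: "v = lin_comb V c T" "finite T" "T \<subseteq> S" "c \<in> T \<rightarrow> carrier K"
        unfolding lin_span_def by blast
      let ?f = "\<lambda>x. if x \<in> T then c x else \<zero>\<^bsub>K\<^esub>"
      have f: "?f \<in> fin_supp K S" using T by (intro fin_suppI[where S = T]) auto
      have "lin_ext K V (\<lambda>x. x) ?f = (\<Oplus>\<^bsub>V\<^esub>x\<in>T. ?f x \<odot>\<^bsub>V\<^esub> x)"
        using T by (intro lin_ext_superset[OF K assms(1) f id]) auto
      also have "\<dots> = v"
        unfolding T(1) lin_comb_def using T assms(2) by (intro V.M.finsum_cong') auto
      finally show "v \<in> lin_ext K V (\<lambda>x. x) ` fin_supp K S" using f by blast
    qed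
    show "lin_ext K V (\<lambda>x. x) ` fin_supp K S \<subseteq> lin_span K V S"
    proof
      fix v assume "v \<in> lin_ext K V (\<lambda>x. x) ` fin_supp K S"
      then obtain f where f: "f \<in> fin_supp K S" "v = lin_ext K V (\<lambda>x. x) f" by blast
      then have "v = lin_comb V f {x. f x \<noteq> \<zero>\<^bsub>K\<^esub>}" by (simp add: lin_ext_def lin_comb_def)
      moreover have "f \<in> {x. f x \<noteq> \<zero>\<^bsub>K\<^esub>} \<rightarrow> carrier K" using fin_supp_closed[OF f(1)] by blast
      ultimately show "v \<in> lin_span K V S"
        unfolding lin_span_def using fin_supp_finite[OF f(1)] fin_supp_subset[OF f(1)] by blast
    qed
  qed
qed

lemma lin_span_submodule:
  assumes "Module.module K V" "S \<subseteq> carrier V"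
  shows "submodule (lin_span K V S) K V"
proof -
  have "lin_ext K V (\<lambda>x. x) \<in> lin_map K (free_space K S) V"
    using assms by (intro lin_ext_lin_map[OF K]) auto
  from lin_map_image_submodule[OF free_space_module[OF K] assms(1) this]
  show ?thesis by (simp add: lin_span_eq_image[OF assms])
qed

lemma lin_span_superset:
  assumes "Module.module K V" "S \<subseteq> carrier V"
  shows "S \<subseteq> lin_span K V S"
proof
  fix s assume s: "s \<in> S"
  have id: "(\<lambda>x. x) \<in> S \<rightarrow> carrier V" using assms(2) by blast
  have "lin_ext K V (\<lambda>x. x) (delta K s) = s" by (rule lin_ext_delta[OF K assms(1) id s])
  then show "s \<in> lin_span K V S"
    unfolding lin_span_eq_image[OF assms] using s delta_in_fin_supp[OF K, of s S] by (metis imageI)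
qed

lemma lin_map_image_lin_span:
  assumes V: "Module.module K V" and S: "S \<subseteq> carrier V" and f: "f \<in> lin_map K V U"
    and U: "Module.module K U" and W: "submodule W K U" and fS: "\<And>s. s \<in> S \<Longrightarrow> f s \<in> W"
  shows "f ` lin_span K V S \<subseteq> W"
proof -
  interpret U: Module.module K U by fact
  interpret W: submodule W K U by fact
  have id: "(\<lambda>x. x) \<in> S \<rightarrow> carrier V" using S by blast
  define g where "g = (\<lambda>c. f (lin_ext K V (\<lambda>x. x) c))"
  have g: "g \<in> lin_map K (free_space K S) U"
    unfolding g_def by (rule lin_map_comp[OF lin_ext_lin_map[OF K V id] f])
  have "g c \<in> W" if "c \<in> fin_supp K S" for c
    using that
  proof (induction rule: fin_supp_induct[OF K, consumes 1, case_names zero add delta])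
    case zero
    show ?case using lin_map_zero[OF free_space_module[OF K] U g] W.one_closed by simp
  next
    case (add c d)
    then show ?case using lin_map_add[OF g, of c d] W.m_closed[of "g c" "g d"] by simp
  next
    case (delta a s)
    have "g (delta K s) = f s" unfolding g_def by (simp add: lin_ext_delta[OF K V id delta(2)])
    then have "g (\<lambda>y. a \<otimes>\<^bsub>K\<^esub> delta K s y) = a \<odot>\<^bsub>U\<^esub> f s"
      using lin_map_smult[OF g delta(1), of "delta K s"] delta by (simp add: delta_in_fin_supp[OF K])
    then show ?case using W.smult_closed[OF delta(1) fS[OF delta(2)]] by simp
  qed
  then show ?thesis unfolding lin_span_eq_image[OF V S] g_def by blast
qed

end

text \<open>Maps on a quotient are obtained by evaluating \<open>f\<close> at an arbitrarily chosen
  representative; since \<open>f\<close> kills \<open>W\<close>, the choice is immaterial.\<close>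

lemma (in Module.module) quot_class_lift:
  assumes W: "submodule W R M" and U: "Module.module R U" and f: "f \<in> lin_map R M U"
    and zero: "\<And>x. x \<in> W \<Longrightarrow> f x = \<zero>\<^bsub>U\<^esub>" and x: "x \<in> carrier M"
  shows "f (SOME z. z \<in> W +>\<^bsub>M\<^esub> x) = f x"
proof -
  interpret U: Module.module R U by fact
  interpret W: abelian_subgroup W M by (rule submodule_abelian_subgroup[OF W])
  have "(SOME z. z \<in> W +>\<^bsub>M\<^esub> x) \<in> W +>\<^bsub>M\<^esub> x"
    by (rule someI[of "\<lambda>z. z \<in> W +>\<^bsub>M\<^esub> x", OF W.a_rcos_self[OF x]])
  then obtain y where y: "y \<in> W" "(SOME z. z \<in> W +>\<^bsub>M\<^esub> x) = y \<oplus>\<^bsub>M\<^esub> x"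
    by (auto simp: a_r_coset_def')
  show ?thesis unfolding y(2) lin_map_add[OF f W.a_Hcarr[OF y(1)] x]
    using zero[OF y(1)] lin_map_closed[OF f x] by simp
qed

text \<open>The bilinearity defects before the span is taken, separated from
  \<open>tensor_rels\<close> so that the lemmas on spans apply.\<close>

definition tensor_gens :: "('k, 'r) ring_scheme \<Rightarrow> ('k, 'v, 'y) module_scheme \<Rightarrow>
    ('k, 'w, 'z) module_scheme \<Rightarrow> ('v \<times> 'w \<Rightarrow> 'k) set" where
  "tensor_gens K V W = (let F = free_space K (carrier V \<times> carrier W) in
     {delta K (v \<oplus>\<^bsub>V\<^esub> v', w) \<ominus>\<^bsub>F\<^esub> (delta K (v, w) \<oplus>\<^bsub>F\<^esub> delta K (v', w)) | v v' w.
        v \<in> carrier V \<and> v' \<in> carrier V \<and> w \<in> carrier W} \<union>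
     {delta K (v, w \<oplus>\<^bsub>W\<^esub> w') \<ominus>\<^bsub>F\<^esub> (delta K (v, w) \<oplus>\<^bsub>F\<^esub> delta K (v, w')) | v w w'.
        v \<in> carrier V \<and> w \<in> carrier W \<and> w' \<in> carrier W} \<union>
     {delta K (c \<odot>\<^bsub>V\<^esub> v, w) \<ominus>\<^bsub>F\<^esub> (c \<odot>\<^bsub>F\<^esub> delta K (v, w)) | c v w.
        c \<in> carrier K \<and> v \<in> carrier V \<and> w \<in> carrier W} \<union>
     {delta K (v, c \<odot>\<^bsub>W\<^esub> w) \<ominus>\<^bsub>F\<^esub> (c \<odot>\<^bsub>F\<^esub> delta K (v, w)) | c v w.
        c \<in> carrier K \<and> v \<in> carrier V \<and> w \<in> carrier W})"

lemma tensor_rels_eq: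
  "tensor_rels K V W = lin_span K (free_space K (carrier V \<times> carrier W)) (tensor_gens K V W)"
  by (simp only: tensor_rels_def tensor_gens_def Let_def)

section \<open>Tensor products and projective bimodules\<close>

locale tensor_product = K?: field K + V?: Module.module K V + W?: Module.module K W
  for K :: "('k, 'r) ring_scheme" and V :: "('k, 'v, 'y) module_scheme"
    and W :: "('k, 'w, 'z) module_scheme"
begin

abbreviation "VW \<equiv> free_space K (carrier V \<times> carrier W)"
abbreviation "rels \<equiv> tensor_rels K V W"

lemma VW_module: "Module.module K VW"
  by (rule free_space_module[OF K.field_axioms])

lemma delta_in_VW: "\<lbrakk>v \<in> carrier V; w \<in> carrier W\<rbrakk> \<Longrightarrow> delta K (v, w) \<in> carrier VW"
  by (simp add: delta_in_fin_supp[OF K.field_axioms])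

lemma tensor_gens_subset: "tensor_gens K V W \<subseteq> carrier VW"
proof -
  interpret F: Module.module K VW by (rule VW_module)
  show ?thesis
    unfolding tensor_gens_def Let_def
    by (intro Un_least subsetI; clarify;
        intro F.M.minus_closed F.M.a_closed F.smult_closed delta_in_VW V.M.a_closed W.M.a_closed
          V.smult_closed W.smult_closed; assumption)
qed

lemma rels_submodule: "submodule rels K VW"
  unfolding tensor_rels_eq by (rule lin_span_submodule[OF K.field_axioms VW_module tensor_gens_subset])

lemma gens_in_rels:
  shows rel_add_left: "\<lbrakk>v \<in> carrier V; v' \<in> carrier V; w \<in> carrier W\<rbrakk> \<Longrightarrow>
      delta K (v \<oplus>\<^bsub>V\<^esub> v', w) \<ominus>\<^bsub>VW\<^esub> (delta K (v, w) \<oplus>\<^bsub>VW\<^esub> delta K (v', w)) \<in> rels"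
    and rel_add_right: "\<lbrakk>v \<in> carrier V; w \<in> carrier W; w' \<in> carrier W\<rbrakk> \<Longrightarrow>
      delta K (v, w \<oplus>\<^bsub>W\<^esub> w') \<ominus>\<^bsub>VW\<^esub> (delta K (v, w) \<oplus>\<^bsub>VW\<^esub> delta K (v, w')) \<in> rels"
    and rel_smult_left: "\<lbrakk>c \<in> carrier K; v \<in> carrier V; w \<in> carrier W\<rbrakk> \<Longrightarrow>
      delta K (c \<odot>\<^bsub>V\<^esub> v, w) \<ominus>\<^bsub>VW\<^esub> (c \<odot>\<^bsub>VW\<^esub> delta K (v, w)) \<in> rels"
    and rel_smult_right: "\<lbrakk>c \<in> carrier K; v \<in> carrier V; w \<in> carrier W\<rbrakk> \<Longrightarrow>
      delta K (v, c \<odot>\<^bsub>W\<^esub> w) \<ominus>\<^bsub>VW\<^esub> (c \<odot>\<^bsub>VW\<^esub> delta K (v, w)) \<in> rels"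
  by (rule subsetD[OF lin_span_superset[OF K.field_axioms VW_module tensor_gens_subset, folded tensor_rels_eq]];
      unfold tensor_gens_def Let_def; blast)+

text \<open>The relations are spanned by the bilinearity defects, so only the images of these
  matter. The subspace \<open>N\<close> is zero for the universal property and \<open>rels\<close>
  itself for endomorphisms of the tensor product.\<close>

lemma rels_image:
  assumes U: "Module.module K U" and f: "f \<in> lin_map K VW U" and N: "submodule N K U"
    and add_left: "\<And>v v' w. \<lbrakk>v \<in> carrier V; v' \<in> carrier V; w \<in> carrier W\<rbrakk> \<Longrightarrow>
      f (delta K (v \<oplus>\<^bsub>V\<^esub> v', w)) \<ominus>\<^bsub>U\<^esub> (f (delta K (v, w)) \<oplus>\<^bsub>U\<^esub> f (delta K (v', w))) \<in> N"
    and add_right: "\<And>v w w'. \<lbrakk>v \<in> carrier V; w \<in> carrier W; w' \<in> carrier W\<rbrakk> \<Longrightarrow>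
      f (delta K (v, w \<oplus>\<^bsub>W\<^esub> w')) \<ominus>\<^bsub>U\<^esub> (f (delta K (v, w)) \<oplus>\<^bsub>U\<^esub> f (delta K (v, w'))) \<in> N"
    and smult_left: "\<And>c v w. \<lbrakk>c \<in> carrier K; v \<in> carrier V; w \<in> carrier W\<rbrakk> \<Longrightarrow>
      f (delta K (c \<odot>\<^bsub>V\<^esub> v, w)) \<ominus>\<^bsub>U\<^esub> (c \<odot>\<^bsub>U\<^esub> f (delta K (v, w))) \<in> N"
    and smult_right: "\<And>c v w. \<lbrakk>c \<in> carrier K; v \<in> carrier V; w \<in> carrier W\<rbrakk> \<Longrightarrow>
      f (delta K (v, c \<odot>\<^bsub>W\<^esub> w)) \<ominus>\<^bsub>U\<^esub> (c \<odot>\<^bsub>U\<^esub> f (delta K (v, w))) \<in> N"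
  shows "f ` rels \<subseteq> N"
  unfolding tensor_rels_eq
proof (rule lin_map_image_lin_span[OF K.field_axioms VW_module tensor_gens_subset f U N])
  interpret F: Module.module K VW by (rule VW_module)
  note m = lin_map_minus[OF VW_module U f] and a = lin_map_add[OF f] and s = lin_map_smult[OF f] and d = delta_in_VW
  have 1: "f (delta K (v \<oplus>\<^bsub>V\<^esub> v', w) \<ominus>\<^bsub>VW\<^esub> (delta K (v, w) \<oplus>\<^bsub>VW\<^esub> delta K (v', w))) \<in> N"
    if "v \<in> carrier V" "v' \<in> carrier V" "w \<in> carrier W" for v v' w
    using add_left[OF that] that
    by (simp only: m[OF d F.M.a_closed[OF d d]] a[OF d d] V.M.a_closed)
  have 2: "f (delta K (v, w \<oplus>\<^bsub>W\<^esub> w') \<ominus>\<^bsub>VW\<^esub> (delta K (v, w) \<oplus>\<^bsub>VW\<^esub> delta K (v, w'))) \<in> N"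
    if "v \<in> carrier V" "w \<in> carrier W" "w' \<in> carrier W" for v w w'
    using add_right[OF that] that
    by (simp only: m[OF d F.M.a_closed[OF d d]] a[OF d d] W.M.a_closed)
  have 3: "f (delta K (c \<odot>\<^bsub>V\<^esub> v, w) \<ominus>\<^bsub>VW\<^esub> (c \<odot>\<^bsub>VW\<^esub> delta K (v, w))) \<in> N"
    if "c \<in> carrier K" "v \<in> carrier V" "w \<in> carrier W" for c v w
    using smult_left[OF that] that
    by (simp only: m[OF d F.smult_closed[OF _ d]] s[OF _ d] V.smult_closed)
  have 4: "f (delta K (v, c \<odot>\<^bsub>W\<^esub> w) \<ominus>\<^bsub>VW\<^esub> (c \<odot>\<^bsub>VW\<^esub> delta K (v, w))) \<in> N"
    if "c \<in> carrier K" "v \<in> carrier V" "w \<in> carrier W" for c v w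
    using smult_right[OF that] that
    by (simp only: m[OF d F.smult_closed[OF _ d]] s[OF _ d] W.smult_closed)
  fix x assume "x \<in> tensor_gens K V W"
  then show "f x \<in> N"
    unfolding tensor_gens_def Let_def
    by (elim UnE CollectE exE conjE) (simp_all only: 1 2 3 4)
qed

definition bilinear :: "('k, 'u, 'x) module_scheme \<Rightarrow> ('v \<Rightarrow> 'w \<Rightarrow> 'u) \<Rightarrow> bool" where
  "bilinear U \<tau> \<longleftrightarrow> (\<forall>v\<in>carrier V. \<tau> v \<in> lin_map K W U) \<and> (\<forall>w\<in>carrier W. (\<lambda>v. \<tau> v w) \<in> lin_map K V U)"

lemma bilinear_vanishes_on_rels:
  assumes U: "Module.module K U" and \<tau>: "bilinear U \<tau>" and x: "x \<in> rels"
  shows "lin_ext K U (\<lambda>(v, w). \<tau> v w) x = \<zero>\<^bsub>U\<^esub>"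
proof -
  interpret U: Module.module K U by fact
  let ?f = "lin_ext K U (\<lambda>(v, w). \<tau> v w)"
  have r: "\<tau> v \<in> lin_map K W U" if "v \<in> carrier V" for v using \<tau> that by (simp add: bilinear_def)
  have l: "(\<lambda>v. \<tau> v w) \<in> lin_map K V U" if "w \<in> carrier W" for w using \<tau> that by (simp add: bilinear_def)
  have c: "\<tau> v w \<in> carrier U" if "v \<in> carrier V" "w \<in> carrier W" for v w
    by (rule lin_map_closed[OF r[OF that(1)] that(2)])
  have t: "(\<lambda>(v, w). \<tau> v w) \<in> carrier V \<times> carrier W \<rightarrow> carrier U" using c by auto
  have fd: "?f (delta K (v, w)) = \<tau> v w" if "v \<in> carrier V" "w \<in> carrier W" for v w
    using lin_ext_delta[OF K.field_axioms U t, of "(v, w)"] that by simp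
  have z: "submodule {\<zero>\<^bsub>U\<^esub>} K U" by (rule U.submoduleI) auto
  have "?f ` rels \<subseteq> {\<zero>\<^bsub>U\<^esub>}"
    by (rule rels_image[OF U lin_ext_lin_map[OF K.field_axioms U t] z])
      (simp_all add: fd c lin_map_add[OF r] lin_map_add[OF l] lin_map_smult[OF r] lin_map_smult[OF l]
        U.M.minus_eq U.M.r_neg)
  then show ?thesis using x by blast
qed

text \<open>This is \<open>\<alpha> \<otimes> \<beta>\<close> on the level of representatives. With
  one of the maps the identity it makes the left and the right action well defined.\<close>

lemma push_rels:
  assumes \<alpha>: "\<alpha> \<in> lin_map K V V" and \<beta>: "\<beta> \<in> lin_map K W W"
  defines "p \<equiv> push K (\<lambda>(v, w). (\<alpha> v, \<beta> w))"
  shows "p \<in> lin_map K VW VW" "p ` rels \<subseteq> rels"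
proof -
  note a = lin_map_closed[OF \<alpha>] and b = lin_map_closed[OF \<beta>]
  show p: "p \<in> lin_map K VW VW"
    unfolding p_def by (rule push_lin_map[OF K.field_axioms]) (auto simp: a b)
  have d: "p (delta K (v, w)) = delta K (\<alpha> v, \<beta> w)" for v w
    unfolding p_def push_delta[OF K.field_axioms] by simp
  show "p ` rels \<subseteq> rels"
    by (rule rels_image[OF VW_module p rels_submodule]; unfold d;
        simp only: lin_map_add[OF \<alpha>] lin_map_add[OF \<beta>] lin_map_smult[OF \<alpha>] lin_map_smult[OF \<beta>];
        intro gens_in_rels a b; assumption)
qed

end

section \<open>Direct sums of bimodules Bg \<otimes> eA\<close>

lemma (in k_algebra) left_multiples_module:
  assumes "g \<in> carrier A"
  shows "Module.module K (A\<lparr>carrier := {b \<otimes>\<^bsub>A\<^esub> g | b. b \<in> carrier A}\<rparr>)"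
proof -
  have "{b \<otimes>\<^bsub>A\<^esub> g | b. b \<in> carrier A} = (\<lambda>b. b \<otimes>\<^bsub>A\<^esub> g) ` carrier A" by blast
  then have "submodule {b \<otimes>\<^bsub>A\<^esub> g | b. b \<in> carrier A} K A"
    using lin_map_image_submodule[OF module_axioms module_axioms lin_map_mult_left[OF assms]] by simp
  then show ?thesis by (rule submodule.submodule_is_module[OF _ module_axioms])
qed

lemma (in k_algebra) right_multiples_module:
  assumes "e \<in> carrier A"
  shows "Module.module K (A\<lparr>carrier := {e \<otimes>\<^bsub>A\<^esub> a | a. a \<in> carrier A}\<rparr>)"
proof -
  have "{e \<otimes>\<^bsub>A\<^esub> a | a. a \<in> carrier A} = (\<lambda>a. e \<otimes>\<^bsub>A\<^esub> a) ` carrier A" by blast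
  then have "submodule {e \<otimes>\<^bsub>A\<^esub> a | a. a \<in> carrier A} K A"
    using lin_map_image_submodule[OF module_axioms module_axioms lin_map_mult_right[OF assms]] by simp
  then show ?thesis by (rule submodule.submodule_is_module[OF _ module_axioms])
qed

text \<open>Fixing the isomorphism \<open>h\<close> makes generators of \<open>M\<close> available.
  The locale serves for \<open>M\<close> and, with the two algebras exchanged, for
  \<open>N\<close>.\<close>

locale proj_bimodule = k_bimodule K B A M
  for K :: "('k, 'r) ring_scheme" and B :: "('k, 'b, 'y) module_scheme"
    and A :: "('k, 'a, 'z) module_scheme" and M :: "('k, 'b, 'a, 'm) bimod" +
  fixes F :: "'b set" and E :: "'a set" and m :: "'b \<Rightarrow> 'a \<Rightarrow> nat"
    and h :: "'m \<Rightarrow> 'b \<times> 'a \<times> nat \<Rightarrow> ('b \<times> 'a \<Rightarrow> 'k) set"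
  assumes finite_F: "finite F" and finite_E: "finite E"
    and F_idem: "g \<in> F \<Longrightarrow> idempotent B g" and E_idem: "e \<in> E \<Longrightarrow> idempotent A e"
    and h_bij: "bij_betw h (carrier M) (carrier (proj_sum K B A F E m))"
    and h_lin: "h \<in> lin_map K M (proj_sum K B A F E m)"
    and h_lact: "\<lbrakk>b \<in> carrier B; x \<in> carrier M\<rbrakk> \<Longrightarrow> h (lact M b x) = lact (proj_sum K B A F E m) b (h x)"
    and h_ract: "\<lbrakk>x \<in> carrier M; a \<in> carrier A\<rbrakk> \<Longrightarrow> h (ract M x a) = ract (proj_sum K B A F E m) (h x) a"
begin

abbreviation "Bg u \<equiv> B\<lparr>carrier := {b \<otimes>\<^bsub>B\<^esub> fst u | b. b \<in> carrier B}\<rparr>"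
abbreviation "eA u \<equiv> A\<lparr>carrier := {fst (snd u) \<otimes>\<^bsub>A\<^esub> a | a. a \<in> carrier A}\<rparr>"
abbreviation "BA u \<equiv> free_space K (carrier (Bg u) \<times> carrier (eA u))"
abbreviation "T u \<equiv> tensor_rels K (Bg u) (eA u)"
abbreviation "pb u \<equiv> proj_bimod K B A (fst u) (fst (snd u))"
abbreviation "PS \<equiv> proj_sum K B A F E m"

definition summands :: "('b \<times> 'a \<times> nat) set" where
  "summands = {(g, e, i). g \<in> F \<and> e \<in> E \<and> i < m g e}"

lemma summandsD:
  assumes "u \<in> summands"
  shows "fst u \<in> carrier B" "fst u \<otimes>\<^bsub>B\<^esub> fst u = fst u"
    "fst (snd u) \<in> carrier A" "fst (snd u) \<otimes>\<^bsub>A\<^esub> fst (snd u) = fst (snd u)"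
  using assms F_idem E_idem by (auto simp: summands_def idempotent_def)

lemma finite_summands: "finite summands"
proof -
  have "summands \<subseteq> F \<times> E \<times> (\<Union>g\<in>F. \<Union>e\<in>E. {..<m g e})" by (auto simp: summands_def)
  then show ?thesis by (rule finite_subset) (use finite_F finite_E in auto)
qed

lemma tensor:
  assumes "u \<in> summands"
  shows "tensor_product K (Bg u) (eA u)"
  by (intro tensor_product.intro B.K.field_axioms B.left_multiples_module A.right_multiples_module
      summandsD[OF assms])

lemma pb_simps:
  "carrier (pb u) = carrier (quot_mod (BA u) (T u))" "add (pb u) = add (quot_mod (BA u) (T u))"
  "zero (pb u) = zero (quot_mod (BA u) (T u))" "smult (pb u) = smult (quot_mod (BA u) (T u))"
  "lact (pb u) = (\<lambda>b X. \<Union>f\<in>X. T u +>\<^bsub>BA u\<^esub> push K (\<lambda>(x, y). (b \<otimes>\<^bsub>B\<^esub> x, y)) f)"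
  "ract (pb u) = (\<lambda>X a. \<Union>f\<in>X. T u +>\<^bsub>BA u\<^esub> push K (\<lambda>(x, y). (x, y \<otimes>\<^bsub>A\<^esub> a)) f)"
  by (simp_all only: proj_bimod_def Let_def tensor_def module.extend_def bimod.fields_def
      bimod.simps module.simps ring.simps monoid.simps partial_object.simps)

text \<open>There are finitely many summands, which makes the finiteness condition of the direct sum
  vacuous and the carrier a full product.\<close>

lemma PS_simps:
  "carrier PS = (\<Pi>\<^sub>E u\<in>summands. carrier (pb u))" "zero PS = (\<lambda>u\<in>summands. \<zero>\<^bsub>pb u\<^esub>)"
  "add PS = (\<lambda>s t. \<lambda>u\<in>summands. s u \<oplus>\<^bsub>pb u\<^esub> t u)" "smult PS = (\<lambda>c s. \<lambda>u\<in>summands. c \<odot>\<^bsub>pb u\<^esub> s u)"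
  "lact PS = (\<lambda>b s. \<lambda>u\<in>summands. lact (pb u) b (s u))" "ract PS = (\<lambda>s a. \<lambda>u\<in>summands. ract (pb u) (s u) a)"
proof -
  have *: "(\<lambda>(g, e, i). proj_bimod K B A g e) = pb" by (simp add: fun_eq_iff)
  have **: "PS = bimod_direct_sum summands pb" unfolding proj_sum_def summands_def * ..
  have "finite {u \<in> summands. P u}" for P using finite_summands by simp
  then show "carrier PS = (\<Pi>\<^sub>E u\<in>summands. carrier (pb u))"
    unfolding ** bimod_direct_sum_def by simp
  show "zero PS = (\<lambda>u\<in>summands. \<zero>\<^bsub>pb u\<^esub>)"
    "add PS = (\<lambda>s t. \<lambda>u\<in>summands. s u \<oplus>\<^bsub>pb u\<^esub> t u)" "smult PS = (\<lambda>c s. \<lambda>u\<in>summands. c \<odot>\<^bsub>pb u\<^esub> s u)"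
    "lact PS = (\<lambda>b s. \<lambda>u\<in>summands. lact (pb u) b (s u))" "ract PS = (\<lambda>s a. \<lambda>u\<in>summands. ract (pb u) (s u) a)"
    unfolding ** bimod_direct_sum_def by simp_all
qed

lemma quot_mod_module':
  assumes "u \<in> summands"
  shows "Module.module K (quot_mod (BA u) (T u))"
  by (rule module.quot_mod_module[OF tensor_product.VW_module[OF tensor[OF assms]]
      tensor_product.rels_submodule[OF tensor[OF assms]]])

lemma pb_module:
  assumes "u \<in> summands"
  shows "Module.module K (pb u)"
proof (rule module_surj_image[OF quot_mod_module'[OF assms]])
  show "(\<lambda>x. x) \<in> lin_map K (quot_mod (BA u) (T u)) (pb u)"
    unfolding lin_map_def pb_simps by blast
  show "(\<lambda>x. x) ` carrier (quot_mod (BA u) (T u)) = carrier (pb u)" unfolding pb_simps by simp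
qed (simp only: pb_simps)

definition cls :: "'b \<times> 'a \<times> nat \<Rightarrow> ('b \<times> 'a \<Rightarrow> 'k) \<Rightarrow> ('b \<times> 'a \<Rightarrow> 'k) set" where
  "cls u f = T u +>\<^bsub>BA u\<^esub> f"

lemma cls:
  assumes "u \<in> summands"
  shows cls_lin_map: "cls u \<in> lin_map K (BA u) (pb u)"
    and cls_surj: "cls u ` carrier (BA u) = carrier (pb u)"
    and cls_zero: "cls u \<zero>\<^bsub>BA u\<^esub> = \<zero>\<^bsub>pb u\<^esub>"
proof -
  interpret T: tensor_product K "Bg u" "eA u" by (rule tensor[OF assms])
  note q = module.quot_class[OF T.VW_module T.rels_submodule]
  show "cls u \<in> lin_map K (BA u) (pb u)"
    using q(1) unfolding lin_map_def pb_simps cls_def .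
  show "cls u ` carrier (BA u) = carrier (pb u)" using q(2) unfolding pb_simps cls_def .
  show "cls u \<zero>\<^bsub>BA u\<^esub> = \<zero>\<^bsub>pb u\<^esub>" using q(3) unfolding pb_simps cls_def by simp
qed

lemma left_mult_lin_map:
  assumes u: "u \<in> summands" and b: "b \<in> carrier B"
  shows "(\<lambda>x. b \<otimes>\<^bsub>B\<^esub> x) \<in> lin_map K (Bg u) (Bg u)"
proof (rule lin_mapI)
  fix x assume "x \<in> carrier (Bg u)"
  then obtain b' where b': "b' \<in> carrier B" "x = b' \<otimes>\<^bsub>B\<^esub> fst u" by auto
  have xB: "x \<in> carrier B" using b' summandsD[OF u] by simp
  have "b \<otimes>\<^bsub>B\<^esub> x = (b \<otimes>\<^bsub>B\<^esub> b') \<otimes>\<^bsub>B\<^esub> fst u" using b b' summandsD[OF u] by (simp add: B.A.m_assoc)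
  then show "b \<otimes>\<^bsub>B\<^esub> x \<in> carrier (Bg u)" using b b' by auto
  show "b \<otimes>\<^bsub>B\<^esub> (c \<odot>\<^bsub>Bg u\<^esub> x) = c \<odot>\<^bsub>Bg u\<^esub> (b \<otimes>\<^bsub>B\<^esub> x)" if "c \<in> carrier K" for c
    using that b xB by (simp add: B.smult_mult_right)
  fix y assume "y \<in> carrier (Bg u)"
  then have "y \<in> carrier B" using summandsD[OF u] by auto
  then show "b \<otimes>\<^bsub>B\<^esub> (x \<oplus>\<^bsub>Bg u\<^esub> y) = b \<otimes>\<^bsub>B\<^esub> x \<oplus>\<^bsub>Bg u\<^esub> b \<otimes>\<^bsub>B\<^esub> y"
    using b xB by (simp add: B.A.r_distr)
qed

lemma right_mult_lin_map:
  assumes u: "u \<in> summands" and a: "a \<in> carrier A"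
  shows "(\<lambda>x. x \<otimes>\<^bsub>A\<^esub> a) \<in> lin_map K (eA u) (eA u)"
proof (rule lin_mapI)
  fix x assume "x \<in> carrier (eA u)"
  then obtain a' where a': "a' \<in> carrier A" "x = fst (snd u) \<otimes>\<^bsub>A\<^esub> a'" by auto
  have xA: "x \<in> carrier A" using a' summandsD[OF u] by simp
  have "x \<otimes>\<^bsub>A\<^esub> a = fst (snd u) \<otimes>\<^bsub>A\<^esub> (a' \<otimes>\<^bsub>A\<^esub> a)" using a a' summandsD[OF u] by (simp add: A.A.m_assoc)
  then show "x \<otimes>\<^bsub>A\<^esub> a \<in> carrier (eA u)" using a a' by auto
  show "(c \<odot>\<^bsub>eA u\<^esub> x) \<otimes>\<^bsub>A\<^esub> a = c \<odot>\<^bsub>eA u\<^esub> (x \<otimes>\<^bsub>A\<^esub> a)" if "c \<in> carrier K" for c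
    using that a xA by (simp add: A.smult_mult_left)
  fix y assume "y \<in> carrier (eA u)"
  then have "y \<in> carrier A" using summandsD[OF u] by auto
  then show "(x \<oplus>\<^bsub>eA u\<^esub> y) \<otimes>\<^bsub>A\<^esub> a = x \<otimes>\<^bsub>A\<^esub> a \<oplus>\<^bsub>eA u\<^esub> y \<otimes>\<^bsub>A\<^esub> a"
    using a xA by (simp add: A.A.l_distr)
qed

lemma id_lin_map: "(\<lambda>x. x) \<in> lin_map K V V"
  by (simp add: lin_map_def)

text \<open>The action is a union over representatives. It collapses to one class since
  multiplication by \<open>b\<close> on the first tensor factor preserves the bilinearity
  relations.\<close>

lemma pb_lact:
  assumes u: "u \<in> summands" and b: "b \<in> carrier B"
  shows pb_lact_cls: "f \<in> carrier (BA u) \<Longrightarrow> lact (pb u) b (cls u f) = cls u (push K (\<lambda>(x, y). (b \<otimes>\<^bsub>B\<^esub> x, y)) f)"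
    and pb_lact_zero: "lact (pb u) b \<zero>\<^bsub>pb u\<^esub> = \<zero>\<^bsub>pb u\<^esub>"
proof -
  interpret T: tensor_product K "Bg u" "eA u" by (rule tensor[OF u])
  interpret BA: Module.module K "BA u" by (rule T.VW_module)
  note p = T.push_rels[OF left_mult_lin_map[OF u b] id_lin_map]
  show *: "lact (pb u) b (cls u f) = cls u (push K (\<lambda>(x, y). (b \<otimes>\<^bsub>B\<^esub> x, y)) f)" if "f \<in> carrier (BA u)" for f
    unfolding pb_simps cls_def by (rule BA.quot_class_image[OF T.rels_submodule that p])
  show "lact (pb u) b \<zero>\<^bsub>pb u\<^esub> = \<zero>\<^bsub>pb u\<^esub>"
    using *[OF BA.M.zero_closed] unfolding cls_zero[OF u] lin_map_zero[OF T.VW_module T.VW_module p(1)] .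
qed

lemma pb_ract:
  assumes u: "u \<in> summands" and a: "a \<in> carrier A"
  shows pb_ract_cls: "f \<in> carrier (BA u) \<Longrightarrow> ract (pb u) (cls u f) a = cls u (push K (\<lambda>(x, y). (x, y \<otimes>\<^bsub>A\<^esub> a)) f)"
    and pb_ract_zero: "ract (pb u) \<zero>\<^bsub>pb u\<^esub> a = \<zero>\<^bsub>pb u\<^esub>"
proof -
  interpret T: tensor_product K "Bg u" "eA u" by (rule tensor[OF u])
  interpret BA: Module.module K "BA u" by (rule T.VW_module)
  note p = T.push_rels[OF id_lin_map right_mult_lin_map[OF u a]]
  show *: "ract (pb u) (cls u f) a = cls u (push K (\<lambda>(x, y). (x, y \<otimes>\<^bsub>A\<^esub> a)) f)" if "f \<in> carrier (BA u)" for f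
    unfolding pb_simps cls_def by (rule BA.quot_class_image[OF T.rels_submodule that p])
  show "ract (pb u) \<zero>\<^bsub>pb u\<^esub> a = \<zero>\<^bsub>pb u\<^esub>"
    using *[OF BA.M.zero_closed] unfolding cls_zero[OF u] lin_map_zero[OF T.VW_module T.VW_module p(1)] .
qed

text \<open>The target is not yet known to be a module, so additivity does not give this; instead
  the scalar zero annihilates every component. Afterwards the module structure of \<open>PS\<close>
  is transported from \<open>M\<close> along \<open>h\<close>.\<close>

lemma h_zero: "h \<zero>\<^bsub>M\<^esub> = \<zero>\<^bsub>PS\<^esub>"
proof -
  have h0: "h \<zero>\<^bsub>M\<^esub> \<in> carrier PS" by (rule lin_map_closed[OF h_lin M.M.zero_closed])
  have "h \<zero>\<^bsub>M\<^esub> = h (\<zero>\<^bsub>K\<^esub> \<odot>\<^bsub>M\<^esub> \<zero>\<^bsub>M\<^esub>)" by simp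
  also have "\<dots> = \<zero>\<^bsub>K\<^esub> \<odot>\<^bsub>PS\<^esub> h \<zero>\<^bsub>M\<^esub>"
    by (rule lin_map_smult[OF h_lin]) simp_all
  also have "\<dots> = \<zero>\<^bsub>PS\<^esub>"
    unfolding PS_simps
    by (rule restrict_ext)
      (rule Module.module.smult_l_null[OF pb_module PiE_mem[OF h0[unfolded PS_simps]]])
  finally show ?thesis .
qed

lemma PS_module: "Module.module K PS"
  by (rule module_surj_image[OF M.module_axioms bij_betw_imp_surj_on[OF h_bij] h_zero h_lin])

definition hinv :: "('b \<times> 'a \<times> nat \<Rightarrow> ('b \<times> 'a \<Rightarrow> 'k) set) \<Rightarrow> 'm" where
  "hinv = inv_into (carrier M) h"

lemma h_hinv: "s \<in> carrier PS \<Longrightarrow> h (hinv s) = s"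
  unfolding hinv_def by (rule bij_betw_inv_into_right[OF h_bij])

lemma hinv_h: "x \<in> carrier M \<Longrightarrow> hinv (h x) = x"
  unfolding hinv_def by (rule bij_betw_inv_into_left[OF h_bij])

lemma hinv_closed: "s \<in> carrier PS \<Longrightarrow> hinv s \<in> carrier M"
  unfolding hinv_def using bij_betw_imp_surj_on[OF h_bij] by (metis inv_into_into)

lemma hinv_eqI: "\<lbrakk>x \<in> carrier M; h x = s\<rbrakk> \<Longrightarrow> hinv s = x"
  using hinv_h by blast

lemma hinv_lin_map: "hinv \<in> lin_map K PS M"
  by (rule lin_mapI; (rule hinv_eqI)?)
    (simp_all add: hinv_closed lin_map_add[OF h_lin] lin_map_smult[OF h_lin] h_hinv)

definition single where
  "single u Y = (\<lambda>v\<in>summands. if v = u then Y else \<zero>\<^bsub>pb v\<^esub>)"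

lemma single_lin_map:
  assumes u: "u \<in> summands"
  shows "single u \<in> lin_map K (pb u) PS"
proof (rule lin_mapI)
  have z: "\<zero>\<^bsub>pb v\<^esub> \<in> carrier (pb v)" "\<zero>\<^bsub>pb v\<^esub> \<oplus>\<^bsub>pb v\<^esub> \<zero>\<^bsub>pb v\<^esub> = \<zero>\<^bsub>pb v\<^esub>"
    "c \<in> carrier K \<Longrightarrow> c \<odot>\<^bsub>pb v\<^esub> \<zero>\<^bsub>pb v\<^esub> = \<zero>\<^bsub>pb v\<^esub>" if "v \<in> summands" for v c
  proof -
    interpret P: Module.module K "pb v" by (rule pb_module[OF that])
    show "\<zero>\<^bsub>pb v\<^esub> \<in> carrier (pb v)" "\<zero>\<^bsub>pb v\<^esub> \<oplus>\<^bsub>pb v\<^esub> \<zero>\<^bsub>pb v\<^esub> = \<zero>\<^bsub>pb v\<^esub>" by simp_all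
    show "c \<in> carrier K \<Longrightarrow> c \<odot>\<^bsub>pb v\<^esub> \<zero>\<^bsub>pb v\<^esub> = \<zero>\<^bsub>pb v\<^esub>" by (rule P.smult_r_null)
  qed
  show "single u X \<in> carrier PS" if "X \<in> carrier (pb u)" for X
    using that z(1) unfolding PS_simps single_def by (intro restrict_PiE_iff[THEN iffD2] ballI) simp
  show "single u (X \<oplus>\<^bsub>pb u\<^esub> Y) = single u X \<oplus>\<^bsub>PS\<^esub> single u Y" for X Y
    unfolding PS_simps single_def by (rule restrict_ext) (simp add: z(2))
  show "single u (c \<odot>\<^bsub>pb u\<^esub> X) = c \<odot>\<^bsub>PS\<^esub> single u X" if "c \<in> carrier K" for c X
    unfolding PS_simps single_def by (rule restrict_ext) (simp add: z(3) that)
qed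

text \<open>The inclusion of the summand \<open>u\<close> into \<open>M\<close>, precomposed with
  the passage from representatives to tensors. Working with representatives gives access to
  \<open>fin_supp_induct\<close>.\<close>

definition \<kappa> :: "'b \<times> 'a \<times> nat \<Rightarrow> ('b \<times> 'a \<Rightarrow> 'k) \<Rightarrow> 'm" where
  "\<kappa> u f = hinv (single u (cls u f))"

text \<open>The element \<open>g \<otimes> e\<close> of the summand \<open>u\<close>, transported to
  \<open>M\<close>. It becomes the image of the new arrow with index \<open>u\<close>.\<close>

definition gen :: "'b \<times> 'a \<times> nat \<Rightarrow> 'm" where
  "gen u = \<kappa> u (delta K (fst u, fst (snd u)))"

lemma \<kappa>_lin_map: "u \<in> summands \<Longrightarrow> \<kappa> u \<in> lin_map K (BA u) M"
  unfolding \<kappa>_def by (rule lin_map_comp[OF lin_map_comp[OF cls_lin_map single_lin_map] hinv_lin_map])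

lemma single_closed: "\<lbrakk>u \<in> summands; f \<in> carrier (BA u)\<rbrakk> \<Longrightarrow> single u (cls u f) \<in> carrier PS"
  by (rule lin_map_closed[OF single_lin_map lin_map_closed[OF cls_lin_map]])

lemma \<kappa>_lact:
  assumes u: "u \<in> summands" and b: "b \<in> carrier B" and f: "f \<in> carrier (BA u)"
  shows "lact M b (\<kappa> u f) = \<kappa> u (push K (\<lambda>(x, y). (b \<otimes>\<^bsub>B\<^esub> x, y)) f)"
proof -
  have s: "single u (cls u f) \<in> carrier PS" by (rule single_closed[OF u f])
  have "h (lact M b (\<kappa> u f)) = lact PS b (single u (cls u f))"
    unfolding \<kappa>_def by (simp add: h_lact[OF b hinv_closed[OF s]] h_hinv[OF s])
  also have "\<dots> = single u (cls u (push K (\<lambda>(x, y). (b \<otimes>\<^bsub>B\<^esub> x, y)) f))"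
    unfolding PS_simps single_def
    by (rule restrict_ext) (simp add: pb_lact_cls[OF u b f] pb_lact_zero[OF _ b] del: free_space_simps)
  finally show ?thesis
    unfolding \<kappa>_def by (intro hinv_eqI[symmetric] lact_closed[OF b] hinv_closed[OF s])
qed

lemma \<kappa>_ract:
  assumes u: "u \<in> summands" and a: "a \<in> carrier A" and f: "f \<in> carrier (BA u)"
  shows "ract M (\<kappa> u f) a = \<kappa> u (push K (\<lambda>(x, y). (x, y \<otimes>\<^bsub>A\<^esub> a)) f)"
proof -
  have s: "single u (cls u f) \<in> carrier PS" by (rule single_closed[OF u f])
  have "h (ract M (\<kappa> u f) a) = ract PS (single u (cls u f)) a"
    unfolding \<kappa>_def by (simp add: h_ract[OF hinv_closed[OF s] a] h_hinv[OF s])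
  also have "\<dots> = single u (cls u (push K (\<lambda>(x, y). (x, y \<otimes>\<^bsub>A\<^esub> a)) f))"
    unfolding PS_simps single_def
    by (rule restrict_ext) (simp add: pb_ract_cls[OF u a f] pb_ract_zero[OF _ a] del: free_space_simps)
  finally show ?thesis
    unfolding \<kappa>_def by (intro hinv_eqI[symmetric] ract_closed[OF _ a] hinv_closed[OF s])
qed

lemma delta_in_BA:
  assumes u: "u \<in> summands" and "b \<in> carrier B" "a \<in> carrier A"
  shows "delta K (b \<otimes>\<^bsub>B\<^esub> fst u, fst (snd u) \<otimes>\<^bsub>A\<^esub> a) \<in> carrier (BA u)"
  using assms by (intro tensor_product.delta_in_VW[OF tensor[OF u]]) auto

lemma gen_delta_in_BA: "u \<in> summands \<Longrightarrow> delta K (fst u, fst (snd u)) \<in> carrier (BA u)"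
  using delta_in_BA[of u "fst u" "fst (snd u)"] by (simp add: summandsD)

lemma gen_closed: "u \<in> summands \<Longrightarrow> gen u \<in> carrier M"
  unfolding gen_def by (rule lin_map_closed[OF \<kappa>_lin_map gen_delta_in_BA])

text \<open>Both actions push a representative forward. Consequently every pure tensor of the
  summand \<open>u\<close> is a two-sided multiple of \<open>gen u\<close>.\<close>

lemma act_gen:
  assumes u: "u \<in> summands" and b: "b \<in> carrier B" and a: "a \<in> carrier A"
  shows "ract M (lact M b (gen u)) a = \<kappa> u (delta K (b \<otimes>\<^bsub>B\<^esub> fst u, fst (snd u) \<otimes>\<^bsub>A\<^esub> a))"
proof -
  have d: "delta K (b \<otimes>\<^bsub>B\<^esub> fst u, fst (snd u)) \<in> carrier (BA u)"
    using delta_in_BA[OF u b, of "fst (snd u)"] by (simp add: summandsD[OF u])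
  have "lact M b (gen u) = \<kappa> u (delta K (b \<otimes>\<^bsub>B\<^esub> fst u, fst (snd u)))"
    unfolding gen_def \<kappa>_lact[OF u b gen_delta_in_BA[OF u]] by (simp add: push_delta[OF B.K.field_axioms])
  then show ?thesis by (simp add: \<kappa>_ract[OF u a d] push_delta[OF B.K.field_axioms])
qed

lemma gen_ends:
  assumes u: "u \<in> summands"
  shows "lact M (fst u) (gen u) = gen u" "ract M (gen u) (fst (snd u)) = gen u"
  unfolding gen_def \<kappa>_lact[OF u summandsD(1)[OF u] gen_delta_in_BA[OF u]]
    \<kappa>_ract[OF u summandsD(3)[OF u] gen_delta_in_BA[OF u]]
  by (simp_all add: push_delta[OF B.K.field_axioms] summandsD[OF u])

text \<open>Scalars have no case of their own because they are absorbed into \<open>b\<close>, so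
  the elements \<open>b (gen u) a\<close> generate \<open>M\<close> already as an additive group.
  Two inductions are combined: over representatives within one summand, and over a growing set of
  summands.\<close>

lemma gen_induct [consumes 1, case_names zero add gen]:
  assumes x: "x \<in> carrier M"
    and zero: "P \<zero>\<^bsub>M\<^esub>"
    and add: "\<And>x y. \<lbrakk>x \<in> carrier M; y \<in> carrier M; P x; P y\<rbrakk> \<Longrightarrow> P (x \<oplus>\<^bsub>M\<^esub> y)"
    and gen: "\<And>u b a. \<lbrakk>u \<in> summands; b \<in> carrier B; a \<in> carrier A\<rbrakk> \<Longrightarrow> P (ract M (lact M b (gen u)) a)"
  shows "P x"
proof -
  have \<kappa>: "P (\<kappa> u f)" if u: "u \<in> summands" and f: "f \<in> carrier (BA u)" for u f
    using f[unfolded free_space_simps]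
  proof (induction rule: fin_supp_induct[OF B.K.field_axioms, consumes 1, case_names zero add delta])
    case zero
    show ?case
      using lin_map_zero[OF free_space_module[OF B.K.field_axioms] M.module_axioms \<kappa>_lin_map[OF u]] assms(2) by simp
  next
    case (add f g)
    then show ?case
      using lin_map_add[OF \<kappa>_lin_map[OF u], of f g] lin_map_closed[OF \<kappa>_lin_map[OF u]] assms(3) by simp
  next
    case (delta c q)
    then obtain b a where ba: "b \<in> carrier B" "a \<in> carrier A" "q = (b \<otimes>\<^bsub>B\<^esub> fst u, fst (snd u) \<otimes>\<^bsub>A\<^esub> a)" by auto
    have "\<kappa> u (\<lambda>y. c \<otimes>\<^bsub>K\<^esub> delta K q y) = c \<odot>\<^bsub>M\<^esub> ract M (lact M b (gen u)) a"
      using lin_map_smult[OF \<kappa>_lin_map[OF u] delta(1) delta_in_BA[OF u ba(1,2)]]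
      unfolding act_gen[OF u ba(1,2)] ba(3) by simp
    also have "\<dots> = ract M (lact M (c \<odot>\<^bsub>B\<^esub> b) (gen u)) a"
      using delta(1) ba gen_closed[OF u] by (simp add: lact_smult_left ract_smult_left lact_closed)
    finally show ?case using assms(4)[OF u _ ba(2), of "c \<odot>\<^bsub>B\<^esub> b"] delta(1) ba(1) by simp
  qed
  \<comment> \<open>The truncation of \<open>s\<close> to the components in \<open>D\<close>, where
    \<open>D\<close> grows from the empty set to all summands.\<close>
  let ?r = "\<lambda>D s. \<lambda>v\<in>summands. if v \<in> D then s v else \<zero>\<^bsub>pb v\<^esub>"
  have "P (hinv (?r D s))" if s: "s \<in> carrier PS" and "finite D" "D \<subseteq> summands" for D s
    using that(2,3)
  proof (induction D)
    case empty
    have "?r {} s = \<zero>\<^bsub>PS\<^esub>" unfolding PS_simps by simp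
    then show ?case using lin_map_zero[OF PS_module M.module_axioms hinv_lin_map] zero by simp
  next
    case (insert u D)
    have u: "u \<in> summands" using insert by simp
    have sv: "s v \<in> carrier (pb v)" if "v \<in> summands" for v using s that unfolding PS_simps by (rule PiE_mem)
    obtain f where f: "f \<in> carrier (BA u)" "s u = cls u f" using cls_surj[OF u] sv[OF u] by blast
    have D: "?r D s \<in> carrier PS"
      unfolding PS_simps using sv abelian_monoid.zero_closed[OF abelian_group.axioms(1)[OF module.axioms(2)[OF pb_module]]]
      by (intro restrict_PiE_iff[THEN iffD2] ballI) simp
    have "?r (insert u D) s = single u (s u) \<oplus>\<^bsub>PS\<^esub> ?r D s"
      unfolding PS_simps single_def
    proof (rule restrict_ext)
      fix v assume v: "v \<in> summands"
      interpret P: Module.module K "pb v" by (rule pb_module[OF v])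
      show "(if v \<in> insert u D then s v else \<zero>\<^bsub>pb v\<^esub>) =
        (\<lambda>v\<in>summands. if v = u then s u else \<zero>\<^bsub>pb v\<^esub>) v \<oplus>\<^bsub>pb v\<^esub> ?r D s v"
      proof (cases "v = u")
        case True
        then show ?thesis using v P.M.r_zero[OF sv[OF v]] insert.hyps by simp
      next
        case False
        then show ?thesis using v P.M.l_zero[OF sv[OF v]] by simp
      qed
    qed
    then have eq: "hinv (?r (insert u D) s) = \<kappa> u f \<oplus>\<^bsub>M\<^esub> hinv (?r D s)"
      using lin_map_add[OF hinv_lin_map single_closed[OF u f(1)] D] f(2) by (simp add: \<kappa>_def)
    have "P (hinv (?r D s))" by (rule insert.IH) (use insert.prems in simp)
    then show ?case
      unfolding eq
      by (rule add[OF lin_map_closed[OF \<kappa>_lin_map[OF u] f(1)] hinv_closed[OF D] \<kappa>[OF u f(1)]])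
  qed
  from this[OF lin_map_closed[OF h_lin x] finite_summands order_refl]
  have P: "P (hinv (?r summands (h x)))" .
  have r: "?r summands (h x) = h x"
  proof
    fix v
    show "?r summands (h x) v = h x v"
      using PiE_arb[OF lin_map_closed[OF h_lin x, unfolded PS_simps], of v]
      by (cases "v \<in> summands") simp_all
  qed
  show ?thesis using P unfolding r hinv_h[OF x] .
qed

text \<open>Each bilinear map \<open>\<tau> u\<close> extends to representatives, vanishes on the
  relations and so descends to the summand \<open>u\<close>; the components are then added over the
  finitely many summands. Compatibility with the actions is left to
  \<open>universal_algebra\<close>.\<close>

lemma universal:
  assumes V: "Module.module K V"
    and \<tau>: "\<And>u. u \<in> summands \<Longrightarrow> tensor_product.bilinear K (Bg u) (eA u) V (\<tau> u)"
  obtains \<Psi> where "\<Psi> \<in> lin_map K M V"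
    "\<And>u b a. \<lbrakk>u \<in> summands; b \<in> carrier B; a \<in> carrier A\<rbrakk> \<Longrightarrow>
      \<Psi> (ract M (lact M b (gen u)) a) = \<tau> u (b \<otimes>\<^bsub>B\<^esub> fst u) (fst (snd u) \<otimes>\<^bsub>A\<^esub> a)"
proof -
  interpret V: Module.module K V by (rule V)
  define t where "t = (\<lambda>u. lin_ext K V (\<lambda>(v, w). \<tau> u v w))"
  define l where "l = (\<lambda>u Y. t u (SOME f. f \<in> Y))"
  have tPi: "(\<lambda>(v, w). \<tau> u v w) \<in> carrier (Bg u) \<times> carrier (eA u) \<rightarrow> carrier V" if u: "u \<in> summands" for u
  proof -
    have "\<tau> u v w \<in> carrier V" if "v \<in> carrier (Bg u)" "w \<in> carrier (eA u)" for v w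
      using \<tau>[OF u] that unfolding tensor_product.bilinear_def[OF tensor[OF u]]
      by (blast intro: lin_map_closed)
    then show ?thesis by auto
  qed
  have t: "t u \<in> lin_map K (BA u) V" if "u \<in> summands" for u
    unfolding t_def by (rule lin_ext_lin_map[OF B.K.field_axioms V tPi[OF that]])
  have lc: "l u (cls u f) = t u f" if u: "u \<in> summands" and f: "f \<in> carrier (BA u)" for u f
  proof -
    interpret T: tensor_product K "Bg u" "eA u" by (rule tensor[OF u])
    show ?thesis unfolding l_def cls_def
      by (rule module.quot_class_lift[OF T.VW_module T.rels_submodule V t[OF u] _ f])
        (use T.bilinear_vanishes_on_rels[OF V \<tau>[OF u]] in \<open>simp add: t_def\<close>)
  qed
  have l: "l u \<in> lin_map K (pb u) V" if u: "u \<in> summands" for u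
  proof -
    have ex: "\<exists>f\<in>carrier (BA u). Y = cls u f" if "Y \<in> carrier (pb u)" for Y
      using that unfolding cls_surj[OF u, symmetric] by blast
    interpret T: tensor_product K "Bg u" "eA u" by (rule tensor[OF u])
    interpret BA: Module.module K "BA u" by (rule T.VW_module)
    show ?thesis
    proof (rule lin_mapI)
      fix Y assume "Y \<in> carrier (pb u)"
      then obtain f where f: "f \<in> carrier (BA u)" "Y = cls u f" using ex by blast
      show "l u Y \<in> carrier V" unfolding f(2) lc[OF u f(1)] by (rule lin_map_closed[OF t[OF u] f(1)])
      show "l u (c \<odot>\<^bsub>pb u\<^esub> Y) = c \<odot>\<^bsub>V\<^esub> l u Y" if c: "c \<in> carrier K" for c
        unfolding f(2) lin_map_smult[OF cls_lin_map[OF u] c f(1), symmetric] lc[OF u f(1)]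
          lc[OF u BA.smult_closed[OF c f(1)]] by (rule lin_map_smult[OF t[OF u] c f(1)])
      fix Z assume "Z \<in> carrier (pb u)"
      then obtain g where g: "g \<in> carrier (BA u)" "Z = cls u g" using ex by blast
      show "l u (Y \<oplus>\<^bsub>pb u\<^esub> Z) = l u Y \<oplus>\<^bsub>V\<^esub> l u Z"
        unfolding f(2) g(2) lin_map_add[OF cls_lin_map[OF u] f(1) g(1), symmetric] lc[OF u f(1)] lc[OF u g(1)]
          lc[OF u BA.M.a_closed[OF f(1) g(1)]] by (rule lin_map_add[OF t[OF u] f(1) g(1)])
    qed
  qed
  define \<Psi> where "\<Psi> = (\<lambda>x. \<Oplus>\<^bsub>V\<^esub>u\<in>summands. l u (h x u))"
  have hx: "h x u \<in> carrier (pb u)" if "x \<in> carrier M" "u \<in> summands" for x u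
    using lin_map_closed[OF h_lin that(1)] that(2) unfolding PS_simps by (rule PiE_mem)
  have lx: "l u (h x u) \<in> carrier V" if "x \<in> carrier M" "u \<in> summands" for x u
    by (rule lin_map_closed[OF l[OF that(2)] hx[OF that]])
  have "\<Psi> \<in> lin_map K M V"
  proof (rule lin_mapI)
    fix x assume x: "x \<in> carrier M"
    show "\<Psi> x \<in> carrier V" unfolding \<Psi>_def using lx[OF x] by (intro V.M.finsum_closed) blast
    { fix c assume c: "c \<in> carrier K"
      have "\<Psi> (c \<odot>\<^bsub>M\<^esub> x) = (\<Oplus>\<^bsub>V\<^esub>u\<in>summands. c \<odot>\<^bsub>V\<^esub> l u (h x u))"
        unfolding \<Psi>_def
      proof (rule V.M.finsum_cong'[OF refl])
        show "(\<lambda>u. c \<odot>\<^bsub>V\<^esub> l u (h x u)) \<in> summands \<rightarrow> carrier V"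
          using lx[OF x] c by (auto intro: V.smult_closed)
        fix u assume u: "u \<in> summands"
        have "h (c \<odot>\<^bsub>M\<^esub> x) u = c \<odot>\<^bsub>pb u\<^esub> h x u"
          using u by (simp add: lin_map_smult[OF h_lin c x] PS_simps)
        then show "l u (h (c \<odot>\<^bsub>M\<^esub> x) u) = c \<odot>\<^bsub>V\<^esub> l u (h x u)"
          using lin_map_smult[OF l[OF u] c hx[OF x u]] by simp
      qed
      also have "\<dots> = c \<odot>\<^bsub>V\<^esub> \<Psi> x"
        unfolding \<Psi>_def using lx[OF x] c by (intro V.finsum_smult_ldistr[symmetric] finite_summands) auto
      finally show "\<Psi> (c \<odot>\<^bsub>M\<^esub> x) = c \<odot>\<^bsub>V\<^esub> \<Psi> x" . }
    fix y assume y: "y \<in> carrier M"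
    have "\<Psi> (x \<oplus>\<^bsub>M\<^esub> y) = (\<Oplus>\<^bsub>V\<^esub>u\<in>summands. l u (h x u) \<oplus>\<^bsub>V\<^esub> l u (h y u))"
      unfolding \<Psi>_def
    proof (rule V.M.finsum_cong'[OF refl])
      show "(\<lambda>u. l u (h x u) \<oplus>\<^bsub>V\<^esub> l u (h y u)) \<in> summands \<rightarrow> carrier V"
        using lx[OF x] lx[OF y] by auto
      fix u assume u: "u \<in> summands"
      have "h (x \<oplus>\<^bsub>M\<^esub> y) u = h x u \<oplus>\<^bsub>pb u\<^esub> h y u"
        using u by (simp add: lin_map_add[OF h_lin x y] PS_simps)
      then show "l u (h (x \<oplus>\<^bsub>M\<^esub> y) u) = l u (h x u) \<oplus>\<^bsub>V\<^esub> l u (h y u)"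
        using lin_map_add[OF l[OF u] hx[OF x u] hx[OF y u]] by simp
    qed
    also have "\<dots> = \<Psi> x \<oplus>\<^bsub>V\<^esub> \<Psi> y"
      unfolding \<Psi>_def using lx[OF x] lx[OF y] by (intro V.M.finsum_addf) auto
    finally show "\<Psi> (x \<oplus>\<^bsub>M\<^esub> y) = \<Psi> x \<oplus>\<^bsub>V\<^esub> \<Psi> y" .
  qed
  moreover have "\<Psi> (ract M (lact M b (gen u)) a) = \<tau> u (b \<otimes>\<^bsub>B\<^esub> fst u) (fst (snd u) \<otimes>\<^bsub>A\<^esub> a)"
    if u: "u \<in> summands" and b: "b \<in> carrier B" and a: "a \<in> carrier A" for u b a
  proof -
    let ?d = "delta K (b \<otimes>\<^bsub>B\<^esub> fst u, fst (snd u) \<otimes>\<^bsub>A\<^esub> a)"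
    have d: "?d \<in> carrier (BA u)" by (rule delta_in_BA[OF u b a])
    have td: "t u ?d = \<tau> u (b \<otimes>\<^bsub>B\<^esub> fst u) (fst (snd u) \<otimes>\<^bsub>A\<^esub> a)"
      unfolding t_def using lin_ext_delta[OF B.K.field_axioms V tPi[OF u],
          of "(b \<otimes>\<^bsub>B\<^esub> fst u, fst (snd u) \<otimes>\<^bsub>A\<^esub> a)"] b a by auto
    have tc: "t u ?d \<in> carrier V" by (rule lin_map_closed[OF t[OF u] d])
    have hk: "h (\<kappa> u ?d) = single u (cls u ?d)" unfolding \<kappa>_def by (rule h_hinv[OF single_closed[OF u d]])
    have "\<Psi> (ract M (lact M b (gen u)) a) = (\<Oplus>\<^bsub>V\<^esub>v\<in>summands. if u = v then t u ?d else \<zero>\<^bsub>V\<^esub>)"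
      unfolding \<Psi>_def act_gen[OF u b a] hk
    proof (rule V.M.finsum_cong'[OF refl])
      show "(\<lambda>v. if u = v then t u ?d else \<zero>\<^bsub>V\<^esub>) \<in> summands \<rightarrow> carrier V" using tc by auto
      fix v assume v: "v \<in> summands"
      have "l v \<zero>\<^bsub>pb v\<^esub> = \<zero>\<^bsub>V\<^esub>" by (rule lin_map_zero[OF pb_module[OF v] V l[OF v]])
      then show "l v (single u (cls u ?d) v) = (if u = v then t u ?d else \<zero>\<^bsub>V\<^esub>)"
      proof (cases "u = v")
        case True
        then show ?thesis using v lc[OF u d] by (simp only: single_def restrict_apply if_True refl)
      next
        case False
        then show ?thesis using v \<open>l v \<zero>\<^bsub>pb v\<^esub> = \<zero>\<^bsub>V\<^esub>\<close> by (simp add: single_def)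
      qed
    qed
    also have "\<dots> = t u ?d"
      by (rule V.M.finsum_singleton[OF u finite_summands]) (simp add: tc)
    finally show ?thesis using td by simp
  qed
  ultimately show thesis by (rule that)
qed

end

section \<open>Gabriel quivers from admissible surjections\<close>

declare One_nat_def [simp del]

lemma lin_map_inj_onI:
  assumes "Module.module K V" "Module.module K W" "f \<in> lin_map K V W"
    and "\<And>x. \<lbrakk>x \<in> carrier V; f x = \<zero>\<^bsub>W\<^esub>\<rbrakk> \<Longrightarrow> x = \<zero>\<^bsub>V\<^esub>"
  shows "inj_on f (carrier V)"
proof (rule inj_onI)
  interpret V: Module.module K V by fact
  interpret W: Module.module K W by fact
  fix x y assume xy: "x \<in> carrier V" "y \<in> carrier V" "f x = f y"
  have "f (x \<ominus>\<^bsub>V\<^esub> y) = \<zero>\<^bsub>W\<^esub>"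
    using lin_map_minus[OF assms(1-3) xy(1,2)] lin_map_closed[OF assms(3) xy(2)] xy(3)
    by (simp add: W.M.minus_eq W.M.r_neg)
  then have "x \<ominus>\<^bsub>V\<^esub> y = \<zero>\<^bsub>V\<^esub>" using assms(4) xy by simp
  moreover have "x = (x \<ominus>\<^bsub>V\<^esub> y) \<oplus>\<^bsub>V\<^esub> y"
    using xy by (simp add: V.M.minus_eq V.M.a_assoc V.M.l_neg)
  ultimately show "x = y" using xy by simp
qed

text \<open>On the free space of the long paths two maps may be compared on deltas of long paths
  alone.\<close>

lemma (in quiver_algebra) lin_map_long:
  assumes "g \<in> lin_map K kQ W"
  shows "g \<in> lin_map K (free_space K (long_paths k)) W"
proof (rule lin_mapI)
  have sub: "f \<in> carrier kQ" if "f \<in> carrier (free_space K (long_paths k))" for f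
    using that long_closed[of f k] by (simp add: long_def)
  show "g f \<in> carrier W" if "f \<in> carrier (free_space K (long_paths k))" for f
    by (rule lin_map_closed[OF assms sub[OF that]])
  show "g (f \<oplus>\<^bsub>free_space K (long_paths k)\<^esub> f') = g f \<oplus>\<^bsub>W\<^esub> g f'"
    if "f \<in> carrier (free_space K (long_paths k))" "f' \<in> carrier (free_space K (long_paths k))" for f f'
    using lin_map_add[OF assms sub[OF that(1)] sub[OF that(2)]] by simp
  show "g (c \<odot>\<^bsub>free_space K (long_paths k)\<^esub> f) = c \<odot>\<^bsub>W\<^esub> g f"
    if "c \<in> carrier K" "f \<in> carrier (free_space K (long_paths k))" for c f
    using lin_map_smult[OF assms that(1) sub[OF that(2)]] by simp
qed

text \<open>Admissibility of the kernel in the form used below: it lies between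
  \<open>long N\<close> and \<open>long 2\<close>. The vertices are elements of \<open>L\<close>
  itself, and \<open>\<phi>_vtx\<close> ties the paths of length zero to them. The locale is used
  for \<open>A\<close>, for \<open>B\<close> and finally for \<Lambda>.\<close>

locale admissible_surjection = quiver_algebra K Q + L?: k_algebra K L
  for K :: "('k, 'r) ring_scheme" and Q :: "('a, 'q) pre_digraph"
    and L :: "('k, 'a, 'z) module_scheme" +
  fixes \<phi> :: "(('a, 'q) path \<Rightarrow> 'k) \<Rightarrow> 'a" and N :: nat
  assumes \<phi>_hom: "\<phi> \<in> alg_hom K kQ L"
    and \<phi>_surj: "\<phi> ` carrier kQ = carrier L"
    and \<phi>_vtx: "x \<in> verts Q \<Longrightarrow> \<phi> (vtx x) = x"
    and \<phi>_long: "f \<in> long N \<Longrightarrow> \<phi> f = \<zero>\<^bsub>L\<^esub>"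
    and \<phi>_ker: "\<lbrakk>f \<in> carrier kQ; \<phi> f = \<zero>\<^bsub>L\<^esub>\<rbrakk> \<Longrightarrow> f \<in> long 2"
begin

lemmas \<phi>_lin = alg_hom_lin_map[OF \<phi>_hom]
lemmas \<phi>_closed = lin_map_closed[OF \<phi>_lin]
lemmas \<phi>_add = lin_map_add[OF \<phi>_lin]
lemmas \<phi>_smult = lin_map_smult[OF \<phi>_lin]
lemmas \<phi>_one = alg_hom_one[OF \<phi>_hom]
lemmas \<phi>_mult = alg_hom_mult[OF \<phi>_hom]

lemma \<phi>_zero: "\<phi> \<zero>\<^bsub>kQ\<^esub> = \<zero>\<^bsub>L\<^esub>"
  by (rule lin_map_zero[OF kQ_module L.module_axioms \<phi>_lin])

lemma \<phi>_cases:
  assumes "a \<in> carrier L"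
  obtains f where "f \<in> carrier kQ" "a = \<phi> f"
  using assms \<phi>_surj by blast

lemma vertex_in_L: "x \<in> verts Q \<Longrightarrow> x \<in> carrier L"
  using \<phi>_closed[of "vtx x"] by (simp add: \<phi>_vtx)

text \<open>The power of the radical of \<open>L\<close> with exponent \<open>k\<close>, by
  \<open>J_0\<close>, \<open>jacobson_rad_eq\<close> and \<open>J_prod\<close>.\<close>

definition J :: "nat \<Rightarrow> 'a set" where
  "J k = \<phi> ` long k"

lemma J_0: "J 0 = carrier L"
  by (simp add: J_def long_0 \<phi>_surj del: kQ_simps)

lemma J_antimono: "j \<le> k \<Longrightarrow> J k \<subseteq> J j"
  unfolding J_def by (intro image_mono long_antimono)

lemma J_mult:
  assumes "a \<in> J i" "b \<in> J j"
  shows "a \<otimes>\<^bsub>L\<^esub> b \<in> J (i + j)"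
proof -
  obtain f g where fg: "f \<in> long i" "a = \<phi> f" "g \<in> long j" "b = \<phi> g" using assms by (auto simp: J_def)
  have "\<phi> (f \<otimes>\<^bsub>kQ\<^esub> g) \<in> J (i + j)" unfolding J_def by (rule imageI[OF long_mult[OF fg(1,3)]])
  then show ?thesis using fg by (simp add: \<phi>_mult long_closed del: kQ_simps)
qed

lemma J_nilpotent: "a \<in> J k \<Longrightarrow> N \<le> k \<Longrightarrow> a = \<zero>\<^bsub>L\<^esub>"
  using \<phi>_long long_antimono[of N k] by (auto simp: J_def)

lemma J_ideal: "ideal (J k) L"
proof (rule L.ideal_of_subspace)
  interpret I: ideal "long k" kQ by (rule long_ideal)
  show "J k \<subseteq> carrier L" using J_antimono[of 0 k] by (simp add: J_0)
  show "\<zero>\<^bsub>L\<^esub> \<in> J k" unfolding J_def \<phi>_zero[symmetric] by (rule imageI[OF I.zero_closed])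
  show "a \<oplus>\<^bsub>L\<^esub> b \<in> J k" if ab: "a \<in> J k" "b \<in> J k" for a b
  proof -
    obtain f g where fg: "f \<in> long k" "a = \<phi> f" "g \<in> long k" "b = \<phi> g" using ab by (auto simp: J_def)
    have "\<phi> (f \<oplus>\<^bsub>kQ\<^esub> g) \<in> J k" unfolding J_def by (rule imageI[OF I.a_closed[OF fg(1,3)]])
    then show ?thesis using fg by (simp add: \<phi>_add long_closed del: kQ_simps)
  qed
  show "c \<odot>\<^bsub>L\<^esub> a \<in> J k" if c: "c \<in> carrier K" and a: "a \<in> J k" for c a
  proof -
    obtain f where f: "f \<in> long k" "a = \<phi> f" using a by (auto simp: J_def)
    have "\<phi> (c \<odot>\<^bsub>kQ\<^esub> f) \<in> J k" unfolding J_def by (rule imageI[OF kQ.smult_mem_ideal[OF long_ideal c f(1)]])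
    then show ?thesis using f c by (simp add: \<phi>_smult long_closed del: kQ_simps)
  qed
  show "a \<otimes>\<^bsub>L\<^esub> b \<in> J k" if "a \<in> carrier L" "b \<in> J k" for a b
    using J_mult[of a 0 b k] that by (simp add: J_0)
  show "b \<otimes>\<^bsub>L\<^esub> a \<in> J k" if "a \<in> carrier L" "b \<in> J k" for a b
    using J_mult[of b k a 0] that by (simp add: J_0)
qed

section \<open>Characters at the vertices and the Jacobson radical\<close>

text \<open>\<open>\<chi> x a\<close> is the coefficient of the vertex \<open>x\<close> in any preimage of \<open>a\<close> under \<open>\<phi>\<close>.\<close>

definition \<chi> :: "'a \<Rightarrow> 'a \<Rightarrow> 'k" where
  "\<chi> x a = (SOME f. f \<in> carrier kQ \<and> \<phi> f = a) (vertex_path x)"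

text \<open>Two preimages of an element differ by a member of the kernel, which lies in
  \<open>long 2\<close> and so has no coefficients at paths of length zero.\<close>

lemma \<chi>_\<phi>:
  assumes f: "f \<in> carrier kQ"
  shows "\<chi> x (\<phi> f) = f (vertex_path x)"
proof -
  define g where "g = (SOME g. g \<in> carrier kQ \<and> \<phi> g = \<phi> f)"
  have "g \<in> carrier kQ \<and> \<phi> g = \<phi> f"
    unfolding g_def by (rule someI[of _ f]) (use f in simp)
  then have g: "g \<in> carrier kQ" "\<phi> g = \<phi> f" by simp_all
  have "\<phi> (f \<ominus>\<^bsub>kQ\<^esub> g) = \<zero>\<^bsub>L\<^esub>"
    using lin_map_minus[OF kQ_module L.module_axioms \<phi>_lin f g(1)] g(2) \<phi>_closed[OF f]
    by (simp add: L.A.minus_eq L.A.r_neg)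
  then have "f \<ominus>\<^bsub>kQ\<^esub> g \<in> long 2" using f g(1) by (intro \<phi>_ker kQ.A.minus_closed)
  then have "(f \<ominus>\<^bsub>kQ\<^esub> g) (vertex_path x) = \<zero>\<^bsub>K\<^esub>"
    by (simp add: long_iff vertex_path_def)
  moreover have "((f \<ominus>\<^bsub>kQ\<^esub> g) \<oplus>\<^bsub>kQ\<^esub> g) (vertex_path x) = f (vertex_path x)"
    using f g(1) by (simp add: kQ.A.minus_eq kQ.A.a_assoc kQ.A.l_neg del: kQ_simps)
  ultimately have "f (vertex_path x) = g (vertex_path x)"
    using fin_supp_closed[OF g(1)[simplified], of "vertex_path x"] by simp
  then show ?thesis unfolding \<chi>_def g_def by simp
qed

text \<open>A path of length zero factors only as itself times itself. This makes
  \<open>\<chi> x\<close> a character of \<open>L\<close>.\<close>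

lemma vertex_coeff_mult:
  assumes "f \<in> carrier kQ" "g \<in> carrier kQ" "x \<in> verts Q"
  shows "(f \<otimes>\<^bsub>kQ\<^esub> g) (vertex_path x) = f (vertex_path x) \<otimes>\<^bsub>K\<^esub> g (vertex_path x)"
proof -
  have "factorizations (vertex_path x) = {(vertex_path x, vertex_path x)}"
    using assms(3)
    by (auto simp: factorizations_def path_comp_def vertex_path_def path_start_def path_end_def paths_iff awalk_Nil_iff)
  then show ?thesis unfolding kQ_mult_apply
    using fin_supp_closed[OF assms(1)[simplified]] fin_supp_closed[OF assms(2)[simplified]] by simp
qed

lemma \<chi>_closed: "a \<in> carrier L \<Longrightarrow> \<chi> x a \<in> carrier K"
  by (erule \<phi>_cases) (simp add: \<chi>_\<phi> fin_supp_closed)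

lemma \<chi>_add: "\<lbrakk>a \<in> carrier L; b \<in> carrier L\<rbrakk> \<Longrightarrow> \<chi> x (a \<oplus>\<^bsub>L\<^esub> b) = \<chi> x a \<oplus>\<^bsub>K\<^esub> \<chi> x b"
  by (erule \<phi>_cases, erule \<phi>_cases)
    (simp add: \<chi>_\<phi> \<phi>_add[symmetric] fin_supp_add[OF K.field_axioms])

lemma \<chi>_smult: "\<lbrakk>c \<in> carrier K; a \<in> carrier L\<rbrakk> \<Longrightarrow> \<chi> x (c \<odot>\<^bsub>L\<^esub> a) = c \<otimes>\<^bsub>K\<^esub> \<chi> x a"
  by (erule \<phi>_cases) (simp add: \<chi>_\<phi> \<phi>_smult[symmetric] fin_supp_smult[OF K.field_axioms])

lemma \<chi>_mult:
  assumes "a \<in> carrier L" "b \<in> carrier L" "x \<in> verts Q"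
  shows "\<chi> x (a \<otimes>\<^bsub>L\<^esub> b) = \<chi> x a \<otimes>\<^bsub>K\<^esub> \<chi> x b"
proof -
  obtain f g where fg: "f \<in> carrier kQ" "a = \<phi> f" "g \<in> carrier kQ" "b = \<phi> g"
    using \<phi>_cases[OF assms(1)] \<phi>_cases[OF assms(2)] by metis
  then have "\<chi> x (a \<otimes>\<^bsub>L\<^esub> b) = (f \<otimes>\<^bsub>kQ\<^esub> g) (vertex_path x)"
    using \<chi>_\<phi>[OF kQ.A.m_closed[OF fg(1,3)]] by (simp add: \<phi>_mult del: kQ_simps)
  then show ?thesis using fg assms(3) by (simp add: vertex_coeff_mult \<chi>_\<phi> del: kQ_simps)
qed

lemma \<chi>_one: "x \<in> verts Q \<Longrightarrow> \<chi> x \<one>\<^bsub>L\<^esub> = \<one>\<^bsub>K\<^esub>"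
  unfolding \<phi>_one[symmetric] by (subst \<chi>_\<phi>[OF kQ.A.one_closed]) (simp add: kQ_one)

lemma \<chi>_vertex: "y \<in> verts Q \<Longrightarrow> \<chi> x y = (if x = y then \<one>\<^bsub>K\<^esub> else \<zero>\<^bsub>K\<^esub>)"
proof -
  assume y: "y \<in> verts Q"
  have "vtx y (vertex_path x) = (if x = y then \<one>\<^bsub>K\<^esub> else \<zero>\<^bsub>K\<^esub>)"
    by (simp add: delta_def vertex_path_def)
  then show ?thesis using \<chi>_\<phi>[of "vtx y" x] y by (simp add: \<phi>_vtx)
qed

text \<open>For the converse direction any preimage will do: its vertex coefficients are the values
  of the characters, and if they vanish it is supported on paths of positive length.\<close>

lemma J1_iff: "a \<in> J 1 \<longleftrightarrow> a \<in> carrier L \<and> (\<forall>x\<in>verts Q. \<chi> x a = \<zero>\<^bsub>K\<^esub>)"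
proof
  assume "a \<in> J 1"
  then obtain f where f: "f \<in> long 1" "a = \<phi> f" by (auto simp: J_def)
  then show "a \<in> carrier L \<and> (\<forall>x\<in>verts Q. \<chi> x a = \<zero>\<^bsub>K\<^esub>)"
    using \<phi>_closed[of f] \<chi>_\<phi>[of f] by (simp add: long_iff vertex_path_def)
next
  assume a: "a \<in> carrier L \<and> (\<forall>x\<in>verts Q. \<chi> x a = \<zero>\<^bsub>K\<^esub>)"
  then obtain f where f: "f \<in> carrier kQ" "a = \<phi> f" using \<phi>_cases by blast
  have "f \<gamma> = \<zero>\<^bsub>K\<^esub>" if "length (snd \<gamma>) < 1" for \<gamma>
  proof (cases "\<gamma> \<in> paths Q")
    case True
    then have "\<gamma> = vertex_path (path_start \<gamma>)" "path_start \<gamma> \<in> verts Q"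
      using that by (simp_all add: vertex_path_of_length_0[OF True, symmetric])
    then show ?thesis using a f \<chi>_\<phi>[OF f(1), of "path_start \<gamma>"] by simp
  next
    case False
    then show ?thesis using fin_supp_outside[OF f(1)[simplified]] by simp
  qed
  then show "a \<in> J 1" unfolding J_def using f by (auto simp: long_iff)
qed

text \<open>The kernel of a character has codimension one: once \<open>a\<close> lies outside it,
  every \<open>b\<close> is a scalar multiple of \<open>a\<close> modulo the kernel.\<close>

lemma maximal_left_ideal_ker_\<chi>:
  assumes x: "x \<in> verts Q"
  shows "maximal_left_ideal {a \<in> carrier L. \<chi> x a = \<zero>\<^bsub>K\<^esub>} L"
  unfolding maximal_left_ideal_def
proof (intro conjI allI impI)
  let ?M = "{a \<in> carrier L. \<chi> x a = \<zero>\<^bsub>K\<^esub>}"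
  have "ideal ?M L"
  proof (rule L.ideal_of_subspace)
    show "\<zero>\<^bsub>L\<^esub> \<in> ?M"
      using \<chi>_smult[of "\<zero>\<^bsub>K\<^esub>" "\<zero>\<^bsub>L\<^esub>" x] \<chi>_closed[of "\<zero>\<^bsub>L\<^esub>"] by simp
  qed (auto simp: \<chi>_add \<chi>_smult \<chi>_mult x \<chi>_closed)
  then show "left_ideal ?M L"
    unfolding left_ideal_def by (intro conjI ballI ideal.axioms(1) ideal.I_l_closed)
  show "?M \<noteq> carrier L"
  proof
    assume "?M = carrier L"
    then have "\<one>\<^bsub>L\<^esub> \<in> ?M" by (simp only: L.A.one_closed)
    then show False using \<chi>_one[OF x] by simp
  qed
  fix M' assume M': "left_ideal M' L \<and> ?M \<subseteq> M'"
  interpret M': additive_subgroup M' L using M' by (simp add: left_ideal_def)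
  show "M' = ?M \<or> M' = carrier L"
  proof (rule disjCI)
    assume "M' \<noteq> carrier L"
    show "M' = ?M"
    proof (rule ccontr)
      assume "M' \<noteq> ?M"
      then obtain a where a: "a \<in> M'" "\<chi> x a \<noteq> \<zero>\<^bsub>K\<^esub>" using M' M'.a_subset by blast
      have aL: "a \<in> carrier L" using a M'.a_subset by blast
      have u: "\<chi> x a \<in> Units K" using a(2) \<chi>_closed[OF aL] by (simp add: K.field_Units)
      have "b \<in> M'" if b: "b \<in> carrier L" for b
      proof -
        \<comment> \<open>The scalar for which \<open>b - c a\<close> is killed by the
          character.\<close>
        define c where "c = \<chi> x b \<otimes>\<^bsub>K\<^esub> inv\<^bsub>K\<^esub> \<chi> x a"
        have c: "c \<in> carrier K" using u b by (simp add: c_def \<chi>_closed)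
        have "\<chi> x b \<otimes>\<^bsub>K\<^esub> inv\<^bsub>K\<^esub> \<chi> x a \<otimes>\<^bsub>K\<^esub> \<chi> x a = \<chi> x b"
          using u b aL by (simp add: K.m_assoc \<chi>_closed K.Units_l_inv)
        then have "\<chi> x (b \<oplus>\<^bsub>L\<^esub> (\<ominus>\<^bsub>K\<^esub> c) \<odot>\<^bsub>L\<^esub> a) = \<zero>\<^bsub>K\<^esub>"
          using b aL c by (simp add: \<chi>_add \<chi>_smult \<chi>_closed K.l_minus c_def[symmetric] K.r_neg)
        then have "b \<oplus>\<^bsub>L\<^esub> (\<ominus>\<^bsub>K\<^esub> c) \<odot>\<^bsub>L\<^esub> a \<in> M'" using M' b aL c by auto
        moreover have "(c \<odot>\<^bsub>L\<^esub> \<one>\<^bsub>L\<^esub>) \<otimes>\<^bsub>L\<^esub> a \<in> M'"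
          using M' a(1) c by (simp add: left_ideal_def)
        then have "c \<odot>\<^bsub>L\<^esub> a \<in> M'" using c aL by (simp add: L.smult_mult_left)
        ultimately have "b \<oplus>\<^bsub>L\<^esub> (\<ominus>\<^bsub>K\<^esub> c) \<odot>\<^bsub>L\<^esub> a \<oplus>\<^bsub>L\<^esub> c \<odot>\<^bsub>L\<^esub> a \<in> M'" by (rule M'.a_closed)
        then show ?thesis using b c aL by (simp add: L.smult_l_minus L.A.a_assoc L.A.l_neg)
      qed
      then show False using \<open>M' \<noteq> carrier L\<close> M'.a_subset by blast
    qed
  qed
qed

text \<open>Nakayama's argument for a nilpotent ideal. If \<open>J 1\<close> were not contained in
  \<open>M\<close>, then \<open>M + J 1\<close> would be all of \<open>L\<close> by maximality;
  substituting the resulting equation \<open>1 = l + j\<close> into itself pushes the second summand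
  into ever higher powers until it vanishes, and then \<open>M\<close> contains one.\<close>

lemma J1_subset_maximal:
  assumes M: "maximal_left_ideal M L"
  shows "J 1 \<subseteq> M"
proof (rule ccontr)
  assume neg: "\<not> J 1 \<subseteq> M"
  have lM: "left_ideal M L" and max: "M \<noteq> carrier L"
    "\<And>M'. left_ideal M' L \<Longrightarrow> M \<subseteq> M' \<Longrightarrow> M' = M \<or> M' = carrier L"
    using M by (auto simp: maximal_left_ideal_def)
  interpret M: additive_subgroup M L using lM by (simp add: left_ideal_def)
  interpret J1: ideal "J 1" L by (rule J_ideal)
  have lc: "a \<otimes>\<^bsub>L\<^esub> b \<in> M" if "a \<in> carrier L" "b \<in> M" for a b
    using that lM by (simp add: left_ideal_def)
  have add: "M <+>\<^bsub>L\<^esub> J 1 = {l \<oplus>\<^bsub>L\<^esub> j | l j. l \<in> M \<and> j \<in> J 1}"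
    by (auto simp: set_add_def')
  have "left_ideal (M <+>\<^bsub>L\<^esub> J 1) L"
    unfolding left_ideal_def
  proof (intro conjI ballI)
    show "additive_subgroup (M <+>\<^bsub>L\<^esub> J 1) L"
      by (rule L.A.add_additive_subgroups[OF M.additive_subgroup_axioms J1.additive_subgroup_axioms])
    fix a x assume a: "a \<in> carrier L" and "x \<in> M <+>\<^bsub>L\<^esub> J 1"
    then obtain l j where lj: "x = l \<oplus>\<^bsub>L\<^esub> j" "l \<in> M" "j \<in> J 1" unfolding add by blast
    then have "a \<otimes>\<^bsub>L\<^esub> x = a \<otimes>\<^bsub>L\<^esub> l \<oplus>\<^bsub>L\<^esub> a \<otimes>\<^bsub>L\<^esub> j" using a by (simp add: L.A.r_distr)
    then show "a \<otimes>\<^bsub>L\<^esub> x \<in> M <+>\<^bsub>L\<^esub> J 1"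
      unfolding add using lc[OF a lj(2)] J1.I_l_closed[OF lj(3) a] by blast
  qed
  moreover have "M \<subseteq> M <+>\<^bsub>L\<^esub> J 1"
  proof
    fix l assume "l \<in> M"
    then show "l \<in> M <+>\<^bsub>L\<^esub> J 1" unfolding add using J1.zero_closed
      by (intro CollectI exI[of _ l] exI[of _ "\<zero>\<^bsub>L\<^esub>"]) simp
  qed
  moreover have "M <+>\<^bsub>L\<^esub> J 1 \<noteq> M"
  proof
    assume eq: "M <+>\<^bsub>L\<^esub> J 1 = M"
    have "j \<in> M" if "j \<in> J 1" for j
    proof -
      have "\<zero>\<^bsub>L\<^esub> \<oplus>\<^bsub>L\<^esub> j \<in> M <+>\<^bsub>L\<^esub> J 1" unfolding add using M.zero_closed that by blast
      then show ?thesis using that eq by simp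
    qed
    then show False using neg by blast
  qed
  ultimately have "\<one>\<^bsub>L\<^esub> \<in> M <+>\<^bsub>L\<^esub> J 1" using max(2) by auto
  then obtain l j where lj: "\<one>\<^bsub>L\<^esub> = l \<oplus>\<^bsub>L\<^esub> j" "l \<in> M" "j \<in> J 1" unfolding add by blast
  have "\<exists>l'\<in>M. \<exists>z\<in>J (Suc k). \<one>\<^bsub>L\<^esub> = l' \<oplus>\<^bsub>L\<^esub> z" for k
  proof (induction k)
    case 0
    then show ?case using lj by (auto simp: One_nat_def)
  next
    case (Suc k)
    then obtain l' z where *: "l' \<in> M" "z \<in> J (Suc k)" "\<one>\<^bsub>L\<^esub> = l' \<oplus>\<^bsub>L\<^esub> z" by blast
    have cl: "l \<in> carrier L" "j \<in> carrier L" "l' \<in> carrier L" "z \<in> carrier L"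
      using lj * J_antimono[of 0 "Suc k"] by (auto simp: J_0)
    \<comment> \<open>The current decomposition of one is inserted into \<open>j = j 1\<close>; the
      new remainder \<open>j z\<close> has gained one order.\<close>
    have "j \<otimes>\<^bsub>L\<^esub> (l' \<oplus>\<^bsub>L\<^esub> z) = j" using cl by (simp only: *(3)[symmetric] L.A.r_one)
    then have "\<one>\<^bsub>L\<^esub> = l \<oplus>\<^bsub>L\<^esub> j \<otimes>\<^bsub>L\<^esub> (l' \<oplus>\<^bsub>L\<^esub> z)" using lj(1) by (simp only:)
    also have "\<dots> = (l \<oplus>\<^bsub>L\<^esub> j \<otimes>\<^bsub>L\<^esub> l') \<oplus>\<^bsub>L\<^esub> j \<otimes>\<^bsub>L\<^esub> z" using cl by (simp add: L.A.r_distr L.A.a_assoc)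
    finally have e: "\<one>\<^bsub>L\<^esub> = (l \<oplus>\<^bsub>L\<^esub> j \<otimes>\<^bsub>L\<^esub> l') \<oplus>\<^bsub>L\<^esub> j \<otimes>\<^bsub>L\<^esub> z" .
    have "l \<oplus>\<^bsub>L\<^esub> j \<otimes>\<^bsub>L\<^esub> l' \<in> M" using lj(2) lc[OF cl(2) *(1)] by (rule M.a_closed)
    moreover have "j \<otimes>\<^bsub>L\<^esub> z \<in> J (Suc (Suc k))" using J_mult[OF lj(3) *(2)] by (simp add: One_nat_def)
    ultimately show ?case using e by (intro bexI)
  qed
  then obtain l' z where *: "l' \<in> M" "z \<in> J (Suc N)" "\<one>\<^bsub>L\<^esub> = l' \<oplus>\<^bsub>L\<^esub> z" by blast
  then have "\<one>\<^bsub>L\<^esub> \<in> M" using J_nilpotent[of z "Suc N"] by simp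
  then have "carrier L \<subseteq> M" using lc by fastforce
  then show False using max(1) M.a_subset by blast
qed

lemma jacobson_rad_eq: "jacobson_rad L = J 1"
proof
  show "jacobson_rad L \<subseteq> J 1"
  proof
    fix a assume a: "a \<in> jacobson_rad L"
    have "\<chi> x a = \<zero>\<^bsub>K\<^esub>" if "x \<in> verts Q" for x
      using a maximal_left_ideal_ker_\<chi>[OF that] unfolding jacobson_rad_def by blast
    then show "a \<in> J 1" using a by (simp add: J1_iff jacobson_rad_def)
  qed
  show "J 1 \<subseteq> jacobson_rad L"
    using J1_subset_maximal J_antimono[of 0 1] unfolding jacobson_rad_def by (auto simp: J_0)
qed

text \<open>The isomorphism lists the values of all characters. It is injective because their common
  kernel is \<open>J 1\<close>, and surjective because combinations of the vertices take arbitrary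
  values.\<close>

lemma quotient_iso_power: "alg_isomorphic K (quot_mod L (J 1)) (power_algebra K (card (verts Q)))"
proof -
  let ?n = "card (verts Q)" and ?q = "\<lambda>a. J 1 +>\<^bsub>L\<^esub> a"
  interpret J1: ideal "J 1" L by (rule J_ideal)
  note sub = L.ideal_submodule[OF J_ideal[of 1]]
  \<comment> \<open>The index set of \<open>power_algebra\<close> is an initial segment of the
    naturals, so the vertices have to be numbered.\<close>
  obtain e where "bij_betw e {0..<?n} (verts Q)" using ex_bij_betw_nat_finite[OF finite_verts] by blast
  then have e: "bij_betw e {..<?n} (verts Q)" by (simp add: lessThan_atLeast0)
  have ev: "e i \<in> verts Q" if "i < ?n" for i using e that by (auto simp: bij_betw_def)
  define H where "H = (\<lambda>a. \<lambda>i\<in>{..<?n}. \<chi> (e i) a)"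
  define h where "h = (\<lambda>X. H (SOME a. a \<in> X))"
  have h: "h (?q a) = H a" if a: "a \<in> carrier L" for a
  proof -
    have "(SOME b. b \<in> ?q a) \<in> ?q a" by (rule someI[of "\<lambda>b. b \<in> ?q a", OF J1.a_rcos_self[OF a]])
    then obtain j where j: "j \<in> J 1" "(SOME b. b \<in> ?q a) = j \<oplus>\<^bsub>L\<^esub> a" by (auto simp: a_r_coset_def')
    then have "\<chi> (e i) (SOME b. b \<in> ?q a) = \<chi> (e i) a" if "i < ?n" for i
      using a that ev[OF that] by (simp add: \<chi>_add J1_iff \<chi>_closed)
    then show ?thesis by (auto simp: h_def H_def restrict_def)
  qed
  have q: "\<exists>a\<in>carrier L. X = ?q a" if "X \<in> carrier (quot_mod L (J 1))" for X
    using that unfolding L.quot_class_surj[OF sub, symmetric] by blast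
  have Hc: "H a \<in> carrier (power_algebra K ?n)" if "a \<in> carrier L" for a
    using that by (simp add: H_def power_algebra_def \<chi>_closed)
  have "h \<in> alg_hom K (quot_mod L (J 1)) (power_algebra K ?n)"
  proof (rule alg_homI[OF lin_mapI])
    fix X assume "X \<in> carrier (quot_mod L (J 1))"
    then obtain a where a: "a \<in> carrier L" "X = ?q a" using q by blast
    show "h X \<in> carrier (power_algebra K ?n)" using a h Hc by simp
    { fix c assume c: "c \<in> carrier K"
      have "c \<odot>\<^bsub>quot_mod L (J 1)\<^esub> X = ?q (c \<odot>\<^bsub>L\<^esub> a)"
        using lin_map_smult[OF L.quot_class_lin_map[OF sub] c a(1)] a(2) by simp
      then show "h (c \<odot>\<^bsub>quot_mod L (J 1)\<^esub> X) = c \<odot>\<^bsub>power_algebra K ?n\<^esub> h X"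
        using a c h by (auto simp del: quot_mod_simps simp: H_def power_algebra_def \<chi>_smult restrict_def) }
    fix Y assume "Y \<in> carrier (quot_mod L (J 1))"
    then obtain b where b: "b \<in> carrier L" "Y = ?q b" using q by blast
    show "h (X \<oplus>\<^bsub>quot_mod L (J 1)\<^esub> Y) = h X \<oplus>\<^bsub>power_algebra K ?n\<^esub> h Y"
      using a b h by (simp add: J1.a_rcos_sum) (auto simp: H_def power_algebra_def \<chi>_add restrict_def)
    show "h (X \<otimes>\<^bsub>quot_mod L (J 1)\<^esub> Y) = h X \<otimes>\<^bsub>power_algebra K ?n\<^esub> h Y"
      using a b h ev by (simp add: J1.rcoset_mult_add) (auto simp: H_def power_algebra_def \<chi>_mult restrict_def)
  next
    show "h \<one>\<^bsub>quot_mod L (J 1)\<^esub> = \<one>\<^bsub>power_algebra K ?n\<^esub>"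
      using h ev by (auto simp: H_def power_algebra_def \<chi>_one restrict_def)
  qed
  moreover have "bij_betw h (carrier (quot_mod L (J 1))) (carrier (power_algebra K ?n))"
  proof (rule bij_betw_imageI)
    show "inj_on h (carrier (quot_mod L (J 1)))"
    proof (rule inj_onI)
      fix X Y assume "X \<in> carrier (quot_mod L (J 1))" "Y \<in> carrier (quot_mod L (J 1))" and eq: "h X = h Y"
      then obtain a b where ab: "a \<in> carrier L" "X = ?q a" "b \<in> carrier L" "Y = ?q b" using q by blast
      then have H: "H a = H b" using eq h by simp
      have "\<chi> x (a \<ominus>\<^bsub>L\<^esub> b) = \<zero>\<^bsub>K\<^esub>" if "x \<in> verts Q" for x
      proof -
        obtain i where i: "i < ?n" "x = e i" using e \<open>x \<in> verts Q\<close> by (auto simp: bij_betw_def)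
        have "\<chi> x a = \<chi> x b" using fun_cong[OF H, of i] i by (simp add: H_def)
        moreover have "\<chi> x (a \<oplus>\<^bsub>L\<^esub> (\<ominus>\<^bsub>K\<^esub> \<one>\<^bsub>K\<^esub>) \<odot>\<^bsub>L\<^esub> b) = \<chi> x a \<oplus>\<^bsub>K\<^esub> (\<ominus>\<^bsub>K\<^esub> \<one>\<^bsub>K\<^esub>) \<otimes>\<^bsub>K\<^esub> \<chi> x b"
          using ab by (simp add: \<chi>_add \<chi>_smult del: K.l_minus L.smult_l_minus)
        ultimately show ?thesis
          using ab by (simp add: L.smult_l_minus L.A.minus_eq K.l_minus \<chi>_closed K.r_neg)
      qed
      then have "a \<ominus>\<^bsub>L\<^esub> b \<in> J 1" using ab by (simp add: J1_iff)
      then show "X = Y" using L.quot_class_eq_iff[OF sub] ab by simp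
    qed
    show "h ` carrier (quot_mod L (J 1)) = carrier (power_algebra K ?n)"
    proof
      show "h ` carrier (quot_mod L (J 1)) \<subseteq> carrier (power_algebra K ?n)"
        using q h Hc by fastforce
      show "carrier (power_algebra K ?n) \<subseteq> h ` carrier (quot_mod L (J 1))"
      proof
        fix g assume "g \<in> carrier (power_algebra K ?n)"
        then have g: "g \<in> {..<?n} \<rightarrow>\<^sub>E carrier K" by (simp add: power_algebra_def)
        define f :: "('a, 'q) path \<Rightarrow> 'k" where "f = (\<lambda>\<gamma>. if \<gamma> \<in> vertex_path ` verts Q
          then g (the_inv_into {..<?n} e (path_start \<gamma>)) else \<zero>\<^bsub>K\<^esub>)"
        have inv: "the_inv_into {..<?n} e x < ?n" if "x \<in> verts Q" for x
          using bij_betwE[OF bij_betw_the_inv_into[OF e]] that by auto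
        have f: "f \<in> carrier kQ"
          using g inv by (auto intro!: fin_suppI[where S = "vertex_path ` verts Q"] simp: f_def PiE_def Pi_iff)
        have "H (\<phi> f) i = g i" for i
        proof (cases "i < ?n")
          case True
          then show ?thesis
            using ev[OF True] the_inv_into_f_f[OF bij_betw_imp_inj_on[OF e], of i]
            by (simp add: H_def \<chi>_\<phi>[OF f]) (simp add: f_def)
        next
          case False
          then show ?thesis using g by (simp add: H_def PiE_def extensional_def)
        qed
        then have "g = h (?q (\<phi> f))" using h[OF \<phi>_closed[OF f]] by (simp add: fun_eq_iff)
        moreover have "?q (\<phi> f) \<in> carrier (quot_mod L (J 1))"
          using L.quot_class_surj[OF sub] \<phi>_closed[OF f] by blast
        ultimately show "g \<in> h ` carrier (quot_mod L (J 1))" by blast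
      qed
    qed
  qed
  ultimately show ?thesis unfolding alg_isomorphic_def by blast
qed

text \<open>For primitivity let \<open>x = e1 + e2\<close> with orthogonal idempotents. At every
  vertex the two values of the character have product zero, and their sum is one at \<open>x\<close>
  and zero elsewhere; hence all characters kill \<open>e1\<close> or all kill \<open>e2\<close>. The
  idempotent killed lies in the nilpotent ideal \<open>J 1\<close> and is zero.\<close>

lemma vertices_complete: "complete_primitive_orthogonal L (verts Q)"
  unfolding complete_primitive_orthogonal_def
proof (intro conjI ballI impI)
  show "finite (verts Q)" by simp
  have mult: "x \<otimes>\<^bsub>L\<^esub> y = (if x = y then x else \<zero>\<^bsub>L\<^esub>)" if "x \<in> verts Q" "y \<in> verts Q" for x y
  proof -
    have "x \<otimes>\<^bsub>L\<^esub> y = \<phi> (vtx x \<otimes>\<^bsub>kQ\<^esub> vtx y)" using that by (simp add: \<phi>_mult \<phi>_vtx)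
    also have "\<dots> = (if x = y then x else \<zero>\<^bsub>L\<^esub>)"
      using that by (simp add: vtx_mult_delta \<phi>_vtx \<phi>_zero del: kQ_simps)
    finally show ?thesis .
  qed
  show "orthogonal L x y" if "x \<in> verts Q" "y \<in> verts Q" "x \<noteq> y" for x y
    using that mult by (simp add: orthogonal_def)
  have "\<one>\<^bsub>L\<^esub> = (\<Oplus>\<^bsub>L\<^esub>x\<in>verts Q. \<phi> (vtx x))"
    unfolding \<phi>_one[symmetric] kQ_one_eq_finsum
    by (rule lin_map_finsum[OF kQ_module L.module_axioms \<phi>_lin finite_verts]) simp
  also have "\<dots> = (\<Oplus>\<^bsub>L\<^esub>x\<in>verts Q. x)"
    by (intro L.A.finsum_cong') (auto simp: \<phi>_vtx vertex_in_L)
  finally show "(\<Oplus>\<^bsub>L\<^esub>x\<in>verts Q. x) = \<one>\<^bsub>L\<^esub>" by simp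
  fix x assume x: "x \<in> verts Q"
  \<comment> \<open>Powers of such an \<open>e\<close> lie in ever higher \<open>J k\<close>, yet
    they all equal \<open>e\<close>.\<close>
  have zero: "e = \<zero>\<^bsub>L\<^esub>" if e: "idempotent L e" "\<And>y. y \<in> verts Q \<Longrightarrow> \<chi> y e = \<zero>\<^bsub>K\<^esub>" for e
  proof -
    have eJ: "e \<in> J 1" using e by (simp add: J1_iff idempotent_def)
    have "e \<in> J (Suc k)" for k
    proof (induction k)
      case (Suc k)
      then show ?case using J_mult[OF eJ Suc] e(1) by (simp add: idempotent_def One_nat_def)
    qed (use eJ in \<open>simp add: One_nat_def\<close>)
    then show ?thesis using J_nilpotent[of e "Suc N"] by simp
  qed
  show "primitive_idempotent L x"
    unfolding primitive_idempotent_def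
  proof (intro conjI notI)
    show "idempotent L x" using x mult by (simp add: idempotent_def vertex_in_L)
    show False if "x = \<zero>\<^bsub>L\<^esub>"
      using \<chi>_vertex[OF x, of x] \<chi>_smult[of "\<zero>\<^bsub>K\<^esub>" x x] that x by (simp add: vertex_in_L)
    assume "\<exists>e1 e2. idempotent L e1 \<and> idempotent L e2 \<and> orthogonal L e1 e2 \<and>
           e1 \<noteq> \<zero>\<^bsub>L\<^esub> \<and> e2 \<noteq> \<zero>\<^bsub>L\<^esub> \<and> x = e1 \<oplus>\<^bsub>L\<^esub> e2"
    then obtain e1 e2 where e: "idempotent L e1" "idempotent L e2" "orthogonal L e1 e2"
      "e1 \<noteq> \<zero>\<^bsub>L\<^esub>" "e2 \<noteq> \<zero>\<^bsub>L\<^esub>" "x = e1 \<oplus>\<^bsub>L\<^esub> e2" by blast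
    have c: "e1 \<in> carrier L" "e2 \<in> carrier L" using e by (simp_all add: idempotent_def)
    have \<chi>0: "\<chi> y \<zero>\<^bsub>L\<^esub> = \<zero>\<^bsub>K\<^esub>" for y
      using \<chi>_smult[of "\<zero>\<^bsub>K\<^esub>" "\<zero>\<^bsub>L\<^esub>" y] \<chi>_closed[of "\<zero>\<^bsub>L\<^esub>"] by simp
    have prod: "\<chi> y e1 = \<zero>\<^bsub>K\<^esub> \<or> \<chi> y e2 = \<zero>\<^bsub>K\<^esub>" if "y \<in> verts Q" for y
    proof -
      have "\<chi> y e1 \<otimes>\<^bsub>K\<^esub> \<chi> y e2 = \<zero>\<^bsub>K\<^esub>"
        using \<chi>_mult[OF c that] e(3) \<chi>0 by (simp add: orthogonal_def)
      then show ?thesis using K.integral c \<chi>_closed by blast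
    qed
    have sum: "\<chi> y e1 \<oplus>\<^bsub>K\<^esub> \<chi> y e2 = (if y = x then \<one>\<^bsub>K\<^esub> else \<zero>\<^bsub>K\<^esub>)" for y
      using \<chi>_add[OF c, of y] \<chi>_vertex[OF x, of y] e(6) by simp
    have other: "\<chi> y e1 = \<zero>\<^bsub>K\<^esub> \<and> \<chi> y e2 = \<zero>\<^bsub>K\<^esub>" if "y \<in> verts Q" "y \<noteq> x" for y
      using prod[OF that(1)] sum[of y] that(2) c \<chi>_closed[of e1 y] \<chi>_closed[of e2 y] by auto
    from prod[OF x] show False
    proof
      assume "\<chi> x e1 = \<zero>\<^bsub>K\<^esub>"
      then have "e1 = \<zero>\<^bsub>L\<^esub>" using other by (intro zero[OF e(1)]) metis
      then show False using e(4) by simp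
    next
      assume "\<chi> x e2 = \<zero>\<^bsub>K\<^esub>"
      then have "e2 = \<zero>\<^bsub>L\<^esub>" using other by (intro zero[OF e(2)]) metis
      then show False using e(5) by simp
    qed
  qed
qed

section \<open>Arrow spaces and the Gabriel quiver\<close>

lemma J_prod: "J i \<cdot>\<^bsub>L\<^esub> J j = J (i + j)"
proof
  show "J i \<cdot>\<^bsub>L\<^esub> J j \<subseteq> J (i + j)"
  proof
    fix a assume "a \<in> J i \<cdot>\<^bsub>L\<^esub> J j"
    then show "a \<in> J (i + j)"
    proof (induction rule: ideal_prod.induct)
      case (sum a b)
      then show ?case using additive_subgroup.a_closed[OF ideal.axioms(1)[OF J_ideal]] by blast
    qed (rule J_mult)
  qed
  show "J (i + j) \<subseteq> J i \<cdot>\<^bsub>L\<^esub> J j"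
  proof
    fix a assume "a \<in> J (i + j)"
    then obtain f where f: "f \<in> long i \<cdot>\<^bsub>kQ\<^esub> long j" "a = \<phi> f" unfolding long_prod J_def by blast
    have "f \<in> carrier kQ \<and> \<phi> f \<in> J i \<cdot>\<^bsub>L\<^esub> J j" using f(1)
    proof (induction rule: ideal_prod.induct)
      case (prod f g)
      then show ?case
        using long_closed[of f i] long_closed[of g j]
        by (auto simp: \<phi>_mult J_def kQ_mult_closed intro!: ideal_prod.prod)
    next
      case (sum f g)
      then show ?case by (auto simp: \<phi>_add simp del: kQ_simps intro!: ideal_prod.sum)
    qed
    then show "a \<in> J i \<cdot>\<^bsub>L\<^esub> J j" using f(2) by simp
  qed
qed

text \<open>The classes of the arrows from \<open>x\<close> to \<open>y\<close> form a basis. They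
  span, because modulo \<open>J 2\<close> only paths of length one count and multiplication by
  vertices on both sides keeps those from \<open>x\<close> to \<open>y\<close>. They are
  independent, because a combination of arrows sent into \<open>J 2\<close> differs from an element
  of \<open>long 2\<close> by a member of the kernel, hence lies in \<open>long 2\<close>, where
  arrows have coefficient zero.\<close>

lemma arrow_space_dim:
  assumes x: "x \<in> verts Q" and y: "y \<in> verts Q"
  shows "has_dim K (arrow_space L y x) (card {a \<in> arcs Q. tail Q a = x \<and> head Q a = y})"
proof -
  let ?X = "{a \<in> arcs Q. tail Q a = x \<and> head Q a = y}"
  let ?V = "arrow_space L y x"
  let ?q = "\<lambda>a. J 2 +>\<^bsub>L\<^esub> a" and ?p = "push K (arrow_path Q)"
  let ?F = "free_space K ?X"
  define \<theta> where "\<theta> = (\<lambda>f. ?q (\<phi> (?p f)))"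
  note sub = L.ideal_submodule[OF J_ideal[of 2]]
  interpret J2: ideal "J 2" L by (rule J_ideal)
  \<comment> \<open>The recursive power starts from the unit ideal, which is
    \<open>J 0\<close>.\<close>
  have "J 1 [^]\<^bsub>ideals_set L\<^esub> (2::nat) = (J 0 \<cdot>\<^bsub>L\<^esub> J 1) \<cdot>\<^bsub>L\<^esub> J 1"
    by (simp add: nat_pow_def ideals_set_def J_0 numeral_2_eq_2)
  then have V: "?V = (quot_mod L (J 2))\<lparr>carrier := {?q (y \<otimes>\<^bsub>L\<^esub> r \<otimes>\<^bsub>L\<^esub> x) | r. r \<in> J 1}\<rparr>"
    by (simp add: arrow_space_def Let_def jacobson_rad_eq J_prod numeral_2_eq_2)
  have inj: "inj (arrow_path Q)" by (auto simp: inj_def arrow_path_def)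
  have p_lin: "?p \<in> lin_map K ?F (free_space K (long_paths 1))"
    by (rule push_lin_map[OF K.field_axioms]) (auto simp: long_paths_def arrow_path_def[of Q] paths_iff arc_implies_awalk)
  have p_long: "?p f \<in> long 1" if "f \<in> fin_supp K ?X" for f
    using lin_map_closed[OF p_lin] that by (simp add: long_def)
  \<comment> \<open>The sandwich by the two vertices, considered on all combinations of paths of
    positive length. It shows both that \<open>\<theta>\<close> takes values in the corner and that
    it reaches all of it.\<close>
  define \<Phi> where "\<Phi> = (\<lambda>f. ?q (\<phi> (vtx y \<otimes>\<^bsub>kQ\<^esub> f \<otimes>\<^bsub>kQ\<^esub> vtx x)))"
  have q_lin: "?q \<in> lin_map K L (quot_mod L (J 2))" by (rule L.quot_class_lin_map[OF sub])
  have \<Phi>_lin: "\<Phi> \<in> lin_map K (free_space K (long_paths 1)) (quot_mod L (J 2))"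
    unfolding \<Phi>_def using x y
    by (intro lin_map_long lin_map_comp[OF lin_map_comp[OF _ \<phi>_lin] q_lin]
        lin_map_comp[OF kQ_mult_lin_map_right kQ_mult_lin_map_left]) simp_all
  have \<theta>_lin': "\<theta> \<in> lin_map K ?F (quot_mod L (J 2))"
    unfolding \<theta>_def by (rule lin_map_comp[OF lin_map_comp[OF p_lin lin_map_long[OF \<phi>_lin]] q_lin])
  note QM = L.quot_mod_module[OF sub]
  have \<theta>_\<Phi>: "\<theta> f = \<Phi> (?p f)" if "f \<in> fin_supp K ?X" for f
  proof (rule lin_map_eq_on_delta[OF K.field_axioms QM \<theta>_lin' lin_map_comp[OF p_lin \<Phi>_lin] _ that])
    fix a assume "a \<in> ?X"
    then show "\<theta> (delta K a) = \<Phi> (?p (delta K a))"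
      unfolding \<theta>_def \<Phi>_def using x y
      by (simp add: push_delta[OF K.field_axioms] vtx_mult_delta del: kQ_simps)
  qed
  have \<Phi>_in: "\<Phi> f \<in> carrier ?V" if "f \<in> long 1" for f
  proof -
    have "\<Phi> f = ?q (y \<otimes>\<^bsub>L\<^esub> \<phi> f \<otimes>\<^bsub>L\<^esub> x)"
      using x y long_closed[OF that] unfolding \<Phi>_def
      by (simp add: \<phi>_mult \<phi>_vtx kQ_mult_closed)
    then show ?thesis using that by (auto simp: V J_def)
  qed
  have \<theta>_lin: "\<theta> \<in> lin_map K ?F ?V"
  proof (rule lin_mapI)
    show "\<theta> f \<in> carrier ?V" if "f \<in> carrier ?F" for f
      using that \<theta>_\<Phi> \<Phi>_in p_long by simp
  qed (use lin_map_add[OF \<theta>_lin'] lin_map_smult[OF \<theta>_lin'] in \<open>simp_all add: V\<close>)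
  have surj: "\<theta> ` carrier ?F = carrier ?V"
  proof
    show "\<theta> ` carrier ?F \<subseteq> carrier ?V" using lin_map_closed[OF \<theta>_lin] by blast
    have "\<Phi> f \<in> \<theta> ` fin_supp K ?X" if "f \<in> fin_supp K (long_paths 1)" for f
      using that
    proof (induction rule: fin_supp_induct[OF K.field_axioms, consumes 1, case_names zero add delta])
      case zero
      have "\<Phi> (\<lambda>_. \<zero>\<^bsub>K\<^esub>) = \<theta> (\<lambda>_. \<zero>\<^bsub>K\<^esub>)"
        using lin_map_zero[OF free_space_module[OF K.field_axioms] QM \<Phi>_lin]
          lin_map_zero[OF free_space_module[OF K.field_axioms] QM \<theta>_lin'] by simp
      then show ?case using fin_supp_zero[OF K.field_axioms] by blast
    next
      case (add f g)
      then obtain f' g' where *: "f' \<in> fin_supp K ?X" "\<Phi> f = \<theta> f'" "g' \<in> fin_supp K ?X" "\<Phi> g = \<theta> g'" by blast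
      have "\<Phi> (\<lambda>x. f x \<oplus>\<^bsub>K\<^esub> g x) = \<theta> (\<lambda>x. f' x \<oplus>\<^bsub>K\<^esub> g' x)"
        using lin_map_add[OF \<Phi>_lin, of f g] lin_map_add[OF \<theta>_lin', of f' g'] add * by simp
      then show ?case using fin_supp_add[OF K.field_axioms *(1,3)] by blast
    next
      case (delta c \<gamma>)
      have \<gamma>: "\<gamma> \<in> paths Q" "1 \<le> length (snd \<gamma>)" using delta by (simp_all add: long_paths_def)
      have \<Phi>c: "\<Phi> (\<lambda>z. c \<otimes>\<^bsub>K\<^esub> delta K \<gamma> z) = c \<odot>\<^bsub>quot_mod L (J 2)\<^esub> \<Phi> (delta K \<gamma>)"
        using lin_map_smult[OF \<Phi>_lin delta(1), of "delta K \<gamma>"] delta(2)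
        by (simp add: delta_in_fin_supp[OF K.field_axioms] del: quot_mod_simps)
      have "\<exists>f'\<in>fin_supp K ?X. \<Phi> (delta K \<gamma>) = \<theta> f'"
      proof (cases "length (snd \<gamma>) = 1 \<and> path_start \<gamma> = x \<and> path_end Q \<gamma> = y")
        case True
        then obtain a where a: "a \<in> arcs Q" "\<gamma> = arrow_path Q a" using arrow_path_of_length_1[OF \<gamma>(1)] by blast
        then have "a \<in> ?X" using True by simp
        then have "delta K a \<in> fin_supp K ?X" by (simp add: delta_in_fin_supp[OF K.field_axioms])
        moreover have "\<Phi> (delta K \<gamma>) = \<theta> (delta K a)"
          using \<theta>_\<Phi>[OF calculation] a by (simp add: push_delta[OF K.field_axioms])
        ultimately show ?thesis by blast
      next
        case False
        \<comment> \<open>Either an endpoint is wrong and the sandwich is zero, or the path has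
          length at least two.\<close>
        have "vtx y \<otimes>\<^bsub>kQ\<^esub> delta K \<gamma> \<otimes>\<^bsub>kQ\<^esub> vtx x \<in> long 2"
        proof (cases "path_start \<gamma> = x \<and> path_end Q \<gamma> = y")
          case True
          then have "2 \<le> length (snd \<gamma>)" using False \<gamma>(2) by linarith
          then show ?thesis using True \<gamma> x y by (simp add: vtx_mult_delta long_delta del: kQ_simps)
        next
          case False
          have "vtx y \<otimes>\<^bsub>kQ\<^esub> delta K \<gamma> \<otimes>\<^bsub>kQ\<^esub> vtx x = \<zero>\<^bsub>kQ\<^esub>"
            using False \<gamma> x y kQ.A.l_null[of "vtx x"] by (auto simp: vtx_mult_delta simp del: kQ_simps(2))
          then show ?thesis using additive_subgroup.zero_closed[OF ideal.axioms(1)[OF long_ideal]] by simp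
        qed
        then have "\<phi> (vtx y \<otimes>\<^bsub>kQ\<^esub> delta K \<gamma> \<otimes>\<^bsub>kQ\<^esub> vtx x) \<in> J 2" by (simp add: J_def)
        then have "\<Phi> (delta K \<gamma>) = J 2" unfolding \<Phi>_def by (rule J2.a_rcos_const)
        also have "J 2 = \<theta> (\<lambda>_. \<zero>\<^bsub>K\<^esub>)"
          using lin_map_zero[OF free_space_module[OF K.field_axioms] QM \<theta>_lin'] by simp
        finally show ?thesis using fin_supp_zero[OF K.field_axioms] by blast
      qed
      then obtain f' where f': "f' \<in> fin_supp K ?X" "\<Phi> (delta K \<gamma>) = \<theta> f'" by blast
      have "\<Phi> (\<lambda>z. c \<otimes>\<^bsub>K\<^esub> delta K \<gamma> z) = \<theta> (\<lambda>z. c \<otimes>\<^bsub>K\<^esub> f' z)"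
        using \<Phi>c f' lin_map_smult[OF \<theta>_lin' delta(1), of f'] by (simp del: quot_mod_simps)
      then show ?case using fin_supp_smult[OF K.field_axioms delta(1) f'(1)] by blast
    qed
    note \<Phi>_\<theta> = this
    show "carrier ?V \<subseteq> \<theta> ` carrier ?F"
    proof
      fix v assume "v \<in> carrier ?V"
      then obtain r where r: "r \<in> J 1" "v = ?q (y \<otimes>\<^bsub>L\<^esub> r \<otimes>\<^bsub>L\<^esub> x)" by (auto simp: V)
      then obtain f where f: "f \<in> long 1" "r = \<phi> f" by (auto simp: J_def)
      then have "v = \<Phi> f" using r(2) x y long_closed[OF f(1)] unfolding \<Phi>_def
        by (simp add: \<phi>_mult \<phi>_vtx kQ_mult_closed)
      then show "v \<in> \<theta> ` carrier ?F" using \<Phi>_\<theta>[of f] f(1) by (simp add: long_def)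
    qed
  qed
  have V_mod: "Module.module K ?V"
    using lin_map_zero[OF free_space_module[OF K.field_axioms] QM \<theta>_lin']
    by (intro module_surj_image[OF free_space_module[OF K.field_axioms] surj _ \<theta>_lin]) (simp add: V)
  have "inj_on \<theta> (carrier ?F)"
  proof (rule lin_map_inj_onI[OF free_space_module[OF K.field_axioms] V_mod \<theta>_lin])
    fix f assume "f \<in> carrier ?F" and zero: "\<theta> f = \<zero>\<^bsub>?V\<^esub>"
    then have f: "f \<in> fin_supp K ?X" by simp
    have pf: "?p f \<in> carrier kQ" by (rule long_closed[OF p_long[OF f]])
    have "?q (\<phi> (?p f)) = J 2" using zero by (simp add: \<theta>_def V)
    then have "\<phi> (?p f) \<in> J 2" using J2.rcos_const_imp_mem \<phi>_closed[OF pf] by blast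
    \<comment> \<open>A second preimage, made of paths of length at least two; the difference of the
      two lies in the kernel and so in \<open>long 2\<close>.\<close>
    then obtain l where l: "l \<in> long 2" "\<phi> (?p f) = \<phi> l" by (auto simp: J_def)
    have lc: "l \<in> carrier kQ" by (rule long_closed[OF l(1)])
    have "\<phi> (?p f \<ominus>\<^bsub>kQ\<^esub> l) = \<zero>\<^bsub>L\<^esub>"
      using lin_map_minus[OF kQ_module L.module_axioms \<phi>_lin pf lc] l(2) \<phi>_closed[OF lc]
      by (simp add: L.A.minus_eq L.A.r_neg)
    then have "?p f \<ominus>\<^bsub>kQ\<^esub> l \<in> long 2" using pf lc by (intro \<phi>_ker kQ.A.minus_closed)
    then have "(?p f \<ominus>\<^bsub>kQ\<^esub> l) \<oplus>\<^bsub>kQ\<^esub> l \<in> long 2"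
      using l(1) by (rule additive_subgroup.a_closed[OF ideal.axioms(1)[OF long_ideal]])
    then have "?p f \<in> long 2"
      using pf lc by (simp add: kQ.A.minus_eq kQ.A.a_assoc kQ.A.l_neg del: kQ_simps)
    then have "?p f (arrow_path Q a) = \<zero>\<^bsub>K\<^esub>" for a by (simp add: long_iff arrow_path_def)
    then have "f a = \<zero>\<^bsub>K\<^esub>" for a using push_inj_image[OF K.field_axioms f inj] by simp
    then show "f = \<zero>\<^bsub>?F\<^esub>" by auto
  qed
  with surj have bij: "bij_betw \<theta> (fin_supp K ?X) (carrier ?V)"
    unfolding bij_betw_def free_space_simps by (intro conjI)
  have "finite ?X" by (rule finite_subset[OF _ finite_arcs]) blast
  then show ?thesis by (rule has_dim_of_free_space_iso[OF K.field_axioms V_mod _ \<theta>_lin bij])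
qed

lemma gabriel_quiver:
  assumes "finite_dim K L"
  shows "gabriel_quiver K L Q"
  unfolding gabriel_quiver_def basic_sober_def
  using L.k_algebra_axioms assms quotient_iso_power vertices_complete arrow_space_dim Q.fin_digraph_axioms
  by (auto simp: jacobson_rad_eq)

end

lemma lin_map_restrict:
  assumes "f \<in> lin_map K V W" "H \<subseteq> carrier V"
  shows "f \<in> lin_map K (V\<lparr>carrier := H\<rparr>) W"
proof (rule lin_mapI)
  have sub: "x \<in> carrier V" if "x \<in> carrier (V\<lparr>carrier := H\<rparr>)" for x
    using that assms(2) by auto
  show "f x \<in> carrier W" if "x \<in> carrier (V\<lparr>carrier := H\<rparr>)" for x
    by (rule lin_map_closed[OF assms(1) sub[OF that]])
  show "f (x \<oplus>\<^bsub>V\<lparr>carrier := H\<rparr>\<^esub> y) = f x \<oplus>\<^bsub>W\<^esub> f y"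
    if "x \<in> carrier (V\<lparr>carrier := H\<rparr>)" "y \<in> carrier (V\<lparr>carrier := H\<rparr>)" for x y
    using lin_map_add[OF assms(1) sub[OF that(1)] sub[OF that(2)]] by simp
  show "f (c \<odot>\<^bsub>V\<lparr>carrier := H\<rparr>\<^esub> x) = c \<odot>\<^bsub>W\<^esub> f x"
    if "c \<in> carrier K" "x \<in> carrier (V\<lparr>carrier := H\<rparr>)" for c x
    using lin_map_smult[OF assms(1) that(1) sub[OF that(2)]] by simp
qed

text \<open>A set-theoretic section of \<open>\<theta>\<close> is composed with \<open>f\<close>. By
  the kernel condition the result does not depend on the section, which makes it linear.\<close>

lemma lin_map_factor:
  assumes V: "Module.module K V" and W: "Module.module K W" and U: "Module.module K U"
    and \<theta>: "\<theta> \<in> lin_map K V W" "\<theta> ` carrier V = carrier W" and f: "f \<in> lin_map K V U"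
    and ker: "\<And>x. \<lbrakk>x \<in> carrier V; \<theta> x = \<zero>\<^bsub>W\<^esub>\<rbrakk> \<Longrightarrow> f x = \<zero>\<^bsub>U\<^esub>"
  obtains \<rho> where "\<rho> \<in> lin_map K W U" "\<And>x. x \<in> carrier V \<Longrightarrow> \<rho> (\<theta> x) = f x"
proof -
  interpret V: Module.module K V by fact
  interpret W: Module.module K W by fact
  interpret U: Module.module K U by fact
  define s where "s = inv_into (carrier V) \<theta>"
  have s: "s y \<in> carrier V" "\<theta> (s y) = y" if "y \<in> carrier W" for y
    using that \<theta>(2) by (simp_all add: s_def inv_into_into f_inv_into_f)
  have eq: "f x = f y" if xy: "x \<in> carrier V" "y \<in> carrier V" "\<theta> x = \<theta> y" for x y
  proof -
    have "\<theta> (x \<ominus>\<^bsub>V\<^esub> y) = \<zero>\<^bsub>W\<^esub>"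
      using lin_map_minus[OF V W \<theta>(1) xy(1,2)] lin_map_closed[OF \<theta>(1) xy(2)] xy(3)
      by (simp add: W.M.minus_eq W.M.r_neg)
    then have "f (x \<ominus>\<^bsub>V\<^esub> y) = \<zero>\<^bsub>U\<^esub>" using ker xy by simp
    moreover have "x = (x \<ominus>\<^bsub>V\<^esub> y) \<oplus>\<^bsub>V\<^esub> y"
      using xy by (simp add: V.M.minus_eq V.M.a_assoc V.M.l_neg)
    then have "f x = f (x \<ominus>\<^bsub>V\<^esub> y) \<oplus>\<^bsub>U\<^esub> f y"
      using lin_map_add[OF f, of "x \<ominus>\<^bsub>V\<^esub> y" y] xy by simp
    ultimately show ?thesis using lin_map_closed[OF f xy(2)] by simp
  qed
  define \<rho> where "\<rho> = (\<lambda>y. f (s y))"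
  have \<rho>: "\<rho> (\<theta> x) = f x" if "x \<in> carrier V" for x
    unfolding \<rho>_def using that s[of "\<theta> x"] lin_map_closed[OF \<theta>(1) that] by (intro eq)
  have "\<rho> \<in> lin_map K W U"
  proof (rule lin_mapI)
    fix y assume "y \<in> carrier W"
    then obtain x where x: "x \<in> carrier V" "y = \<theta> x" using \<theta>(2) by blast
    show "\<rho> y \<in> carrier U" unfolding x(2) \<rho>[OF x(1)] by (rule lin_map_closed[OF f x(1)])
    show "\<rho> (c \<odot>\<^bsub>W\<^esub> y) = c \<odot>\<^bsub>U\<^esub> \<rho> y" if c: "c \<in> carrier K" for c
      unfolding x(2) \<rho>[OF x(1)] lin_map_smult[OF \<theta>(1) c x(1), symmetric]
      using \<rho>[OF V.smult_closed[OF c x(1)]] lin_map_smult[OF f c x(1)] by simp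
    fix z assume "z \<in> carrier W"
    then obtain x' where x': "x' \<in> carrier V" "z = \<theta> x'" using \<theta>(2) by blast
    show "\<rho> (y \<oplus>\<^bsub>W\<^esub> z) = \<rho> y \<oplus>\<^bsub>U\<^esub> \<rho> z"
      unfolding x(2) x'(2) \<rho>[OF x(1)] \<rho>[OF x'(1)] lin_map_add[OF \<theta>(1) x(1) x'(1), symmetric]
      using \<rho>[OF V.M.a_closed[OF x(1) x'(1)]] lin_map_add[OF f x(1) x'(1)] by simp
  qed
  then show thesis using \<rho> by (rule that)
qed

section \<open>Null-square algebras\<close>

locale quiver_embedding = S: quiver_algebra K S + Q: quiver_algebra K Q
  for K :: "('k, 'r) ring_scheme" and S :: "('v, 'p) pre_digraph" and Q :: "('w, 'q) pre_digraph" +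
  fixes i :: "'v \<Rightarrow> 'w" and k :: "'p \<Rightarrow> 'q"
  assumes i_verts: "x \<in> verts S \<Longrightarrow> i x \<in> verts Q" and k_arcs: "a \<in> arcs S \<Longrightarrow> k a \<in> arcs Q"
    and k_tail: "a \<in> arcs S \<Longrightarrow> tail Q (k a) = i (tail S a)"
    and k_head: "a \<in> arcs S \<Longrightarrow> head Q (k a) = i (head S a)"
    and i_inj: "inj_on i (verts S)"
begin

definition path_map :: "('v, 'p) path \<Rightarrow> ('w, 'q) path" where
  "path_map \<gamma> = (i (fst \<gamma>), map k (snd \<gamma>))"

definition j :: "(('v, 'p) path \<Rightarrow> 'k) \<Rightarrow> ('w, 'q) path \<Rightarrow> 'k" where
  "j = push K path_map"

lemma path_map_simps [simp]:
  "path_map (vertex_path x) = vertex_path (i x)"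
  "path_map (path_comp \<alpha> \<beta>) = path_comp (path_map \<alpha>) (path_map \<beta>)"
  "path_start (path_map \<gamma>) = i (path_start \<gamma>)"
  "length (snd (path_map \<gamma>)) = length (snd \<gamma>)"
  by (simp_all add: path_map_def vertex_path_def path_comp_def path_start_def)

lemma path_map_arrow: "a \<in> arcs S \<Longrightarrow> path_map (arrow_path S a) = arrow_path Q (k a)"
  by (simp add: path_map_def arrow_path_def k_tail)

lemma path_map_path:
  assumes "\<gamma> \<in> paths S"
  shows "path_map \<gamma> \<in> paths Q \<and> path_end Q (path_map \<gamma>) = i (path_end S \<gamma>)"
  using assms
proof (induction rule: S.path_induct)
  case (vertex x)
  then show ?case by (simp add: i_verts)
next
  case (arrow a \<gamma>)
  then show ?case
    by (simp add: path_map_arrow k_arcs k_tail k_head Q.path_comp_closed Q.path_end_comp S.path_end_comp)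
qed

lemma j_lin: "j \<in> lin_map K S.kQ Q.kQ"
  unfolding j_def S.kQ_lin_map Q.kQ_lin_map
  by (rule push_lin_map[OF S.K.field_axioms]) (simp add: path_map_path)

lemma j_closed: "f \<in> carrier S.kQ \<Longrightarrow> j f \<in> carrier Q.kQ"
  by (rule lin_map_closed[OF j_lin])

lemma j_delta: "j (delta K \<gamma>) = delta K (path_map \<gamma>)"
  unfolding j_def by (rule push_delta[OF S.K.field_axioms])

lemma j_zero: "j \<zero>\<^bsub>S.kQ\<^esub> = \<zero>\<^bsub>Q.kQ\<^esub>"
  by (rule lin_map_zero[OF S.kQ_module Q.kQ_module j_lin])

text \<open>Composable pairs of paths stay composable, and injectivity on vertices keeps all other
  pairs noncomposable, so that both products vanish.\<close>

lemma j_mult: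
  assumes f: "f \<in> carrier S.kQ" and g: "g \<in> carrier S.kQ"
  shows "j (f \<otimes>\<^bsub>S.kQ\<^esub> g) = j f \<otimes>\<^bsub>Q.kQ\<^esub> j g"
proof -
  have dd: "j (delta K \<alpha> \<otimes>\<^bsub>S.kQ\<^esub> delta K \<beta>) = j (delta K \<alpha>) \<otimes>\<^bsub>Q.kQ\<^esub> j (delta K \<beta>)"
    if "\<alpha> \<in> paths S" "\<beta> \<in> paths S" for \<alpha> \<beta>
    using that path_map_path[OF that(1)] path_map_path[OF that(2)] j_zero inj_onD[OF i_inj, of "path_start \<alpha>" "path_end S \<beta>"]
    by (auto simp: S.kQ_mult_delta Q.kQ_mult_delta j_delta)
  have df: "j (delta K \<alpha> \<otimes>\<^bsub>S.kQ\<^esub> g) = j (delta K \<alpha>) \<otimes>\<^bsub>Q.kQ\<^esub> j g" if "\<alpha> \<in> paths S" for \<alpha>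
  proof (rule S.kQ_lin_map_eqI[OF Q.kQ_module _ _ _ g])
    show "(\<lambda>g. j (delta K \<alpha> \<otimes>\<^bsub>S.kQ\<^esub> g)) \<in> lin_map K S.kQ Q.kQ"
      using that by (intro lin_map_comp[OF S.kQ_mult_lin_map_right j_lin]) simp
    show "(\<lambda>g. j (delta K \<alpha>) \<otimes>\<^bsub>Q.kQ\<^esub> j g) \<in> lin_map K S.kQ Q.kQ"
      using that by (intro lin_map_comp[OF j_lin Q.kQ.lin_map_mult_right] j_closed) simp
  qed (rule dd[OF that])
  show ?thesis
  proof (rule S.kQ_lin_map_eqI[OF Q.kQ_module _ _ _ f])
    show "(\<lambda>f. j (f \<otimes>\<^bsub>S.kQ\<^esub> g)) \<in> lin_map K S.kQ Q.kQ"
      using g by (intro lin_map_comp[OF S.kQ_mult_lin_map_left j_lin]) simp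
    show "(\<lambda>f. j f \<otimes>\<^bsub>Q.kQ\<^esub> j g) \<in> lin_map K S.kQ Q.kQ"
      using g by (intro lin_map_comp[OF j_lin Q.kQ.lin_map_mult_left] j_closed)
  qed (rule df)
qed

lemma j_long: "f \<in> S.long n \<Longrightarrow> j f \<in> Q.long n"
proof -
  assume f: "f \<in> S.long n"
  have "j \<in> lin_map K (free_space K (S.long_paths n)) (free_space K (Q.long_paths n))"
    unfolding j_def by (rule push_lin_map[OF S.K.field_axioms])
      (use path_map_path in \<open>auto simp: S.long_paths_def Q.long_paths_def\<close>)
  from lin_map_closed[OF this] f show ?thesis by (simp add: S.long_def Q.long_def)
qed

text \<open>The preimage of an ideal under \<open>j\<close> is an ideal; multiplicativity suffices
  for this, although \<open>j\<close> may send the unit to a proper idempotent.\<close>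

lemma j_genideal:
  assumes R: "R \<subseteq> carrier S.kQ" and I: "ideal I Q.kQ" and jR: "j ` R \<subseteq> I"
    and f: "f \<in> Idl\<^bsub>S.kQ\<^esub> R"
  shows "j f \<in> I"
proof -
  interpret I: ideal I Q.kQ by (rule I)
  let ?P = "{f \<in> carrier S.kQ. j f \<in> I}"
  have "ideal ?P S.kQ"
  proof (rule S.kQ.ideal_of_subspace)
    show "?P \<subseteq> carrier S.kQ" by blast
    show "\<zero>\<^bsub>S.kQ\<^esub> \<in> ?P" unfolding mem_Collect_eq j_zero using S.kQ.A.zero_closed I.zero_closed by blast
    show "x \<oplus>\<^bsub>S.kQ\<^esub> y \<in> ?P" if "x \<in> ?P" "y \<in> ?P" for x y
    proof -
      have xy: "x \<in> carrier S.kQ" "y \<in> carrier S.kQ" using that by blast+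
      then show ?thesis
        using that S.kQ.A.a_closed[OF xy] I.a_closed unfolding mem_Collect_eq lin_map_add[OF j_lin xy] by blast
    qed
    show "c \<odot>\<^bsub>S.kQ\<^esub> x \<in> ?P" if "c \<in> carrier K" "x \<in> ?P" for c x
    proof -
      have x: "x \<in> carrier S.kQ" "j x \<in> I" using that by blast+
      show ?thesis
        unfolding mem_Collect_eq lin_map_smult[OF j_lin that(1) x(1)]
        using S.kQ.smult_closed[OF that(1) x(1)] Q.kQ.smult_mem_ideal[OF I that(1) x(2)] by blast
    qed
    show "x \<otimes>\<^bsub>S.kQ\<^esub> y \<in> ?P" if "x \<in> carrier S.kQ" "y \<in> ?P" for x y
    proof -
      have y: "y \<in> carrier S.kQ" "j y \<in> I" using that by blast+
      show ?thesis
        unfolding mem_Collect_eq j_mult[OF that(1) y(1)]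
        using S.kQ.A.m_closed[OF that(1) y(1)] I.I_l_closed[OF y(2) j_closed[OF that(1)]] by blast
    qed
    show "y \<otimes>\<^bsub>S.kQ\<^esub> x \<in> ?P" if "x \<in> carrier S.kQ" "y \<in> ?P" for x y
    proof -
      have y: "y \<in> carrier S.kQ" "j y \<in> I" using that by blast+
      show ?thesis
        unfolding mem_Collect_eq j_mult[OF y(1) that(1)]
        using S.kQ.A.m_closed[OF y(1) that(1)] I.I_r_closed[OF y(2) j_closed[OF that(1)]] by blast
    qed
  qed
  then have "Idl\<^bsub>S.kQ\<^esub> R \<subseteq> ?P" using R jR by (intro S.kQ.A.genideal_minimal) auto
  then show ?thesis using f by blast
qed

end

section \<open>The algebra structure of null-square algebras\<close>

context k_bimodule
begin

lemma lact_lin_map: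
  shows lact_lin_map_left: "x \<in> carrier M \<Longrightarrow> (\<lambda>b. lact M b x) \<in> lin_map K B M"
    and lact_lin_map_right: "b \<in> carrier B \<Longrightarrow> (\<lambda>x. lact M b x) \<in> lin_map K M M"
    and ract_lin_map_left: "a \<in> carrier A \<Longrightarrow> (\<lambda>x. ract M x a) \<in> lin_map K M M"
    and ract_lin_map_right: "x \<in> carrier M \<Longrightarrow> (\<lambda>a. ract M x a) \<in> lin_map K A M"
  by (rule lin_mapI; simp add: lact_closed ract_closed lact_add_left lact_add_right ract_add_left
      ract_add_right lact_smult_left lact_smult_right ract_smult_left ract_smult_right)+

lemma act_zero [simp]:
  "x \<in> carrier M \<Longrightarrow> lact M \<zero>\<^bsub>B\<^esub> x = \<zero>\<^bsub>M\<^esub>" "b \<in> carrier B \<Longrightarrow> lact M b \<zero>\<^bsub>M\<^esub> = \<zero>\<^bsub>M\<^esub>"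
  "a \<in> carrier A \<Longrightarrow> ract M \<zero>\<^bsub>M\<^esub> a = \<zero>\<^bsub>M\<^esub>" "x \<in> carrier M \<Longrightarrow> ract M x \<zero>\<^bsub>A\<^esub> = \<zero>\<^bsub>M\<^esub>"
  using lin_map_zero[OF B.module_axioms M.module_axioms lact_lin_map_left]
    lin_map_zero[OF M.module_axioms M.module_axioms lact_lin_map_right]
    lin_map_zero[OF M.module_axioms M.module_axioms ract_lin_map_left]
    lin_map_zero[OF A.module_axioms M.module_axioms ract_lin_map_right]
  by blast+

end

locale null_square = MM: k_bimodule K B A M + NN: k_bimodule K A B N
  for K :: "('k, 'r) ring_scheme" and A :: "('k, 'a, 'x) module_scheme" and B :: "('k, 'b, 'y) module_scheme"
    and M :: "('k, 'b, 'a, 'm) bimod" and N :: "('k, 'a, 'b, 'n) bimod"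
begin

abbreviation "\<Lambda> \<equiv> null_square_algebra A N M B"

lemma \<Lambda>_simps [simp]:
  "(a, n, m, b) \<in> carrier \<Lambda> \<longleftrightarrow> a \<in> carrier A \<and> n \<in> carrier N \<and> m \<in> carrier M \<and> b \<in> carrier B"
  "(a, n, m, b) \<otimes>\<^bsub>\<Lambda>\<^esub> (a', n', m', b') =
    (a \<otimes>\<^bsub>A\<^esub> a', lact N a n' \<oplus>\<^bsub>N\<^esub> ract N n b', ract M m a' \<oplus>\<^bsub>M\<^esub> lact M b m', b \<otimes>\<^bsub>B\<^esub> b')"
  "\<one>\<^bsub>\<Lambda>\<^esub> = (\<one>\<^bsub>A\<^esub>, \<zero>\<^bsub>N\<^esub>, \<zero>\<^bsub>M\<^esub>, \<one>\<^bsub>B\<^esub>)" "\<zero>\<^bsub>\<Lambda>\<^esub> = (\<zero>\<^bsub>A\<^esub>, \<zero>\<^bsub>N\<^esub>, \<zero>\<^bsub>M\<^esub>, \<zero>\<^bsub>B\<^esub>)"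
  "(a, n, m, b) \<oplus>\<^bsub>\<Lambda>\<^esub> (a', n', m', b') = (a \<oplus>\<^bsub>A\<^esub> a', n \<oplus>\<^bsub>N\<^esub> n', m \<oplus>\<^bsub>M\<^esub> m', b \<oplus>\<^bsub>B\<^esub> b')"
  "c \<odot>\<^bsub>\<Lambda>\<^esub> (a, n, m, b) = (c \<odot>\<^bsub>A\<^esub> a, c \<odot>\<^bsub>N\<^esub> n, c \<odot>\<^bsub>M\<^esub> m, c \<odot>\<^bsub>B\<^esub> b)"
  by (simp_all add: null_square_algebra_def)

lemma \<Lambda>_cases:
  assumes "z \<in> carrier \<Lambda>"
  obtains a n m b where "z = (a, n, m, b)" "a \<in> carrier A" "n \<in> carrier N" "m \<in> carrier M" "b \<in> carrier B"
  using assms by (cases z) auto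

lemma \<Lambda>_module: "Module.module K \<Lambda>"
proof (intro moduleI abelian_groupI)
  show "cring K" by (rule MM.B.K.is_cring)
  show "\<zero>\<^bsub>\<Lambda>\<^esub> \<in> carrier \<Lambda>" by simp
  fix x assume x: "x \<in> carrier \<Lambda>"
  obtain a n m b where x': "x = (a, n, m, b)" "a \<in> carrier A" "n \<in> carrier N" "m \<in> carrier M" "b \<in> carrier B"
    using \<Lambda>_cases[OF x] .
  show "\<zero>\<^bsub>\<Lambda>\<^esub> \<oplus>\<^bsub>\<Lambda>\<^esub> x = x" using x' by simp
  show "\<exists>y\<in>carrier \<Lambda>. y \<oplus>\<^bsub>\<Lambda>\<^esub> x = \<zero>\<^bsub>\<Lambda>\<^esub>"
    using x' by (intro bexI[of _ "(\<ominus>\<^bsub>A\<^esub> a, \<ominus>\<^bsub>N\<^esub> n, \<ominus>\<^bsub>M\<^esub> m, \<ominus>\<^bsub>B\<^esub> b)"])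
      (simp_all add: MM.A.A.l_neg MM.B.A.l_neg MM.M.M.l_neg NN.M.M.l_neg)
  show "\<one>\<^bsub>K\<^esub> \<odot>\<^bsub>\<Lambda>\<^esub> x = x" using x' by simp
  { fix c assume c: "c \<in> carrier K"
    show "c \<odot>\<^bsub>\<Lambda>\<^esub> x \<in> carrier \<Lambda>" using x' c by simp
    fix d assume d: "d \<in> carrier K"
    show "(c \<oplus>\<^bsub>K\<^esub> d) \<odot>\<^bsub>\<Lambda>\<^esub> x = c \<odot>\<^bsub>\<Lambda>\<^esub> x \<oplus>\<^bsub>\<Lambda>\<^esub> d \<odot>\<^bsub>\<Lambda>\<^esub> x"
      using x' c d by (simp add: MM.A.smult_l_distr MM.B.smult_l_distr MM.M.smult_l_distr NN.M.smult_l_distr)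
    show "(c \<otimes>\<^bsub>K\<^esub> d) \<odot>\<^bsub>\<Lambda>\<^esub> x = c \<odot>\<^bsub>\<Lambda>\<^esub> (d \<odot>\<^bsub>\<Lambda>\<^esub> x)"
      using x' c d by (simp add: MM.A.smult_assoc1 MM.B.smult_assoc1 MM.M.smult_assoc1 NN.M.smult_assoc1) }
  fix y assume y: "y \<in> carrier \<Lambda>"
  obtain a2 n2 m2 b2 where y': "y = (a2, n2, m2, b2)" "a2 \<in> carrier A" "n2 \<in> carrier N" "m2 \<in> carrier M" "b2 \<in> carrier B"
    using \<Lambda>_cases[OF y] .
  show "x \<oplus>\<^bsub>\<Lambda>\<^esub> y \<in> carrier \<Lambda>" "x \<oplus>\<^bsub>\<Lambda>\<^esub> y = y \<oplus>\<^bsub>\<Lambda>\<^esub> x"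
    using x' y' by (simp_all add: MM.A.A.a_comm MM.B.A.a_comm MM.M.M.a_comm NN.M.M.a_comm)
  { fix c assume c: "c \<in> carrier K"
    show "c \<odot>\<^bsub>\<Lambda>\<^esub> (x \<oplus>\<^bsub>\<Lambda>\<^esub> y) = c \<odot>\<^bsub>\<Lambda>\<^esub> x \<oplus>\<^bsub>\<Lambda>\<^esub> c \<odot>\<^bsub>\<Lambda>\<^esub> y"
      using x' y' c by (simp add: MM.A.smult_r_distr MM.B.smult_r_distr MM.M.smult_r_distr NN.M.smult_r_distr) }
  fix z assume z: "z \<in> carrier \<Lambda>"
  obtain a3 n3 m3 b3 where z': "z = (a3, n3, m3, b3)" "a3 \<in> carrier A" "n3 \<in> carrier N" "m3 \<in> carrier M" "b3 \<in> carrier B"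
    using \<Lambda>_cases[OF z] .
  show "x \<oplus>\<^bsub>\<Lambda>\<^esub> y \<oplus>\<^bsub>\<Lambda>\<^esub> z = x \<oplus>\<^bsub>\<Lambda>\<^esub> (y \<oplus>\<^bsub>\<Lambda>\<^esub> z)"
    using x' y' z' by (simp add: MM.A.A.a_assoc MM.B.A.a_assoc MM.M.M.a_assoc NN.M.M.a_assoc)
qed

lemmas act_closed = MM.lact_closed MM.ract_closed NN.lact_closed NN.ract_closed

lemma \<Lambda>_algebra: "k_algebra K \<Lambda>"
proof (rule k_algebraI[OF MM.B.K.field_axioms \<Lambda>_module])
  show "\<one>\<^bsub>\<Lambda>\<^esub> \<in> carrier \<Lambda>" by simp
  fix x assume x: "x \<in> carrier \<Lambda>"
  obtain a n m b where x': "x = (a, n, m, b)" "a \<in> carrier A" "n \<in> carrier N" "m \<in> carrier M" "b \<in> carrier B"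
    using \<Lambda>_cases[OF x] .
  show "\<one>\<^bsub>\<Lambda>\<^esub> \<otimes>\<^bsub>\<Lambda>\<^esub> x = x" "x \<otimes>\<^bsub>\<Lambda>\<^esub> \<one>\<^bsub>\<Lambda>\<^esub> = x"
    using x' by (simp_all add: MM.lact_one MM.ract_one NN.lact_one NN.ract_one)
  have cl: "x \<otimes>\<^bsub>\<Lambda>\<^esub> y \<in> carrier \<Lambda>" "y \<otimes>\<^bsub>\<Lambda>\<^esub> x \<in> carrier \<Lambda>" if y: "y \<in> carrier \<Lambda>" for y
  proof -
    obtain a2 n2 m2 b2 where "y = (a2, n2, m2, b2)" "a2 \<in> carrier A" "n2 \<in> carrier N" "m2 \<in> carrier M" "b2 \<in> carrier B"
      using \<Lambda>_cases[OF y] .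
    then show "x \<otimes>\<^bsub>\<Lambda>\<^esub> y \<in> carrier \<Lambda>" "y \<otimes>\<^bsub>\<Lambda>\<^esub> x \<in> carrier \<Lambda>" using x' by (simp_all add: act_closed)
  qed
  show "(\<lambda>y. y \<otimes>\<^bsub>\<Lambda>\<^esub> x) \<in> lin_map K \<Lambda> \<Lambda>"
  proof (rule lin_mapI[OF cl(2)])
    fix y assume y: "y \<in> carrier \<Lambda>"
    obtain a2 n2 m2 b2 where y': "y = (a2, n2, m2, b2)" "a2 \<in> carrier A" "n2 \<in> carrier N" "m2 \<in> carrier M" "b2 \<in> carrier B"
      using \<Lambda>_cases[OF y] .
    show "(c \<odot>\<^bsub>\<Lambda>\<^esub> y) \<otimes>\<^bsub>\<Lambda>\<^esub> x = c \<odot>\<^bsub>\<Lambda>\<^esub> (y \<otimes>\<^bsub>\<Lambda>\<^esub> x)" if "c \<in> carrier K" for c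
      using x' y' that
      by (simp add: act_closed MM.A.smult_mult_left MM.B.smult_mult_left MM.lact_smult_left NN.lact_smult_left
          MM.ract_smult_left NN.ract_smult_left MM.M.smult_r_distr NN.M.smult_r_distr)
    fix z assume z: "z \<in> carrier \<Lambda>"
    obtain a3 n3 m3 b3 where z': "z = (a3, n3, m3, b3)" "a3 \<in> carrier A" "n3 \<in> carrier N" "m3 \<in> carrier M" "b3 \<in> carrier B"
      using \<Lambda>_cases[OF z] .
    show "(y \<oplus>\<^bsub>\<Lambda>\<^esub> z) \<otimes>\<^bsub>\<Lambda>\<^esub> x = y \<otimes>\<^bsub>\<Lambda>\<^esub> x \<oplus>\<^bsub>\<Lambda>\<^esub> z \<otimes>\<^bsub>\<Lambda>\<^esub> x"
      using x' y' z'
      by (simp add: act_closed MM.A.A.l_distr MM.B.A.l_distr MM.lact_add_left NN.lact_add_left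
          MM.ract_add_left NN.ract_add_left MM.M.M.a_ac NN.M.M.a_ac)
  qed
  show "(\<lambda>y. x \<otimes>\<^bsub>\<Lambda>\<^esub> y) \<in> lin_map K \<Lambda> \<Lambda>"
  proof (rule lin_mapI[OF cl(1)])
    fix y assume y: "y \<in> carrier \<Lambda>"
    obtain a2 n2 m2 b2 where y': "y = (a2, n2, m2, b2)" "a2 \<in> carrier A" "n2 \<in> carrier N" "m2 \<in> carrier M" "b2 \<in> carrier B"
      using \<Lambda>_cases[OF y] .
    show "x \<otimes>\<^bsub>\<Lambda>\<^esub> (c \<odot>\<^bsub>\<Lambda>\<^esub> y) = c \<odot>\<^bsub>\<Lambda>\<^esub> (x \<otimes>\<^bsub>\<Lambda>\<^esub> y)" if "c \<in> carrier K" for c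
      using x' y' that
      by (simp add: act_closed MM.A.smult_mult_right MM.B.smult_mult_right MM.lact_smult_right NN.lact_smult_right
          MM.ract_smult_right NN.ract_smult_right MM.M.smult_r_distr NN.M.smult_r_distr)
    fix z assume z: "z \<in> carrier \<Lambda>"
    obtain a3 n3 m3 b3 where z': "z = (a3, n3, m3, b3)" "a3 \<in> carrier A" "n3 \<in> carrier N" "m3 \<in> carrier M" "b3 \<in> carrier B"
      using \<Lambda>_cases[OF z] .
    show "x \<otimes>\<^bsub>\<Lambda>\<^esub> (y \<oplus>\<^bsub>\<Lambda>\<^esub> z) = x \<otimes>\<^bsub>\<Lambda>\<^esub> y \<oplus>\<^bsub>\<Lambda>\<^esub> x \<otimes>\<^bsub>\<Lambda>\<^esub> z"
      using x' y' z'
      by (simp add: act_closed MM.A.A.r_distr MM.B.A.r_distr MM.lact_add_right NN.lact_add_right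
          MM.ract_add_right NN.ract_add_right MM.M.M.a_ac NN.M.M.a_ac)
  qed
  fix y assume y: "y \<in> carrier \<Lambda>"
  show "x \<otimes>\<^bsub>\<Lambda>\<^esub> y \<in> carrier \<Lambda>" by (rule cl(1)[OF y])
  obtain a2 n2 m2 b2 where y': "y = (a2, n2, m2, b2)" "a2 \<in> carrier A" "n2 \<in> carrier N" "m2 \<in> carrier M" "b2 \<in> carrier B"
    using \<Lambda>_cases[OF y] .
  fix z assume z: "z \<in> carrier \<Lambda>"
  obtain a3 n3 m3 b3 where z': "z = (a3, n3, m3, b3)" "a3 \<in> carrier A" "n3 \<in> carrier N" "m3 \<in> carrier M" "b3 \<in> carrier B"
    using \<Lambda>_cases[OF z] .
  show "x \<otimes>\<^bsub>\<Lambda>\<^esub> y \<otimes>\<^bsub>\<Lambda>\<^esub> z = x \<otimes>\<^bsub>\<Lambda>\<^esub> (y \<otimes>\<^bsub>\<Lambda>\<^esub> z)"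
    using x' y' z'
    by (simp add: act_closed MM.A.A.m_assoc MM.B.A.m_assoc MM.lact_add_right NN.lact_add_right
        MM.ract_add_left NN.ract_add_left MM.lact_mult NN.lact_mult MM.ract_mult NN.ract_mult
        MM.lact_ract NN.lact_ract MM.M.M.a_assoc NN.M.M.a_assoc)
qed

text \<open>The corner embeddings. On the diagonal they are also the embeddings of the vertices, so
  \<open>inA\<close> and \<open>inB\<close> serve for elements and for the new quiver alike.\<close>

definition inA where "inA a = (a, \<zero>\<^bsub>N\<^esub>, \<zero>\<^bsub>M\<^esub>, \<zero>\<^bsub>B\<^esub>)"
definition inB where "inB b = (\<zero>\<^bsub>A\<^esub>, \<zero>\<^bsub>N\<^esub>, \<zero>\<^bsub>M\<^esub>, b)"
definition inM where "inM m = (\<zero>\<^bsub>A\<^esub>, \<zero>\<^bsub>N\<^esub>, m, \<zero>\<^bsub>B\<^esub>)"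
definition inN where "inN n = (\<zero>\<^bsub>A\<^esub>, n, \<zero>\<^bsub>M\<^esub>, \<zero>\<^bsub>B\<^esub>)"

lemma in_lin_map:
  "inA \<in> lin_map K A \<Lambda>" "inB \<in> lin_map K B \<Lambda>" "inM \<in> lin_map K M \<Lambda>" "inN \<in> lin_map K N \<Lambda>"
  by (rule lin_mapI; simp add: inA_def inB_def inM_def inN_def)+

lemma in_mult:
  "\<lbrakk>a \<in> carrier A; a' \<in> carrier A\<rbrakk> \<Longrightarrow> inA a \<otimes>\<^bsub>\<Lambda>\<^esub> inA a' = inA (a \<otimes>\<^bsub>A\<^esub> a')"
  "\<lbrakk>b \<in> carrier B; b' \<in> carrier B\<rbrakk> \<Longrightarrow> inB b \<otimes>\<^bsub>\<Lambda>\<^esub> inB b' = inB (b \<otimes>\<^bsub>B\<^esub> b')"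
  "\<lbrakk>a \<in> carrier A; b \<in> carrier B\<rbrakk> \<Longrightarrow> inA a \<otimes>\<^bsub>\<Lambda>\<^esub> inB b = \<zero>\<^bsub>\<Lambda>\<^esub>"
  "\<lbrakk>a \<in> carrier A; b \<in> carrier B\<rbrakk> \<Longrightarrow> inB b \<otimes>\<^bsub>\<Lambda>\<^esub> inA a = \<zero>\<^bsub>\<Lambda>\<^esub>"
  "\<lbrakk>b \<in> carrier B; m \<in> carrier M\<rbrakk> \<Longrightarrow> inB b \<otimes>\<^bsub>\<Lambda>\<^esub> inM m = inM (lact M b m)"
  "\<lbrakk>a \<in> carrier A; m \<in> carrier M\<rbrakk> \<Longrightarrow> inM m \<otimes>\<^bsub>\<Lambda>\<^esub> inA a = inM (ract M m a)"
  "\<lbrakk>a \<in> carrier A; n \<in> carrier N\<rbrakk> \<Longrightarrow> inA a \<otimes>\<^bsub>\<Lambda>\<^esub> inN n = inN (lact N a n)"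
  "\<lbrakk>b \<in> carrier B; n \<in> carrier N\<rbrakk> \<Longrightarrow> inN n \<otimes>\<^bsub>\<Lambda>\<^esub> inB b = inN (ract N n b)"
  by (simp_all add: inA_def inB_def inM_def inN_def act_closed)

lemma \<Lambda>_decomp:
  assumes "a \<in> carrier A" "n \<in> carrier N" "m \<in> carrier M" "b \<in> carrier B"
  shows "(a, n, m, b) = inA a \<oplus>\<^bsub>\<Lambda>\<^esub> inN n \<oplus>\<^bsub>\<Lambda>\<^esub> inM m \<oplus>\<^bsub>\<Lambda>\<^esub> inB b"
  using assms by (simp add: inA_def inB_def inM_def inN_def)

end

sublocale null_square \<subseteq> \<Lambda>: k_algebra K \<Lambda>
  by (rule \<Lambda>_algebra)

section \<open>Maps determined by quotients and generators\<close>

lemma (in k_algebra) quot_algebra: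
  assumes "ideal I A"
  shows quot_class_alg_hom: "(+>\<^bsub>A\<^esub>) I \<in> alg_hom K A (quot_mod A I)"
    and quot_k_algebra: "k_algebra K (quot_mod A I)"
proof -
  interpret I: ideal I A by fact
  note sub = ideal_submodule[OF assms]
  show hom: "(+>\<^bsub>A\<^esub>) I \<in> alg_hom K A (quot_mod A I)"
    by (rule alg_homI[OF quot_class_lin_map[OF sub]]) (simp_all add: I.rcoset_mult_add)
  show "k_algebra K (quot_mod A I)"
    by (rule k_algebra_surj_image[OF k_algebra_axioms quot_class_surj[OF sub] _ hom])
      (simp add: quot_class_zero[OF sub])
qed

lemma (in k_algebra) quot_class_eq_zero_iff:
  assumes "ideal I A" "x \<in> carrier A"
  shows "I +>\<^bsub>A\<^esub> x = \<zero>\<^bsub>quot_mod A I\<^esub> \<longleftrightarrow> x \<in> I"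
proof -
  interpret I: ideal I A by fact
  show ?thesis using I.a_rcos_const I.rcos_const_imp_mem[OF assms(2)] by auto
qed

text \<open>The map factors through \<open>kQ\<close> modulo the ideal of \<open>R\<close>, where
  the classes of \<open>P\<close> span. Applied to maps such as \<open>b \<mapsto> v b u\<close>,
  this lets relations indexed by \<open>P\<close> alone yield vanishing for all elements.\<close>

lemma (in quiver_algebra) vanishes_of_path_basis:
  assumes P: "path_basis K Q R P" and R: "R \<subseteq> carrier kQ"
    and U: "Module.module K U" and f: "f \<in> lin_map K kQ U"
    and fR: "\<And>x. x \<in> Idl\<^bsub>kQ\<^esub> R \<Longrightarrow> f x = \<zero>\<^bsub>U\<^esub>"
    and fP: "\<And>\<gamma>. \<gamma> \<in> P \<Longrightarrow> f (delta K \<gamma>) = \<zero>\<^bsub>U\<^esub>"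
    and x: "x \<in> carrier kQ"
  shows "f x = \<zero>\<^bsub>U\<^esub>"
proof -
  interpret U: Module.module K U by (rule U)
  let ?I = "Idl\<^bsub>kQ\<^esub> R" and ?V = "quot_mod kQ (Idl\<^bsub>kQ\<^esub> R)"
  have I: "ideal ?I kQ" by (rule kQ.A.genideal_ideal[OF R])
  note sub = kQ.ideal_submodule[OF I] and V = kQ.quot_mod_module[OF kQ.ideal_submodule[OF I]]
  have P_sub: "P \<subseteq> paths Q" and span: "lin_span K ?V ((\<lambda>\<gamma>. ?I +>\<^bsub>kQ\<^esub> delta K \<gamma>) ` P) = carrier ?V"
    and P_V: "(\<lambda>\<gamma>. ?I +>\<^bsub>kQ\<^esub> delta K \<gamma>) ` P \<subseteq> carrier ?V"
    using P by (simp_all add: path_basis_def Let_def is_basis_def del: quot_mod_simps)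
  have ker: "f x = \<zero>\<^bsub>U\<^esub>" if "x \<in> carrier kQ" "?I +>\<^bsub>kQ\<^esub> x = \<zero>\<^bsub>?V\<^esub>" for x
    using fR that kQ.quot_class_eq_zero_iff[OF I that(1)] by blast
  obtain g where g: "g \<in> lin_map K ?V U" "\<And>x. x \<in> carrier kQ \<Longrightarrow> g (?I +>\<^bsub>kQ\<^esub> x) = f x"
    using lin_map_factor[OF kQ_module V U kQ.quot_class_lin_map[OF sub] kQ.quot_class_surj[OF sub] f ker] by blast
  have zero: "submodule {\<zero>\<^bsub>U\<^esub>} K U" by (rule U.submoduleI) auto
  have "g ` carrier ?V \<subseteq> {\<zero>\<^bsub>U\<^esub>}"
    unfolding span[symmetric]
  proof (rule lin_map_image_lin_span[OF K.field_axioms V P_V g(1) U zero])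
    fix s assume "s \<in> (\<lambda>\<gamma>. ?I +>\<^bsub>kQ\<^esub> delta K \<gamma>) ` P"
    then obtain \<gamma> where \<gamma>: "\<gamma> \<in> P" "s = ?I +>\<^bsub>kQ\<^esub> delta K \<gamma>" by blast
    then have "delta K \<gamma> \<in> carrier kQ" using P_sub by auto
    then show "g s \<in> {\<zero>\<^bsub>U\<^esub>}" using g(2) \<gamma> fP by simp
  qed
  moreover have "?I +>\<^bsub>kQ\<^esub> x \<in> carrier ?V" using kQ.quot_class_surj[OF sub] x by blast
  ultimately show ?thesis using g(2)[OF x] by auto
qed

text \<open>The target algebra is viewed as a bimodule through \<open>\<rho>B\<close> and
  \<open>\<rho>A\<close>, and \<open>gen u\<close> is sent to \<open>U u\<close>. The conditions
  \<open>Ul\<close> and \<open>Ur\<close> say that \<open>U u\<close> sits in the corner cut out by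
  the two idempotents of the summand, as \<open>gen u\<close> does. Linearity comes from
  \<open>universal\<close>; the two actions are then checked on generators.\<close>

lemma (in proj_bimodule) universal_algebra:
  assumes C: "k_algebra K C"
    and \<rho>A: "\<rho>A \<in> lin_map K A C" "\<And>a a'. \<lbrakk>a \<in> carrier A; a' \<in> carrier A\<rbrakk> \<Longrightarrow> \<rho>A (a \<otimes>\<^bsub>A\<^esub> a') = \<rho>A a \<otimes>\<^bsub>C\<^esub> \<rho>A a'"
    and \<rho>B: "\<rho>B \<in> lin_map K B C" "\<And>b b'. \<lbrakk>b \<in> carrier B; b' \<in> carrier B\<rbrakk> \<Longrightarrow> \<rho>B (b \<otimes>\<^bsub>B\<^esub> b') = \<rho>B b \<otimes>\<^bsub>C\<^esub> \<rho>B b'"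
    and U: "\<And>u. u \<in> summands \<Longrightarrow> U u \<in> carrier C"
    and Ul: "\<And>u. u \<in> summands \<Longrightarrow> \<rho>B (fst u) \<otimes>\<^bsub>C\<^esub> U u = U u"
    and Ur: "\<And>u. u \<in> summands \<Longrightarrow> U u \<otimes>\<^bsub>C\<^esub> \<rho>A (fst (snd u)) = U u"
  obtains \<psi> where "\<psi> \<in> lin_map K M C"
    and "\<And>b x. \<lbrakk>b \<in> carrier B; x \<in> carrier M\<rbrakk> \<Longrightarrow> \<psi> (lact M b x) = \<rho>B b \<otimes>\<^bsub>C\<^esub> \<psi> x"
    and "\<And>x a. \<lbrakk>x \<in> carrier M; a \<in> carrier A\<rbrakk> \<Longrightarrow> \<psi> (ract M x a) = \<psi> x \<otimes>\<^bsub>C\<^esub> \<rho>A a"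
    and "\<And>u b a. \<lbrakk>u \<in> summands; b \<in> carrier B; a \<in> carrier A\<rbrakk> \<Longrightarrow>
      \<psi> (ract M (lact M b (gen u)) a) = \<rho>B b \<otimes>\<^bsub>C\<^esub> U u \<otimes>\<^bsub>C\<^esub> \<rho>A a"
proof -
  interpret C: k_algebra K C by (rule C)
  note cA = lin_map_closed[OF \<rho>A(1)] and cB = lin_map_closed[OF \<rho>B(1)]
  define \<tau> where "\<tau> = (\<lambda>u b a. \<rho>B b \<otimes>\<^bsub>C\<^esub> U u \<otimes>\<^bsub>C\<^esub> \<rho>A a)"
  have bil: "tensor_product.bilinear K (Bg u) (eA u) C (\<tau> u)" if u: "u \<in> summands" for u
    unfolding tensor_product.bilinear_def[OF tensor[OF u]]
  proof (intro conjI ballI)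
    note su = summandsD[OF u]
    have sB: "carrier (Bg u) \<subseteq> carrier B" and sA: "carrier (eA u) \<subseteq> carrier A" using su by auto
    show "\<tau> u b \<in> lin_map K (eA u) C" if "b \<in> carrier (Bg u)" for b
    proof -
      have "b \<in> carrier B" using that sB by blast
      then have "\<tau> u b \<in> lin_map K A C"
        unfolding \<tau>_def by (intro lin_map_comp[OF \<rho>A(1) C.lin_map_mult_right] C.A.m_closed cB U u)
      from lin_map_restrict[OF this] sA show ?thesis by simp
    qed
    show "(\<lambda>b. \<tau> u b a) \<in> lin_map K (Bg u) C" if "a \<in> carrier (eA u)" for a
    proof -
      have "a \<in> carrier A" using that sA by blast
      then have "(\<lambda>b. \<tau> u b a) \<in> lin_map K B C"
        unfolding \<tau>_def
        by (intro lin_map_comp[OF lin_map_comp[OF \<rho>B(1) C.lin_map_mult_left] C.lin_map_mult_left] cA U u)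
      from lin_map_restrict[OF this] sB show ?thesis by simp
    qed
  qed
  obtain \<psi> where \<psi>: "\<psi> \<in> lin_map K M C"
    and \<psi>_gen: "\<And>u b a. \<lbrakk>u \<in> summands; b \<in> carrier B; a \<in> carrier A\<rbrakk> \<Longrightarrow>
      \<psi> (ract M (lact M b (gen u)) a) = \<tau> u (b \<otimes>\<^bsub>B\<^esub> fst u) (fst (snd u) \<otimes>\<^bsub>A\<^esub> a)"
    using universal[OF C.module_axioms bil] by blast
  have gen: "\<psi> (ract M (lact M b (gen u)) a) = \<rho>B b \<otimes>\<^bsub>C\<^esub> U u \<otimes>\<^bsub>C\<^esub> \<rho>A a"
    if u: "u \<in> summands" and b: "b \<in> carrier B" and a: "a \<in> carrier A" for u b a
  proof -
    note su = summandsD[OF u]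
    have cl: "\<rho>B b \<in> carrier C" "\<rho>B (fst u) \<in> carrier C" "\<rho>A a \<in> carrier C" "\<rho>A (fst (snd u)) \<in> carrier C" "U u \<in> carrier C"
      using a b su cA cB U[OF u] by simp_all
    \<comment> \<open>The universal property yields the idempotents of the summand on both sides;
      they are absorbed by \<open>U u\<close>.\<close>
    have "\<psi> (ract M (lact M b (gen u)) a) = (\<rho>B b \<otimes>\<^bsub>C\<^esub> \<rho>B (fst u)) \<otimes>\<^bsub>C\<^esub> U u \<otimes>\<^bsub>C\<^esub> (\<rho>A (fst (snd u)) \<otimes>\<^bsub>C\<^esub> \<rho>A a)"
      unfolding \<psi>_gen[OF u b a] \<tau>_def \<rho>B(2)[OF b su(1)] \<rho>A(2)[OF su(3) a] ..
    also have "\<dots> = \<rho>B b \<otimes>\<^bsub>C\<^esub> (((\<rho>B (fst u)) \<otimes>\<^bsub>C\<^esub> U u) \<otimes>\<^bsub>C\<^esub> \<rho>A (fst (snd u))) \<otimes>\<^bsub>C\<^esub> \<rho>A a"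
      using cl by (simp add: C.A.m_assoc)
    also have "\<dots> = \<rho>B b \<otimes>\<^bsub>C\<^esub> U u \<otimes>\<^bsub>C\<^esub> \<rho>A a" unfolding Ul[OF u] Ur[OF u] ..
    finally show ?thesis .
  qed
  have l: "\<psi> (lact M b x) = \<rho>B b \<otimes>\<^bsub>C\<^esub> \<psi> x" if b: "b \<in> carrier B" and x: "x \<in> carrier M" for b x
    using x
  proof (induction rule: gen_induct)
    case zero
    show ?case using b cB[OF b] lin_map_zero[OF M.module_axioms C.module_axioms \<psi>] by simp
  next
    case (add x y)
    then show ?case
      using b cB[OF b] lin_map_closed[OF \<psi>]
      by (simp add: lact_add_right lact_closed lin_map_add[OF \<psi>] C.A.r_distr)
  next
    case (gen u b' a)
    have "lact M b (ract M (lact M b' (gen u)) a) = ract M (lact M (b \<otimes>\<^bsub>B\<^esub> b') (gen u)) a"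
      using gen b gen_closed[OF gen(1)] by (simp add: lact_mult lact_closed lact_ract)
    then show ?case
      using gen b cA cB U[OF gen(1)]
      by (simp add: \<open>\<And>u b a. \<lbrakk>u \<in> summands; b \<in> carrier B; a \<in> carrier A\<rbrakk> \<Longrightarrow>
        \<psi> (ract M (lact M b (gen u)) a) = \<rho>B b \<otimes>\<^bsub>C\<^esub> U u \<otimes>\<^bsub>C\<^esub> \<rho>A a\<close> \<rho>B(2) C.A.m_assoc)
  qed
  have r: "\<psi> (ract M x a) = \<psi> x \<otimes>\<^bsub>C\<^esub> \<rho>A a" if x: "x \<in> carrier M" and a: "a \<in> carrier A" for a x
    using x
  proof (induction rule: gen_induct)
    case zero
    show ?case using a cA[OF a] lin_map_zero[OF M.module_axioms C.module_axioms \<psi>] by simp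
  next
    case (add x y)
    then show ?case
      using a cA[OF a] lin_map_closed[OF \<psi>]
      by (simp add: ract_add_left ract_closed lin_map_add[OF \<psi>] C.A.l_distr)
  next
    case (gen u b a')
    have "ract M (ract M (lact M b (gen u)) a') a = ract M (lact M b (gen u)) (a' \<otimes>\<^bsub>A\<^esub> a)"
      using gen a gen_closed[OF gen(1)] by (simp add: ract_mult lact_closed)
    then show ?case
      using gen a cA cB U[OF gen(1)]
      by (simp add: \<open>\<And>u b a. \<lbrakk>u \<in> summands; b \<in> carrier B; a \<in> carrier A\<rbrakk> \<Longrightarrow>
        \<psi> (ract M (lact M b (gen u)) a) = \<rho>B b \<otimes>\<^bsub>C\<^esub> U u \<otimes>\<^bsub>C\<^esub> \<rho>A a\<close> \<rho>A(2) C.A.m_assoc)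
  qed
  show thesis by (rule that[OF \<psi> l r gen])
qed

section \<open>The presentation of a null-square projective algebra\<close>

text \<open>Collects what the hypotheses provide as chosen data: the isomorphisms \<open>hM\<close>
  and \<open>hN\<close>, and the surjections \<open>\<phi>A\<close> and \<open>\<phi>B\<close>,
  which vanish on paths of length at least \<open>dA\<close> and \<open>dB\<close>.\<close>

locale null_square_presentation = null_square K A B M N +
    MM: proj_bimodule K B A M "verts QB" "verts QA" m hM +
    NN: proj_bimodule K A B N "verts QA" "verts QB" n hN +
    SA: admissible_surjection K QA A \<phi>A dA +
    SB: admissible_surjection K QB B \<phi>B dB
  for K :: "('k, 'r) ring_scheme"
    and A :: "('k, 'a) module" and B :: "('k, 'b) module"
    and M :: "('k, 'b, 'a, 'm) bimod" and N :: "('k, 'a, 'b, 'n) bimod"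
    and QA :: "('a, 'p) pre_digraph" and QB :: "('b, 'q) pre_digraph"
    and m :: "'b \<Rightarrow> 'a \<Rightarrow> nat" and n :: "'a \<Rightarrow> 'b \<Rightarrow> nat"
    and hM hN \<phi>A dA \<phi>B dB +
  fixes RA :: "(('a, 'p) path \<Rightarrow> 'k) set" and RB :: "(('b, 'q) path \<Rightarrow> 'k) set"
    and PA :: "('a, 'p) path set" and PB :: "('b, 'q) path set"
  assumes RA_subset: "RA \<subseteq> carrier SA.kQ" and RB_subset: "RB \<subseteq> carrier SB.kQ"
    and ker_\<phi>A: "a_kernel SA.kQ A \<phi>A = Idl\<^bsub>SA.kQ\<^esub> RA"
    and ker_\<phi>B: "a_kernel SB.kQ B \<phi>B = Idl\<^bsub>SB.kQ\<^esub> RB"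
    and RA_form: "r \<in> RA \<Longrightarrow> \<exists>x\<in>verts QA. \<exists>y\<in>verts QA. \<exists>z\<in>a_kernel SA.kQ A \<phi>A.
      r = SA.vtx y \<otimes>\<^bsub>SA.kQ\<^esub> z \<otimes>\<^bsub>SA.kQ\<^esub> SA.vtx x"
    and RB_form: "s \<in> RB \<Longrightarrow> \<exists>x\<in>verts QB. \<exists>y\<in>verts QB. \<exists>z\<in>a_kernel SB.kQ B \<phi>B.
      s = SB.vtx y \<otimes>\<^bsub>SB.kQ\<^esub> z \<otimes>\<^bsub>SB.kQ\<^esub> SB.vtx x"
    and PA_basis: "path_basis K QA RA PA" and PB_basis: "path_basis K QB RB PB"
begin

abbreviation "Q \<equiv> null_square_quiver inA inB QA QB m n"

definition down :: "'b \<times> 'a \<times> nat \<Rightarrow> ('a, 'b, 'p, 'q) null_square_arrow" where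
  "down u = Down (fst u) (fst (snd u)) (snd (snd u))"

definition up :: "'a \<times> 'b \<times> nat \<Rightarrow> ('a, 'b, 'p, 'q) null_square_arrow" where
  "up v = Up (fst v) (fst (snd v)) (snd (snd v))"

lemma down_arrows_eq: "down_arrows (verts QB) (verts QA) m = down ` MM.summands"
  by (force simp: down_arrows_def MM.summands_def down_def)

lemma up_arrows_eq: "up_arrows (verts QA) (verts QB) n = up ` NN.summands"
  by (force simp: up_arrows_def NN.summands_def up_def)

lemma Q_simps [simp]:
  "verts Q = inA ` verts QA \<union> inB ` verts QB"
  "arcs Q = Arrow_A ` arcs QA \<union> Arrow_B ` arcs QB \<union> down ` MM.summands \<union> up ` NN.summands"
  "tail Q (Arrow_A p) = inA (tail QA p)" "head Q (Arrow_A p) = inA (head QA p)"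
  "tail Q (Arrow_B q) = inB (tail QB q)" "head Q (Arrow_B q) = inB (head QB q)"
  "tail Q (down u) = inA (fst (snd u))" "head Q (down u) = inB (fst u)"
  "tail Q (up v) = inB (fst (snd v))" "head Q (up v) = inA (fst v)"
  by (simp_all add: null_square_quiver_def down_arrows_eq up_arrows_eq, simp_all add: down_def up_def)

lemma down_ends: "u \<in> MM.summands \<Longrightarrow> fst u \<in> verts QB \<and> fst (snd u) \<in> verts QA"
  by (auto simp: MM.summands_def)

lemma up_ends: "v \<in> NN.summands \<Longrightarrow> fst v \<in> verts QA \<and> fst (snd v) \<in> verts QB"
  by (auto simp: NN.summands_def)

lemma Q_digraph: "fin_digraph Q"
proof
  fix a assume a: "a \<in> arcs Q"
  then consider p where "p \<in> arcs QA" "a = Arrow_A p" | q where "q \<in> arcs QB" "a = Arrow_B q"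
    | u where "u \<in> MM.summands" "a = down u" | v where "v \<in> NN.summands" "a = up v" by auto
  then show "tail Q a \<in> verts Q" "head Q a \<in> verts Q"
    using down_ends up_ends by (cases; simp)+
qed (use MM.finite_summands NN.finite_summands in auto)

end

sublocale null_square_presentation \<subseteq> Q: quiver_algebra K Q
  by (intro quiver_algebra.intro MM.B.K.field_axioms Q_digraph)

context null_square_presentation
begin

lemma inA_inj: "inj inA" and inB_inj: "inj inB"
  by (auto simp: inj_def inA_def inB_def)

lemma embedding_A: "quiver_embedding K QA Q inA Arrow_A"
  and embedding_B: "quiver_embedding K QB Q inB Arrow_B"
  by (auto intro!: quiver_embedding.intro quiver_embedding_axioms.intro SA.quiver_algebra_axioms
      SB.quiver_algebra_axioms Q.quiver_algebra_axioms inj_on_subset[OF inA_inj] inj_on_subset[OF inB_inj])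

end

sublocale null_square_presentation \<subseteq> EA: quiver_embedding K QA Q inA Arrow_A
  by (rule embedding_A)

sublocale null_square_presentation \<subseteq> EB: quiver_embedding K QB Q inB Arrow_B
  by (rule embedding_B)

context null_square_presentation
begin

section \<open>The evaluation map onto \<Lambda>\<close>

definition \<theta> :: "('a, 'b, 'p, 'q) null_square_arrow \<Rightarrow> 'a \<times> 'n \<times> 'm \<times> 'b" where
  "\<theta> c = (case c of Arrow_A p \<Rightarrow> inA (\<phi>A (SA.arr p)) | Arrow_B q \<Rightarrow> inB (\<phi>B (SB.arr q))
    | Down g e i \<Rightarrow> inM (MM.gen (g, e, i)) | Up f h j \<Rightarrow> inN (NN.gen (f, h, j)))"

lemma \<theta>_simps [simp]:
  "\<theta> (Arrow_A p) = inA (\<phi>A (SA.arr p))" "\<theta> (Arrow_B q) = inB (\<phi>B (SB.arr q))"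
  "\<theta> (down u) = inM (MM.gen u)" "\<theta> (up v) = inN (NN.gen v)"
  by (simp_all add: \<theta>_def down_def up_def)

lemma arrow_cases:
  assumes "c \<in> arcs Q"
  obtains p where "p \<in> arcs QA" "c = Arrow_A p" | q where "q \<in> arcs QB" "c = Arrow_B q"
    | u where "u \<in> MM.summands" "c = down u" | v where "v \<in> NN.summands" "c = up v"
  using assms by auto

lemma vertex_cases:
  assumes "x \<in> verts Q"
  obtains e where "e \<in> verts QA" "x = inA e" | g where "g \<in> verts QB" "x = inB g"
  using assms by auto

lemma vertex_mult:
  shows vertex_mult_A: "\<lbrakk>e \<in> verts QA; e' \<in> verts QA\<rbrakk> \<Longrightarrow> e \<otimes>\<^bsub>A\<^esub> e' = (if e = e' then e else \<zero>\<^bsub>A\<^esub>)"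
    and vertex_mult_B: "\<lbrakk>g \<in> verts QB; g' \<in> verts QB\<rbrakk> \<Longrightarrow> g \<otimes>\<^bsub>B\<^esub> g' = (if g = g' then g else \<zero>\<^bsub>B\<^esub>)"
  using SA.vertices_complete SB.vertices_complete MM.E_idem MM.F_idem
  by (auto simp: complete_primitive_orthogonal_def orthogonal_def idempotent_def)

lemma \<phi>A_arr:
  assumes "p \<in> arcs QA"
  shows "\<phi>A (SA.arr p) \<in> carrier A" "head QA p \<otimes>\<^bsub>A\<^esub> \<phi>A (SA.arr p) = \<phi>A (SA.arr p)"
    "\<phi>A (SA.arr p) \<otimes>\<^bsub>A\<^esub> tail QA p = \<phi>A (SA.arr p)"
proof -
  have v: "head QA p \<in> verts QA" "tail QA p \<in> verts QA" using assms by simp_all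
  show "\<phi>A (SA.arr p) \<in> carrier A" using SA.\<phi>_closed[of "SA.arr p"] assms by simp
  show "head QA p \<otimes>\<^bsub>A\<^esub> \<phi>A (SA.arr p) = \<phi>A (SA.arr p)"
    using SA.\<phi>_mult[of "SA.vtx (head QA p)" "SA.arr p"] assms v
    by (simp add: SA.\<phi>_vtx SA.vtx_mult_delta)
  show "\<phi>A (SA.arr p) \<otimes>\<^bsub>A\<^esub> tail QA p = \<phi>A (SA.arr p)"
    using SA.\<phi>_mult[of "SA.arr p" "SA.vtx (tail QA p)"] assms v
    by (simp add: SA.\<phi>_vtx SA.vtx_mult_delta)
qed

lemma \<phi>B_arr:
  assumes "p \<in> arcs QB"
  shows "\<phi>B (SB.arr p) \<in> carrier B" "head QB p \<otimes>\<^bsub>B\<^esub> \<phi>B (SB.arr p) = \<phi>B (SB.arr p)"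
    "\<phi>B (SB.arr p) \<otimes>\<^bsub>B\<^esub> tail QB p = \<phi>B (SB.arr p)"
proof -
  have v: "head QB p \<in> verts QB" "tail QB p \<in> verts QB" using assms by simp_all
  show "\<phi>B (SB.arr p) \<in> carrier B" using SB.\<phi>_closed[of "SB.arr p"] assms by simp
  show "head QB p \<otimes>\<^bsub>B\<^esub> \<phi>B (SB.arr p) = \<phi>B (SB.arr p)"
    using SB.\<phi>_mult[of "SB.vtx (head QB p)" "SB.arr p"] assms v
    by (simp add: SB.\<phi>_vtx SB.vtx_mult_delta)
  show "\<phi>B (SB.arr p) \<otimes>\<^bsub>B\<^esub> tail QB p = \<phi>B (SB.arr p)"
    using SB.\<phi>_mult[of "SB.arr p" "SB.vtx (tail QB p)"] assms v
    by (simp add: SB.\<phi>_vtx SB.vtx_mult_delta)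
qed

lemma in_closed:
  "a \<in> carrier A \<Longrightarrow> inA a \<in> carrier \<Lambda>" "b \<in> carrier B \<Longrightarrow> inB b \<in> carrier \<Lambda>"
  "x \<in> carrier M \<Longrightarrow> inM x \<in> carrier \<Lambda>" "y \<in> carrier N \<Longrightarrow> inN y \<in> carrier \<Lambda>"
  by (simp_all add: inA_def inB_def inM_def inN_def)

lemma in_zero: "inA \<zero>\<^bsub>A\<^esub> = \<zero>\<^bsub>\<Lambda>\<^esub>" "inB \<zero>\<^bsub>B\<^esub> = \<zero>\<^bsub>\<Lambda>\<^esub>" "inM \<zero>\<^bsub>M\<^esub> = \<zero>\<^bsub>\<Lambda>\<^esub>" "inN \<zero>\<^bsub>N\<^esub> = \<zero>\<^bsub>\<Lambda>\<^esub>"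
  by (simp_all add: inA_def inB_def inM_def inN_def)

text \<open>The two families of vertices are disjoint, because a common element would be zero, and
  zero is not primitive. Hence the sum splits into the two diagonal units.\<close>

lemma vertex_sum_\<Lambda>: "(\<Oplus>\<^bsub>\<Lambda>\<^esub>x\<in>verts Q. x) = \<one>\<^bsub>\<Lambda>\<^esub>"
proof -
  have disj: "inA ` verts QA \<inter> inB ` verts QB = {}"
  proof (rule equals0I)
    fix z assume "z \<in> inA ` verts QA \<inter> inB ` verts QB"
    then have "\<zero>\<^bsub>A\<^esub> \<in> verts QA" by (auto simp: inA_def inB_def)
    then show False
      using SA.vertices_complete by (auto simp: complete_primitive_orthogonal_def primitive_idempotent_def)
  qed
  have "(\<Oplus>\<^bsub>\<Lambda>\<^esub>x\<in>verts Q. x) = (\<Oplus>\<^bsub>\<Lambda>\<^esub>x\<in>inA ` verts QA. x) \<oplus>\<^bsub>\<Lambda>\<^esub> (\<Oplus>\<^bsub>\<Lambda>\<^esub>x\<in>inB ` verts QB. x)"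
    unfolding Q_simps using disj
    by (intro \<Lambda>.A.finsum_Un_disjoint) (auto intro!: in_closed SA.vertex_in_L SB.vertex_in_L)
  also have "(\<Oplus>\<^bsub>\<Lambda>\<^esub>x\<in>inA ` verts QA. x) = (\<Oplus>\<^bsub>\<Lambda>\<^esub>e\<in>verts QA. inA e)"
    by (rule \<Lambda>.A.finsum_reindex) (auto intro!: in_closed SA.vertex_in_L inj_on_subset[OF inA_inj])
  also have "\<dots> = inA (\<Oplus>\<^bsub>A\<^esub>e\<in>verts QA. e)"
    by (rule lin_map_finsum[OF MM.A.module_axioms \<Lambda>_module in_lin_map(1), symmetric])
      (auto intro: SA.vertex_in_L)
  also have "(\<Oplus>\<^bsub>\<Lambda>\<^esub>x\<in>inB ` verts QB. x) = (\<Oplus>\<^bsub>\<Lambda>\<^esub>g\<in>verts QB. inB g)"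
    by (rule \<Lambda>.A.finsum_reindex) (auto intro!: in_closed SB.vertex_in_L inj_on_subset[OF inB_inj])
  also have "\<dots> = inB (\<Oplus>\<^bsub>B\<^esub>g\<in>verts QB. g)"
    by (rule lin_map_finsum[OF MM.B.module_axioms \<Lambda>_module in_lin_map(2), symmetric])
      (auto intro: SB.vertex_in_L)
  also have "inA (\<Oplus>\<^bsub>A\<^esub>e\<in>verts QA. e) \<oplus>\<^bsub>\<Lambda>\<^esub> inB (\<Oplus>\<^bsub>B\<^esub>g\<in>verts QB. g) = \<one>\<^bsub>\<Lambda>\<^esub>"
    using SA.vertices_complete SB.vertices_complete
    by (simp add: complete_primitive_orthogonal_def inA_def inB_def)
  finally show ?thesis .
qed

text \<open>For new arrows the head and tail conditions hold because \<open>g \<otimes> e\<close> is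
  fixed by \<open>g\<close> on the left and by \<open>e\<close> on the right.\<close>

lemma evaluation_axioms: "path_evaluation K Q \<Lambda> (\<lambda>x. x) \<theta>"
proof (intro path_evaluation.intro path_evaluation_axioms.intro Q.quiver_algebra_axioms \<Lambda>_algebra)
  show "(\<Oplus>\<^bsub>\<Lambda>\<^esub>x\<in>verts Q. x) = \<one>\<^bsub>\<Lambda>\<^esub>" by (rule vertex_sum_\<Lambda>)
  fix x assume x: "x \<in> verts Q"
  then show "x \<in> carrier \<Lambda>" by (rule vertex_cases) (auto intro: in_closed SA.vertex_in_L SB.vertex_in_L)
  show "x \<otimes>\<^bsub>\<Lambda>\<^esub> x = x"
    using x by (rule vertex_cases)
      (simp_all add: in_mult vertex_mult_A vertex_mult_B SA.vertex_in_L SB.vertex_in_L)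
  fix y assume y: "y \<in> verts Q" and neq: "x \<noteq> y"
  from x show "x \<otimes>\<^bsub>\<Lambda>\<^esub> y = \<zero>\<^bsub>\<Lambda>\<^esub>"
  proof (rule vertex_cases)
    fix e assume e: "e \<in> verts QA" "x = inA e"
    show ?thesis
      by (rule vertex_cases[OF y]; use e neq in
        \<open>auto simp: in_mult vertex_mult_A SA.vertex_in_L SB.vertex_in_L in_zero simp del: \<Lambda>_simps\<close>)
  next
    fix g assume g: "g \<in> verts QB" "x = inB g"
    show ?thesis
      by (rule vertex_cases[OF y]; use g neq in
        \<open>auto simp: in_mult vertex_mult_B SA.vertex_in_L SB.vertex_in_L in_zero simp del: \<Lambda>_simps\<close>)
  qed
next
  fix c assume c: "c \<in> arcs Q"
  then show "\<theta> c \<in> carrier \<Lambda>"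
    by (rule arrow_cases) (auto intro!: in_closed \<phi>A_arr(1) \<phi>B_arr(1) MM.gen_closed NN.gen_closed)
  from c show "head Q c \<otimes>\<^bsub>\<Lambda>\<^esub> \<theta> c = \<theta> c"
    by (rule arrow_cases)
      (simp_all add: in_mult SA.vertex_in_L SB.vertex_in_L \<phi>A_arr \<phi>B_arr MM.gen_closed NN.gen_closed
        MM.gen_ends NN.gen_ends down_ends up_ends)
  from c show "\<theta> c \<otimes>\<^bsub>\<Lambda>\<^esub> tail Q c = \<theta> c"
    by (rule arrow_cases)
      (simp_all add: in_mult SA.vertex_in_L SB.vertex_in_L \<phi>A_arr \<phi>B_arr MM.gen_closed NN.gen_closed
        MM.gen_ends NN.gen_ends down_ends up_ends)
qed

end

sublocale null_square_presentation \<subseteq> ev: path_evaluation K Q \<Lambda> "\<lambda>x. x" \<theta>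
  by (rule evaluation_axioms)

context null_square_presentation
begin

abbreviation "\<phi> \<equiv> ev.evaluation"

lemmas \<phi>_lin = ev.evaluation_lin_map
lemmas \<phi>_closed = lin_map_closed[OF ev.evaluation_lin_map]
lemmas \<phi>_mult = alg_hom_mult[OF ev.evaluation_alg_hom]

text \<open>Both maps are linear and multiplicative and agree on the vertices and arrows of
  \<open>QA\<close>; both send the unit to the idempotent of the corner \<open>A\<close>.\<close>

lemma \<phi>_jA:
  assumes "f \<in> carrier SA.kQ"
  shows "\<phi> (EA.j f) = inA (\<phi>A f)"
proof (rule SA.kQ_maps_eqI[OF \<Lambda>_algebra _ _ _ _ _ _ assms])
  show "(\<lambda>f. \<phi> (EA.j f)) \<in> lin_map K SA.kQ \<Lambda>" by (rule lin_map_comp[OF EA.j_lin \<phi>_lin])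
  show "(\<lambda>f. inA (\<phi>A f)) \<in> lin_map K SA.kQ \<Lambda>" by (rule lin_map_comp[OF SA.\<phi>_lin in_lin_map(1)])
  show "\<phi> (EA.j (x \<otimes>\<^bsub>SA.kQ\<^esub> y)) = \<phi> (EA.j x) \<otimes>\<^bsub>\<Lambda>\<^esub> \<phi> (EA.j y)"
    if "x \<in> carrier SA.kQ" "y \<in> carrier SA.kQ" for x y
    unfolding EA.j_mult[OF that] by (rule \<phi>_mult[OF EA.j_closed[OF that(1)] EA.j_closed[OF that(2)]])
  show "inA (\<phi>A (x \<otimes>\<^bsub>SA.kQ\<^esub> y)) = inA (\<phi>A x) \<otimes>\<^bsub>\<Lambda>\<^esub> inA (\<phi>A y)"
    if "x \<in> carrier SA.kQ" "y \<in> carrier SA.kQ" for x y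
    unfolding SA.\<phi>_mult[OF that] in_mult(1)[OF SA.\<phi>_closed[OF that(1)] SA.\<phi>_closed[OF that(2)]] ..
  show "\<phi> (EA.j (SA.vtx x)) = inA (\<phi>A (SA.vtx x))" if "x \<in> verts QA" for x
    using that ev.evaluation_vertex[of "inA x"] by (simp add: EA.j_delta SA.\<phi>_vtx)
  show "\<phi> (EA.j (SA.arr p)) = inA (\<phi>A (SA.arr p))" if "p \<in> arcs QA" for p
    using that ev.evaluation_arrow[of "Arrow_A p"] by (simp add: EA.j_delta EA.path_map_arrow)
qed

lemma \<phi>_jB:
  assumes "f \<in> carrier SB.kQ"
  shows "\<phi> (EB.j f) = inB (\<phi>B f)"
proof (rule SB.kQ_maps_eqI[OF \<Lambda>_algebra _ _ _ _ _ _ assms])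
  show "(\<lambda>f. \<phi> (EB.j f)) \<in> lin_map K SB.kQ \<Lambda>" by (rule lin_map_comp[OF EB.j_lin \<phi>_lin])
  show "(\<lambda>f. inB (\<phi>B f)) \<in> lin_map K SB.kQ \<Lambda>" by (rule lin_map_comp[OF SB.\<phi>_lin in_lin_map(2)])
  show "\<phi> (EB.j (x \<otimes>\<^bsub>SB.kQ\<^esub> y)) = \<phi> (EB.j x) \<otimes>\<^bsub>\<Lambda>\<^esub> \<phi> (EB.j y)"
    if "x \<in> carrier SB.kQ" "y \<in> carrier SB.kQ" for x y
    unfolding EB.j_mult[OF that] by (rule \<phi>_mult[OF EB.j_closed[OF that(1)] EB.j_closed[OF that(2)]])
  show "inB (\<phi>B (x \<otimes>\<^bsub>SB.kQ\<^esub> y)) = inB (\<phi>B x) \<otimes>\<^bsub>\<Lambda>\<^esub> inB (\<phi>B y)"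
    if "x \<in> carrier SB.kQ" "y \<in> carrier SB.kQ" for x y
    unfolding SB.\<phi>_mult[OF that] in_mult(2)[OF SB.\<phi>_closed[OF that(1)] SB.\<phi>_closed[OF that(2)]] ..
  show "\<phi> (EB.j (SB.vtx x)) = inB (\<phi>B (SB.vtx x))" if "x \<in> verts QB" for x
    using that ev.evaluation_vertex[of "inB x"] by (simp add: EB.j_delta SB.\<phi>_vtx)
  show "\<phi> (EB.j (SB.arr p)) = inB (\<phi>B (SB.arr p))" if "p \<in> arcs QB" for p
    using that ev.evaluation_arrow[of "Arrow_B p"] by (simp add: EB.j_delta EB.path_map_arrow)
qed

lemma \<phi>_down: "u \<in> MM.summands \<Longrightarrow> \<phi> (Q.arr (down u)) = inM (MM.gen u)"
  by (subst ev.evaluation_arrow) simp_all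

lemma \<phi>_up: "v \<in> NN.summands \<Longrightarrow> \<phi> (Q.arr (up v)) = inN (NN.gen v)"
  by (subst ev.evaluation_arrow) simp_all

lemma arr_in_kQ: "u \<in> MM.summands \<Longrightarrow> Q.arr (down u) \<in> carrier Q.kQ" "v \<in> NN.summands \<Longrightarrow> Q.arr (up v) \<in> carrier Q.kQ"
  by simp_all

text \<open>The image is closed under sums and products and contains the two diagonal corners. The
  off-diagonal corners follow by \<open>gen_induct\<close>, as their generators are images of new
  arrows.\<close>

lemma \<phi>_surj: "\<phi> ` carrier Q.kQ = carrier \<Lambda>"
proof
  show "\<phi> ` carrier Q.kQ \<subseteq> carrier \<Lambda>" using \<phi>_closed by blast
  have add: "x \<oplus>\<^bsub>\<Lambda>\<^esub> y \<in> \<phi> ` carrier Q.kQ" if "x \<in> \<phi> ` carrier Q.kQ" "y \<in> \<phi> ` carrier Q.kQ" for x y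
    using submodule.axioms(1)[OF lin_map_image_submodule[OF Q.kQ_module \<Lambda>_module \<phi>_lin]] that
    by (auto dest: subgroup.m_closed)
  have mult: "x \<otimes>\<^bsub>\<Lambda>\<^esub> y \<in> \<phi> ` carrier Q.kQ" if xy: "x \<in> \<phi> ` carrier Q.kQ" "y \<in> \<phi> ` carrier Q.kQ" for x y
  proof -
    obtain f g where fg: "f \<in> carrier Q.kQ" "x = \<phi> f" "g \<in> carrier Q.kQ" "y = \<phi> g" using xy by blast
    then show ?thesis using imageI[OF Q.kQ.A.m_closed[OF fg(1,3)], of \<phi>] \<phi>_mult[OF fg(1,3)] by simp
  qed
  have A: "inA a \<in> \<phi> ` carrier Q.kQ" if "a \<in> carrier A" for a
    using that by (rule SA.\<phi>_cases) (metis \<phi>_jA EA.j_closed imageI)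
  have B: "inB b \<in> \<phi> ` carrier Q.kQ" if "b \<in> carrier B" for b
    using that by (rule SB.\<phi>_cases) (metis \<phi>_jB EB.j_closed imageI)
  have zero: "\<zero>\<^bsub>\<Lambda>\<^esub> \<in> \<phi> ` carrier Q.kQ" using A[OF MM.A.A.zero_closed] unfolding in_zero .
  have M: "inM x \<in> \<phi> ` carrier Q.kQ" if "x \<in> carrier M" for x
    using that
  proof (induction rule: MM.gen_induct)
    case zero
    show ?case unfolding in_zero by (rule \<open>\<zero>\<^bsub>\<Lambda>\<^esub> \<in> \<phi> ` carrier Q.kQ\<close>)
  next
    case (add x y)
    then show ?case unfolding lin_map_add[OF in_lin_map(3) add(1,2)] by (intro \<open>\<And>x y. _ \<Longrightarrow> _ \<Longrightarrow> x \<oplus>\<^bsub>\<Lambda>\<^esub> y \<in> _\<close>)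
  next
    case (gen u b a)
    have g: "inM (MM.gen u) \<in> \<phi> ` carrier Q.kQ"
      using imageI[OF arr_in_kQ(1)[OF gen(1)], of \<phi>] \<phi>_down[OF gen(1)] by simp
    have "inM (ract M (lact M b (MM.gen u)) a) = inB b \<otimes>\<^bsub>\<Lambda>\<^esub> inM (MM.gen u) \<otimes>\<^bsub>\<Lambda>\<^esub> inA a"
      using gen MM.gen_closed[OF gen(1)] by (simp add: in_mult act_closed)
    then show ?case using mult[OF mult[OF B[OF gen(2)] g] A[OF gen(3)]] by simp
  qed
  have N: "inN x \<in> \<phi> ` carrier Q.kQ" if "x \<in> carrier N" for x
    using that
  proof (induction rule: NN.gen_induct)
    case zero
    show ?case unfolding in_zero by (rule \<open>\<zero>\<^bsub>\<Lambda>\<^esub> \<in> \<phi> ` carrier Q.kQ\<close>)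
  next
    case (add x y)
    then show ?case unfolding lin_map_add[OF in_lin_map(4) add(1,2)] by (intro \<open>\<And>x y. _ \<Longrightarrow> _ \<Longrightarrow> x \<oplus>\<^bsub>\<Lambda>\<^esub> y \<in> _\<close>)
  next
    case (gen v a b)
    have g: "inN (NN.gen v) \<in> \<phi> ` carrier Q.kQ"
      using imageI[OF arr_in_kQ(2)[OF gen(1)], of \<phi>] \<phi>_up[OF gen(1)] by simp
    have "inN (ract N (lact N a (NN.gen v)) b) = inA a \<otimes>\<^bsub>\<Lambda>\<^esub> inN (NN.gen v) \<otimes>\<^bsub>\<Lambda>\<^esub> inB b"
      using gen NN.gen_closed[OF gen(1)] by (simp add: in_mult act_closed)
    then show ?case using mult[OF mult[OF A[OF gen(2)] g] B[OF gen(3)]] by simp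
  qed
  show "carrier \<Lambda> \<subseteq> \<phi> ` carrier Q.kQ"
  proof
    fix z assume "z \<in> carrier \<Lambda>"
    then obtain a y x b where z: "z = (a, y, x, b)" "a \<in> carrier A" "y \<in> carrier N" "x \<in> carrier M" "b \<in> carrier B"
      by (rule \<Lambda>_cases)
    show "z \<in> \<phi> ` carrier Q.kQ"
      unfolding z(1) \<Lambda>_decomp[OF z(2-5)] by (intro add A N M B z(2-5))
  qed
qed

section \<open>Long paths vanish in \<Lambda>\<close>

text \<open>
  A path of length \<open>k\<close> is sent into \<open>filtration k\<close>. An off-diagonal entry of such an element is
  killed by radical powers of total order above \<open>dA + dB - k\<close>, since it arises from a generator by
  multiplying with radical elements.
\<close>

definition filtration :: "nat \<Rightarrow> ('a \<times> 'n \<times> 'm \<times> 'b) set" where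
  "filtration k = {(a, y, x, b). a \<in> SA.J k \<and> b \<in> SB.J k \<and> y \<in> carrier N \<and> x \<in> carrier M \<and>
     (\<forall>i l. dA + dB < i + l + k \<longrightarrow> (\<forall>a'\<in>SA.J i. \<forall>b'\<in>SB.J l.
        ract M (lact M b' x) a' = \<zero>\<^bsub>M\<^esub> \<and> ract N (lact N a' y) b' = \<zero>\<^bsub>N\<^esub>))}"

lemma J_closed: "a \<in> SA.J i \<Longrightarrow> a \<in> carrier A" "b \<in> SB.J i \<Longrightarrow> b \<in> carrier B"
  using SA.J_antimono[of 0 i] SB.J_antimono[of 0 i] by (auto simp: SA.J_0 SB.J_0)

lemma J_zero: "\<zero>\<^bsub>A\<^esub> \<in> SA.J i" "\<zero>\<^bsub>B\<^esub> \<in> SB.J i"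
  using additive_subgroup.zero_closed[OF ideal.axioms(1)[OF SA.J_ideal]]
    additive_subgroup.zero_closed[OF ideal.axioms(1)[OF SB.J_ideal]] by blast+

lemma \<phi>_arr_in_J: "p \<in> arcs QA \<Longrightarrow> \<phi>A (SA.arr p) \<in> SA.J 1" "q \<in> arcs QB \<Longrightarrow> \<phi>B (SB.arr q) \<in> SB.J 1"
  by (auto simp: SA.J_def SB.J_def SA.long_delta SB.long_delta intro!: imageI) (simp_all add: arrow_path_def)

text \<open>Left multiplication by an old arrow contributes one radical factor, which is merged into
  the test element \<open>a'\<close> or \<open>b'\<close>. A new arrow turns a diagonal entry of
  order \<open>k\<close> into an off-diagonal one, for which the bound is obtained directly from
  nilpotency on the two sides of the generator.\<close>

lemma filtration_step:
  assumes c: "c \<in> arcs Q" and z: "z \<in> filtration k"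
  shows "\<theta> c \<otimes>\<^bsub>\<Lambda>\<^esub> z \<in> filtration (Suc k)"
proof -
  obtain a y x b where z': "z = (a, y, x, b)" "a \<in> SA.J k" "b \<in> SB.J k" "y \<in> carrier N" "x \<in> carrier M"
    and kill: "\<And>i l a' b'. \<lbrakk>dA + dB < i + l + k; a' \<in> SA.J i; b' \<in> SB.J l\<rbrakk> \<Longrightarrow>
      ract M (lact M b' x) a' = \<zero>\<^bsub>M\<^esub> \<and> ract N (lact N a' y) b' = \<zero>\<^bsub>N\<^esub>"
    using z unfolding filtration_def by blast
  have ab: "a \<in> carrier A" "b \<in> carrier B" using z' J_closed by blast+
  note cl = act_closed J_closed
  from c show ?thesis
  proof (rule arrow_cases)
    fix p assume p: "p \<in> arcs QA" "c = Arrow_A p"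
    define t where "t = \<phi>A (SA.arr p)"
    have t: "t \<in> SA.J 1" "t \<in> carrier A" using \<phi>_arr_in_J(1)[OF p(1)] J_closed by (simp_all add: t_def)
    have eq: "\<theta> c \<otimes>\<^bsub>\<Lambda>\<^esub> z = (t \<otimes>\<^bsub>A\<^esub> a, lact N t y, \<zero>\<^bsub>M\<^esub>, \<zero>\<^bsub>B\<^esub>)"
      using p z' t ab by (simp add: inA_def act_closed flip: t_def)
    have "t \<otimes>\<^bsub>A\<^esub> a \<in> SA.J (Suc k)" using SA.J_mult[OF t(1) z'(2)] by (simp add: One_nat_def)
    \<comment> \<open>The factor \<open>t\<close> is moved into \<open>a'\<close>, trading one order
      of \<open>k\<close> for one of \<open>i\<close>.\<close>
    moreover have "ract N (lact N a' (lact N t y)) b' = \<zero>\<^bsub>N\<^esub>"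
      if "dA + dB < i + l + Suc k" "a' \<in> SA.J i" "b' \<in> SB.J l" for i l a' b'
      using kill[of "i + 1" l "a' \<otimes>\<^bsub>A\<^esub> t" b'] SA.J_mult[OF that(2) t(1)] that cl(5)[OF that(2)] t z'(4)
      by (simp add: NN.lact_mult One_nat_def)
    ultimately show ?thesis
      unfolding eq filtration_def using t z'(4) cl by (auto simp: J_zero NN.lact_closed)
  next
    fix q assume q: "q \<in> arcs QB" "c = Arrow_B q"
    define t where "t = \<phi>B (SB.arr q)"
    have t: "t \<in> SB.J 1" "t \<in> carrier B" using \<phi>_arr_in_J(2)[OF q(1)] J_closed by (simp_all add: t_def)
    have eq: "\<theta> c \<otimes>\<^bsub>\<Lambda>\<^esub> z = (\<zero>\<^bsub>A\<^esub>, \<zero>\<^bsub>N\<^esub>, lact M t x, t \<otimes>\<^bsub>B\<^esub> b)"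
      using q z' t ab by (simp add: inB_def act_closed flip: t_def)
    have "t \<otimes>\<^bsub>B\<^esub> b \<in> SB.J (Suc k)" using SB.J_mult[OF t(1) z'(3)] by (simp add: One_nat_def)
    moreover have "ract M (lact M b' (lact M t x)) a' = \<zero>\<^bsub>M\<^esub>"
      if "dA + dB < i + l + Suc k" "a' \<in> SA.J i" "b' \<in> SB.J l" for i l a' b'
      using kill[of i "l + 1" a' "b' \<otimes>\<^bsub>B\<^esub> t"] SB.J_mult[OF that(3) t(1)] that cl(6)[OF that(3)] t z'(5)
      by (simp add: MM.lact_mult One_nat_def)
    ultimately show ?thesis
      unfolding eq filtration_def using t z'(5) cl by (auto simp: J_zero MM.lact_closed)
  next
    fix u assume u: "u \<in> MM.summands" "c = down u"
    have g: "MM.gen u \<in> carrier M" by (rule MM.gen_closed[OF u(1)])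
    have eq: "\<theta> c \<otimes>\<^bsub>\<Lambda>\<^esub> z = (\<zero>\<^bsub>A\<^esub>, \<zero>\<^bsub>N\<^esub>, ract M (MM.gen u) a, \<zero>\<^bsub>B\<^esub>)"
      using u z' g ab by (simp add: inM_def act_closed)
    have "ract M (lact M b' (ract M (MM.gen u) a)) a' = \<zero>\<^bsub>M\<^esub>"
      if "dA + dB < i + l + Suc k" "a' \<in> SA.J i" "b' \<in> SB.J l" for i l a' b'
    proof -
      have c': "a' \<in> carrier A" "b' \<in> carrier B" using that J_closed by blast+
      \<comment> \<open>The generator separates the radical factors into \<open>b'\<close> of order
        \<open>l\<close> and \<open>a a'\<close> of order \<open>k + i\<close>. As these orders add
        up to at least \<open>dA + dB\<close>, one of the two factors is zero.\<close>
      have e: "ract M (lact M b' (ract M (MM.gen u) a)) a' = ract M (lact M b' (MM.gen u)) (a \<otimes>\<^bsub>A\<^esub> a')"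
        using g c' ab by (simp add: MM.ract_mult MM.lact_ract act_closed flip: MM.lact_ract)
      show ?thesis
      proof (cases "dB \<le> l")
        case True
        then have "b' = \<zero>\<^bsub>B\<^esub>" using SB.J_nilpotent that by blast
        then show ?thesis unfolding e using g c' ab by simp
      next
        case False
        then have "dA \<le> k + i" using that(1) by linarith
        then have "a \<otimes>\<^bsub>A\<^esub> a' = \<zero>\<^bsub>A\<^esub>" using SA.J_nilpotent SA.J_mult[OF z'(2) that(2)] by blast
        then show ?thesis using g c' ab by (simp add: e act_closed)
      qed
    qed
    then show ?thesis
      unfolding eq filtration_def using g ab cl by (auto simp: J_zero MM.ract_closed)
  next
    fix v assume v: "v \<in> NN.summands" "c = up v"
    have g: "NN.gen v \<in> carrier N" by (rule NN.gen_closed[OF v(1)])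
    have eq: "\<theta> c \<otimes>\<^bsub>\<Lambda>\<^esub> z = (\<zero>\<^bsub>A\<^esub>, ract N (NN.gen v) b, \<zero>\<^bsub>M\<^esub>, \<zero>\<^bsub>B\<^esub>)"
      using v z' g ab by (simp add: inN_def act_closed)
    have "ract N (lact N a' (ract N (NN.gen v) b)) b' = \<zero>\<^bsub>N\<^esub>"
      if "dA + dB < i + l + Suc k" "a' \<in> SA.J i" "b' \<in> SB.J l" for i l a' b'
    proof -
      have c': "a' \<in> carrier A" "b' \<in> carrier B" using that J_closed by blast+
      have e: "ract N (lact N a' (ract N (NN.gen v) b)) b' = ract N (lact N a' (NN.gen v)) (b \<otimes>\<^bsub>B\<^esub> b')"
        using g c' ab by (simp add: NN.ract_mult NN.lact_ract act_closed flip: NN.lact_ract)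
      show ?thesis
      proof (cases "dA \<le> i")
        case True
        then have "a' = \<zero>\<^bsub>A\<^esub>" using SA.J_nilpotent that by blast
        then show ?thesis unfolding e using g c' ab by simp
      next
        case False
        then have "dB \<le> k + l" using that(1) by linarith
        then have "b \<otimes>\<^bsub>B\<^esub> b' = \<zero>\<^bsub>B\<^esub>" using SB.J_nilpotent SB.J_mult[OF z'(3) that(3)] by blast
        then show ?thesis using g c' ab by (simp add: e act_closed)
      qed
    qed
    then show ?thesis
      unfolding eq filtration_def using g ab cl by (auto simp: J_zero NN.ract_closed)
  qed
qed

lemma path_in_filtration:
  assumes "\<gamma> \<in> paths Q"
  shows "\<phi> (delta K \<gamma>) \<in> filtration (length (snd \<gamma>))"
  using assms
proof (induction rule: Q.path_induct)
  case (vertex x)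
  have "x \<in> filtration 0"
    using vertex
  proof (rule vertex_cases)
    fix e assume "e \<in> verts QA" "x = inA e"
    then show ?thesis
      using SA.vertex_in_L J_closed by (auto simp: filtration_def inA_def J_zero SA.J_0)
  next
    fix g assume "g \<in> verts QB" "x = inB g"
    then show ?thesis
      using SB.vertex_in_L J_closed by (auto simp: filtration_def inB_def J_zero SB.J_0)
  qed
  then show ?case using vertex by (subst ev.evaluation_vertex) (simp_all add: vertex_path_def)
next
  case (arrow c \<gamma>)
  have c: "arrow_path Q c \<in> paths Q" using arrow(1) by (rule Q.arrow_path_in_paths)
  have "\<phi> (delta K (path_comp (arrow_path Q c) \<gamma>)) = \<theta> c \<otimes>\<^bsub>\<Lambda>\<^esub> \<phi> (delta K \<gamma>)"
    using arrow c by (simp add: Q.delta_comp \<phi>_mult ev.evaluation_arrow del: Q_simps)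
  moreover have "length (snd (path_comp (arrow_path Q c) \<gamma>)) = Suc (length (snd \<gamma>))"
    by (simp add: path_comp_def arrow_path_def)
  ultimately show ?case using filtration_step[OF arrow(1,4)] by simp
qed

text \<open>Beyond the bound the condition in \<open>filtration\<close> applies already with orders
  \<open>i = l = 0\<close>, where the units may serve as test elements. The successor reflects the
  strict inequality in that condition.\<close>

lemma \<phi>_long:
  assumes "f \<in> Q.long (Suc (dA + dB))"
  shows "\<phi> f = \<zero>\<^bsub>\<Lambda>\<^esub>"
proof -
  let ?L = "Q.long_paths (Suc (dA + dB))"
  have f: "f \<in> fin_supp K ?L" using assms by (simp add: Q.long_def)
  have zero: "(\<lambda>_. \<zero>\<^bsub>\<Lambda>\<^esub>) \<in> lin_map K (free_space K ?L) \<Lambda>"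
    by (rule lin_mapI) (simp_all del: \<Lambda>_simps)
  show ?thesis
  proof (rule lin_map_eq_on_delta[OF MM.B.K.field_axioms \<Lambda>_module Q.lin_map_long[OF \<phi>_lin] zero _ f])
    fix \<gamma> assume "\<gamma> \<in> ?L"
    then have \<gamma>: "\<gamma> \<in> paths Q" "dA + dB < length (snd \<gamma>)" by (auto simp: Q.long_paths_def)
    obtain a y x b where z: "\<phi> (delta K \<gamma>) = (a, y, x, b)" "a \<in> SA.J (length (snd \<gamma>))" "b \<in> SB.J (length (snd \<gamma>))"
      "y \<in> carrier N" "x \<in> carrier M"
      and kill: "\<And>i l a' b'. \<lbrakk>dA + dB < i + l + length (snd \<gamma>); a' \<in> SA.J i; b' \<in> SB.J l\<rbrakk> \<Longrightarrow>
        ract M (lact M b' x) a' = \<zero>\<^bsub>M\<^esub> \<and> ract N (lact N a' y) b' = \<zero>\<^bsub>N\<^esub>"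
      using path_in_filtration[OF \<gamma>(1)] unfolding filtration_def by blast
    have "a = \<zero>\<^bsub>A\<^esub>" "b = \<zero>\<^bsub>B\<^esub>"
      using SA.J_nilpotent[OF z(2)] SB.J_nilpotent[OF z(3)] \<gamma>(2) by simp_all
    moreover have "x = \<zero>\<^bsub>M\<^esub>" "y = \<zero>\<^bsub>N\<^esub>"
      using kill[of 0 0 "\<one>\<^bsub>A\<^esub>" "\<one>\<^bsub>B\<^esub>"] \<gamma>(2) z(4,5)
      by (simp_all add: SA.J_0 SB.J_0 MM.lact_one MM.ract_one NN.lact_one NN.ract_one)
    ultimately show "\<phi> (delta K \<gamma>) = \<zero>\<^bsub>\<Lambda>\<^esub>" by (simp add: z(1))
  qed
qed

section \<open>The relations and the ideal generated by them\<close>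

abbreviation "R \<equiv> null_square_relations K inA inB QA QB m n RA RB PA PB"
abbreviation "I \<equiv> Idl\<^bsub>Q.kQ\<^esub> R"

text \<open>The path \<open>v \<beta> u\<close> as a product in \<open>kQ\<close>; in this form its
  middle factor can vary linearly over the whole path algebra of \<open>QB\<close>.\<close>

definition rel_B where
  "rel_B v \<beta> u = Q.arr (up v) \<otimes>\<^bsub>Q.kQ\<^esub> (EB.j (delta K \<beta>) \<otimes>\<^bsub>Q.kQ\<^esub> Q.arr (down u))"

definition rel_A where
  "rel_A u \<alpha> v = Q.arr (down u) \<otimes>\<^bsub>Q.kQ\<^esub> (EA.j (delta K \<alpha>) \<otimes>\<^bsub>Q.kQ\<^esub> Q.arr (up v))"

lemma PA_paths: "PA \<subseteq> paths QA" and PB_paths: "PB \<subseteq> paths QB"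
  using PA_basis PB_basis by (simp_all add: path_basis_def)

lemma arrow_paths [simp]:
  "u \<in> MM.summands \<Longrightarrow> arrow_path Q (down u) \<in> paths Q" "v \<in> NN.summands \<Longrightarrow> arrow_path Q (up v) \<in> paths Q"
  by (rule Q.arrow_path_in_paths, simp)+

lemma path_maps [simp]:
  "\<alpha> \<in> paths QA \<Longrightarrow> EA.path_map \<alpha> \<in> paths Q" "\<alpha> \<in> paths QA \<Longrightarrow> path_end Q (EA.path_map \<alpha>) = inA (path_end QA \<alpha>)"
  "\<beta> \<in> paths QB \<Longrightarrow> EB.path_map \<beta> \<in> paths Q" "\<beta> \<in> paths QB \<Longrightarrow> path_end Q (EB.path_map \<beta>) = inB (path_end QB \<beta>)"
  using EA.path_map_path EB.path_map_path by blast+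

lemma rel_B_path:
  assumes "u \<in> MM.summands" "v \<in> NN.summands" "\<beta> \<in> paths QB" "path_start \<beta> = fst u" "path_end QB \<beta> = fst (snd v)"
  defines "\<gamma> \<equiv> path_comp (arrow_path Q (up v)) (path_comp (EB.path_map \<beta>) (arrow_path Q (down u)))"
  shows "\<gamma> \<in> paths Q" "delta K \<gamma> = rel_B v \<beta> u" "2 \<le> length (snd \<gamma>)"
  using assms(1-5)
  by (simp_all add: \<gamma>_def rel_B_def EB.j_delta Q.delta_comp Q.path_comp_closed Q.path_end_comp del: Q_simps(1,2))
    (simp add: arrow_path_def)

lemma rel_A_path:
  assumes "u \<in> MM.summands" "v \<in> NN.summands" "\<alpha> \<in> paths QA" "path_start \<alpha> = fst v" "path_end QA \<alpha> = fst (snd u)"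
  defines "\<gamma> \<equiv> path_comp (arrow_path Q (down u)) (path_comp (EA.path_map \<alpha>) (arrow_path Q (up v)))"
  shows "\<gamma> \<in> paths Q" "delta K \<gamma> = rel_A u \<alpha> v" "2 \<le> length (snd \<gamma>)"
  using assms(1-5)
  by (simp_all add: \<gamma>_def rel_A_def EA.j_delta Q.delta_comp Q.path_comp_closed Q.path_end_comp del: Q_simps(1,2))
    (simp add: arrow_path_def)

lemma curlyvee_B:
  assumes "u \<in> MM.summands" "v \<in> NN.summands"
  shows "delta K ` curlyvee Q (path_B inB ` PB) (up v) (down u) =
    (\<lambda>\<beta>. rel_B v \<beta> u) ` {\<beta> \<in> PB. path_start \<beta> = fst u \<and> path_end QB \<beta> = fst (snd v)}"
proof -
  have "path_B inB = EB.path_map" by (simp add: fun_eq_iff path_B_def EB.path_map_def)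
  then have pb: "paths_between Q (path_B inB ` PB) (tail Q (up v)) (head Q (down u)) =
      EB.path_map ` {\<beta> \<in> PB. path_start \<beta> = fst u \<and> path_end QB \<beta> = fst (snd v)}"
    using PB_paths path_maps(4) by (auto simp: paths_between_def inj_eq[OF inB_inj] subset_iff)
  have cv: "curlyvee Q (path_B inB ` PB) (up v) (down u) =
      (\<lambda>\<beta>. path_comp (arrow_path Q (up v)) (path_comp (EB.path_map \<beta>) (arrow_path Q (down u)))) `
        {\<beta> \<in> PB. path_start \<beta> = fst u \<and> path_end QB \<beta> = fst (snd v)}"
    unfolding curlyvee_def pb Setcompr_eq_image image_image by (rule refl)
  have "delta K (path_comp (arrow_path Q (up v)) (path_comp (EB.path_map \<beta>) (arrow_path Q (down u)))) = rel_B v \<beta> u"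
    if "\<beta> \<in> {\<beta> \<in> PB. path_start \<beta> = fst u \<and> path_end QB \<beta> = fst (snd v)}" for \<beta>
    using that PB_paths by (intro rel_B_path(2)[OF assms]) auto
  then show ?thesis unfolding cv image_image by (rule image_cong[OF refl])
qed

lemma curlyvee_A:
  assumes "u \<in> MM.summands" "v \<in> NN.summands"
  shows "delta K ` curlyvee Q (path_A inA ` PA) (down u) (up v) =
    (\<lambda>\<alpha>. rel_A u \<alpha> v) ` {\<alpha> \<in> PA. path_start \<alpha> = fst v \<and> path_end QA \<alpha> = fst (snd u)}"
proof -
  have "path_A inA = EA.path_map" by (simp add: fun_eq_iff path_A_def EA.path_map_def)
  then have pb: "paths_between Q (path_A inA ` PA) (tail Q (down u)) (head Q (up v)) =
      EA.path_map ` {\<alpha> \<in> PA. path_start \<alpha> = fst v \<and> path_end QA \<alpha> = fst (snd u)}"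
    using PA_paths path_maps(2) by (auto simp: paths_between_def inj_eq[OF inA_inj] subset_iff)
  have cv: "curlyvee Q (path_A inA ` PA) (down u) (up v) =
      (\<lambda>\<alpha>. path_comp (arrow_path Q (down u)) (path_comp (EA.path_map \<alpha>) (arrow_path Q (up v)))) `
        {\<alpha> \<in> PA. path_start \<alpha> = fst v \<and> path_end QA \<alpha> = fst (snd u)}"
    unfolding curlyvee_def pb Setcompr_eq_image image_image by (rule refl)
  have "delta K (path_comp (arrow_path Q (down u)) (path_comp (EA.path_map \<alpha>) (arrow_path Q (up v)))) = rel_A u \<alpha> v"
    if "\<alpha> \<in> {\<alpha> \<in> PA. path_start \<alpha> = fst v \<and> path_end QA \<alpha> = fst (snd u)}" for \<alpha>
    using that PA_paths by (intro rel_A_path(2)[OF assms]) auto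
  then show ?thesis unfolding cv image_image by (rule image_cong[OF refl])
qed

lemma R_eq: "R = EA.j ` RA \<union> EB.j ` RB \<union>
    (\<Union>u\<in>MM.summands. \<Union>v\<in>NN.summands. (\<lambda>\<beta>. rel_B v \<beta> u) ` {\<beta> \<in> PB. path_start \<beta> = fst u \<and> path_end QB \<beta> = fst (snd v)}) \<union>
    (\<Union>u\<in>MM.summands. \<Union>v\<in>NN.summands. (\<lambda>\<alpha>. rel_A u \<alpha> v) ` {\<alpha> \<in> PA. path_start \<alpha> = fst v \<and> path_end QA \<alpha> = fst (snd u)})"
proof -
  have A: "path_A inA = EA.path_map" and B: "path_B inB = EB.path_map"
    by (simp_all add: fun_eq_iff path_A_def path_B_def EA.path_map_def EB.path_map_def)
  show ?thesis
    unfolding null_square_relations_def Let_def down_arrows_eq up_arrows_eq UN_simps(10)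
    by (intro arg_cong2[where f = "(\<union>)"] SUP_cong refl curlyvee_A curlyvee_B)
      (simp_all only: A B EA.j_def EB.j_def)
qed

lemma R_intros:
  shows jA_in_R: "s \<in> RA \<Longrightarrow> EA.j s \<in> R" and jB_in_R: "t \<in> RB \<Longrightarrow> EB.j t \<in> R"
    and rel_B_in_R: "\<lbrakk>u \<in> MM.summands; v \<in> NN.summands; \<beta> \<in> PB; path_start \<beta> = fst u; path_end QB \<beta> = fst (snd v)\<rbrakk> \<Longrightarrow>
      rel_B v \<beta> u \<in> R"
    and rel_A_in_R: "\<lbrakk>u \<in> MM.summands; v \<in> NN.summands; \<alpha> \<in> PA; path_start \<alpha> = fst v; path_end QA \<alpha> = fst (snd u)\<rbrakk> \<Longrightarrow>
      rel_A u \<alpha> v \<in> R"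
proof -
  show "s \<in> RA \<Longrightarrow> EA.j s \<in> R" unfolding R_eq by (intro UnI1 imageI)
  show "t \<in> RB \<Longrightarrow> EB.j t \<in> R" unfolding R_eq by (rule UnI1, rule UnI1, rule UnI2, rule imageI)
  show "rel_B v \<beta> u \<in> R"
    if "u \<in> MM.summands" "v \<in> NN.summands" "\<beta> \<in> PB" "path_start \<beta> = fst u" "path_end QB \<beta> = fst (snd v)"
    unfolding R_eq
    by (rule UnI1, rule UnI2, rule UN_I[OF that(1)], rule UN_I[OF that(2)], rule imageI) (simp add: that)
  show "rel_A u \<alpha> v \<in> R"
    if "u \<in> MM.summands" "v \<in> NN.summands" "\<alpha> \<in> PA" "path_start \<alpha> = fst v" "path_end QA \<alpha> = fst (snd u)"
    unfolding R_eq
    by (rule UnI2, rule UN_I[OF that(1)], rule UN_I[OF that(2)], rule imageI) (simp add: that)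
qed

text \<open>The two families of new relations are merged: both consist of single paths of length at
  least two, annihilated by \<open>\<phi>\<close> because products of \<open>M\<close> and
  \<open>N\<close> are zero in \<Lambda>.\<close>

lemma R_cases:
  assumes "r \<in> R"
  obtains s where "s \<in> RA" "r = EA.j s"
  | s where "s \<in> RB" "r = EB.j s"
  | u v \<gamma> where "u \<in> MM.summands" "v \<in> NN.summands" "\<gamma> \<in> paths Q" "2 \<le> length (snd \<gamma>)" "r = delta K \<gamma>" "\<phi> r = \<zero>\<^bsub>\<Lambda>\<^esub>"
proof -
  have z: "inN y \<otimes>\<^bsub>\<Lambda>\<^esub> (inB b \<otimes>\<^bsub>\<Lambda>\<^esub> inM x) = \<zero>\<^bsub>\<Lambda>\<^esub>" "inM x \<otimes>\<^bsub>\<Lambda>\<^esub> (inA a \<otimes>\<^bsub>\<Lambda>\<^esub> inN y) = \<zero>\<^bsub>\<Lambda>\<^esub>"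
    if "x \<in> carrier M" "y \<in> carrier N" "a \<in> carrier A" "b \<in> carrier B" for x y a b
    using that by (simp_all add: inA_def inB_def inM_def inN_def act_closed)
  from assms[unfolded R_eq] consider s where "s \<in> RA" "r = EA.j s" | s where "s \<in> RB" "r = EB.j s"
    | u v \<beta> where "u \<in> MM.summands" "v \<in> NN.summands" "\<beta> \<in> PB" "path_start \<beta> = fst u" "path_end QB \<beta> = fst (snd v)" "r = rel_B v \<beta> u"
    | u v \<alpha> where "u \<in> MM.summands" "v \<in> NN.summands" "\<alpha> \<in> PA" "path_start \<alpha> = fst v" "path_end QA \<alpha> = fst (snd u)" "r = rel_A u \<alpha> v"
    by blast
  then show thesis
  proof cases
    case (3 u v \<beta>)
    have \<beta>: "\<beta> \<in> paths QB" using 3 PB_paths by blast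
    then have d: "delta K \<beta> \<in> carrier SB.kQ" by simp
    note a = arr_in_kQ(1)[OF 3(1)] arr_in_kQ(2)[OF 3(2)] EB.j_closed[OF d]
    have "\<phi> r = inN (NN.gen v) \<otimes>\<^bsub>\<Lambda>\<^esub> (inB (\<phi>B (delta K \<beta>)) \<otimes>\<^bsub>\<Lambda>\<^esub> inM (MM.gen u))"
      unfolding 3(6) rel_B_def \<phi>_mult[OF a(2) Q.kQ.A.m_closed[OF a(3,1)]] \<phi>_mult[OF a(3,1)]
        \<phi>_up[OF 3(2)] \<phi>_down[OF 3(1)] \<phi>_jB[OF d] ..
    also have "\<dots> = \<zero>\<^bsub>\<Lambda>\<^esub>"
      by (rule z(1)[OF MM.gen_closed[OF 3(1)] NN.gen_closed[OF 3(2)] MM.A.A.zero_closed SB.\<phi>_closed[OF d]])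
    finally show ?thesis
      using that(3)[OF 3(1,2) rel_B_path(1,3)[OF 3(1,2) \<beta> 3(4,5)]] rel_B_path(2)[OF 3(1,2) \<beta> 3(4,5)] 3(6) by simp
  next
    case (4 u v \<alpha>)
    have \<alpha>: "\<alpha> \<in> paths QA" using 4 PA_paths by blast
    then have d: "delta K \<alpha> \<in> carrier SA.kQ" by simp
    note a = arr_in_kQ(1)[OF 4(1)] arr_in_kQ(2)[OF 4(2)] EA.j_closed[OF d]
    have "\<phi> r = inM (MM.gen u) \<otimes>\<^bsub>\<Lambda>\<^esub> (inA (\<phi>A (delta K \<alpha>)) \<otimes>\<^bsub>\<Lambda>\<^esub> inN (NN.gen v))"
      unfolding 4(6) rel_A_def \<phi>_mult[OF a(1) Q.kQ.A.m_closed[OF a(3,2)]] \<phi>_mult[OF a(3,2)]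
        \<phi>_up[OF 4(2)] \<phi>_down[OF 4(1)] \<phi>_jA[OF d] ..
    also have "\<dots> = \<zero>\<^bsub>\<Lambda>\<^esub>"
      by (rule z(2)[OF MM.gen_closed[OF 4(1)] NN.gen_closed[OF 4(2)] SA.\<phi>_closed[OF d] MM.B.A.zero_closed])
    finally show ?thesis
      using that(3)[OF 4(1,2) rel_A_path(1,3)[OF 4(1,2) \<alpha> 4(4,5)]] rel_A_path(2)[OF 4(1,2) \<alpha> 4(4,5)] 4(6) by simp
  qed (use that(1,2) in blast)+
qed

lemma RA_in_ker: "s \<in> RA \<Longrightarrow> s \<in> carrier SA.kQ \<and> \<phi>A s = \<zero>\<^bsub>A\<^esub>"
  using SA.kQ.A.genideal_self[OF RA_subset] unfolding ker_\<phi>A[symmetric] a_kernel_def' by blast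

lemma RB_in_ker: "s \<in> RB \<Longrightarrow> s \<in> carrier SB.kQ \<and> \<phi>B s = \<zero>\<^bsub>B\<^esub>"
  using SB.kQ.A.genideal_self[OF RB_subset] unfolding ker_\<phi>B[symmetric] a_kernel_def' by blast

text \<open>The old relations lie in the kernels of \<open>\<phi>A\<close> and
  \<open>\<phi>B\<close>, which start in length two; a new relation contains two new arrows.\<close>

lemma R_long: "R \<subseteq> Q.long 2"
proof
  fix r assume "r \<in> R"
  then show "r \<in> Q.long 2"
  proof (rule R_cases)
    fix s assume "s \<in> RA" "r = EA.j s"
    then show ?thesis using RA_in_ker SA.\<phi>_ker EA.j_long by blast
  next
    fix s assume "s \<in> RB" "r = EB.j s"
    then show ?thesis using RB_in_ker SB.\<phi>_ker EB.j_long by blast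
  next
    fix \<gamma> assume "\<gamma> \<in> paths Q" "2 \<le> length (snd \<gamma>)" "r = delta K \<gamma>"
    then show ?thesis by (simp add: Q.long_delta)
  qed
qed

lemma R_subset: "R \<subseteq> carrier Q.kQ"
  using R_long Q.long_closed by blast

lemma I_ideal: "ideal I Q.kQ"
  by (rule Q.kQ.A.genideal_ideal[OF R_subset])

lemma R_in_I: "R \<subseteq> I"
  by (rule Q.kQ.A.genideal_self[OF R_subset])

lemma I_long: "I \<subseteq> Q.long 2"
  by (rule Q.kQ.A.genideal_minimal[OF Q.long_ideal R_long])

lemma R_\<phi>: "r \<in> R \<Longrightarrow> \<phi> r = \<zero>\<^bsub>\<Lambda>\<^esub>"
  by (erule R_cases) (use RA_in_ker RB_in_ker in \<open>auto simp: \<phi>_jA \<phi>_jB in_zero simp del: \<Lambda>_simps\<close>)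

lemma \<phi>_ring_hom: "ring_hom_ring Q.kQ \<Lambda> \<phi>"
  using ev.evaluation_alg_hom
  by (intro ring_hom_ringI2 Q.kQ.A.ring_axioms \<Lambda>.A.ring_axioms) (simp add: alg_hom_def)

lemma I_in_ker: "I \<subseteq> a_kernel Q.kQ \<Lambda> \<phi>"
  by (rule Q.kQ.A.genideal_minimal[OF ring_hom_ring.kernel_is_ideal[OF \<phi>_ring_hom]])
    (use R_\<phi> R_subset in \<open>auto simp: a_kernel_def' simp del: \<Lambda>_simps\<close>)

text \<open>No vertex belongs to both old quivers, since a common one would be the zero element,
  which is not primitive; so paths of the two are never composable.\<close>

lemma jA_jB_zero:
  assumes s: "s \<in> carrier SA.kQ" and t: "t \<in> carrier SB.kQ"
  shows "EA.j s \<otimes>\<^bsub>Q.kQ\<^esub> EB.j t = \<zero>\<^bsub>Q.kQ\<^esub>" "EB.j t \<otimes>\<^bsub>Q.kQ\<^esub> EA.j s = \<zero>\<^bsub>Q.kQ\<^esub>"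
proof -
  have neq: "inA e \<noteq> inB g" if "e \<in> verts QA" for e g
  proof
    assume "inA e = inB g"
    then have "\<zero>\<^bsub>A\<^esub> \<in> verts QA" using that by (auto simp: inA_def inB_def)
    then show False
      using SA.vertices_complete by (auto simp: complete_primitive_orthogonal_def primitive_idempotent_def)
  qed
  have zero: "(\<lambda>_. \<zero>\<^bsub>Q.kQ\<^esub>) \<in> lin_map K V Q.kQ" for V :: "('k, 'x) module"
    by (rule lin_mapI) (simp_all del: Q.kQ_simps)
  have dd: "EA.j (delta K \<alpha>) \<otimes>\<^bsub>Q.kQ\<^esub> EB.j (delta K \<beta>) = \<zero>\<^bsub>Q.kQ\<^esub>"
    "EB.j (delta K \<beta>) \<otimes>\<^bsub>Q.kQ\<^esub> EA.j (delta K \<alpha>) = \<zero>\<^bsub>Q.kQ\<^esub>" if "\<alpha> \<in> paths QA" "\<beta> \<in> paths QB" for \<alpha> \<beta>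
    using that neq[of "path_start \<alpha>" "path_end QB \<beta>"] neq[of "path_end QA \<alpha>" "path_start \<beta>"]
    by (simp_all add: EA.j_delta EB.j_delta Q.kQ_mult_delta del: Q.kQ_simps)
  have df: "EA.j (delta K \<alpha>) \<otimes>\<^bsub>Q.kQ\<^esub> EB.j t = \<zero>\<^bsub>Q.kQ\<^esub>" "EB.j t \<otimes>\<^bsub>Q.kQ\<^esub> EA.j (delta K \<alpha>) = \<zero>\<^bsub>Q.kQ\<^esub>"
    if \<alpha>: "\<alpha> \<in> paths QA" for \<alpha>
  proof -
    have jd: "EA.j (delta K \<alpha>) \<in> carrier Q.kQ" using \<alpha> by (intro EA.j_closed) simp
    show "EA.j (delta K \<alpha>) \<otimes>\<^bsub>Q.kQ\<^esub> EB.j t = \<zero>\<^bsub>Q.kQ\<^esub>"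
      by (rule SB.kQ_lin_map_eqI[OF Q.kQ_module lin_map_comp[OF EB.j_lin Q.kQ.lin_map_mult_right[OF jd]] zero dd(1)[OF \<alpha>] t])
    show "EB.j t \<otimes>\<^bsub>Q.kQ\<^esub> EA.j (delta K \<alpha>) = \<zero>\<^bsub>Q.kQ\<^esub>"
      by (rule SB.kQ_lin_map_eqI[OF Q.kQ_module lin_map_comp[OF EB.j_lin Q.kQ.lin_map_mult_left[OF jd]] zero dd(2)[OF \<alpha>] t])
  qed
  have jt: "EB.j t \<in> carrier Q.kQ" by (rule EB.j_closed[OF t])
  show "EA.j s \<otimes>\<^bsub>Q.kQ\<^esub> EB.j t = \<zero>\<^bsub>Q.kQ\<^esub>"
    by (rule SA.kQ_lin_map_eqI[OF Q.kQ_module lin_map_comp[OF EA.j_lin Q.kQ.lin_map_mult_left[OF jt]] zero df(1) s])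
  show "EB.j t \<otimes>\<^bsub>Q.kQ\<^esub> EA.j s = \<zero>\<^bsub>Q.kQ\<^esub>"
    by (rule SA.kQ_lin_map_eqI[OF Q.kQ_module lin_map_comp[OF EA.j_lin Q.kQ.lin_map_mult_right[OF jt]] zero df(2) s])
qed

section \<open>The quotient kQ / I\<close>

abbreviation "C \<equiv> quot_mod Q.kQ I"

definition cl :: "(('a \<times> 'n \<times> 'm \<times> 'b, ('a, 'b, 'p, 'q) null_square_arrow) path \<Rightarrow> 'k) \<Rightarrow> _" where
  "cl f = I +>\<^bsub>Q.kQ\<^esub> f"

lemma cl_hom: "cl \<in> alg_hom K Q.kQ C"
  using Q.kQ.quot_class_alg_hom[OF I_ideal] unfolding cl_def .

lemma C_algebra: "k_algebra K C"
  by (rule Q.kQ.quot_k_algebra[OF I_ideal])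

lemmas cl_lin = alg_hom_lin_map[OF cl_hom]
lemmas cl_closed = lin_map_closed[OF alg_hom_lin_map[OF cl_hom]]
lemmas cl_mult = alg_hom_mult[OF cl_hom]

lemma cl_eq_zero_iff: "f \<in> carrier Q.kQ \<Longrightarrow> cl f = \<zero>\<^bsub>C\<^esub> \<longleftrightarrow> f \<in> I"
  unfolding cl_def by (rule Q.kQ.quot_class_eq_zero_iff[OF I_ideal])

lemma cl_zero: "f \<in> I \<Longrightarrow> cl f = \<zero>\<^bsub>C\<^esub>"
  using cl_eq_zero_iff[OF ideal.Icarr[OF I_ideal]] by simp

text \<open>The generators \<open>RA\<close> are mapped into \<open>R\<close>, and by
  \<open>j_genideal\<close> this extends to the ideal they generate.\<close>

lemma cl_jA_zero: "s \<in> Idl\<^bsub>SA.kQ\<^esub> RA \<Longrightarrow> EA.j s \<in> I"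
  by (rule EA.j_genideal[OF RA_subset I_ideal]) (rule image_subsetI[OF subsetD[OF R_in_I jA_in_R]])

lemma cl_jB_zero: "s \<in> Idl\<^bsub>SB.kQ\<^esub> RB \<Longrightarrow> EB.j s \<in> I"
  by (rule EB.j_genideal[OF RB_subset I_ideal]) (rule image_subsetI[OF subsetD[OF R_in_I jB_in_R]])

lemma mult_delta_zero:
  assumes "\<alpha> \<in> paths Q" "\<beta> \<in> paths Q" "\<gamma> \<in> paths Q"
    and "path_start \<beta> \<noteq> path_end Q \<gamma> \<or> path_start \<alpha> \<noteq> path_end Q \<beta>"
  shows "delta K \<alpha> \<otimes>\<^bsub>Q.kQ\<^esub> (delta K \<beta> \<otimes>\<^bsub>Q.kQ\<^esub> delta K \<gamma>) = \<zero>\<^bsub>Q.kQ\<^esub>"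
proof (cases "path_start \<beta> = path_end Q \<gamma>")
  case True
  then have "delta K \<beta> \<otimes>\<^bsub>Q.kQ\<^esub> delta K \<gamma> = delta K (path_comp \<beta> \<gamma>)" and "path_comp \<beta> \<gamma> \<in> paths Q"
    and "path_end Q (path_comp \<beta> \<gamma>) = path_end Q \<beta>"
    using assms by (simp_all add: Q.kQ_mult_delta Q.path_comp_closed Q.path_end_comp)
  then show ?thesis using True assms by (simp add: Q.kQ_mult_delta del: Q.kQ_simps)
next
  case False
  have "delta K \<beta> \<otimes>\<^bsub>Q.kQ\<^esub> delta K \<gamma> = \<zero>\<^bsub>Q.kQ\<^esub>"
    unfolding Q.kQ_mult_delta[OF assms(2,3)] using False by (simp only: if_False)
  then show ?thesis using Q.kQ.A.r_null[of "delta K \<alpha>"] assms(1) by (simp del: Q.kQ_simps(2))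
qed

text \<open>The expression is linear in \<open>s\<close> and vanishes on the ideal of
  \<open>RA\<close>, so it has to be examined only for paths in \<open>PA\<close>. Such a path
  either fits between \<open>v\<close> and \<open>u\<close> and gives a relation, or has a wrong
  endpoint, and then the product is zero already in \<open>kQ\<close>.\<close>

lemma rel_A_zero:
  assumes u: "u \<in> MM.summands" and v: "v \<in> NN.summands" and s: "s \<in> carrier SA.kQ"
  shows "cl (Q.arr (down u) \<otimes>\<^bsub>Q.kQ\<^esub> (EA.j s \<otimes>\<^bsub>Q.kQ\<^esub> Q.arr (up v))) = \<zero>\<^bsub>C\<^esub>"
proof (rule SA.vanishes_of_path_basis[where
      f = "\<lambda>s. cl (Q.arr (down u) \<otimes>\<^bsub>Q.kQ\<^esub> (EA.j s \<otimes>\<^bsub>Q.kQ\<^esub> Q.arr (up v)))",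
      OF PA_basis RA_subset _ _ _ _ s])
  interpret C: k_algebra K C by (rule C_algebra)
  interpret I: ideal I Q.kQ by (rule I_ideal)
  note a = arr_in_kQ(1)[OF u] arr_in_kQ(2)[OF v]
  show "Module.module K C" by (rule C.module_axioms)
  show "(\<lambda>s. cl (Q.arr (down u) \<otimes>\<^bsub>Q.kQ\<^esub> (EA.j s \<otimes>\<^bsub>Q.kQ\<^esub> Q.arr (up v)))) \<in> lin_map K SA.kQ C"
    by (intro lin_map_comp[OF lin_map_comp[OF lin_map_comp[OF EA.j_lin Q.kQ.lin_map_mult_left[OF a(2)]]
        Q.kQ.lin_map_mult_right[OF a(1)]] cl_lin])
  show "cl (Q.arr (down u) \<otimes>\<^bsub>Q.kQ\<^esub> (EA.j s \<otimes>\<^bsub>Q.kQ\<^esub> Q.arr (up v))) = \<zero>\<^bsub>C\<^esub>" if "s \<in> Idl\<^bsub>SA.kQ\<^esub> RA" for s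
  proof -
    have "Q.arr (down u) \<otimes>\<^bsub>Q.kQ\<^esub> (EA.j s \<otimes>\<^bsub>Q.kQ\<^esub> Q.arr (up v)) \<in> I"
      by (rule I.I_l_closed[OF I.I_r_closed[OF cl_jA_zero[OF that] a(2)] a(1)])
    then show ?thesis by (rule cl_zero)
  qed
  fix \<alpha> assume \<alpha>: "\<alpha> \<in> PA"
  then have \<alpha>p: "\<alpha> \<in> paths QA" using PA_paths by blast
  show "cl (Q.arr (down u) \<otimes>\<^bsub>Q.kQ\<^esub> (EA.j (delta K \<alpha>) \<otimes>\<^bsub>Q.kQ\<^esub> Q.arr (up v))) = \<zero>\<^bsub>C\<^esub>"
  proof (cases "path_start \<alpha> = fst v \<and> path_end QA \<alpha> = fst (snd u)")
    case True
    then have "rel_A u \<alpha> v \<in> I" using u v \<alpha> by (intro subsetD[OF R_in_I] rel_A_in_R) simp_all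
    then show ?thesis unfolding rel_A_def by (rule cl_zero)
  next
    case False
    have "Q.arr (down u) \<otimes>\<^bsub>Q.kQ\<^esub> (EA.j (delta K \<alpha>) \<otimes>\<^bsub>Q.kQ\<^esub> Q.arr (up v)) = \<zero>\<^bsub>Q.kQ\<^esub>"
      unfolding EA.j_delta
      by (rule mult_delta_zero) (use False u v \<alpha>p in \<open>auto simp: inj_eq[OF inA_inj] simp del: Q_simps(1,2)\<close>)
    then show ?thesis using lin_map_zero[OF Q.kQ_module C.module_axioms cl_lin] by simp
  qed
qed

lemma rel_B_zero:
  assumes u: "u \<in> MM.summands" and v: "v \<in> NN.summands" and s: "s \<in> carrier SB.kQ"
  shows "cl (Q.arr (up v) \<otimes>\<^bsub>Q.kQ\<^esub> (EB.j s \<otimes>\<^bsub>Q.kQ\<^esub> Q.arr (down u))) = \<zero>\<^bsub>C\<^esub>"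
proof (rule SB.vanishes_of_path_basis[where
      f = "\<lambda>s. cl (Q.arr (up v) \<otimes>\<^bsub>Q.kQ\<^esub> (EB.j s \<otimes>\<^bsub>Q.kQ\<^esub> Q.arr (down u)))",
      OF PB_basis RB_subset _ _ _ _ s])
  interpret C: k_algebra K C by (rule C_algebra)
  interpret I: ideal I Q.kQ by (rule I_ideal)
  note a = arr_in_kQ(1)[OF u] arr_in_kQ(2)[OF v]
  show "Module.module K C" by (rule C.module_axioms)
  show "(\<lambda>s. cl (Q.arr (up v) \<otimes>\<^bsub>Q.kQ\<^esub> (EB.j s \<otimes>\<^bsub>Q.kQ\<^esub> Q.arr (down u)))) \<in> lin_map K SB.kQ C"
    by (intro lin_map_comp[OF lin_map_comp[OF lin_map_comp[OF EB.j_lin Q.kQ.lin_map_mult_left[OF a(1)]]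
        Q.kQ.lin_map_mult_right[OF a(2)]] cl_lin])
  show "cl (Q.arr (up v) \<otimes>\<^bsub>Q.kQ\<^esub> (EB.j s \<otimes>\<^bsub>Q.kQ\<^esub> Q.arr (down u))) = \<zero>\<^bsub>C\<^esub>" if "s \<in> Idl\<^bsub>SB.kQ\<^esub> RB" for s
  proof -
    have "Q.arr (up v) \<otimes>\<^bsub>Q.kQ\<^esub> (EB.j s \<otimes>\<^bsub>Q.kQ\<^esub> Q.arr (down u)) \<in> I"
      by (rule I.I_l_closed[OF I.I_r_closed[OF cl_jB_zero[OF that] a(1)] a(2)])
    then show ?thesis by (rule cl_zero)
  qed
  fix \<beta> assume \<beta>: "\<beta> \<in> PB"
  then have \<beta>p: "\<beta> \<in> paths QB" using PB_paths by blast
  show "cl (Q.arr (up v) \<otimes>\<^bsub>Q.kQ\<^esub> (EB.j (delta K \<beta>) \<otimes>\<^bsub>Q.kQ\<^esub> Q.arr (down u))) = \<zero>\<^bsub>C\<^esub>"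
  proof (cases "path_start \<beta> = fst u \<and> path_end QB \<beta> = fst (snd v)")
    case True
    then have "rel_B v \<beta> u \<in> I" using u v \<beta> by (intro subsetD[OF R_in_I] rel_B_in_R) simp_all
    then show ?thesis unfolding rel_B_def by (rule cl_zero)
  next
    case False
    have "Q.arr (up v) \<otimes>\<^bsub>Q.kQ\<^esub> (EB.j (delta K \<beta>) \<otimes>\<^bsub>Q.kQ\<^esub> Q.arr (down u)) = \<zero>\<^bsub>Q.kQ\<^esub>"
      unfolding EB.j_delta
      by (rule mult_delta_zero) (use False u v \<beta>p in \<open>auto simp: inj_eq[OF inB_inj] simp del: Q_simps(1,2)\<close>)
    then show ?thesis using lin_map_zero[OF Q.kQ_module C.module_axioms cl_lin] by simp
  qed
qed

section \<open>The kernel of the evaluation\<close>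

text \<open>
  The inverse of the map \<open>kQ / I \<rightarrow> \<Lambda>\<close> induced by \<open>\<phi>\<close>: on the diagonal it comes from the
  presentations of \<open>A\<close> and \<open>B\<close>, on \<open>M\<close> and \<open>N\<close> from the universal property of projective bimodules.
\<close>

lemma kernel_subset_I:
  assumes f: "f \<in> carrier Q.kQ" and \<phi>f: "\<phi> f = \<zero>\<^bsub>\<Lambda>\<^esub>"
  shows "f \<in> I"
proof -
  interpret C: k_algebra K C by (rule C_algebra)
  have kerA: "cl (EA.j s) = \<zero>\<^bsub>C\<^esub>" if "s \<in> carrier SA.kQ" "\<phi>A s = \<zero>\<^bsub>A\<^esub>" for s
  proof -
    have "s \<in> Idl\<^bsub>SA.kQ\<^esub> RA" unfolding ker_\<phi>A[symmetric] a_kernel_def' using that by blast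
    then show ?thesis by (rule cl_zero[OF cl_jA_zero])
  qed
  have kerB: "cl (EB.j s) = \<zero>\<^bsub>C\<^esub>" if "s \<in> carrier SB.kQ" "\<phi>B s = \<zero>\<^bsub>B\<^esub>" for s
  proof -
    have "s \<in> Idl\<^bsub>SB.kQ\<^esub> RB" unfolding ker_\<phi>B[symmetric] a_kernel_def' using that by blast
    then show ?thesis by (rule cl_zero[OF cl_jB_zero])
  qed
  \<comment> \<open>The kernel of \<open>\<phi>A\<close> is generated by \<open>RA\<close>, and
    these relations hold in kQ / I, so the embedding of paths descends to \<open>A\<close>.\<close>
  obtain \<rho>A where \<rho>A: "\<rho>A \<in> lin_map K A C" and \<rho>A_\<phi>: "\<And>s. s \<in> carrier SA.kQ \<Longrightarrow> \<rho>A (\<phi>A s) = cl (EA.j s)"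
    using lin_map_factor[OF SA.kQ_module MM.A.module_axioms C.module_axioms SA.\<phi>_lin SA.\<phi>_surj
        lin_map_comp[OF EA.j_lin cl_lin] kerA] by blast
  obtain \<rho>B where \<rho>B: "\<rho>B \<in> lin_map K B C" and \<rho>B_\<phi>: "\<And>s. s \<in> carrier SB.kQ \<Longrightarrow> \<rho>B (\<phi>B s) = cl (EB.j s)"
    using lin_map_factor[OF SB.kQ_module MM.B.module_axioms C.module_axioms SB.\<phi>_lin SB.\<phi>_surj
        lin_map_comp[OF EB.j_lin cl_lin] kerB] by blast
  note cA = lin_map_closed[OF \<rho>A] and cB = lin_map_closed[OF \<rho>B]
  have \<rho>A_mult: "\<rho>A (a \<otimes>\<^bsub>A\<^esub> a') = \<rho>A a \<otimes>\<^bsub>C\<^esub> \<rho>A a'" if a: "a \<in> carrier A" "a' \<in> carrier A" for a a'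
  proof -
    obtain s where s: "s \<in> carrier SA.kQ" "a = \<phi>A s" by (rule SA.\<phi>_cases[OF a(1)])
    obtain s' where s': "s' \<in> carrier SA.kQ" "a' = \<phi>A s'" by (rule SA.\<phi>_cases[OF a(2)])
    show ?thesis
      unfolding s(2) s'(2) SA.\<phi>_mult[OF s(1) s'(1), symmetric] \<rho>A_\<phi>[OF s(1)] \<rho>A_\<phi>[OF s'(1)]
        \<rho>A_\<phi>[OF SA.kQ.A.m_closed[OF s(1) s'(1)]] EA.j_mult[OF s(1) s'(1)]
      by (rule cl_mult[OF EA.j_closed[OF s(1)] EA.j_closed[OF s'(1)]])
  qed
  have \<rho>B_mult: "\<rho>B (b \<otimes>\<^bsub>B\<^esub> b') = \<rho>B b \<otimes>\<^bsub>C\<^esub> \<rho>B b'" if b: "b \<in> carrier B" "b' \<in> carrier B" for b b'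
  proof -
    obtain s where s: "s \<in> carrier SB.kQ" "b = \<phi>B s" by (rule SB.\<phi>_cases[OF b(1)])
    obtain s' where s': "s' \<in> carrier SB.kQ" "b' = \<phi>B s'" by (rule SB.\<phi>_cases[OF b(2)])
    show ?thesis
      unfolding s(2) s'(2) SB.\<phi>_mult[OF s(1) s'(1), symmetric] \<rho>B_\<phi>[OF s(1)] \<rho>B_\<phi>[OF s'(1)]
        \<rho>B_\<phi>[OF SB.kQ.A.m_closed[OF s(1) s'(1)]] EB.j_mult[OF s(1) s'(1)]
      by (rule cl_mult[OF EB.j_closed[OF s(1)] EB.j_closed[OF s'(1)]])
  qed
  have cl0: "cl \<zero>\<^bsub>Q.kQ\<^esub> = \<zero>\<^bsub>C\<^esub>" by (rule lin_map_zero[OF Q.kQ_module C.module_axioms cl_lin])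
  have AB: "\<rho>A a \<otimes>\<^bsub>C\<^esub> \<rho>B b = \<zero>\<^bsub>C\<^esub>" "\<rho>B b \<otimes>\<^bsub>C\<^esub> \<rho>A a = \<zero>\<^bsub>C\<^esub>" if ab: "a \<in> carrier A" "b \<in> carrier B" for a b
  proof -
    obtain s where s: "s \<in> carrier SA.kQ" "a = \<phi>A s" by (rule SA.\<phi>_cases[OF ab(1)])
    obtain t where t: "t \<in> carrier SB.kQ" "b = \<phi>B t" by (rule SB.\<phi>_cases[OF ab(2)])
    note j = EA.j_closed[OF s(1)] EB.j_closed[OF t(1)]
    show "\<rho>A a \<otimes>\<^bsub>C\<^esub> \<rho>B b = \<zero>\<^bsub>C\<^esub>"
      unfolding s(2) t(2) \<rho>A_\<phi>[OF s(1)] \<rho>B_\<phi>[OF t(1)] cl_mult[OF j, symmetric] jA_jB_zero[OF s(1) t(1)] by (rule cl0)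
    show "\<rho>B b \<otimes>\<^bsub>C\<^esub> \<rho>A a = \<zero>\<^bsub>C\<^esub>"
      unfolding s(2) t(2) \<rho>A_\<phi>[OF s(1)] \<rho>B_\<phi>[OF t(1)] cl_mult[OF j(2,1), symmetric] jA_jB_zero[OF s(1) t(1)] by (rule cl0)
  qed
  have \<rho>A_vtx: "\<rho>A e = cl (Q.vtx (inA e))" if "e \<in> verts QA" for e
    using \<rho>A_\<phi>[of "SA.vtx e"] that by (simp add: SA.\<phi>_vtx EA.j_delta)
  have \<rho>B_vtx: "\<rho>B g = cl (Q.vtx (inB g))" if "g \<in> verts QB" for g
    using \<rho>B_\<phi>[of "SB.vtx g"] that by (simp add: SB.\<phi>_vtx EB.j_delta)
  define D where "D = (\<lambda>u. cl (Q.arr (down u)))"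
  define U where "U = (\<lambda>v. cl (Q.arr (up v)))"
  have Dc: "D u \<in> carrier C" if "u \<in> MM.summands" for u
    unfolding D_def by (rule cl_closed[OF arr_in_kQ(1)[OF that]])
  have Uc: "U v \<in> carrier C" if "v \<in> NN.summands" for v
    unfolding U_def by (rule cl_closed[OF arr_in_kQ(2)[OF that]])
  have vtx_c: "Q.vtx x \<in> carrier Q.kQ" if "x \<in> verts Q" for x
    using that by (simp del: Q_simps)
  have ends: "cl (Q.vtx (head Q c)) \<otimes>\<^bsub>C\<^esub> cl (Q.arr c) = cl (Q.arr c)"
    "cl (Q.arr c) \<otimes>\<^bsub>C\<^esub> cl (Q.vtx (tail Q c)) = cl (Q.arr c)" if c: "c \<in> arcs Q" for c
  proof -
    have cc: "Q.arr c \<in> carrier Q.kQ" "arrow_path Q c \<in> paths Q" using Q.arrow_path_in_paths[OF c] by simp_all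
    note v = Q.head_in_verts[OF c] Q.tail_in_verts[OF c]
    show "cl (Q.vtx (head Q c)) \<otimes>\<^bsub>C\<^esub> cl (Q.arr c) = cl (Q.arr c)"
      unfolding cl_mult[OF vtx_c[OF v(1)] cc(1), symmetric] Q.vtx_mult_delta(1)[OF v(1) cc(2)] by simp
    show "cl (Q.arr c) \<otimes>\<^bsub>C\<^esub> cl (Q.vtx (tail Q c)) = cl (Q.arr c)"
      unfolding cl_mult[OF cc(1) vtx_c[OF v(2)], symmetric] Q.vtx_mult_delta(2)[OF v(2) cc(2)] by simp
  qed
  \<comment> \<open>These are the conditions \<open>Ul\<close> and \<open>Ur\<close> of
    \<open>universal_algebra\<close>.\<close>
  have D_ends: "\<rho>B (fst u) \<otimes>\<^bsub>C\<^esub> D u = D u" "D u \<otimes>\<^bsub>C\<^esub> \<rho>A (fst (snd u)) = D u" if u: "u \<in> MM.summands" for u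
    using ends[of "down u"] u down_ends[OF u] by (simp_all add: D_def \<rho>A_vtx \<rho>B_vtx del: quot_mod_simps)
  have U_ends: "\<rho>A (fst v) \<otimes>\<^bsub>C\<^esub> U v = U v" "U v \<otimes>\<^bsub>C\<^esub> \<rho>B (fst (snd v)) = U v" if v: "v \<in> NN.summands" for v
    using ends[of "up v"] v up_ends[OF v] by (simp_all add: U_def \<rho>A_vtx \<rho>B_vtx del: quot_mod_simps)
  obtain \<psi>M where \<psi>M: "\<psi>M \<in> lin_map K M C"
    and \<psi>M_l: "\<And>b x. \<lbrakk>b \<in> carrier B; x \<in> carrier M\<rbrakk> \<Longrightarrow> \<psi>M (lact M b x) = \<rho>B b \<otimes>\<^bsub>C\<^esub> \<psi>M x"
    and \<psi>M_r: "\<And>x a. \<lbrakk>x \<in> carrier M; a \<in> carrier A\<rbrakk> \<Longrightarrow> \<psi>M (ract M x a) = \<psi>M x \<otimes>\<^bsub>C\<^esub> \<rho>A a"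
    and \<psi>M_gen: "\<And>u b a. \<lbrakk>u \<in> MM.summands; b \<in> carrier B; a \<in> carrier A\<rbrakk> \<Longrightarrow>
      \<psi>M (ract M (lact M b (MM.gen u)) a) = \<rho>B b \<otimes>\<^bsub>C\<^esub> D u \<otimes>\<^bsub>C\<^esub> \<rho>A a"
    using MM.universal_algebra[OF C_algebra \<rho>A \<rho>A_mult \<rho>B \<rho>B_mult Dc D_ends] by blast
  \<comment> \<open>For \<open>N\<close> the roles of \<open>A\<close> and \<open>B\<close> in
    \<open>universal_algebra\<close> are exchanged.\<close>
  obtain \<psi>N where \<psi>N: "\<psi>N \<in> lin_map K N C"
    and \<psi>N_l: "\<And>a y. \<lbrakk>a \<in> carrier A; y \<in> carrier N\<rbrakk> \<Longrightarrow> \<psi>N (lact N a y) = \<rho>A a \<otimes>\<^bsub>C\<^esub> \<psi>N y"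
    and \<psi>N_r: "\<And>y b. \<lbrakk>y \<in> carrier N; b \<in> carrier B\<rbrakk> \<Longrightarrow> \<psi>N (ract N y b) = \<psi>N y \<otimes>\<^bsub>C\<^esub> \<rho>B b"
    and \<psi>N_gen: "\<And>v a b. \<lbrakk>v \<in> NN.summands; a \<in> carrier A; b \<in> carrier B\<rbrakk> \<Longrightarrow>
      \<psi>N (ract N (lact N a (NN.gen v)) b) = \<rho>A a \<otimes>\<^bsub>C\<^esub> U v \<otimes>\<^bsub>C\<^esub> \<rho>B b"
    using NN.universal_algebra[OF C_algebra \<rho>B \<rho>B_mult \<rho>A \<rho>A_mult Uc U_ends] by blast
  note cM = lin_map_closed[OF \<psi>M] and cN = lin_map_closed[OF \<psi>N]
  have one: "\<psi>M x = \<rho>B \<one>\<^bsub>B\<^esub> \<otimes>\<^bsub>C\<^esub> \<psi>M x" "\<psi>N y = \<rho>A \<one>\<^bsub>A\<^esub> \<otimes>\<^bsub>C\<^esub> \<psi>N y" if "x \<in> carrier M" "y \<in> carrier N" for x y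
    using \<psi>M_l[of "\<one>\<^bsub>B\<^esub>" x] \<psi>N_l[of "\<one>\<^bsub>A\<^esub>" y] that by (simp_all add: MM.lact_one NN.lact_one del: quot_mod_simps)
  \<comment> \<open>A product is zero if orthogonal factors can be split off at the place where its
    two sides meet. In the applications these are images of an idempotent of \<open>A\<close> and
    one of \<open>B\<close>.\<close>
  have assoc0: "p \<otimes>\<^bsub>C\<^esub> r = \<zero>\<^bsub>C\<^esub>" if "p = p' \<otimes>\<^bsub>C\<^esub> p''" "r = r'' \<otimes>\<^bsub>C\<^esub> r'" "p'' \<otimes>\<^bsub>C\<^esub> r'' = \<zero>\<^bsub>C\<^esub>"
    "p' \<in> carrier C" "p'' \<in> carrier C" "r' \<in> carrier C" "r'' \<in> carrier C" for p p' p'' r r' r''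
  proof -
    have "p \<otimes>\<^bsub>C\<^esub> r = p' \<otimes>\<^bsub>C\<^esub> ((p'' \<otimes>\<^bsub>C\<^esub> r'') \<otimes>\<^bsub>C\<^esub> r')"
      unfolding that(1,2) using that(4-7) by (simp add: C.A.m_assoc del: quot_mod_simps)
    also have "\<dots> = \<zero>\<^bsub>C\<^esub>" unfolding that(3) using that(4-7) by (simp del: quot_mod_simps)
    finally show ?thesis .
  qed
  note oneA = cA[OF MM.A.A.one_closed] and oneB = cB[OF MM.B.A.one_closed]
  have unit: "\<rho>A a = \<rho>A a \<otimes>\<^bsub>C\<^esub> \<rho>A \<one>\<^bsub>A\<^esub>" "\<rho>A a = \<rho>A \<one>\<^bsub>A\<^esub> \<otimes>\<^bsub>C\<^esub> \<rho>A a"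
    "\<rho>B b = \<rho>B b \<otimes>\<^bsub>C\<^esub> \<rho>B \<one>\<^bsub>B\<^esub>" "\<rho>B b = \<rho>B \<one>\<^bsub>B\<^esub> \<otimes>\<^bsub>C\<^esub> \<rho>B b" if "a \<in> carrier A" "b \<in> carrier B" for a b
    using \<rho>A_mult[of a "\<one>\<^bsub>A\<^esub>"] \<rho>A_mult[of "\<one>\<^bsub>A\<^esub>" a] \<rho>B_mult[of b "\<one>\<^bsub>B\<^esub>"] \<rho>B_mult[of "\<one>\<^bsub>B\<^esub>" b] that
    by (simp_all del: quot_mod_simps)
  \<comment> \<open>This and the next five facts are the products that vanish for reasons of
    corners, without any use of the new relations.\<close>
  have A_M: "\<rho>A a \<otimes>\<^bsub>C\<^esub> \<psi>M x = \<zero>\<^bsub>C\<^esub>" if "a \<in> carrier A" "x \<in> carrier M" for a x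
    by (rule assoc0[OF unit(1)[OF that(1) MM.B.A.one_closed] one(1)[OF that(2) NN.M.M.zero_closed]
        AB(1)[OF MM.A.A.one_closed MM.B.A.one_closed] cA[OF that(1)] oneA cM[OF that(2)] oneB])
  have B_N: "\<rho>B b \<otimes>\<^bsub>C\<^esub> \<psi>N y = \<zero>\<^bsub>C\<^esub>" if "b \<in> carrier B" "y \<in> carrier N" for b y
    by (rule assoc0[OF unit(3)[OF MM.A.A.one_closed that(1)] one(2)[OF MM.M.M.zero_closed that(2)]
        AB(2)[OF MM.A.A.one_closed MM.B.A.one_closed] cB[OF that(1)] oneB cN[OF that(2)] oneA])
  have D_B: "D u \<otimes>\<^bsub>C\<^esub> \<rho>B b = \<zero>\<^bsub>C\<^esub>" if u: "u \<in> MM.summands" and b: "b \<in> carrier B" for u b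
    by (rule assoc0[OF D_ends(2)[OF u, symmetric] unit(4)[OF MM.A.A.one_closed b]
        AB(1)[OF MM.summandsD(3)[OF u] MM.B.A.one_closed] Dc[OF u] cA[OF MM.summandsD(3)[OF u]] cB[OF b] oneB])
  have U_A: "U v \<otimes>\<^bsub>C\<^esub> \<rho>A a = \<zero>\<^bsub>C\<^esub>" if v: "v \<in> NN.summands" and a: "a \<in> carrier A" for v a
    by (rule assoc0[OF U_ends(2)[OF v, symmetric] unit(2)[OF a MM.B.A.one_closed]
        AB(2)[OF MM.A.A.one_closed NN.summandsD(3)[OF v]] Uc[OF v] cB[OF NN.summandsD(3)[OF v]] cA[OF a] oneA])
  have D_M: "D u \<otimes>\<^bsub>C\<^esub> \<psi>M x = \<zero>\<^bsub>C\<^esub>" if u: "u \<in> MM.summands" and x: "x \<in> carrier M" for u x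
    by (rule assoc0[OF D_ends(2)[OF u, symmetric] one(1)[OF x NN.M.M.zero_closed]
        AB(1)[OF MM.summandsD(3)[OF u] MM.B.A.one_closed] Dc[OF u] cA[OF MM.summandsD(3)[OF u]] cM[OF x] oneB])
  have U_N: "U v \<otimes>\<^bsub>C\<^esub> \<psi>N y = \<zero>\<^bsub>C\<^esub>" if v: "v \<in> NN.summands" and y: "y \<in> carrier N" for v y
    by (rule assoc0[OF U_ends(2)[OF v, symmetric] one(2)[OF MM.M.M.zero_closed y]
        AB(2)[OF MM.A.A.one_closed NN.summandsD(3)[OF v]] Uc[OF v] cB[OF NN.summandsD(3)[OF v]] cN[OF y] oneA])
  \<comment> \<open>Here the idempotents match, and the product vanishes because of the new
    relations.\<close>
  have DAU: "D u \<otimes>\<^bsub>C\<^esub> (\<rho>A a \<otimes>\<^bsub>C\<^esub> U v) = \<zero>\<^bsub>C\<^esub>"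
    if u: "u \<in> MM.summands" and v: "v \<in> NN.summands" and a: "a \<in> carrier A" for u v a
  proof -
    obtain s where s: "s \<in> carrier SA.kQ" "a = \<phi>A s" by (rule SA.\<phi>_cases[OF a])
    note c = arr_in_kQ(1)[OF u] arr_in_kQ(2)[OF v] EA.j_closed[OF s(1)]
    show ?thesis
      unfolding s(2) \<rho>A_\<phi>[OF s(1)] D_def U_def cl_mult[OF c(3,2), symmetric]
        cl_mult[OF c(1) Q.kQ.A.m_closed[OF c(3,2)], symmetric] by (rule rel_A_zero[OF u v s(1)])
  qed
  have UBD: "U v \<otimes>\<^bsub>C\<^esub> (\<rho>B b \<otimes>\<^bsub>C\<^esub> D u) = \<zero>\<^bsub>C\<^esub>"
    if u: "u \<in> MM.summands" and v: "v \<in> NN.summands" and b: "b \<in> carrier B" for u v b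
  proof -
    obtain s where s: "s \<in> carrier SB.kQ" "b = \<phi>B s" by (rule SB.\<phi>_cases[OF b])
    note c = arr_in_kQ(1)[OF u] arr_in_kQ(2)[OF v] EB.j_closed[OF s(1)]
    show ?thesis
      unfolding s(2) \<rho>B_\<phi>[OF s(1)] D_def U_def cl_mult[OF c(3,1), symmetric]
        cl_mult[OF c(2) Q.kQ.A.m_closed[OF c(3,1)], symmetric] by (rule rel_B_zero[OF u v s(1)])
  qed
  \<comment> \<open>The image of a generator of \<open>N\<close> begins with an element of
    \<open>A\<close> followed by an up arrow, so \<open>DAU\<close> applies.\<close>
  have D_N: "D u \<otimes>\<^bsub>C\<^esub> \<psi>N y = \<zero>\<^bsub>C\<^esub>" if u: "u \<in> MM.summands" and y: "y \<in> carrier N" for u y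
    using y
  proof (induction rule: NN.gen_induct)
    case zero
    show ?case unfolding lin_map_zero[OF NN.M.module_axioms C.module_axioms \<psi>N] by (rule C.A.r_null[OF Dc[OF u]])
  next
    case (add y y')
    show ?case
      unfolding lin_map_add[OF \<psi>N add(1,2)] C.A.r_distr[OF cN[OF add(1)] cN[OF add(2)] Dc[OF u]] add(3,4)
      by (rule C.A.l_zero[OF C.A.zero_closed])
  next
    case (gen v a b)
    have "D u \<otimes>\<^bsub>C\<^esub> (\<rho>A a \<otimes>\<^bsub>C\<^esub> U v \<otimes>\<^bsub>C\<^esub> \<rho>B b) = D u \<otimes>\<^bsub>C\<^esub> (\<rho>A a \<otimes>\<^bsub>C\<^esub> U v) \<otimes>\<^bsub>C\<^esub> \<rho>B b"
      using Dc[OF u] cA[OF gen(2)] Uc[OF gen(1)] cB[OF gen(3)] by (simp add: C.A.m_assoc del: quot_mod_simps)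
    then show ?case unfolding \<psi>N_gen[OF gen] DAU[OF u gen(1,2)] C.A.l_null[OF cB[OF gen(3)]] .
  qed
  have U_M: "U v \<otimes>\<^bsub>C\<^esub> \<psi>M x = \<zero>\<^bsub>C\<^esub>" if v: "v \<in> NN.summands" and x: "x \<in> carrier M" for v x
    using x
  proof (induction rule: MM.gen_induct)
    case zero
    show ?case unfolding lin_map_zero[OF MM.M.module_axioms C.module_axioms \<psi>M] by (rule C.A.r_null[OF Uc[OF v]])
  next
    case (add x x')
    show ?case
      unfolding lin_map_add[OF \<psi>M add(1,2)] C.A.r_distr[OF cM[OF add(1)] cM[OF add(2)] Uc[OF v]] add(3,4)
      by (rule C.A.l_zero[OF C.A.zero_closed])
  next
    case (gen u b a)
    have "U v \<otimes>\<^bsub>C\<^esub> (\<rho>B b \<otimes>\<^bsub>C\<^esub> D u \<otimes>\<^bsub>C\<^esub> \<rho>A a) = U v \<otimes>\<^bsub>C\<^esub> (\<rho>B b \<otimes>\<^bsub>C\<^esub> D u) \<otimes>\<^bsub>C\<^esub> \<rho>A a"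
      using Uc[OF v] cB[OF gen(2)] Dc[OF gen(1)] cA[OF gen(3)] by (simp add: C.A.m_assoc del: quot_mod_simps)
    then show ?case unfolding \<psi>M_gen[OF gen] UBD[OF gen(1) v gen(2)] C.A.l_null[OF cA[OF gen(3)]] .
  qed
  define \<psi> where "\<psi> = (\<lambda>(a, y, x, b). \<rho>A a \<oplus>\<^bsub>C\<^esub> \<psi>N y \<oplus>\<^bsub>C\<^esub> \<psi>M x \<oplus>\<^bsub>C\<^esub> \<rho>B b)"
  note lin0 = lin_map_zero[OF MM.A.module_axioms C.module_axioms \<rho>A] lin_map_zero[OF MM.B.module_axioms C.module_axioms \<rho>B]
    lin_map_zero[OF MM.M.module_axioms C.module_axioms \<psi>M] lin_map_zero[OF NN.M.module_axioms C.module_axioms \<psi>N]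
  note lin_add = lin_map_add[OF \<rho>A] lin_map_add[OF \<rho>B] lin_map_add[OF \<psi>M] lin_map_add[OF \<psi>N]
  note lin_smult = lin_map_smult[OF \<rho>A] lin_map_smult[OF \<rho>B] lin_map_smult[OF \<psi>M] lin_map_smult[OF \<psi>N]
  have \<psi>_lin: "\<psi> \<in> lin_map K \<Lambda> C"
  proof (rule lin_mapI)
    fix z assume z: "z \<in> carrier \<Lambda>"
    obtain a y x b where z': "z = (a, y, x, b)" "a \<in> carrier A" "y \<in> carrier N" "x \<in> carrier M" "b \<in> carrier B"
      using \<Lambda>_cases[OF z] .
    show "\<psi> z \<in> carrier C" using z' by (simp add: \<psi>_def cA cB cM cN del: quot_mod_simps)
    show "\<psi> (c \<odot>\<^bsub>\<Lambda>\<^esub> z) = c \<odot>\<^bsub>C\<^esub> \<psi> z" if "c \<in> carrier K" for c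
      using z' that by (simp add: \<psi>_def cA cB cM cN lin_smult C.smult_r_distr del: quot_mod_simps)
    fix w assume w: "w \<in> carrier \<Lambda>"
    obtain a2 y2 x2 b2 where w': "w = (a2, y2, x2, b2)" "a2 \<in> carrier A" "y2 \<in> carrier N" "x2 \<in> carrier M" "b2 \<in> carrier B"
      using \<Lambda>_cases[OF w] .
    show "\<psi> (z \<oplus>\<^bsub>\<Lambda>\<^esub> w) = \<psi> z \<oplus>\<^bsub>C\<^esub> \<psi> w"
      using z' w' by (simp add: \<psi>_def cA cB cM cN lin_add C.A.a_ac del: quot_mod_simps)
  qed
  \<comment> \<open>The intertwining identity. In each case some entries of \<open>z\<close> are
    lost in \<Lambda>, and the vanishing products above make their images disappear in kQ / I as
    well.\<close>
  have step: "\<psi> (\<theta> c \<otimes>\<^bsub>\<Lambda>\<^esub> z) = cl (Q.arr c) \<otimes>\<^bsub>C\<^esub> \<psi> z" if c: "c \<in> arcs Q" and z: "z \<in> carrier \<Lambda>" for c z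
  proof -
    obtain a y x b where z': "z = (a, y, x, b)" "a \<in> carrier A" "y \<in> carrier N" "x \<in> carrier M" "b \<in> carrier B"
      using \<Lambda>_cases[OF z] .
    note cl4 = cA[OF z'(2)] cN[OF z'(3)] cM[OF z'(4)] cB[OF z'(5)]
    from c show ?thesis
    proof (rule arrow_cases)
      fix p assume p: "p \<in> arcs QA" "c = Arrow_A p"
      define t where "t = \<phi>A (SA.arr p)"
      have t: "t \<in> carrier A" using \<phi>A_arr(1)[OF p(1)] by (simp add: t_def)
      have ct: "cl (Q.arr c) = \<rho>A t"
        using \<rho>A_\<phi>[of "SA.arr p"] p by (simp add: t_def EA.j_delta EA.path_map_arrow)
      have "\<theta> c \<otimes>\<^bsub>\<Lambda>\<^esub> z = (t \<otimes>\<^bsub>A\<^esub> a, lact N t y, \<zero>\<^bsub>M\<^esub>, \<zero>\<^bsub>B\<^esub>)"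
        using p z' t by (simp add: inA_def act_closed flip: t_def)
      then show ?thesis
        using z' t cl4 cA[OF t] A_M[OF t] AB(1)[OF t]
        by (simp add: ct \<psi>_def lin0 \<rho>A_mult \<psi>N_l C.A.r_distr del: quot_mod_simps)
    next
      fix q assume q: "q \<in> arcs QB" "c = Arrow_B q"
      define t where "t = \<phi>B (SB.arr q)"
      have t: "t \<in> carrier B" using \<phi>B_arr(1)[OF q(1)] by (simp add: t_def)
      have ct: "cl (Q.arr c) = \<rho>B t"
        using \<rho>B_\<phi>[of "SB.arr q"] q by (simp add: t_def EB.j_delta EB.path_map_arrow)
      have "\<theta> c \<otimes>\<^bsub>\<Lambda>\<^esub> z = (\<zero>\<^bsub>A\<^esub>, \<zero>\<^bsub>N\<^esub>, lact M t x, t \<otimes>\<^bsub>B\<^esub> b)"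
        using q z' t by (simp add: inB_def act_closed flip: t_def)
      then show ?thesis
        using z' t cl4 cB[OF t] B_N[OF t] AB(2)[OF z'(2) t]
        by (simp add: ct \<psi>_def lin0 \<rho>B_mult \<psi>M_l C.A.r_distr del: quot_mod_simps)
    next
      fix u assume u: "u \<in> MM.summands" "c = down u"
      have g: "MM.gen u \<in> carrier M" by (rule MM.gen_closed[OF u(1)])
      have ct: "cl (Q.arr c) = D u" using u by (simp add: D_def)
      have "\<theta> c \<otimes>\<^bsub>\<Lambda>\<^esub> z = (\<zero>\<^bsub>A\<^esub>, \<zero>\<^bsub>N\<^esub>, ract M (MM.gen u) a, \<zero>\<^bsub>B\<^esub>)"
        using u z' g by (simp add: inM_def act_closed)
      moreover have "\<psi>M (ract M (MM.gen u) a) = D u \<otimes>\<^bsub>C\<^esub> \<rho>A a"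
      proof -
        have "\<psi>M (ract M (MM.gen u) a) = \<rho>B (fst u) \<otimes>\<^bsub>C\<^esub> D u \<otimes>\<^bsub>C\<^esub> \<rho>A a"
          using \<psi>M_gen[OF u(1) MM.summandsD(1)[OF u(1)] z'(2)] unfolding MM.gen_ends[OF u(1)] .
        then show ?thesis unfolding D_ends[OF u(1)] .
      qed
      ultimately show ?thesis
        using z' cl4 Dc[OF u(1)] D_B[OF u(1)] D_M[OF u(1)] D_N[OF u(1)]
        by (simp add: ct \<psi>_def lin0 C.A.r_distr del: quot_mod_simps)
    next
      fix v assume v: "v \<in> NN.summands" "c = up v"
      have g: "NN.gen v \<in> carrier N" by (rule NN.gen_closed[OF v(1)])
      have ct: "cl (Q.arr c) = U v" using v by (simp add: U_def)
      have "\<theta> c \<otimes>\<^bsub>\<Lambda>\<^esub> z = (\<zero>\<^bsub>A\<^esub>, ract N (NN.gen v) b, \<zero>\<^bsub>M\<^esub>, \<zero>\<^bsub>B\<^esub>)"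
        using v z' g by (simp add: inN_def act_closed)
      moreover have "\<psi>N (ract N (NN.gen v) b) = U v \<otimes>\<^bsub>C\<^esub> \<rho>B b"
      proof -
        have "\<psi>N (ract N (NN.gen v) b) = \<rho>A (fst v) \<otimes>\<^bsub>C\<^esub> U v \<otimes>\<^bsub>C\<^esub> \<rho>B b"
          using \<psi>N_gen[OF v(1) NN.summandsD(1)[OF v(1)] z'(5)] unfolding NN.gen_ends[OF v(1)] .
        then show ?thesis unfolding U_ends[OF v(1)] .
      qed
      ultimately show ?thesis
        using z' cl4 Uc[OF v(1)] U_A[OF v(1)] U_M[OF v(1)] U_N[OF v(1)]
        by (simp add: ct \<psi>_def lin0 C.A.r_distr del: quot_mod_simps)
    qed
  qed
  have \<psi>_\<phi>: "\<psi> (\<phi> (delta K \<gamma>)) = cl (delta K \<gamma>)" if "\<gamma> \<in> paths Q" for \<gamma>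
    using that
  proof (induction rule: Q.path_induct)
    case (vertex x)
    show ?case
      unfolding ev.evaluation_vertex[OF vertex]
      using vertex
    proof (rule vertex_cases)
      fix e assume e: "e \<in> verts QA" "x = inA e"
      show "\<psi> x = cl (Q.vtx x)"
        using \<rho>A_vtx[OF e(1)] cA[OF SA.vertex_in_L[OF e(1)]] e(2)
        by (simp add: \<psi>_def inA_def lin0 del: quot_mod_simps)
    next
      fix g assume g: "g \<in> verts QB" "x = inB g"
      show "\<psi> x = cl (Q.vtx x)"
        using \<rho>B_vtx[OF g(1)] cB[OF SB.vertex_in_L[OF g(1)]] g(2)
        by (simp add: \<psi>_def inB_def lin0 del: quot_mod_simps)
    qed
  next
    case (arrow c \<gamma>)
    have c: "arrow_path Q c \<in> paths Q" using arrow(1) by (rule Q.arrow_path_in_paths)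
    then have kQ: "Q.arr c \<in> carrier Q.kQ" "delta K \<gamma> \<in> carrier Q.kQ" using arrow(2) by simp_all
    have d: "delta K (path_comp (arrow_path Q c) \<gamma>) = Q.arr c \<otimes>\<^bsub>Q.kQ\<^esub> delta K \<gamma>"
      using arrow c by (simp add: Q.delta_comp)
    show ?case
      unfolding d \<phi>_mult[OF kQ] ev.evaluation_arrow[OF arrow(1)] step[OF arrow(1) \<phi>_closed[OF kQ(2)]]
        arrow(4) cl_mult[OF kQ] ..
  qed
  have "cl f = \<psi> (\<phi> f)"
    by (rule Q.kQ_lin_map_eqI[OF C.module_axioms cl_lin lin_map_comp[OF \<phi>_lin \<psi>_lin] \<psi>_\<phi>[symmetric] f])
  also have "\<dots> = \<zero>\<^bsub>C\<^esub>" unfolding \<phi>f by (rule lin_map_zero[OF \<Lambda>_module C.module_axioms \<psi>_lin])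
  finally show ?thesis using cl_eq_zero_iff[OF f] by blast
qed

lemma kernel_eq: "a_kernel Q.kQ \<Lambda> \<phi> = I"
proof
  show "a_kernel Q.kQ \<Lambda> \<phi> \<subseteq> I" using kernel_subset_I unfolding a_kernel_def' by blast
qed (rule I_in_ker)

section \<open>Admissibility and the presentation\<close>

lemma relation_form:
  assumes "r \<in> R"
  shows "\<exists>x\<in>verts Q. \<exists>y\<in>verts Q. \<exists>z\<in>I. r = Q.vtx y \<otimes>\<^bsub>Q.kQ\<^esub> z \<otimes>\<^bsub>Q.kQ\<^esub> Q.vtx x"
  using assms
proof (rule R_cases)
  fix s assume s: "s \<in> RA" "r = EA.j s"
  from RA_form[OF s(1)] obtain x y z where xyz: "x \<in> verts QA" "y \<in> verts QA" "z \<in> a_kernel SA.kQ A \<phi>A"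
    "s = SA.vtx y \<otimes>\<^bsub>SA.kQ\<^esub> z \<otimes>\<^bsub>SA.kQ\<^esub> SA.vtx x" by blast
  have zc: "z \<in> carrier SA.kQ" using xyz(3) by (simp add: a_kernel_def')
  have zI: "EA.j z \<in> I" by (rule cl_jA_zero[OF xyz(3)[unfolded ker_\<phi>A]])
  have v: "SA.vtx x \<in> carrier SA.kQ" "SA.vtx y \<in> carrier SA.kQ" using xyz by simp_all
  have "r = Q.vtx (inA y) \<otimes>\<^bsub>Q.kQ\<^esub> EA.j z \<otimes>\<^bsub>Q.kQ\<^esub> Q.vtx (inA x)"
    unfolding s(2) xyz(4) EA.j_mult[OF SA.kQ.A.m_closed[OF v(2) zc] v(1)] EA.j_mult[OF v(2) zc]
    by (simp add: EA.j_delta)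
  then show ?thesis using xyz(1,2) zI by (intro bexI) auto
next
  fix s assume s: "s \<in> RB" "r = EB.j s"
  from RB_form[OF s(1)] obtain x y z where xyz: "x \<in> verts QB" "y \<in> verts QB" "z \<in> a_kernel SB.kQ B \<phi>B"
    "s = SB.vtx y \<otimes>\<^bsub>SB.kQ\<^esub> z \<otimes>\<^bsub>SB.kQ\<^esub> SB.vtx x" by blast
  have zc: "z \<in> carrier SB.kQ" using xyz(3) by (simp add: a_kernel_def')
  have zI: "EB.j z \<in> I" by (rule cl_jB_zero[OF xyz(3)[unfolded ker_\<phi>B]])
  have v: "SB.vtx x \<in> carrier SB.kQ" "SB.vtx y \<in> carrier SB.kQ" using xyz by simp_all
  have "r = Q.vtx (inB y) \<otimes>\<^bsub>Q.kQ\<^esub> EB.j z \<otimes>\<^bsub>Q.kQ\<^esub> Q.vtx (inB x)"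
    unfolding s(2) xyz(4) EB.j_mult[OF SB.kQ.A.m_closed[OF v(2) zc] v(1)] EB.j_mult[OF v(2) zc]
    by (simp add: EB.j_delta)
  then show ?thesis using xyz(1,2) zI by (intro bexI) auto
next
  fix \<gamma> assume \<gamma>: "\<gamma> \<in> paths Q" "r = delta K \<gamma>"
  have "r \<in> I" using R_in_I assms by blast
  moreover have "r = Q.vtx (path_end Q \<gamma>) \<otimes>\<^bsub>Q.kQ\<^esub> r \<otimes>\<^bsub>Q.kQ\<^esub> Q.vtx (path_start \<gamma>)"
    unfolding \<gamma>(2) Q.vtx_mult_delta[OF Q.path_end_in_verts[OF \<gamma>(1)] \<gamma>(1)]
      Q.vtx_mult_delta[OF Q.path_start_in_verts[OF \<gamma>(1)] \<gamma>(1)] by (simp add: Q.vtx_mult_delta[OF Q.path_start_in_verts[OF \<gamma>(1)] \<gamma>(1)] del: Q_simps)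
  ultimately show ?thesis using Q.path_end_in_verts[OF \<gamma>(1)] Q.path_start_in_verts[OF \<gamma>(1)] by blast
qed

text \<open>With this the radical, the idempotents and the arrow spaces of \<Lambda> are governed by
  the general results on admissible surjections, so that \<open>Q\<close> is its Gabriel
  quiver.\<close>

lemma \<phi>_admissible_surjection: "admissible_surjection K Q \<Lambda> \<phi> (Suc (dA + dB))"
proof (intro admissible_surjection.intro admissible_surjection_axioms.intro Q.quiver_algebra_axioms
    \<Lambda>_algebra ev.evaluation_alg_hom \<phi>_surj)
  show "\<phi> (Q.vtx x) = x" if "x \<in> verts Q" for x by (rule ev.evaluation_vertex[OF that])
  show "\<phi> f = \<zero>\<^bsub>\<Lambda>\<^esub>" if "f \<in> Q.long (Suc (dA + dB))" for f by (rule \<phi>_long[OF that])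
  show "f \<in> Q.long 2" if "f \<in> carrier Q.kQ" "\<phi> f = \<zero>\<^bsub>\<Lambda>\<^esub>" for f
    using I_long kernel_subset_I[OF that] by blast
qed

lemma presentation:
  assumes "finite_dim K \<Lambda>"
  shows "presentation K \<Lambda> Q R"
proof -
  have "Q.long (Suc (dA + dB)) \<subseteq> I"
    using kernel_subset_I \<phi>_long Q.long_closed by blast
  then have adm: "admissible K Q I"
    unfolding Q.admissible_iff using I_ideal I_long by blast
  show ?thesis
    unfolding presentation_def Let_def
    by (intro conjI admissible_surjection.gabriel_quiver[OF \<phi>_admissible_surjection assms]
        bexI[OF _ ev.evaluation_alg_hom] \<phi>_surj ballI ev.evaluation_vertex R_subset;
        (unfold kernel_eq)?; (rule refl adm | erule relation_form | assumption))
qed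

end

section \<open>From the hypotheses of the theorem to the chosen data\<close>

lemma presentation_obtain:
  assumes "k_algebra K A" and "presentation K A Q R"
  obtains \<phi> d where "admissible_surjection K Q A \<phi> d"
    and "R \<subseteq> carrier (path_algebra K Q)"
    and "a_kernel (path_algebra K Q) A \<phi> = Idl\<^bsub>path_algebra K Q\<^esub> R"
    and "\<forall>r\<in>R. \<exists>x\<in>verts Q. \<exists>y\<in>verts Q. \<exists>z\<in>a_kernel (path_algebra K Q) A \<phi>.
      r = delta K (vertex_path y) \<otimes>\<^bsub>path_algebra K Q\<^esub> z \<otimes>\<^bsub>path_algebra K Q\<^esub> delta K (vertex_path x)"
proof -
  interpret A: k_algebra K A by fact
  from assms(2) have gq: "gabriel_quiver K A Q" unfolding presentation_def by (rule conjunct1)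
  interpret quiver_algebra K Q
    using gq by (intro quiver_algebra.intro A.K.field_axioms) (simp add: gabriel_quiver_def)
  obtain \<phi> where \<phi>: "\<phi> \<in> alg_hom K kQ A" "\<phi> ` carrier kQ = carrier A" "\<forall>x\<in>verts Q. \<phi> (vtx x) = x"
    and R: "R \<subseteq> carrier kQ" "a_kernel kQ A \<phi> = Idl\<^bsub>kQ\<^esub> R"
    and adm: "admissible K Q (a_kernel kQ A \<phi>)"
    and form: "\<forall>r\<in>R. \<exists>x\<in>verts Q. \<exists>y\<in>verts Q. \<exists>z\<in>a_kernel kQ A \<phi>. r = vtx y \<otimes>\<^bsub>kQ\<^esub> z \<otimes>\<^bsub>kQ\<^esub> vtx x"
    using assms(2) unfolding presentation_def Let_def by (elim conjE bexE)
  from adm obtain d where d: "long d \<subseteq> a_kernel kQ A \<phi>" and two: "a_kernel kQ A \<phi> \<subseteq> long 2"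
    unfolding admissible_iff by (elim conjE exE)
  have "admissible_surjection K Q A \<phi> d"
  proof (intro admissible_surjection.intro admissible_surjection_axioms.intro
      quiver_algebra_axioms A.k_algebra_axioms \<phi>(1,2))
    show "\<phi> (vtx x) = x" if "x \<in> verts Q" for x using \<phi>(3) that by (rule bspec)
    show "\<phi> f = \<zero>\<^bsub>A\<^esub>" if "f \<in> long d" for f using subsetD[OF d that] by (simp add: a_kernel_def')
    show "f \<in> long 2" if "f \<in> carrier kQ" "\<phi> f = \<zero>\<^bsub>A\<^esub>" for f
      by (rule subsetD[OF two]) (use that in \<open>simp add: a_kernel_def' del: kQ_simps\<close>)
  qed
  then show thesis using R form by (rule that)
qed

lemma proj_bimodule_obtain:
  assumes "k_bimodule K B A M" and "bimod_isomorphic K B A M (proj_sum K B A F E m)"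
    and "complete_primitive_orthogonal B F" and "complete_primitive_orthogonal A E"
  obtains h where "proj_bimodule K B A M F E m h"
proof -
  from assms(2) obtain h where h: "bij_betw h (carrier M) (carrier (proj_sum K B A F E m))"
    "\<forall>x\<in>carrier M. \<forall>y\<in>carrier M. h (x \<oplus>\<^bsub>M\<^esub> y) = h x \<oplus>\<^bsub>proj_sum K B A F E m\<^esub> h y"
    "\<forall>c\<in>carrier K. \<forall>x\<in>carrier M. h (c \<odot>\<^bsub>M\<^esub> x) = c \<odot>\<^bsub>proj_sum K B A F E m\<^esub> h x"
    "\<forall>b\<in>carrier B. \<forall>x\<in>carrier M. h (lact M b x) = lact (proj_sum K B A F E m) b (h x)"
    "\<forall>x\<in>carrier M. \<forall>a\<in>carrier A. h (ract M x a) = ract (proj_sum K B A F E m) (h x) a"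
    unfolding bimod_isomorphic_def by (elim exE conjE)
  have lin: "h \<in> lin_map K M (proj_sum K B A F E m)"
    by (rule lin_mapI; use h(2,3) bij_betwE[OF h(1)] in simp)
  have idem: "idempotent B g" if "g \<in> F" for g
    using assms(3) that unfolding complete_primitive_orthogonal_def primitive_idempotent_def by blast
  have idem': "idempotent A e" if "e \<in> E" for e
    using assms(4) that unfolding complete_primitive_orthogonal_def primitive_idempotent_def by blast
  have fin: "finite F" "finite E" using assms(3,4) unfolding complete_primitive_orthogonal_def by blast+
  have "proj_bimodule K B A M F E m h"
    by (intro proj_bimodule.intro proj_bimodule_axioms.intro assms(1) fin idem idem' h(1) lin)
      (use h(4,5) in simp_all)
  then show thesis by (rule that)
qed

theorem theorem5p4:
  fixes K :: "('k, 'r) ring_scheme"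
    and A :: "('k, 'a) module" and B :: "('k, 'b) module"
    and M :: "('k, 'b, 'a, 'm) bimod" and N :: "('k, 'a, 'b, 'n) bimod"
    and QA :: "('a, 'p) pre_digraph" and QB :: "('b, 'q) pre_digraph"
    and RA :: "(('a, 'p) path \<Rightarrow> 'k) set" and RB :: "(('b, 'q) path \<Rightarrow> 'k) set"
    and PA :: "('a, 'p) path set" and PB :: "('b, 'q) path set"
    and m :: "'b \<Rightarrow> 'a \<Rightarrow> nat" and n :: "'a \<Rightarrow> 'b \<Rightarrow> nat"
  defines "\<Lambda> \<equiv> null_square_algebra A N M B"
    and "iA \<equiv> vertex_A N M B" and "iB \<equiv> vertex_B A N M"
  assumes "field K"
    and "k_algebra K A" and "k_algebra K B"
    and "k_bimodule K B A M" and "k_bimodule K A B N"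
    and "finite_dim K \<Lambda>"
    and "basic_sober K A" and "basic_sober K B"
    and "presentation K A QA RA" and "presentation K B QB RB"
    and "bimod_isomorphic K B A M (proj_sum K B A (verts QB) (verts QA) m)"
    and "bimod_isomorphic K A B N (proj_sum K A B (verts QA) (verts QB) n)"
    and "path_basis K QA RA PA" and "path_basis K QB RB PB"
  shows "presentation K \<Lambda> (null_square_quiver iA iB QA QB m n)
           (null_square_relations K iA iB QA QB m n RA RB PA PB)"
proof -
  have E: "complete_primitive_orthogonal A (verts QA)" "complete_primitive_orthogonal B (verts QB)"
    using \<open>presentation K A QA RA\<close> \<open>presentation K B QB RB\<close>
    by (simp_all add: presentation_def gabriel_quiver_def)
  obtain \<phi>A dA where \<phi>A: "admissible_surjection K QA A \<phi>A dA"
    "RA \<subseteq> carrier (path_algebra K QA)" "a_kernel (path_algebra K QA) A \<phi>A = Idl\<^bsub>path_algebra K QA\<^esub> RA"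
    "\<forall>r\<in>RA. \<exists>x\<in>verts QA. \<exists>y\<in>verts QA. \<exists>z\<in>a_kernel (path_algebra K QA) A \<phi>A.
      r = delta K (vertex_path y) \<otimes>\<^bsub>path_algebra K QA\<^esub> z \<otimes>\<^bsub>path_algebra K QA\<^esub> delta K (vertex_path x)"
    by (rule presentation_obtain[OF \<open>k_algebra K A\<close> \<open>presentation K A QA RA\<close>])
  obtain \<phi>B dB where \<phi>B: "admissible_surjection K QB B \<phi>B dB"
    "RB \<subseteq> carrier (path_algebra K QB)" "a_kernel (path_algebra K QB) B \<phi>B = Idl\<^bsub>path_algebra K QB\<^esub> RB"
    "\<forall>r\<in>RB. \<exists>x\<in>verts QB. \<exists>y\<in>verts QB. \<exists>z\<in>a_kernel (path_algebra K QB) B \<phi>B.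
      r = delta K (vertex_path y) \<otimes>\<^bsub>path_algebra K QB\<^esub> z \<otimes>\<^bsub>path_algebra K QB\<^esub> delta K (vertex_path x)"
    by (rule presentation_obtain[OF \<open>k_algebra K B\<close> \<open>presentation K B QB RB\<close>])
  obtain hM where hM: "proj_bimodule K B A M (verts QB) (verts QA) m hM"
    by (rule proj_bimodule_obtain[OF \<open>k_bimodule K B A M\<close>
      \<open>bimod_isomorphic K B A M (proj_sum K B A (verts QB) (verts QA) m)\<close> E(2,1)])
  obtain hN where hN: "proj_bimodule K A B N (verts QA) (verts QB) n hN"
    by (rule proj_bimodule_obtain[OF \<open>k_bimodule K A B N\<close>
      \<open>bimod_isomorphic K A B N (proj_sum K A B (verts QA) (verts QB) n)\<close> E])
  interpret P: null_square_presentation K A B M N QA QB m n hM hN \<phi>A dA \<phi>B dB RA RB PA PB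
    by (intro null_square_presentation.intro null_square_presentation_axioms.intro null_square.intro
      \<open>k_bimodule K B A M\<close> \<open>k_bimodule K A B N\<close> hM hN \<phi>A(1-3) \<phi>B(1-3)
      bspec[OF \<phi>A(4)] bspec[OF \<phi>B(4)]
      \<open>path_basis K QA RA PA\<close> \<open>path_basis K QB RB PB\<close>)
  \<comment> \<open>The vertex embeddings of the statement are the diagonal corner embeddings, so
    the quiver and the relations of the locale are those of the theorem.\<close>
  have "iA = P.inA" "iB = P.inB"
    by (simp_all add: fun_eq_iff iA_def iB_def vertex_A_def vertex_B_def P.inA_def P.inB_def)
  then show ?thesis using P.presentation \<open>finite_dim K \<Lambda>\<close> unfolding \<Lambda>_def by simp
qed

end
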